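(* Fix a natural number $g$. The $\operatorname{Out}(F_g)$-actions on the pure tropical Teichmüller space $\mathcal T_g^{tr,p}$ and on the tropical Teichmüller space $\mathcal T_g^{tr}$ given by changing the marking are admissible with respect to the ideal stacky fan structures of these spaces.
   Context: Graphs are finite and connected, loops and multiple edges allowed; $g(\Gamma)=|E(\Gamma)|-|V(\Gamma)|+1$; a loop counts twice in the valence. A weighted graph $(\Gamma,w)$ has $w:V(\Gamma)\to\mathbb Z_{\ge0}$; $|w|=\sum_vw(v)$; its genus is $g(\Gamma)+|w|$; it is stable if every vertex of weight $0$ has valence $\ge3$. A tropical curve of genus $g$ is $(\Gamma,w,l)$ with $(\Gamma,w)$ stable of genus $g$ and $l:E(\Gamma)\to\mathbb R_{>0}$; it is pure if $w=0$. $\Gamma^w$ is obtained from $\Gamma$ by attaching $w(v)$ "virtual" loops at each vertex $v$. $R_g$ is the rose with one vertex $v$ and $g$ loops $\gamma_1,\dots,\gamma_g$, and $\pi_1(R_g,v)=F_g$ is the free group of rank $g$. A marking of $(\Gamma,w)$ is a homotopy equivalence $h:R_g\to\Gamma^w$. Two markings $h,h'$ of $(\Gamma,w)$ are equivalent if, after homotoping $h$ and $h'$: (a) $h(v)=h'(v)$ is a point of $\Gamma$ which is not a vertex; (b) $h$ and $h'$ are immersions on the interior of each $\gamma_i$; (c) for each $i=1,\dots,g$, the directed loop $h'(\gamma_i)$ is obtained, up to homotopy fixing the basepoint, from the directed loop $h(\gamma_i)$ by repeatedly replacing sequences of virtual loops at a vertex with other sequences of virtual loops at that vertex (the sequences may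 be empty, i.e. virtual loops at a vertex may be added or removed). Marked weighted graphs $(\Gamma,w,h),(\Gamma',w',h')$ are equivalent if there is an isomorphism $\gamma:\Gamma^w\to\Gamma'^{w'}$ of 1-complexes taking virtual loops to virtual loops with $\gamma\circ h$ equivalent to $h'$; for marked tropical curves $(\Gamma,w,l,h)$ one also requires $\gamma$ to respect the lengths of the edges of $\Gamma$. In the pure case $w=0$ this means: an isomorphism (resp. isometry) $\gamma:\Gamma\to\Gamma'$ with $\gamma\circ h$ homotopic to $h'$. Specialization: $(\Gamma,w)\rightsquigarrow(\Gamma',w')$ if $\Gamma'$ arises by contracting a set $S$ of edges, where contracting a loop at a vertex increases the weight of that vertex by $1$ and contracting an edge between distinct $v_1,v_2$ gives a vertex of weight $w(v_1)+w(v_2)$. A marking $h$ of $(\Gamma,w)$ induces a marking $h'$ of $(\Gamma',w')$, well defined up to equivalence, by contracting a spanning forest of $S$ (the remaining edges of $S$ becoming virtual loops); then $(\Gamma,w,h)\rightsquigarrow(\Gamma',w',h')$. The inclusion $E(\Gamma')\hookrightarrow E(\Gamma)$ induces $L_\iota:\mathbb R_{\ge0}^{E(\Gamma')}\hookrightarrow\mathbb R_{\ge0}^{E(\Gamma)}$. $\mathcal T_g^{tr}$ is the stacky fan obtained as the quotient of $\coprod\mathbb R_{\ge0}^{E(\Gamma)}$ (lattice $\mathbb Z^{E(\Gamma)}$), over equivalence classes of stable marked weighted graphs $(\Gamma,w,h)$ of genus $g$, by the relation generated by the $L_\iota$ of all specializations. $\mathcal T_g^{tr,p}$ is the ideal stacky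 fan defined in the same way using only $w=0$, the ideal cones $\mathcal C_{(\Gamma,h)}=\{l\in\mathbb R_{\ge0}^{E(\Gamma)}:l^{-1}(0)\text{ contains no cycle}\}$, and specializations contracting acyclic subgraphs. Their points are the equivalence classes of marked tropical curves, resp. marked pure tropical curves, of genus $g$. The action: for $\alpha\in\operatorname{Aut}(F_g)$ let $\alpha_R:R_g\to R_g$ be the homotopy equivalence (unique up to homotopy) fixing the vertex and inducing $\alpha$ on $\pi_1(R_g,v)=F_g$; then $(\Gamma,w,l,h)\cdot\alpha=(\Gamma,w,l,h\circ\alpha_R)$. Inner automorphisms act trivially. Admissibility: an action of a group $G$ on an ideal stacky fan $X=(\coprod\sigma_i)/\!\sim$ glued from (ideal) cones is admissible if for each $\gamma\in G$ and each cone $\sigma_i$ there are some (necessarily unique) cone $\sigma_j$ and a linear isomorphism $L:\sigma_i\to\sigma_j$ identifying the lattices of their spans, such that $\sigma_i\to X\xrightarrow{\gamma}X$ equals $\sigma_i\xrightarrow{L}\sigma_j\to X$. *)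

theory Defs
  imports
    "HOL-Analysis.Analysis"
    "HOL-Analysis.Finite_Function_Topology"
    "HOL-Algebra.Coset"
    "HOL-Algebra.Bij"
    "Graph_Theory.Digraph_Component"
begin

section \<open>Graphs as topological spaces\<close>

text \<open>
  A finite graph with loops and multiple edges is a finite multidigraph
  \<^typ>\<open>('v, 'e) pre_digraph\<close>; the direction of an arc is only a reference orientation, used to
  parametrize the edge by the unit interval. No notion below depends on it: isomorphisms may reverse
  edges, and connectedness and valence ignore directions.
\<close>

datatype ('v, 'e) gpoint = Vertex 'v | Inner 'e real

definition edge_path :: "('v, 'e) pre_digraph \<Rightarrow> 'e \<Rightarrow> real \<Rightarrow> ('v, 'e) gpoint" where
  "edge_path G e t =
     (if t \<le> 0 then Vertex (tail G e) else if 1 \<le> t then Vertex (head G e) else Inner e t)"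

definition gpoints :: "('v, 'e) pre_digraph \<Rightarrow> ('v, 'e) gpoint set" where
  "gpoints G = Vertex ` verts G \<union> {Inner e t | e t. e \<in> arcs G \<and> 0 < t \<and> t < 1}"

text \<open>
  The quotient topology for the map from the disjoint union of the discrete space of vertices and one
  copy of the unit interval per edge.
\<close>

definition realization :: "('v, 'e) pre_digraph \<Rightarrow> ('v, 'e) gpoint topology" where
  "realization G = topology (\<lambda>U. U \<subseteq> gpoints G \<and>
     (\<forall>e\<in>arcs G. openin (top_of_set {0..1}) {t \<in> {0..1}. edge_path G e t \<in> U}))"

lemma istopology_realization:
  "istopology (\<lambda>U. U \<subseteq> gpoints G \<and>
     (\<forall>e\<in>arcs G. openin (top_of_set {0..1}) {t \<in> {0..1}. edge_path G e t \<in> U}))"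
  unfolding istopology_def
proof (intro conjI allI impI ballI)
  fix S T e
  assume "S \<subseteq> gpoints G \<and> (\<forall>e\<in>arcs G. openin (top_of_set {0..1}) {t \<in> {0..1}. edge_path G e t \<in> S})"
    and "T \<subseteq> gpoints G \<and> (\<forall>e\<in>arcs G. openin (top_of_set {0..1}) {t \<in> {0..1}. edge_path G e t \<in> T})"
    and "e \<in> arcs G"
  then have "openin (top_of_set {0..1})
      ({t \<in> {0..1}. edge_path G e t \<in> S} \<inter> {t \<in> {0..1}. edge_path G e t \<in> T})"
    by blast
  moreover have "{t \<in> {0..1}. edge_path G e t \<in> S} \<inter> {t \<in> {0..1}. edge_path G e t \<in> T}
      = {t \<in> {0..1}. edge_path G e t \<in> S \<inter> T}"
    by blast
  ultimately show "openin (top_of_set {0..1}) {t \<in> {0..1}. edge_path G e t \<in> S \<inter> T}"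
    by simp
next
  fix K e
  assume K: "\<forall>U\<in>K. U \<subseteq> gpoints G \<and>
      (\<forall>e\<in>arcs G. openin (top_of_set {0..1}) {t \<in> {0..1}. edge_path G e t \<in> U})"
    and "e \<in> arcs G"
  then have "openin (top_of_set {0..1}) (\<Union>U\<in>K. {t \<in> {0..1}. edge_path G e t \<in> U})"
    by blast
  moreover have "(\<Union>U\<in>K. {t \<in> {0..1}. edge_path G e t \<in> U})
      = {t \<in> {0..1}. edge_path G e t \<in> \<Union>K}"
    by blast
  ultimately show "openin (top_of_set {0..1}) {t \<in> {0..1}. edge_path G e t \<in> \<Union>K}"
    by simp
qed blast+

lemma openin_realization:
  "openin (realization G) U \<longleftrightarrow> U \<subseteq> gpoints G \<and>
     (\<forall>e\<in>arcs G. openin (top_of_set {0..1}) {t \<in> {0..1}. edge_path G e t \<in> U})"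
  unfolding realization_def topology_inverse'[OF istopology_realization] ..

section \<open>Homotopy\<close>

definition homotopy_equivalence_map :: "'a topology \<Rightarrow> 'b topology \<Rightarrow> ('a \<Rightarrow> 'b) \<Rightarrow> bool" where
  "homotopy_equivalence_map X Y f \<longleftrightarrow> continuous_map X Y f \<and>
     (\<exists>k. continuous_map Y X k \<and> homotopic_with (\<lambda>_. True) X X (k \<circ> f) id \<and>
          homotopic_with (\<lambda>_. True) Y Y (f \<circ> k) id)"

definition path_homotopic :: "'a topology \<Rightarrow> (real \<Rightarrow> 'a) \<Rightarrow> (real \<Rightarrow> 'a) \<Rightarrow> bool" where
  "path_homotopic X p q \<longleftrightarrow>
     homotopic_with (\<lambda>r. r 0 = p 0 \<and> r 1 = p 1) (top_of_set {0..1}) X p q"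

definition path_cat :: "(real \<Rightarrow> 'a) \<Rightarrow> (real \<Rightarrow> 'a) \<Rightarrow> real \<Rightarrow> 'a" where
  "path_cat p q t = (if t \<le> 1/2 then p (2 * t) else q (2 * t - 1))"

definition path_rev :: "(real \<Rightarrow> 'a) \<Rightarrow> real \<Rightarrow> 'a" where
  "path_rev p t = p (1 - t)"

definition loops_at :: "'a topology \<Rightarrow> 'a \<Rightarrow> (real \<Rightarrow> 'a) set" where
  "loops_at X x = {p. pathin X p \<and> p 0 = x \<and> p 1 = x}"

definition loop_class :: "'a topology \<Rightarrow> 'a \<Rightarrow> (real \<Rightarrow> 'a) \<Rightarrow> (real \<Rightarrow> 'a) set" where
  "loop_class X x p = {q \<in> loops_at X x. path_homotopic X p q}"

definition fundamental_group :: "'a topology \<Rightarrow> 'a \<Rightarrow> (real \<Rightarrow> 'a) set monoid" where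
  "fundamental_group X x =
     \<lparr>carrier = loop_class X x ` loops_at X x,
      mult = (\<lambda>A B. \<Union>p\<in>A. \<Union>q\<in>B. loop_class X x (path_cat p q)),
      one = loop_class X x (\<lambda>_. x)\<rparr>"

section \<open>The rose and the outer automorphism group of the free group\<close>

definition rose :: "nat \<Rightarrow> (unit, nat) pre_digraph" where
  "rose g = \<lparr>verts = {()}, arcs = {..<g}, tail = (\<lambda>_. ()), head = (\<lambda>_. ())\<rparr>"

abbreviation rose_space :: "nat \<Rightarrow> (unit, nat) gpoint topology" where
  "rose_space g \<equiv> realization (rose g)"

abbreviation rose_base :: "(unit, nat) gpoint" where
  "rose_base \<equiv> Vertex ()"

text \<open>The free group of rank \<open>g\<close> is taken to be the fundamental group of the rose.\<close>

abbreviation free_group :: "nat \<Rightarrow> (real \<Rightarrow> (unit, nat) gpoint) set monoid" where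
  "free_group g \<equiv> fundamental_group (rose_space g) rose_base"

definition Inn :: "('a, 'b) monoid_scheme \<Rightarrow> ('a \<Rightarrow> 'a) set" where
  "Inn G = {\<lambda>y \<in> carrier G. x \<otimes>\<^bsub>G\<^esub> y \<otimes>\<^bsub>G\<^esub> inv\<^bsub>G\<^esub> x | x. x \<in> carrier G}"

definition Out :: "('a, 'b) monoid_scheme \<Rightarrow> ('a \<Rightarrow> 'a) set monoid" where
  "Out G = AutoGroup G Mod Inn G"

definition induces_automorphism ::
    "nat \<Rightarrow> ((unit, nat) gpoint \<Rightarrow> (unit, nat) gpoint) \<Rightarrow>
     ((real \<Rightarrow> (unit, nat) gpoint) set \<Rightarrow> (real \<Rightarrow> (unit, nat) gpoint) set) \<Rightarrow> bool" where
  "induces_automorphism g f \<alpha> \<longleftrightarrow>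
     homotopy_equivalence_map (rose_space g) (rose_space g) f \<and> f rose_base = rose_base \<and>
     (\<forall>p \<in> loops_at (rose_space g) rose_base.
        \<alpha> (loop_class (rose_space g) rose_base p) = loop_class (rose_space g) rose_base (f \<circ> p))"

section \<open>Weighted graphs, markings and tropical curves\<close>

text \<open>
  \<open>virt G w\<close> attaches \<open>w v\<close> virtual loops \<open>Inr (v, i)\<close>, \<open>i < w v\<close>, at each vertex \<open>v\<close>; the edges of
  \<open>G\<close> itself are \<open>Inl e\<close>.
\<close>

definition virt ::
    "('v, 'e) pre_digraph \<Rightarrow> ('v \<Rightarrow> nat) \<Rightarrow> ('v, 'e + 'v \<times> nat) pre_digraph" where
  "virt G w = \<lparr>verts = verts G,
     arcs = Inl ` arcs G \<union> Inr ` {(v, i). v \<in> verts G \<and> i < w v},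
     tail = case_sum (tail G) fst, head = case_sum (head G) fst\<rparr>"

abbreviation virt_space ::
    "('v, 'e) pre_digraph \<Rightarrow> ('v \<Rightarrow> nat) \<Rightarrow> ('v, 'e + 'v \<times> nat) gpoint topology" where
  "virt_space G w \<equiv> realization (virt G w)"

definition weighted_genus :: "('v, 'e) pre_digraph \<Rightarrow> ('v \<Rightarrow> nat) \<Rightarrow> int" where
  "weighted_genus G w =
     int (card (arcs G)) - int (card (verts G)) + 1 + int (\<Sum>v\<in>verts G. w v)"

definition stable :: "('v, 'e) pre_digraph \<Rightarrow> ('v \<Rightarrow> nat) \<Rightarrow> bool" where
  "stable G w \<longleftrightarrow> (\<forall>v\<in>verts G. w v = 0 \<longrightarrow> 3 \<le> in_degree G v + out_degree G v)"

type_synonym lengths = "nat \<Rightarrow>\<^sub>0 real"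

text \<open>
  Vertices and edges are labelled by natural numbers, so that the marked weighted graphs of genus \<open>g\<close>
  form a set; every finite graph is isomorphic to one of this form.
\<close>

type_synonym marking = "(unit, nat) gpoint \<Rightarrow> (nat, nat + nat \<times> nat) gpoint"

type_synonym marked_graph = "(nat, nat) pre_digraph \<times> (nat \<Rightarrow> nat) \<times> marking"

definition stable_marked_graphs :: "nat \<Rightarrow> marked_graph set" where
  "stable_marked_graphs g = {(G, w, h). fin_digraph G \<and> Digraph_Component.connected G \<and>
     stable G w \<and> weighted_genus G w = int g \<and>
     homotopy_equivalence_map (rose_space g) (virt_space G w) h}"

definition pure_marked_graphs :: "nat \<Rightarrow> marked_graph set" where
  "pure_marked_graphs g = {(G, w, h) \<in> stable_marked_graphs g. \<forall>v\<in>verts G. w v = 0}"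

inductive virtual_sequence ::
    "('v, 'e) pre_digraph \<Rightarrow> ('v \<Rightarrow> nat) \<Rightarrow> 'v \<Rightarrow> (real \<Rightarrow> ('v, 'e + 'v \<times> nat) gpoint) \<Rightarrow> bool"
  for G w u where
  empty: "virtual_sequence G w u (\<lambda>_. Vertex u)"
| forward: "i < w u \<Longrightarrow> virtual_sequence G w u s \<Longrightarrow>
     virtual_sequence G w u (path_cat (edge_path (virt G w) (Inr (u, i))) s)"
| backward: "i < w u \<Longrightarrow> virtual_sequence G w u s \<Longrightarrow>
     virtual_sequence G w u (path_cat (path_rev (edge_path (virt G w) (Inr (u, i)))) s)"

inductive virtual_replacement ::
    "('v, 'e) pre_digraph \<Rightarrow> ('v \<Rightarrow> nat) \<Rightarrow> ('v, 'e + 'v \<times> nat) gpoint \<Rightarrow>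
     (real \<Rightarrow> ('v, 'e + 'v \<times> nat) gpoint) \<Rightarrow> (real \<Rightarrow> ('v, 'e + 'v \<times> nat) gpoint) \<Rightarrow> bool"
  for G w x where
  homotopy: "p \<in> loops_at (virt_space G w) x \<Longrightarrow> path_homotopic (virt_space G w) p q \<Longrightarrow>
     virtual_replacement G w x p q"
| replace: "u \<in> verts G \<Longrightarrow>
     pathin (virt_space G w) a \<Longrightarrow> a 0 = x \<Longrightarrow> a 1 = Vertex u \<Longrightarrow>
     pathin (virt_space G w) b \<Longrightarrow> b 0 = Vertex u \<Longrightarrow> b 1 = x \<Longrightarrow>
     virtual_sequence G w u s \<Longrightarrow> virtual_sequence G w u s' \<Longrightarrow>
     virtual_replacement G w x (path_cat a (path_cat s b)) (path_cat a (path_cat s' b))"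
| trans: "virtual_replacement G w x p q \<Longrightarrow> virtual_replacement G w x q r \<Longrightarrow>
     virtual_replacement G w x p r"

definition locally_injective :: "(real \<Rightarrow> 'a) \<Rightarrow> bool" where
  "locally_injective p \<longleftrightarrow> (\<forall>t. 0 < t \<and> t < 1 \<longrightarrow> (\<exists>\<epsilon>>0. inj_on p ({0<..<1} \<inter> ball t \<epsilon>)))"

text \<open>
  The base point is required to be a point of \<open>G\<close> other than a vertex, unless \<open>G\<close> is a single vertex
  without edges: there no such point exists, and the vertex itself is used as the base point.
\<close>

definition marking_equiv ::
    "nat \<Rightarrow> (nat, nat) pre_digraph \<Rightarrow> (nat \<Rightarrow> nat) \<Rightarrow> marking \<Rightarrow> marking \<Rightarrow> bool" where
  "marking_equiv g G w h h' \<longleftrightarrow>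
     (\<exists>k k'. homotopic_with (\<lambda>_. True) (rose_space g) (virt_space G w) h k \<and>
        homotopic_with (\<lambda>_. True) (rose_space g) (virt_space G w) h' k' \<and>
        k rose_base = k' rose_base \<and>
        (if arcs G = {} then k rose_base \<in> Vertex ` verts G
         else k rose_base \<in> {Inner (Inl e) t | e t. e \<in> arcs G \<and> 0 < t \<and> t < 1}) \<and>
        (\<forall>i<g. locally_injective (k \<circ> edge_path (rose g) i) \<and>
               locally_injective (k' \<circ> edge_path (rose g) i)) \<and>
        (\<forall>i<g. virtual_replacement G w (k rose_base)
                 (k \<circ> edge_path (rose g) i) (k' \<circ> edge_path (rose g) i)))"

record ('v, 'e, 'v2, 'e2) complex_iso =
  vmap :: "'v \<Rightarrow> 'v2"
  emap :: "'e \<Rightarrow> 'e2"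
  flipped :: "'e \<Rightarrow> bool"

definition is_complex_iso ::
    "('v, 'e) pre_digraph \<Rightarrow> ('v2, 'e2) pre_digraph \<Rightarrow> ('v, 'e, 'v2, 'e2) complex_iso \<Rightarrow> bool" where
  "is_complex_iso G H \<gamma> \<longleftrightarrow>
     bij_betw (vmap \<gamma>) (verts G) (verts H) \<and> bij_betw (emap \<gamma>) (arcs G) (arcs H) \<and>
     (\<forall>e\<in>arcs G. (tail H (emap \<gamma> e), head H (emap \<gamma> e)) =
        (if flipped \<gamma> e then (vmap \<gamma> (head G e), vmap \<gamma> (tail G e))
         else (vmap \<gamma> (tail G e), vmap \<gamma> (head G e))))"

primrec iso_point :: "('v, 'e, 'v2, 'e2) complex_iso \<Rightarrow> ('v, 'e) gpoint \<Rightarrow> ('v2, 'e2) gpoint" where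
  "iso_point \<gamma> (Vertex v) = Vertex (vmap \<gamma> v)"
| "iso_point \<gamma> (Inner e t) = Inner (emap \<gamma> e) (if flipped \<gamma> e then 1 - t else t)"

type_synonym marked_iso = "(nat, nat + nat \<times> nat, nat, nat + nat \<times> nat) complex_iso"

text \<open>
  An edge is virtual iff it is a right injection, so a bijection on edges takes virtual loops to
  virtual loops (and edges of \<open>G\<close> to edges of \<open>G'\<close>) iff it preserves \<^const>\<open>isl\<close>.
\<close>

fun is_marked_iso :: "nat \<Rightarrow> marked_iso \<Rightarrow> marked_graph \<Rightarrow> marked_graph \<Rightarrow> bool" where
  "is_marked_iso g \<gamma> (G, w, h) (G', w', h') \<longleftrightarrow>
     is_complex_iso (virt G w) (virt G' w') \<gamma> \<and>
     (\<forall>e\<in>arcs (virt G w). isl (emap \<gamma> e) = isl e) \<and>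
     marking_equiv g G' w' (iso_point \<gamma> \<circ> h) h'"

definition marked_equiv :: "nat \<Rightarrow> marked_graph \<Rightarrow> marked_graph \<Rightarrow> bool" where
  "marked_equiv g m m' \<longleftrightarrow> (\<exists>\<gamma>. is_marked_iso g \<gamma> m m')"

definition real_edge_map :: "marked_iso \<Rightarrow> nat \<Rightarrow> nat" where
  "real_edge_map \<gamma> e = projl (emap \<gamma> (Inl e))"

definition curve_equiv ::
    "nat \<Rightarrow> marked_graph \<times> lengths \<Rightarrow> marked_graph \<times> lengths \<Rightarrow> bool" where
  "curve_equiv g = (\<lambda>(m, l) (m', l'). \<exists>\<gamma>. is_marked_iso g \<gamma> m m' \<and>
     (\<forall>e\<in>arcs (fst m). Poly_Mapping.lookup l' (real_edge_map \<gamma> e) = Poly_Mapping.lookup l e))"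

section \<open>Specialization\<close>

text \<open>
  Contracting a single edge \<open>e\<close>. If \<open>e\<close> is a loop, it becomes a new virtual loop at its vertex.
  Otherwise the head of \<open>e\<close> is identified with its tail \<open>u\<close>, the virtual loops at the head being
  renumbered so as to follow those at \<open>u\<close>. The marking is composed with this map of 1-complexes.
\<close>

definition contract_point ::
    "(nat, nat) pre_digraph \<Rightarrow> (nat \<Rightarrow> nat) \<Rightarrow> nat \<Rightarrow>
     (nat, nat + nat \<times> nat) gpoint \<Rightarrow> (nat, nat + nat \<times> nat) gpoint" where
  "contract_point G w e x =
     (let u = tail G e; v = head G e in
      if u = v then
        (case x of Inner (Inl a) t \<Rightarrow> if a = e then Inner (Inr (u, w u)) t else x | _ \<Rightarrow> x)
      else
        (case x of
           Vertex y \<Rightarrow> if y = v then Vertex u else x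
         | Inner (Inl a) t \<Rightarrow> if a = e then Vertex u else x
         | Inner (Inr (y, i)) t \<Rightarrow> if y = v then Inner (Inr (u, w u + i)) t else x))"

fun contract_edge :: "nat \<Rightarrow> marked_graph \<Rightarrow> marked_graph" where
  "contract_edge e (G, w, h) =
     (let u = tail G e; v = head G e in
      if u = v then
        (G\<lparr>arcs := arcs G - {e}\<rparr>, w(u := w u + 1), contract_point G w e \<circ> h)
      else
        (\<lparr>verts = verts G - {v}, arcs = arcs G - {e},
          tail = (\<lambda>a. if tail G a = v then u else tail G a),
          head = (\<lambda>a. if head G a = v then u else head G a)\<rparr>,
         w(u := w u + w v), contract_point G w e \<circ> h))"

text \<open>
  A set \<open>S\<close> of edges is contracted one edge after the other, in the order of an enumeration \<open>es\<close> of
  \<open>S\<close>. The edges that are not loops when their turn comes form a spanning forest of \<open>S\<close>, and the other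
  ones become virtual loops.

  \<open>specialization g m es \<gamma> m'\<close>: the marked graph \<open>m'\<close> is equivalent, via \<open>\<gamma>\<close>, to the result of
  contracting \<open>es\<close> in \<open>m\<close>. As the edges of the contraction are edges of \<open>m\<close>, the map
  \<open>real_edge_map \<gamma>\<close> is the inclusion of the edges of \<open>m'\<close> into those of \<open>m\<close>.
\<close>

definition specialization ::
    "nat \<Rightarrow> marked_graph \<Rightarrow> nat list \<Rightarrow> marked_iso \<Rightarrow> marked_graph \<Rightarrow> bool" where
  "specialization g m es \<gamma> m' \<longleftrightarrow> distinct es \<and> set es \<subseteq> arcs (fst m) \<and>
     is_marked_iso g \<gamma> m' (fold contract_edge es m)"

text \<open>The linear map on lengths that extends by zero along the inclusion of edges.\<close>

definition extend_lengths ::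
    "marked_iso \<Rightarrow> marked_graph \<Rightarrow> lengths \<Rightarrow> lengths" where
  "extend_lengths \<gamma> m' l =
     (\<Sum>e\<in>arcs (fst m'). Poly_Mapping.single (real_edge_map \<gamma> e) (Poly_Mapping.lookup l e))"

section \<open>Ideal stacky fans and admissible actions\<close>

text \<open>
  All cones live in finitely many coordinates of the space of finitely supported functions
  \<^typ>\<open>lengths\<close>, with the lattice of integral points. The component \<open>fan_gluing\<close> is the
  relation on the disjoint union of the cones that generates the equivalence relation.
\<close>

record 'i ideal_stacky_fan =
  fan_index :: "'i set"
  fan_cone :: "'i \<Rightarrow> lengths set"
  fan_gluing :: "'i \<times> lengths \<Rightarrow> 'i \<times> lengths \<Rightarrow> bool"

definition fan_union :: "'i ideal_stacky_fan \<Rightarrow> ('i \<times> lengths) set" where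
  "fan_union F = (SIGMA i:fan_index F. fan_cone F i)"

definition fan_rel ::
    "'i ideal_stacky_fan \<Rightarrow> (('i \<times> lengths) \<times> ('i \<times> lengths)) set" where
  "fan_rel F = {(p, q) \<in> fan_union F \<times> fan_union F.
     equivclp (\<lambda>a b. a \<in> fan_union F \<and> b \<in> fan_union F \<and> fan_gluing F a b) p q}"

definition fan_points :: "'i ideal_stacky_fan \<Rightarrow> ('i \<times> lengths) set set" where
  "fan_points F = fan_union F // fan_rel F"

definition fan_proj ::
    "'i ideal_stacky_fan \<Rightarrow> 'i \<Rightarrow> lengths \<Rightarrow> ('i \<times> lengths) set" where
  "fan_proj F i l = fan_rel F `` {(i, l)}"

definition lattice_in :: "lengths set \<Rightarrow> lengths set" where
  "lattice_in V = {l \<in> V. \<forall>e. Poly_Mapping.lookup l e \<in> \<int>}"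

definition right_action :: "('a, 'b) monoid_scheme \<Rightarrow> 'x set \<Rightarrow> ('a \<Rightarrow> 'x \<Rightarrow> 'x) \<Rightarrow> bool" where
  "right_action G X act \<longleftrightarrow> group G \<and>
     (\<forall>a\<in>carrier G. \<forall>x\<in>X. act a x \<in> X) \<and>
     (\<forall>x\<in>X. act \<one>\<^bsub>G\<^esub> x = x) \<and>
     (\<forall>a\<in>carrier G. \<forall>b\<in>carrier G. \<forall>x\<in>X. act (a \<otimes>\<^bsub>G\<^esub> b) x = act b (act a x))"

text \<open>
  A linear isomorphism between the spans of two cones is given as the restriction of a linear map of
  the ambient space; every linear map between subspaces extends in this way.
\<close>

definition admissible_action ::
    "('a, 'b) monoid_scheme \<Rightarrow> 'i ideal_stacky_fan \<Rightarrow>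
     ('a \<Rightarrow> ('i \<times> lengths) set \<Rightarrow> ('i \<times> lengths) set) \<Rightarrow> bool" where
  "admissible_action G F act \<longleftrightarrow> right_action G (fan_points F) act \<and>
     (\<forall>a\<in>carrier G. \<forall>i\<in>fan_index F. \<exists>j\<in>fan_index F. \<exists>L. linear L \<and>
        bij_betw L (span (fan_cone F i)) (span (fan_cone F j)) \<and>
        L ` lattice_in (span (fan_cone F i)) = lattice_in (span (fan_cone F j)) \<and>
        L ` fan_cone F i = fan_cone F j \<and>
        (\<forall>l\<in>fan_cone F i. act a (fan_proj F i l) = fan_proj F j (L l)))"

section \<open>Tropical Teichmueller spaces\<close>

definition orthant :: "marked_graph \<Rightarrow> lengths set" where
  "orthant m = {l. Poly_Mapping.keys l \<subseteq> arcs (fst m) \<and> (\<forall>e. 0 \<le> Poly_Mapping.lookup l e)}"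

text \<open>
  Cycles of the undirected graph \<open>(verts G, S)\<close>: cycles of the digraph in which every edge of \<open>S\<close> occurs
  once in each direction, traversing each edge at most once. Loops, and pairs of parallel edges, are
  cycles.
\<close>

definition bidirected :: "('v, 'e) pre_digraph \<Rightarrow> 'e set \<Rightarrow> ('v, 'e \<times> bool) pre_digraph" where
  "bidirected G S = \<lparr>verts = verts G, arcs = S \<times> UNIV,
     tail = (\<lambda>(e, b). if b then tail G e else head G e),
     head = (\<lambda>(e, b). if b then head G e else tail G e)\<rparr>"

definition contains_cycle :: "('v, 'e) pre_digraph \<Rightarrow> 'e set \<Rightarrow> bool" where
  "contains_cycle G S \<longleftrightarrow> (\<exists>p. pre_digraph.cycle (bidirected G S) p \<and> distinct (map fst p))"

definition pure_cone :: "marked_graph \<Rightarrow> lengths set" where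
  "pure_cone m =
     {l \<in> orthant m. \<not> contains_cycle (fst m) {e \<in> arcs (fst m). Poly_Mapping.lookup l e = 0}}"

definition class_rep :: "marked_graph set \<Rightarrow> marked_graph" where
  "class_rep c = (SOME m. m \<in> c)"

text \<open>
  The fan with one cone per equivalence class of marked graphs in \<open>M\<close>, that of a chosen
  representative, glued along all specializations between representatives. Specializations with no
  contracted edge account for automorphisms. The glued points lie in the cones; a point of the form
  \<open>extend_lengths \<gamma> m' l\<close> vanishes on the contracted edges, so if it lies in a pure cone the set of
  contracted edges contains no cycle.
\<close>

definition teichmueller_fan ::
    "nat \<Rightarrow> marked_graph set \<Rightarrow> (marked_graph \<Rightarrow> lengths set) \<Rightarrow>
     marked_graph set ideal_stacky_fan" where
  "teichmueller_fan g M C =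
     \<lparr>fan_index = M // {(m, m') \<in> M \<times> M. marked_equiv g m m'},
      fan_cone = (\<lambda>c. C (class_rep c)),
      fan_gluing = (\<lambda>(c', l') (c, l). \<exists>es \<gamma>.
        specialization g (class_rep c) es \<gamma> (class_rep c') \<and>
        l = extend_lengths \<gamma> (class_rep c') l')\<rparr>"

definition tropical_teichmueller :: "nat \<Rightarrow> marked_graph set ideal_stacky_fan" where
  "tropical_teichmueller g = teichmueller_fan g (stable_marked_graphs g) orthant"

definition pure_tropical_teichmueller :: "nat \<Rightarrow> marked_graph set ideal_stacky_fan" where
  "pure_tropical_teichmueller g = teichmueller_fan g (pure_marked_graphs g) pure_cone"

definition marked_curves :: "marked_graph set \<Rightarrow> (marked_graph \<times> lengths) set" where
  "marked_curves M = {(m, l). m \<in> M \<and> Poly_Mapping.keys l = arcs (fst m) \<and>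
     (\<forall>e\<in>arcs (fst m). 0 < Poly_Mapping.lookup l e)}"

text \<open>
  The point \<open>x\<close> is that of the marked tropical curve \<open>(m, l)\<close>: the curve is equivalent to the one with
  lengths \<open>l'\<close> on the representative of the class \<open>c\<close>, for some \<open>(c, l')\<close> lying over \<open>x\<close>.
\<close>

definition is_point_of ::
    "nat \<Rightarrow> marked_graph \<times> lengths \<Rightarrow> (marked_graph set \<times> lengths) set \<Rightarrow> bool" where
  "is_point_of g X x \<longleftrightarrow> (\<exists>(c, l') \<in> x. curve_equiv g X (class_rep c, l'))"

definition change_marking ::
    "nat \<Rightarrow> marked_graph set \<Rightarrow> marked_graph set ideal_stacky_fan \<Rightarrow>
     ((real \<Rightarrow> (unit, nat) gpoint) set \<Rightarrow> (real \<Rightarrow> (unit, nat) gpoint) set) set \<Rightarrow>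
     (marked_graph set \<times> lengths) set \<Rightarrow> (marked_graph set \<times> lengths) set" where
  "change_marking g M F A x =
     (THE y. y \<in> fan_points F \<and>
        (\<exists>G w h l. \<exists>\<alpha>\<in>A. \<exists>f. ((G, w, h), l) \<in> marked_curves M \<and> is_point_of g ((G, w, h), l) x \<and>
           induces_automorphism g f \<alpha> \<and> is_point_of g ((G, w, h \<circ> f), l) y))"

definition teichmueller_action where
  "teichmueller_action g = change_marking g (stable_marked_graphs g) (tropical_teichmueller g)"

definition pure_teichmueller_action where
  "pure_teichmueller_action g =
     change_marking g (pure_marked_graphs g) (pure_tropical_teichmueller g)"

end

theory Submission
  imports Defs
begin

text \<open>
  Deleting virtual loops gives a retraction of \<open>virt_space G w\<close> onto \<open>realization G\<close>, and two markings are equivalent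
  iff they become freely homotopic after this retraction: replacing sequences of virtual loops means
  working modulo the normal closure of the virtual loops in the fundamental group. Hence, up to equivalence, the
  contraction of a set of edges depends only on the set, and every point of a cone contracts, along its edges of
  length zero, to a marked curve with positive lengths that is unique up to equivalence. Two points of
  cones represent the same point of the fan iff they contract to equivalent curves. Precomposing
  markings with a self-map of the rose commutes with all of this, and the self-maps induced by the elements of one
  class in \<open>Out (free_group g)\<close> are freely homotopic, so the cone of a marked graph is mapped isomorphically
  onto the cone of the graph with the changed marking.
\<close>

section \<open>Homotopies of paths\<close>

text \<open>The hardest point is the equivalence of markings. It asks for representatives that share
  a base point off the vertices and are locally injective on every petal. A petal can be made
  locally injective only if it is not null-homotopic, which for a homotopy equivalence follows by
  lifting through the exponential map. The rest is done by reduced words: every path in a graph is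
  homotopic to a word of straight segments of edges, and consecutive letters of a reduced word meet
  at vertices. So reduced words are locally injective, they run through each virtual loop
  completely, which is the form in which it may be replaced by nothing, and on the rose they show
  that the petals generate. No presentation of a fundamental group enters. Along contractions the
  markings are compared after deleting the virtual loops, so that few steps see the numbering of
  these loops. The action is defined through a choice of a curve, an automorphism and a map of the
  rose; that its value does not depend on them uses all the uniqueness results.\<close>

lemma path_homotopicI:
  assumes "continuous_map (top_of_set ({0..1::real} \<times> {0..1})) X (\<lambda>(s, t). F s t)"
    and "\<And>t. t \<in> {0..1} \<Longrightarrow> F 0 t = p t" "\<And>t. t \<in> {0..1} \<Longrightarrow> F 1 t = q t"
    and "\<And>s. s \<in> {0..1} \<Longrightarrow> F s 0 = p 0" "\<And>s. s \<in> {0..1} \<Longrightarrow> F s 1 = p 1"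
  shows "path_homotopic X p q"
  unfolding path_homotopic_def
\<comment> \<open>By definition \<open>homotopic_with\<close> prescribes both ends of the homotopy
  on all of \<open>real\<close>. The rule of the same name weakens this to the unit interval, which
  is possible since the condition on the intermediate maps only looks at 0 and 1.\<close>
proof (subst homotopic_with)
  show "\<exists>h. continuous_map (prod_topology (top_of_set {0..1::real}) (top_of_set {0..1})) X h \<and>
        (\<forall>x\<in>topspace (top_of_set {0..1}). h (0, x) = p x) \<and>
        (\<forall>x\<in>topspace (top_of_set {0..1}). h (1, x) = q x) \<and>
        (\<forall>t\<in>{0..1}. h (t, 0) = p 0 \<and> h (t, 1) = p 1)"
    by (rule exI[of _ "\<lambda>(s, t). F s t"]) (use assms in \<open>simp add: prod_topology_subtopology_eu\<close>)
qed auto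

lemma path_homotopicE:
  assumes "path_homotopic X p q"
  obtains F where "continuous_map (top_of_set ({0..1::real} \<times> {0..1})) X (\<lambda>(s, t). F s t)"
    "\<And>t. F 0 t = p t" "\<And>t. F 1 t = q t"
    "\<And>s. s \<in> {0..1} \<Longrightarrow> F s 0 = p 0" "\<And>s. s \<in> {0..1} \<Longrightarrow> F s 1 = p 1"
proof -
  obtain h where h: "continuous_map (prod_topology (top_of_set {0..1::real}) (top_of_set {0..1})) X h"
    "\<forall>x. h (0, x) = p x" "\<forall>x. h (1, x) = q x" "\<forall>t\<in>{0..1}. h (t, 0) = p 0 \<and> h (t, 1) = p 1"
    using assms unfolding path_homotopic_def homotopic_with_def by (elim exE conjE) (rule that; assumption)
  show thesis by (rule that[of "\<lambda>s t. h (s, t)"]) (use h in \<open>auto simp: prod_topology_subtopology_eu\<close>)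
qed

lemma path_homotopic_paths:
  assumes "path_homotopic X p q" shows "pathin X p" "pathin X q"
  using assms unfolding path_homotopic_def pathin_def
  by (auto dest: homotopic_with_imp_continuous_maps)

lemma path_homotopic_ends:
  assumes "path_homotopic X p q" shows "q 0 = p 0" "q 1 = p 1"
  using assms unfolding path_homotopic_def
  by (auto dest: homotopic_with_imp_property)

text \<open>Paths are total functions on \<open>real\<close>, so two of them may agree on the unit
  interval without being equal. This is the bridge between them.\<close>

lemma path_homotopic_eq:
  assumes "pathin X p" "\<And>t. t \<in> {0..1} \<Longrightarrow> p t = q t"
  shows "path_homotopic X p q"
  unfolding path_homotopic_def
  by (rule homotopic_with_equal) (use assms in \<open>auto simp: pathin_def\<close>)

lemma path_homotopic_refl: "pathin X p \<Longrightarrow> path_homotopic X p p"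
  by (simp add: path_homotopic_eq)

lemma path_homotopic_sym: assumes "path_homotopic X p q" shows "path_homotopic X q p"
  using homotopic_with_symD[OF assms[unfolded path_homotopic_def]] path_homotopic_ends[OF assms]
  unfolding path_homotopic_def by simp

lemma path_homotopic_trans [trans]:
  assumes "path_homotopic X p q" "path_homotopic X q r"
  shows "path_homotopic X p r"
  using homotopic_with_trans[OF assms(1)[unfolded path_homotopic_def], of r]
    assms(2)[unfolded path_homotopic_def] path_homotopic_ends[OF assms(1)]
  unfolding path_homotopic_def by simp

lemma path_homotopic_map:
  assumes "continuous_map X Y f" "path_homotopic X p q"
  shows "path_homotopic Y (f \<circ> p) (f \<circ> q)"
  using assms(2) unfolding path_homotopic_def
  by (rule homotopic_with_compose_continuous_map_left[OF _ assms(1)]) auto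

text \<open>The straight-line homotopy between the two parametrizations stays in the convex set
  \<open>C\<close>, and \<open>P\<close> carries it to \<open>X\<close>. With the unit interval as
  \<open>C\<close> it gives the groupoid laws of paths, with the unit square the commuting boundary
  of a homotopy.\<close>

lemma path_homotopic_reparam:
  fixes C :: "'a::real_normed_vector set"
  assumes P: "continuous_map (top_of_set C) X P" and C: "convex C"
    and \<phi>: "continuous_on {0..1} \<phi>" "\<phi> ` {0..1} \<subseteq> C"
    and \<psi>: "continuous_on {0..1} \<psi>" "\<psi> ` {0..1} \<subseteq> C"
    and ends: "\<phi> 0 = \<psi> 0" "\<phi> 1 = \<psi> 1"
  shows "path_homotopic X (P \<circ> \<phi>) (P \<circ> \<psi>)"
proof (rule path_homotopicI[where F = "\<lambda>s t. P ((1 - s) *\<^sub>R \<phi> t + s *\<^sub>R \<psi> t)"])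
  have \<phi>2: "continuous_on ({0..1::real} \<times> {0..1}) (\<lambda>x. \<phi> (snd x))"
    by (rule continuous_on_compose2[OF \<phi>(1)]) (auto intro: continuous_intros)
  have \<psi>2: "continuous_on ({0..1::real} \<times> {0..1}) (\<lambda>x. \<psi> (snd x))"
    by (rule continuous_on_compose2[OF \<psi>(1)]) (auto intro: continuous_intros)
  have "continuous_map (top_of_set ({0..1::real} \<times> {0..1})) (top_of_set C)
      (\<lambda>x. (1 - fst x) *\<^sub>R \<phi> (snd x) + fst x *\<^sub>R \<psi> (snd x))"
    unfolding continuous_map_subtopology_eu
  proof
    show "continuous_on ({0..1::real} \<times> {0..1}) (\<lambda>x. (1 - fst x) *\<^sub>R \<phi> (snd x) + fst x *\<^sub>R \<psi> (snd x))"
      by (intro continuous_intros \<phi>2 \<psi>2)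
    show "(\<lambda>x. (1 - fst x) *\<^sub>R \<phi> (snd x) + fst x *\<^sub>R \<psi> (snd x)) \<in> ({0..1::real} \<times> {0..1}) \<rightarrow> C"
    proof (clarsimp)
      fix a b :: real assume "0 \<le> a" "a \<le> 1" "0 \<le> b" "b \<le> 1"
      then show "(1 - a) *\<^sub>R \<phi> b + a *\<^sub>R \<psi> b \<in> C"
        using \<phi>(2) \<psi>(2) by (intro convexD_alt[OF C]) auto
    qed
  qed
  from continuous_map_compose[OF this P]
  show "continuous_map (top_of_set ({0..1::real} \<times> {0..1})) X
      (\<lambda>(s, t). P ((1 - s) *\<^sub>R \<phi> t + s *\<^sub>R \<psi> t))"
    by (simp add: o_def case_prod_unfold)
qed (auto simp: ends algebra_simps simp flip: scaleR_add_left)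

lemma path_homotopic_reparam_path:
  assumes p: "pathin X p"
    and \<phi>: "continuous_on {0..1} \<phi>" "\<phi> ` {0..1} \<subseteq> {0..1}" "\<phi> 0 = a" "\<phi> 1 = b"
    and \<psi>: "continuous_on {0..1} \<psi>" "\<psi> ` {0..1} \<subseteq> {0..1}" "\<psi> 0 = a" "\<psi> 1 = b"
    and eq: "\<And>t. t \<in> {0..1} \<Longrightarrow> q t = p (\<phi> t)" "\<And>t. t \<in> {0..1} \<Longrightarrow> r t = p (\<psi> t)"
  shows "path_homotopic X q r"
proof -
  have 1: "path_homotopic X (p \<circ> \<phi>) (p \<circ> \<psi>)"
    by (rule path_homotopic_reparam[where C = "{0..1}"]) (use assms in \<open>auto simp: pathin_def\<close>)
  have 2: "path_homotopic X (p \<circ> \<phi>) q"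
    by (rule path_homotopic_eq) (use eq path_homotopic_paths[OF 1] in auto)
  have 3: "path_homotopic X (p \<circ> \<psi>) r"
    by (rule path_homotopic_eq) (use eq path_homotopic_paths[OF 1] in auto)
  show ?thesis
    using 1 2 3 path_homotopic_sym path_homotopic_trans by meson
qed

text \<open>The parameter set \<open>S\<close> makes one statement serve twice: a singleton gives
  the concatenation of paths, the unit interval that of homotopies.\<close>

lemma continuous_map_path_cat:
  assumes P: "continuous_map (top_of_set (S \<times> {0..1})) X (\<lambda>(s, t). P s t)"
    and Q: "continuous_map (top_of_set (S \<times> {0..1})) X (\<lambda>(s, t). Q s t)"
    and eq: "\<And>s. s \<in> S \<Longrightarrow> P s 1 = Q s 0"
  shows "continuous_map (top_of_set (S \<times> {0..1})) X (\<lambda>(s, t). path_cat (P s) (Q s) t)"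
proof -
  let ?T = "top_of_set (S \<times> {0..1::real})"
  have "continuous_map ?T X (\<lambda>x. if snd x \<le> 1/2 then P (fst x) (2 * snd x) else Q (fst x) (2 * snd x - 1))"
  proof (rule continuous_map_cases_le)
    show "continuous_map ?T euclideanreal snd"
      by (auto intro: continuous_intros)
    show "continuous_map ?T euclideanreal (\<lambda>x. 1/2)" by auto
    have A: "continuous_map (subtopology ?T {x \<in> topspace ?T. snd x \<le> 1/2}) ?T
        (\<lambda>x. (fst x, 2 * snd x))"
      by (simp add: subtopology_subtopology) (auto intro!: continuous_intros)
    show "continuous_map (subtopology ?T {x \<in> topspace ?T. snd x \<le> 1/2}) X
        (\<lambda>x. P (fst x) (2 * snd x))"
      using continuous_map_compose[OF A P] by (simp add: o_def)
    have B: "continuous_map (subtopology ?T {x \<in> topspace ?T. 1/2 \<le> snd x}) ?T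
        (\<lambda>x. (fst x, 2 * snd x - 1))"
      by (simp add: subtopology_subtopology) (auto intro!: continuous_intros)
    show "continuous_map (subtopology ?T {x \<in> topspace ?T. 1/2 \<le> snd x}) X
        (\<lambda>x. Q (fst x) (2 * snd x - 1))"
      using continuous_map_compose[OF B Q] by (simp add: o_def)
    fix x assume "x \<in> topspace ?T" and "snd x = 1/2"
    then show "P (fst x) (2 * snd x) = Q (fst x) (2 * snd x - 1)"
      using eq[of "fst x"] by (auto simp del: eq_divide_eq_numeral1)
  qed
  then show ?thesis
    by (simp add: path_cat_def case_prod_unfold)
qed

lemma pathin_imp_continuous_map_snd:
  "pathin X p \<Longrightarrow> continuous_map (top_of_set (S \<times> {0..1})) X (\<lambda>(s, t). p t)"
proof -
  assume "pathin X p"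
  moreover have "continuous_map (top_of_set (S \<times> {0..1})) (top_of_set {0..1::real}) snd"
    by (auto intro: continuous_intros)
  ultimately have "continuous_map (top_of_set (S \<times> {0..1})) X (p \<circ> snd)"
    unfolding pathin_def by (rule continuous_map_compose[rotated])
  then show ?thesis by (simp add: o_def case_prod_unfold)
qed

lemma pathin_slice:
  assumes "continuous_map (top_of_set (S \<times> {0..1})) X (\<lambda>(s, t). F s t)" "s \<in> S"
  shows "pathin X (F s)"
proof -
  have "continuous_map (top_of_set {0..1}) (top_of_set (S \<times> {0..1::real})) (\<lambda>t. (s, t))"
    using assms(2) by (auto intro: continuous_intros)
  from continuous_map_compose[OF this assms(1)] show ?thesis
    by (simp add: pathin_def o_def)
qed

lemma pathin_path_cat:
  assumes "pathin X p" "pathin X q" "p 1 = q 0" shows "pathin X (path_cat p q)"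
proof -
  have "continuous_map (top_of_set ({0::real} \<times> {0..1})) X (\<lambda>(s, t). path_cat p q t)"
    by (rule continuous_map_path_cat) (use assms pathin_imp_continuous_map_snd in auto)
  from pathin_slice[OF this] show ?thesis by auto
qed

lemma path_cat_ends [simp]: "path_cat p q 0 = p 0" "path_cat p q 1 = q 1"
  by (auto simp: path_cat_def)

lemma path_rev_ends [simp]: "path_rev p 0 = p 1" "path_rev p 1 = p 0"
  by (auto simp: path_rev_def)

lemma path_rev_rev [simp]: "path_rev (path_rev p) = p"
  by (auto simp: path_rev_def)

lemma comp_path_cat: "f \<circ> path_cat p q = path_cat (f \<circ> p) (f \<circ> q)"
  by (auto simp: path_cat_def)

lemma comp_path_rev: "f \<circ> path_rev p = path_rev (f \<circ> p)"
  by (auto simp: path_rev_def)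

lemma path_rev_const [simp]: "path_rev (\<lambda>_. x) = (\<lambda>_. x)"
  by (auto simp: path_rev_def)

lemma path_cat_const [simp]: "path_cat (\<lambda>_. x) (\<lambda>_. x) = (\<lambda>_. x)"
  by (auto simp: path_cat_def)

lemma pathin_path_rev: assumes "pathin X p" shows "pathin X (path_rev p)"
proof -
  have "continuous_map (top_of_set {0..1}) (top_of_set {0..1::real}) (\<lambda>t. 1 - t)"
    by (auto intro!: continuous_intros)
  from continuous_map_compose[OF this assms[unfolded pathin_def]] show ?thesis
    by (simp add: pathin_def path_rev_def[abs_def] o_def)
qed

lemma pathin_in_topspace: "pathin X p \<Longrightarrow> t \<in> {0..1} \<Longrightarrow> p t \<in> topspace X"
  unfolding pathin_def continuous_map_def by (auto simp: Pi_iff)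

lemma pathin_const' [simp]: "pathin X (\<lambda>_. x) \<longleftrightarrow> x \<in> topspace X"
  by (auto simp: pathin_def)

lemma path_homotopic_cat:
  assumes "path_homotopic X p p'" "path_homotopic X q q'" "p 1 = q 0"
  shows "path_homotopic X (path_cat p q) (path_cat p' q')"
proof -
  obtain F where F: "continuous_map (top_of_set ({0..1::real} \<times> {0..1})) X (\<lambda>(s, t). F s t)"
    "\<And>t. F 0 t = p t" "\<And>t. F 1 t = p' t"
    "\<And>s. s \<in> {0..1} \<Longrightarrow> F s 0 = p 0" "\<And>s. s \<in> {0..1} \<Longrightarrow> F s 1 = p 1"
    by (rule path_homotopicE[OF assms(1)]) blast
  obtain H where H: "continuous_map (top_of_set ({0..1::real} \<times> {0..1})) X (\<lambda>(s, t). H s t)"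
    "\<And>t. H 0 t = q t" "\<And>t. H 1 t = q' t"
    "\<And>s. s \<in> {0..1} \<Longrightarrow> H s 0 = q 0" "\<And>s. s \<in> {0..1} \<Longrightarrow> H s 1 = q 1"
    by (rule path_homotopicE[OF assms(2)]) blast
  show ?thesis
  proof (rule path_homotopicI)
    show "continuous_map (top_of_set ({0..1::real} \<times> {0..1})) X (\<lambda>(s, t). path_cat (F s) (H s) t)"
      by (rule continuous_map_path_cat) (use F H assms in auto)
  qed (use F H in \<open>auto simp: path_cat_def\<close>)
qed

lemma path_homotopic_assoc:
  assumes p: "pathin X p" and q: "pathin X q" and r: "pathin X r" and e: "p 1 = q 0" "q 1 = r 0"
  shows "path_homotopic X (path_cat (path_cat p q) r) (path_cat p (path_cat q r))"
proof -
  \<comment> \<open>The piecewise linear map that takes 1/2 and 3/4, where the right-hand side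
    changes pieces, to 1/4 and 1/2. Its slopes 1/2, 1, 2 increase, so it is the maximum of its three
    linear parts.\<close>
  let ?\<phi> = "\<lambda>t::real. max (t / 2) (max (t - 1/4) (2 * t - 1))"
  have w: "path_cat p (path_cat q r) t = path_cat (path_cat p q) r (?\<phi> t)" if "t \<in> {0..1}" for t
  proof -
    consider "t \<le> 1/2" | "1/2 < t" "t \<le> 3/4" | "3/4 < t" by linarith
    then show ?thesis
    proof cases
      case 1
      then have "?\<phi> t = t / 2" by (simp add: max_def)
      then show ?thesis using 1 by (simp add: path_cat_def)
    next
      case 2
      then have "?\<phi> t = t - 1/4" by (simp add: max_def)
      then show ?thesis using 2 by (simp add: path_cat_def algebra_simps)
    next
      case 3
      then have "?\<phi> t = 2 * t - 1" by (simp add: max_def)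
      then show ?thesis using 3 by (simp add: path_cat_def)
    qed
  qed
  show ?thesis
    by (rule path_homotopic_reparam_path[where p = "path_cat (path_cat p q) r" and \<phi> = "\<lambda>t. t"
          and \<psi> = ?\<phi> and a = 0 and b = 1])
       (use w in \<open>auto intro!: continuous_intros pathin_path_cat simp: p q r e le_max_iff_disj\<close>)
qed

lemma path_homotopic_rid:
  assumes p: "pathin X p" and "x = p 1"
  shows "path_homotopic X (path_cat p (\<lambda>_. x)) p"
  by (rule path_homotopic_reparam_path[where p = p and \<phi> = "\<lambda>t. min 1 (2 * t)"
          and \<psi> = "\<lambda>t. t" and a = 0 and b = 1])
     (use assms in \<open>auto intro!: continuous_intros simp: path_cat_def min_absorb1 min_absorb2\<close>)

lemma path_homotopic_lid:
  assumes p: "pathin X p" and "x = p 0"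
  shows "path_homotopic X (path_cat (\<lambda>_. x) p) p"
  by (rule path_homotopic_reparam_path[where p = p and \<phi> = "\<lambda>t. max 0 (2 * t - 1)"
          and \<psi> = "\<lambda>t. t" and a = 0 and b = 1])
     (use assms in \<open>auto intro!: continuous_intros simp: path_cat_def max_absorb1 max_absorb2\<close>)

text \<open>The concatenation is \<open>p\<close> along a tent map. As a path in the unit interval
  the tent map starts and ends at 0, so it contracts to the constant 0.\<close>

lemma path_homotopic_rinv:
  assumes p: "pathin X p"
  shows "path_homotopic X (path_cat p (path_rev p)) (\<lambda>_. p 0)"
  by (rule path_homotopic_reparam_path[where p = p and \<phi> = "\<lambda>t. min (2 * t) (2 - 2 * t)"
          and \<psi> = "\<lambda>t. 0" and a = 0 and b = 0])
     (use assms in \<open>auto intro!: continuous_intros simp: path_cat_def path_rev_def min_absorb1 min_absorb2 algebra_simps\<close>)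

lemma path_homotopic_linv:
  assumes p: "pathin X p"
  shows "path_homotopic X (path_cat (path_rev p) p) (\<lambda>_. p 1)"
  using path_homotopic_rinv[OF pathin_path_rev[OF p]] by simp

lemma path_homotopic_cancel_left:
  assumes p: "pathin X p" and q: "pathin X q" and e: "p 1 = q 0"
  shows "path_homotopic X (path_cat (path_rev p) (path_cat p q)) q"
proof -
  have "path_homotopic X (path_cat (path_rev p) (path_cat p q)) (path_cat (path_cat (path_rev p) p) q)"
    by (rule path_homotopic_sym[OF path_homotopic_assoc]) (use assms in \<open>auto simp: pathin_path_rev\<close>)
  also have "path_homotopic X \<dots> (path_cat (\<lambda>_. p 1) q)"
    by (rule path_homotopic_cat[OF path_homotopic_linv[OF p] path_homotopic_refl[OF q]]) (use e in auto)
  also have "path_homotopic X \<dots> q"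
    by (rule path_homotopic_lid) (use assms in auto)
  finally show ?thesis .
qed

lemma path_homotopic_cancel_right:
  assumes p: "pathin X p" and q: "pathin X q" and e: "q 1 = p 0"
  shows "path_homotopic X (path_cat (path_cat q p) (path_rev p)) q"
proof -
  have "path_homotopic X (path_cat (path_cat q p) (path_rev p)) (path_cat q (path_cat p (path_rev p)))"
    by (rule path_homotopic_assoc) (use assms in \<open>auto simp: pathin_path_rev\<close>)
  also have "path_homotopic X \<dots> (path_cat q (\<lambda>_. p 0))"
    by (rule path_homotopic_cat[OF path_homotopic_refl[OF q] path_homotopic_rinv[OF p]]) (use e in auto)
  also have "path_homotopic X \<dots> q"
    by (rule path_homotopic_rid) (use assms in auto)
  finally show ?thesis .
qed

lemma path_homotopic_cancel_right':
  assumes p: "pathin X p" and q: "pathin X q" and e: "q 1 = p 1"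
  shows "path_homotopic X (path_cat (path_cat q (path_rev p)) p) q"
  using path_homotopic_cancel_right[OF pathin_path_rev[OF p] q] e by simp

text \<open>The two ways round the convex unit square have the same ends and are homotopic there.
  This turns a homotopy whose ends move into a statement about homotopies with fixed ends.\<close>

lemma path_homotopic_square:
  assumes F: "continuous_map (top_of_set ({0..1::real} \<times> {0..1})) X (\<lambda>(s, t). F s t)"
  shows "path_homotopic X (path_cat (F 0) (\<lambda>s. F s 1)) (path_cat (\<lambda>s. F s 0) (F 1))"
proof -
  let ?F = "\<lambda>(s, t). F s t"
  let ?a = "path_cat (\<lambda>t. (0, t)) (\<lambda>s. (s, 1)) :: real \<Rightarrow> real \<times> real"
  let ?b = "path_cat (\<lambda>s. (s, 0)) (\<lambda>t. (1, t)) :: real \<Rightarrow> real \<times> real"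
  let ?Q = "{0..1} \<times> {0..1} :: (real \<times> real) set"
  have a: "pathin (top_of_set ?Q) ?a"
    by (rule pathin_path_cat) (auto simp: pathin_def intro!: continuous_intros)
  have b: "pathin (top_of_set ?Q) ?b"
    by (rule pathin_path_cat) (auto simp: pathin_def intro!: continuous_intros)
  have "path_homotopic X (?F \<circ> ?a) (?F \<circ> ?b)"
  proof (rule path_homotopic_reparam[OF F])
    show "convex ?Q" by (intro convex_Times) auto
  qed (use a b in \<open>auto simp: pathin_def Pi_iff\<close>)
  then show ?thesis unfolding comp_path_cat by (simp add: o_def)
qed

text \<open>\<open>\<tau> x\<close> is the curve that \<open>x\<close> describes during the
  homotopy; the last property is the square for the homotopy restricted along \<open>p\<close>. For
  loops it says that a free homotopy amounts to conjugation by the track of the base point.\<close>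

lemma homotopic_with_track:
  assumes "homotopic_with (\<lambda>_. True) X Y f h"
  obtains \<tau> where "\<forall>x\<in>topspace X. pathin Y (\<tau> x)" "\<forall>x. \<tau> x 0 = f x" "\<forall>x. \<tau> x 1 = h x"
    "\<forall>p. pathin X p \<longrightarrow>
       path_homotopic Y (path_cat (f \<circ> p) (\<tau> (p 1))) (path_cat (\<tau> (p 0)) (h \<circ> p))"
proof -
  obtain H where H: "continuous_map (prod_topology (top_of_set {0..1}) X) Y H"
    "\<forall>x. H (0::real, x) = f x" "\<forall>x. H (1, x) = h x"
    using assms unfolding homotopic_with_def by metis
  show thesis
  proof (rule that[of "\<lambda>x s. H (s, x)"]; (intro allI ballI impI)?)
    fix x assume "x \<in> topspace X"
    then have "continuous_map (top_of_set {0..1}) (prod_topology (top_of_set {0..1}) X) (\<lambda>s. (s, x))"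
      by (intro continuous_map_pairedI) auto
    from continuous_map_compose[OF this H(1)] show "pathin Y (\<lambda>s. H (s, x))"
      by (simp add: pathin_def o_def)
  next
    fix p assume p: "pathin X p"
    have "continuous_map (top_of_set ({0..1::real} \<times> {0..1})) (prod_topology (top_of_set {0..1}) X)
        (\<lambda>x. (fst x, p (snd x)))"
    proof (rule continuous_map_pairedI)
      show "continuous_map (top_of_set ({0..1::real} \<times> {0..1})) X (\<lambda>x. p (snd x))"
        using pathin_imp_continuous_map_snd[OF p, of "{0..1::real}"] by (simp add: case_prod_unfold)
    qed (auto intro: continuous_intros)
    from continuous_map_compose[OF this H(1)]
    have "continuous_map (top_of_set ({0..1::real} \<times> {0..1})) Y (\<lambda>(s, t). H (s, p t))"
      by (simp add: o_def case_prod_unfold)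
    from path_homotopic_square[OF this]
    show "path_homotopic Y (path_cat (f \<circ> p) (\<lambda>s. H (s, p 1))) (path_cat (\<lambda>s. H (s, p 0)) (h \<circ> p))"
      using H by (simp add: o_def)
  qed (use H in auto)
qed

lemma path_homotopic_conj:
  assumes "path_homotopic Y (path_cat p b) (path_cat a q)"
    and "pathin Y p" "pathin Y q" "pathin Y a" "pathin Y b" "p 1 = b 0" "q 1 = b 1" "a 1 = q 0"
  shows "path_homotopic Y p (path_cat a (path_cat q (path_rev b)))"
proof -
  have "path_homotopic Y p (path_cat (path_cat p b) (path_rev b))"
    by (rule path_homotopic_sym[OF path_homotopic_cancel_right]) (use assms in auto)
  also have "path_homotopic Y \<dots> (path_cat (path_cat a q) (path_rev b))"
    by (rule path_homotopic_cat) (use assms in \<open>auto simp: path_homotopic_refl pathin_path_rev\<close>)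
  also have "path_homotopic Y \<dots> (path_cat a (path_cat q (path_rev b)))"
    by (rule path_homotopic_assoc) (use assms in \<open>auto simp: pathin_path_rev\<close>)
  finally show ?thesis .
qed

section \<open>Maps out of graphs\<close>

lemma edge_path_ends [simp]:
  "edge_path G e 0 = Vertex (tail G e)" "edge_path G e 1 = Vertex (head G e)"
  by (auto simp: edge_path_def)

lemma edge_path_inner: "0 < t \<Longrightarrow> t < 1 \<Longrightarrow> edge_path G e t = Inner e t"
  by (auto simp: edge_path_def)

lemma (in wf_digraph) edge_path_in_gpoints: "e \<in> arcs G \<Longrightarrow> edge_path G e t \<in> gpoints G"
  by (auto simp: edge_path_def gpoints_def)

lemma (in wf_digraph) topspace_realization: "topspace (realization G) = gpoints G"
proof -
  have "openin (realization G) (gpoints G)"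
    unfolding openin_realization
  proof (intro conjI ballI)
    fix e assume "e \<in> arcs G"
    then have "{t \<in> {0..1}. edge_path G e t \<in> gpoints G} = {0..1}"
      by (auto simp: edge_path_in_gpoints)
    then show "openin (top_of_set {0..1}) {t \<in> {0..1}. edge_path G e t \<in> gpoints G}"
      by (simp only: openin_subtopology_self)
  qed simp
  moreover have "topspace (realization G) \<subseteq> gpoints G"
    using openin_topspace[of "realization G"] unfolding openin_realization by blast
  ultimately show ?thesis using openin_subset by blast
qed

lemma (in wf_digraph) pathin_edge_path: "e \<in> arcs G \<Longrightarrow> pathin (realization G) (edge_path G e)"
  unfolding pathin_def continuous_map_def
  by (auto simp: topspace_realization edge_path_in_gpoints openin_realization)

lemma gpoints_cases:
  assumes "x \<in> gpoints G"
  obtains v where "v \<in> verts G" "x = Vertex v"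
  | e t where "e \<in> arcs G" "0 < t" "t < 1" "x = Inner e t" "x = edge_path G e t"
  using assms by (auto simp: gpoints_def edge_path_inner)

lemma (in wf_digraph) continuous_map_realizationI:
  assumes "\<And>v. v \<in> verts G \<Longrightarrow> f (Vertex v) \<in> topspace Y"
    and "\<And>e. e \<in> arcs G \<Longrightarrow> pathin Y (f \<circ> edge_path G e)"
  shows "continuous_map (realization G) Y f"
  unfolding continuous_map_def
proof (intro conjI allI impI)
  have *: "f x \<in> topspace Y" if "x \<in> gpoints G" for x
    using that
  proof (cases rule: gpoints_cases)
    case (2 e t)
    then show ?thesis using pathin_in_topspace[OF assms(2)[of e], of t] by simp
  qed (use assms in auto)
  then show "f \<in> topspace (realization G) \<rightarrow> topspace Y"
    by (auto simp: topspace_realization)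
  fix U assume U: "openin Y U"
  show "openin (realization G) {x \<in> topspace (realization G). f x \<in> U}"
    unfolding openin_realization topspace_realization
  proof (intro conjI ballI)
    fix e assume e: "e \<in> arcs G"
    have "openin (top_of_set {0..1}) {t \<in> topspace (top_of_set {0..1}). (f \<circ> edge_path G e) t \<in> U}"
      using assms(2)[OF e] U unfolding pathin_def continuous_map_def by blast
    then show "openin (top_of_set {0..1}) {t \<in> {0..1}. edge_path G e t \<in> {x \<in> gpoints G. f x \<in> U}}"
      using e by (simp add: edge_path_in_gpoints)
  qed auto
qed

text \<open>The product of a quotient map with a space need not be a quotient map; here it behaves
  like one because the interval of times is locally compact. The proof is a tube argument: for a
  compact interval \<open>J\<close> of times, the points \<open>x\<close> with
  \<open>F (s, x) \<in> U\<close> for all \<open>s \<in> J\<close> form an open set, which can be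
  tested edge by edge.\<close>

lemma (in wf_digraph) continuous_map_realization_prodI:
  fixes F :: "real \<times> ('a, 'b) gpoint \<Rightarrow> 'c"
  assumes V: "\<And>v. v \<in> verts G \<Longrightarrow> pathin Y (\<lambda>s. F (s, Vertex v))"
    and E: "\<And>e. e \<in> arcs G \<Longrightarrow>
      continuous_map (top_of_set ({0..1::real} \<times> {0..1})) Y (\<lambda>(s, t). F (s, edge_path G e t))"
  shows "continuous_map (prod_topology (top_of_set {0..1}) (realization G)) Y F"
proof -
  let ?I = "{0..1::real}"
  have slice: "pathin Y (\<lambda>s. F (s, x))" if "x \<in> gpoints G" for x
    using that
  proof (cases rule: gpoints_cases)
    case (2 e t)
    have "continuous_map (top_of_set ?I) (top_of_set (?I \<times> ?I)) (\<lambda>s. (s, t))"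
      using 2 by (auto intro: continuous_intros)
    from continuous_map_compose[OF this E[OF 2(1)]] show ?thesis
      using 2 by (simp add: pathin_def o_def)
  qed (use V in auto)
  show ?thesis
    unfolding continuous_map_def
  proof (intro conjI allI impI)
    show "F \<in> topspace (prod_topology (top_of_set ?I) (realization G)) \<rightarrow> topspace Y"
      using pathin_in_topspace[OF slice] by (auto simp: topspace_realization)
    fix U assume U: "openin Y U"
    show "openin (prod_topology (top_of_set ?I) (realization G))
        {x \<in> topspace (prod_topology (top_of_set ?I) (realization G)). F x \<in> U}"
      unfolding openin_prod_topology_alt
    proof (intro allI impI)
      fix s0 x0
      assume "(s0, x0) \<in> {x \<in> topspace (prod_topology (top_of_set ?I) (realization G)). F x \<in> U}"
      then have s0: "s0 \<in> ?I" and x0: "x0 \<in> gpoints G" and FU: "F (s0, x0) \<in> U"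
        by (auto simp: topspace_realization)
      have "openin (top_of_set ?I) {s \<in> ?I. F (s, x0) \<in> U}"
        using slice[OF x0] U unfolding pathin_def continuous_map_def by simp
      then have "\<forall>s\<in>{s \<in> ?I. F (s, x0) \<in> U}. \<exists>d>0. \<forall>s'\<in>?I. dist s' s < d \<longrightarrow> s' \<in> {s \<in> ?I. F (s, x0) \<in> U}"
        unfolding openin_euclidean_subtopology_iff by (rule conjunct2)
      then obtain d where d: "d > 0" "\<And>s. s \<in> ?I \<Longrightarrow> dist s s0 < d \<Longrightarrow> F (s, x0) \<in> U"
        using s0 FU by (metis (mono_tags, lifting) mem_Collect_eq)
      \<comment> \<open>Half of the radius, so that the closed ball lies within the open ball of
        radius \<open>d\<close> on which \<open>F (_, x0)\<close> stays in \<open>U\<close>.\<close>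
      define J where "J = cball s0 (d/2) \<inter> ?I"
      have J: "compact J" "J \<subseteq> ?I" unfolding J_def by auto
      define V where "V = {x \<in> gpoints G. \<forall>s\<in>J. F (s, x) \<in> U}"
      have "openin (realization G) V"
        unfolding openin_realization
      proof (intro conjI ballI)
        fix e assume e: "e \<in> arcs G"
        let ?K = "{z \<in> ?I \<times> ?I. F (fst z, edge_path G e (snd z)) \<in> U}"
        have "openin (top_of_set (?I \<times> ?I)) ?K"
          using E[OF e] U unfolding continuous_map_def by (auto simp: case_prod_unfold)
        from this[unfolded openin_open] obtain W where W: "open W" "?K = (?I \<times> ?I) \<inter> W"
          by (elim exE conjE)
        \<comment> \<open>The edge parameters that fail for some time in \<open>J\<close> are the
          projection of a compact set, hence closed.\<close>
        have "compact (J \<times> ?I - W)"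
          using J W by (intro compact_diff compact_Times) auto
        then have "compact (snd ` (J \<times> ?I - W))"
          by (intro compact_continuous_image continuous_intros)
        then have "closedin (top_of_set ?I) (snd ` (J \<times> ?I - W))"
          by (intro closed_subset compact_imp_closed) auto
        then have "openin (top_of_set ?I) (?I - snd ` (J \<times> ?I - W))"
          by (intro openin_diff) auto
        moreover have "?I - snd ` (J \<times> ?I - W) = {t \<in> ?I. \<forall>s\<in>J. F (s, edge_path G e t) \<in> U}"
        proof -
          have iff: "(s, t) \<in> W \<longleftrightarrow> F (s, edge_path G e t) \<in> U" if "s \<in> ?I" "t \<in> ?I" for s t
            using W(2) that by (auto simp: set_eq_iff)
          have "t \<in> snd ` (J \<times> ?I - W) \<longleftrightarrow> (\<exists>s\<in>J. F (s, edge_path G e t) \<notin> U)" if t: "t \<in> ?I" for t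
          proof -
            have "t \<in> snd ` (J \<times> ?I - W) \<longleftrightarrow> (\<exists>s\<in>J. (s, t) \<notin> W)"
            proof
              assume "\<exists>s\<in>J. (s, t) \<notin> W"
              then obtain s where "s \<in> J" "(s, t) \<notin> W" by blast
              then show "t \<in> snd ` (J \<times> ?I - W)"
                using t by (intro image_eqI[of _ _ "(s, t)"]) auto
            qed auto
            also have "\<dots> \<longleftrightarrow> (\<exists>s\<in>J. F (s, edge_path G e t) \<notin> U)"
              using iff[OF _ t] J(2) by (metis subsetD)
            finally show ?thesis .
          qed
          then show ?thesis by auto
        qed
        ultimately show "openin (top_of_set ?I) {t \<in> ?I. edge_path G e t \<in> V}"
          using e by (simp add: V_def edge_path_in_gpoints)
      qed (auto simp: V_def)
      moreover have "openin (top_of_set ?I) (?I \<inter> ball s0 (d/2))" by auto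
      moreover have "s0 \<in> ?I \<inter> ball s0 (d/2)" using s0 d by auto
      moreover have "x0 \<in> V" using x0 d by (auto simp: V_def J_def dist_commute)
      moreover have "(?I \<inter> ball s0 (d/2)) \<times> V
          \<subseteq> {x \<in> topspace (prod_topology (top_of_set ?I) (realization G)). F x \<in> U}"
        by (auto simp: V_def J_def topspace_realization)
      ultimately show "\<exists>U' V'. openin (top_of_set ?I) U' \<and> openin (realization G) V' \<and>
          s0 \<in> U' \<and> x0 \<in> V' \<and>
          U' \<times> V' \<subseteq> {x \<in> topspace (prod_topology (top_of_set ?I) (realization G)). F x \<in> U}"
        by blast
    qed
  qed
qed

definition glue :: "('v \<Rightarrow> 'c) \<Rightarrow> ('e \<Rightarrow> real \<Rightarrow> 'c) \<Rightarrow> ('v, 'e) gpoint \<Rightarrow> 'c" where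
  "glue f P x = (case x of Vertex v \<Rightarrow> f v | Inner e t \<Rightarrow> P e t)"

lemma glue_simps [simp]: "glue f P (Vertex v) = f v" "glue f P (Inner e t) = P e t"
  by (auto simp: glue_def)

lemma glue_edge_path:
  "P e 0 = f (tail G e) \<Longrightarrow> P e 1 = f (head G e) \<Longrightarrow> t \<in> {0..1} \<Longrightarrow> glue f P (edge_path G e t) = P e t"
  by (auto simp: edge_path_def)

lemma (in wf_digraph) glue_path_homotopic:
  assumes "e \<in> arcs G" "pathin Y (P e)" "P e 0 = f (tail G e)" "P e 1 = f (head G e)"
  shows "path_homotopic Y (glue f P \<circ> edge_path G e) (P e)"
  by (rule path_homotopic_sym[OF path_homotopic_eq]) (use assms in \<open>auto simp: glue_edge_path\<close>)

lemma (in wf_digraph) continuous_map_glue: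
  assumes "\<And>v. v \<in> verts G \<Longrightarrow> f v \<in> topspace Y"
    and "\<And>e. e \<in> arcs G \<Longrightarrow> pathin Y (P e)"
    and "\<And>e. e \<in> arcs G \<Longrightarrow> P e 0 = f (tail G e)" "\<And>e. e \<in> arcs G \<Longrightarrow> P e 1 = f (head G e)"
  shows "continuous_map (realization G) Y (glue f P)"
proof (rule continuous_map_realizationI)
  fix e assume "e \<in> arcs G"
  then show "pathin Y (glue f P \<circ> edge_path G e)"
    using glue_path_homotopic[of e Y P f] assms path_homotopic_paths by blast
qed (use assms in auto)

lemma (in wf_digraph) homotopic_with_glue:
  assumes V: "\<And>v. v \<in> verts G \<Longrightarrow> pathin Y (\<sigma> v)"
    and E: "\<And>e. e \<in> arcs G \<Longrightarrow> continuous_map (top_of_set ({0..1::real} \<times> {0..1})) Y (\<lambda>(s, t). K e s t)"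
    and K: "\<And>e s. e \<in> arcs G \<Longrightarrow> s \<in> {0..1} \<Longrightarrow> K e s 0 = \<sigma> (tail G e) s"
      "\<And>e s. e \<in> arcs G \<Longrightarrow> s \<in> {0..1} \<Longrightarrow> K e s 1 = \<sigma> (head G e) s"
    and f: "\<And>v. v \<in> verts G \<Longrightarrow> f (Vertex v) = \<sigma> v 0"
      "\<And>e t. e \<in> arcs G \<Longrightarrow> 0 < t \<Longrightarrow> t < 1 \<Longrightarrow> f (Inner e t) = K e 0 t"
    and h: "\<And>v. v \<in> verts G \<Longrightarrow> h (Vertex v) = \<sigma> v 1"
      "\<And>e t. e \<in> arcs G \<Longrightarrow> 0 < t \<Longrightarrow> t < 1 \<Longrightarrow> h (Inner e t) = K e 1 t"
  shows "homotopic_with (\<lambda>_. True) (realization G) Y f h"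
proof (subst homotopic_with)
  let ?F = "\<lambda>(s, x). glue (\<lambda>v. \<sigma> v s) (\<lambda>e. K e s) x"
  have c: "continuous_map (prod_topology (top_of_set {0..1}) (realization G)) Y ?F"
  proof (rule continuous_map_realization_prodI)
    fix e assume e: "e \<in> arcs G"
    show "continuous_map (top_of_set ({0..1::real} \<times> {0..1})) Y (\<lambda>(s, t). ?F (s, edge_path G e t))"
      by (rule continuous_map_eq[OF E[OF e]]) (use e K in \<open>auto simp: glue_edge_path\<close>)
  qed (use V in auto)
  show "\<exists>F. continuous_map (prod_topology (top_of_set {0..1::real}) (realization G)) Y F \<and>
      (\<forall>x\<in>topspace (realization G). F (0, x) = f x) \<and>
      (\<forall>x\<in>topspace (realization G). F (1, x) = h x) \<and> (\<forall>t\<in>{0..1::real}. True)"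
    by (rule exI[of _ ?F]) (use c f h in \<open>auto simp: topspace_realization gpoints_def\<close>)
qed auto

text \<open>Converse of \<open>homotopic_with_track\<close> for graphs: tracks of the vertices,
  together with one conjugation relation per edge, suffice for a free homotopy. First
  \<open>f\<close> is deformed, with vertices fixed, to the map \<open>k\<close> that runs along the
  conjugated edges \<open>C e\<close>; then the conjugating tails are absorbed by moving the
  vertices along their tracks.\<close>

lemma (in wf_digraph) homotopic_with_realizationI:
  assumes f: "continuous_map (realization G) Y f" and h: "continuous_map (realization G) Y h"
    and \<tau>: "\<And>v. v \<in> verts G \<Longrightarrow> pathin Y (\<tau> v)" "\<And>v. v \<in> verts G \<Longrightarrow> \<tau> v 0 = f (Vertex v)"
      "\<And>v. v \<in> verts G \<Longrightarrow> \<tau> v 1 = h (Vertex v)"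
    and E: "\<And>e. e \<in> arcs G \<Longrightarrow> path_homotopic Y (f \<circ> edge_path G e)
      (path_cat (\<tau> (tail G e)) (path_cat (h \<circ> edge_path G e) (path_rev (\<tau> (head G e)))))"
  shows "homotopic_with (\<lambda>_. True) (realization G) Y f h"
proof -
  define C where "C e = path_cat (\<tau> (tail G e)) (path_cat (h \<circ> edge_path G e) (path_rev (\<tau> (head G e))))" for e
  have hp: "pathin Y (h \<circ> edge_path G e)" if "e \<in> arcs G" for e
    using pathin_edge_path[OF that] h unfolding pathin_def by (rule continuous_map_compose)
  have C: "pathin Y (C e)" if "e \<in> arcs G" for e
    unfolding C_def using that hp \<tau> by (intro pathin_path_cat pathin_path_rev) auto
  define k where "k = glue (\<lambda>v. f (Vertex v)) C"
  have "\<exists>F. continuous_map (top_of_set ({0..1::real} \<times> {0..1})) Y (\<lambda>(s, t). F s t) \<and>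
    (\<forall>t. F 0 t = f (edge_path G e t)) \<and> (\<forall>t. F 1 t = C e t) \<and>
    (\<forall>s\<in>{0..1}. F s 0 = f (Vertex (tail G e)) \<and> F s 1 = f (Vertex (head G e)))" if "e \<in> arcs G" for e
    by (rule path_homotopicE[OF E[OF that, folded C_def]]) auto
  then obtain F where F: "\<And>e. e \<in> arcs G \<Longrightarrow>
      continuous_map (top_of_set ({0..1::real} \<times> {0..1})) Y (\<lambda>(s, t). F e s t) \<and>
    (\<forall>t. F e 0 t = f (edge_path G e t)) \<and> (\<forall>t. F e 1 t = C e t) \<and>
    (\<forall>s\<in>{0..1}. F e s 0 = f (Vertex (tail G e)) \<and> F e s 1 = f (Vertex (head G e)))"
    by metis
  have "homotopic_with (\<lambda>_. True) (realization G) Y f k"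
  proof (rule homotopic_with_glue[where \<sigma> = "\<lambda>v s. f (Vertex v)" and K = F])
    fix v assume "v \<in> verts G"
    then show "pathin Y (\<lambda>s. f (Vertex v))"
      using f by (auto simp: continuous_map_def topspace_realization gpoints_def)
  qed (use F in \<open>auto simp: k_def edge_path_inner\<close>)
  \<comment> \<open>At time \<open>s\<close> the edge runs over the part of \<open>C e\<close>
    between the parameters \<open>s / 2\<close> and \<open>1 - s / 4\<close>. The two tails of
    \<open>C e\<close> occupy the intervals from 0 to 1/2 and from 3/4 to 1, so the ends sit at time
    \<open>s\<close> of the tracks, and at \<open>s = 1\<close> exactly the edge of \<open>h\<close>
    is left.\<close>
  moreover have "homotopic_with (\<lambda>_. True) (realization G) Y k h"
  proof (rule homotopic_with_glue[where \<sigma> = \<tau> and K = "\<lambda>e s t. C e (s / 2 + t * (1 - 3/4 * s))"])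
    fix e assume e: "e \<in> arcs G"
    have b: "0 \<le> s / 2 + t * (1 - 3/4 * s) \<and> s / 2 + t * (1 - 3/4 * s) \<le> 1"
      if "s \<in> {0..1}" "t \<in> {0..1}" for s t :: real
    proof
      show "0 \<le> s / 2 + t * (1 - 3/4 * s)" using that by auto
      have "t * (1 - 3/4 * s) \<le> 1 * (1 - 3/4 * s)" using that by (intro mult_right_mono) auto
      moreover have "0 \<le> s" using that by auto
      ultimately show "s / 2 + t * (1 - 3/4 * s) \<le> 1" unfolding mult_1 by linarith
    qed
    have "continuous_map (top_of_set ({0..1::real} \<times> {0..1})) (top_of_set {0..1::real})
        (\<lambda>x. fst x / 2 + snd x * (1 - 3/4 * fst x))"
      unfolding continuous_map_subtopology_eu using b by (intro conjI continuous_intros) auto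
    from continuous_map_compose[OF this C[OF e, unfolded pathin_def]]
    show "continuous_map (top_of_set ({0..1::real} \<times> {0..1})) Y (\<lambda>(s, t). C e (s / 2 + t * (1 - 3/4 * s)))"
      by (simp add: o_def case_prod_unfold)
  next
    fix e and s :: real assume e: "e \<in> arcs G" and s: "s \<in> {0..1}"
    show "C e (s / 2 + 0 * (1 - 3/4 * s)) = \<tau> (tail G e) s"
      using s by (auto simp: C_def path_cat_def)
    show "C e (s / 2 + 1 * (1 - 3/4 * s)) = \<tau> (head G e) s"
      using s e \<tau> by (auto simp: C_def path_cat_def path_rev_def algebra_simps)
  next
    fix e and t :: real assume e: "e \<in> arcs G" and t: "0 < t" "t < 1"
    show "k (Inner e t) = C e (0 / 2 + t * (1 - 3/4 * 0))"
      by (simp add: k_def)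
    show "h (Inner e t) = C e (1 / 2 + t * (1 - 3/4 * 1))"
      using t by (auto simp: C_def path_cat_def edge_path_inner)
  qed (use \<tau> in \<open>auto simp: k_def\<close>)
  ultimately show ?thesis by (rule homotopic_with_trans)
qed

lemma (in wf_digraph) homotopic_with_realization_relI:
  assumes f: "continuous_map (realization G) Y f" and h: "continuous_map (realization G) Y h"
    and V: "\<And>v. v \<in> verts G \<Longrightarrow> f (Vertex v) = h (Vertex v)"
    and E: "\<And>e. e \<in> arcs G \<Longrightarrow> path_homotopic Y (f \<circ> edge_path G e) (h \<circ> edge_path G e)"
  shows "homotopic_with (\<lambda>_. True) (realization G) Y f h"
proof (rule homotopic_with_realizationI[OF f h, where \<tau> = "\<lambda>v _. f (Vertex v)"])
  fix v assume "v \<in> verts G"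
  then show "pathin Y (\<lambda>_. f (Vertex v))"
    using f by (auto simp: continuous_map_def topspace_realization gpoints_def)
next
  fix e assume e: "e \<in> arcs G"
  have hp: "pathin Y (h \<circ> edge_path G e)" by (rule path_homotopic_paths(2)[OF E[OF e]])
  have "path_homotopic Y (h \<circ> edge_path G e) (path_cat (h \<circ> edge_path G e) (\<lambda>_. f (Vertex (head G e))))"
    by (rule path_homotopic_sym[OF path_homotopic_rid]) (use hp e V in auto)
  also have "path_homotopic Y \<dots> (path_cat (\<lambda>_. f (Vertex (tail G e)))
      (path_cat (h \<circ> edge_path G e) (\<lambda>_. f (Vertex (head G e)))))"
    by (rule path_homotopic_sym[OF path_homotopic_lid])
       (use hp e V pathin_in_topspace[OF hp, of 1] in \<open>auto intro!: pathin_path_cat\<close>)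
  finally show "path_homotopic Y (f \<circ> edge_path G e) (path_cat (\<lambda>_. f (Vertex (tail G e)))
      (path_cat (h \<circ> edge_path G e) (path_rev (\<lambda>_. f (Vertex (head G e))))))"
    using E[OF e] path_homotopic_trans by auto
qed (use V in auto)

section \<open>Words of edge segments\<close>

text \<open>The end parameter may be smaller than the start, so that segments run in either
  direction; a triple of an edge and two parameters is one letter of a word.\<close>

definition seg :: "('v, 'e) pre_digraph \<Rightarrow> 'e \<Rightarrow> real \<Rightarrow> real \<Rightarrow> real \<Rightarrow> ('v, 'e) gpoint" where
  "seg G e s t r = edge_path G e (s + r * (t - s))"

fun is_word :: "('v, 'e) pre_digraph \<Rightarrow> ('v, 'e) gpoint \<Rightarrow> ('e \<times> real \<times> real) list \<Rightarrow> ('v, 'e) gpoint \<Rightarrow> bool" where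
  "is_word G x [] y \<longleftrightarrow> x = y \<and> x \<in> gpoints G"
| "is_word G x ((e, s, t) # ws) y \<longleftrightarrow>
     e \<in> arcs G \<and> s \<in> {0..1} \<and> t \<in> {0..1} \<and> x = edge_path G e s \<and> is_word G (edge_path G e t) ws y"

fun word_path :: "('v, 'e) pre_digraph \<Rightarrow> ('v, 'e) gpoint \<Rightarrow> ('e \<times> real \<times> real) list \<Rightarrow> real \<Rightarrow> ('v, 'e) gpoint" where
  "word_path G x [] = (\<lambda>_. x)"
| "word_path G x ((e, s, t) # ws) = path_cat (seg G e s t) (word_path G (edge_path G e t) ws)"

text \<open>If a letter ended with the same edge and parameter with which the next one begins, both
  could be merged into one segment. The condition on pairs thus excludes backtracking as well as
  needless subdivision, but still allows a loop to be run several times.\<close>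

fun reduced :: "('e \<times> real \<times> real) list \<Rightarrow> bool" where
  "reduced [] \<longleftrightarrow> True"
| "reduced [(e, s, t)] \<longleftrightarrow> s \<noteq> t"
| "reduced ((e, s, t) # (e', s', t') # ws) \<longleftrightarrow>
     s \<noteq> t \<and> (e, t) \<noteq> (e', s') \<and> reduced ((e', s', t') # ws)"

lemma seg_ends [simp]: "seg G e s t 0 = edge_path G e s" "seg G e s t 1 = edge_path G e t"
  by (auto simp: seg_def)

lemma seg_const: "seg G e s s = (\<lambda>_. edge_path G e s)"
  by (auto simp: seg_def)

lemma affine_mem:
  fixes s t r :: real
  assumes "s \<in> {0..1}" "t \<in> {0..1}" "r \<in> {0..1}" shows "s + r * (t - s) \<in> {0..1}"
proof -
  have "(1 - r) *\<^sub>R s + r *\<^sub>R t \<in> {0..1::real}"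
    by (rule convexD_alt) (use assms in auto)
  then show ?thesis by (simp add: algebra_simps)
qed

lemma affine_mem_open:
  fixes s t r :: real
  assumes "s \<in> {0..1}" "t \<in> {0..1}" "0 < r" "r < 1" "s \<noteq> t"
  shows "0 < s + r * (t - s)" "s + r * (t - s) < 1"
proof -
  have eq: "s + r * (t - s) = (1 - r) * s + r * t" by (simp add: algebra_simps)
  show "0 < s + r * (t - s)"
  proof (cases "s = 0")
    case False
    then have "0 < (1 - r) * s" "0 \<le> r * t" using assms by auto
    then show ?thesis unfolding eq by linarith
  qed (use assms in auto)
  show "s + r * (t - s) < 1"
  proof (cases "s = 1")
    case True
    then have "r * (t - 1) < 0" using assms by (auto simp: mult_less_0_iff)
    then show ?thesis using True by simp
  next
    case False
    then have "(1 - r) * s < 1 - r" "r * t \<le> r" using assms by (auto simp: mult_less_cancel_left1 mult_le_cancel_left1)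
    then show ?thesis unfolding eq by linarith
  qed
qed

context wf_digraph begin

lemma edge_path_reparam:
  assumes "e \<in> arcs G"
    and "continuous_on {0..1} \<phi>" "\<phi> ` {0..1} \<subseteq> {0..1}" "\<phi> 0 = a" "\<phi> 1 = b"
    and "continuous_on {0..1} \<psi>" "\<psi> ` {0..1} \<subseteq> {0..1}" "\<psi> 0 = a" "\<psi> 1 = b"
    and "\<And>t. t \<in> {0..1} \<Longrightarrow> q t = edge_path G e (\<phi> t)" "\<And>t. t \<in> {0..1} \<Longrightarrow> r t = edge_path G e (\<psi> t)"
  shows "path_homotopic (realization G) q r"
  by (rule path_homotopic_reparam_path[OF pathin_edge_path[OF assms(1)] assms(2-)])

text \<open>Convexity of the parameter interval: however the path moves back and forth in the edge,
  only its end parameters matter.\<close>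

lemma edge_path_homotopic_seg:
  assumes "e \<in> arcs G" "continuous_on {0..1} \<phi>" "\<phi> ` {0..1} \<subseteq> {0..1}"
    and "\<And>t. t \<in> {0..1} \<Longrightarrow> q t = edge_path G e (\<phi> t)"
  shows "path_homotopic (realization G) q (seg G e (\<phi> 0) (\<phi> 1))"
proof (rule edge_path_reparam[OF assms(1,2,3) refl refl])
  show "(\<lambda>r. \<phi> 0 + r * (\<phi> 1 - \<phi> 0)) ` {0..1} \<subseteq> {0..1}"
    using affine_mem[of "\<phi> 0" "\<phi> 1"] assms(3) by (simp add: image_subset_iff)
qed (use assms in \<open>auto simp: seg_def intro!: continuous_intros\<close>)

lemma pathin_seg: "e \<in> arcs G \<Longrightarrow> s \<in> {0..1} \<Longrightarrow> t \<in> {0..1} \<Longrightarrow> pathin (realization G) (seg G e s t)"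
  using edge_path_homotopic_seg[where \<phi> = "\<lambda>r. s + r * (t - s)" and q = "seg G e s t" and e = e]
    affine_mem[of s t] path_homotopic_paths
  by (fastforce simp: seg_def intro!: continuous_intros)

lemma seg_cat:
  assumes "e \<in> arcs G" "s \<in> {0..1}" "t \<in> {0..1}" "u \<in> {0..1}"
  shows "path_homotopic (realization G) (path_cat (seg G e s t) (seg G e t u)) (seg G e s u)"
proof -
  let ?\<phi> = "path_cat (\<lambda>r. s + r * (t - s)) (\<lambda>r. t + r * (u - t))"
  have "pathin (top_of_set {0..1}) ?\<phi>"
    using affine_mem[of s t] affine_mem[of t u] assms
    by (intro pathin_path_cat) (auto simp: pathin_def intro!: continuous_intros)
  then have \<phi>: "continuous_on {0..1} ?\<phi>" "?\<phi> ` {0..1} \<subseteq> {0..1}"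
    by (auto simp: pathin_def Pi_iff)
  have "path_homotopic (realization G) (path_cat (seg G e s t) (seg G e t u)) (seg G e (?\<phi> 0) (?\<phi> 1))"
    by (rule edge_path_homotopic_seg[OF assms(1) \<phi>]) (auto simp: path_cat_def seg_def)
  then show ?thesis by simp
qed

lemma word_path_props:
  assumes "is_word G x ws y"
  shows "pathin (realization G) (word_path G x ws) \<and> word_path G x ws 0 = x \<and> word_path G x ws 1 = y"
  using assms
proof (induction ws arbitrary: x)
  case Nil
  then show ?case by (auto simp: topspace_realization)
next
  case (Cons a ws)
  obtain e s t where a: "a = (e, s, t)" by (cases a)
  then show ?case using Cons.prems Cons.IH[of "edge_path G e t"]
    by (auto intro!: pathin_path_cat pathin_seg)
qed

lemma pathin_word_path: "is_word G x ws y \<Longrightarrow> pathin (realization G) (word_path G x ws)"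
  and word_path_0: "is_word G x ws y \<Longrightarrow> word_path G x ws 0 = x"
  and word_path_1: "is_word G x ws y \<Longrightarrow> word_path G x ws 1 = y"
  using word_path_props by blast+

lemma is_word_append: "is_word G x us z \<Longrightarrow> is_word G z vs y \<Longrightarrow> is_word G x (us @ vs) y"
  by (induction us arbitrary: x) auto

lemma word_path_append:
  assumes "is_word G x us z" "is_word G z vs y"
  shows "path_homotopic (realization G) (word_path G x (us @ vs))
    (path_cat (word_path G x us) (word_path G z vs))"
  using assms(1)
proof (induction us arbitrary: x)
  case Nil
  then show ?case
    using path_homotopic_sym[OF path_homotopic_lid[OF pathin_word_path[OF assms(2)]]]
      word_path_0[OF assms(2)] by auto
next
  case (Cons a us)
  obtain e s t where a: "a = (e, s, t)" by (cases a)
  let ?z = "edge_path G e t"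
  have w: "is_word G ?z us z" and est: "e \<in> arcs G" "s \<in> {0..1}" "t \<in> {0..1}"
    using Cons.prems a by auto
  have "path_homotopic (realization G) (path_cat (seg G e s t) (word_path G ?z (us @ vs)))
     (path_cat (seg G e s t) (path_cat (word_path G ?z us) (word_path G z vs)))"
    by (rule path_homotopic_cat[OF path_homotopic_refl Cons.IH])
       (use w est assms word_path_0[OF is_word_append[OF w assms(2)]] in \<open>auto simp: pathin_seg\<close>)
  also have "path_homotopic (realization G) \<dots> (path_cat (path_cat (seg G e s t) (word_path G ?z us)) (word_path G z vs))"
    by (rule path_homotopic_sym[OF path_homotopic_assoc])
       (use w est assms word_path_props[OF w] word_path_props[OF assms(2)] in \<open>auto simp: pathin_seg\<close>)
  finally show ?case by (simp add: a)
qed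

section \<open>Every path is homotopic to a word of segments\<close>

definition wordy :: "(real \<Rightarrow> ('a, 'b) gpoint) \<Rightarrow> bool" where
  "wordy p \<longleftrightarrow> (\<exists>ws. is_word G (p 0) ws (p 1) \<and> path_homotopic (realization G) p (word_path G (p 0) ws))"

lemma wordy_cong: "path_homotopic (realization G) p q \<Longrightarrow> wordy q \<Longrightarrow> wordy p"
  unfolding wordy_def using path_homotopic_ends path_homotopic_trans by metis

lemma wordy_const: "x \<in> gpoints G \<Longrightarrow> wordy (\<lambda>_. x)"
  unfolding wordy_def
  by (rule exI[of _ "[]"]) (auto intro!: path_homotopic_refl simp: topspace_realization)

lemma wordy_cat:
  assumes "wordy p" "wordy q" "p 1 = q 0" shows "wordy (path_cat p q)"
proof -
  obtain us where us: "is_word G (p 0) us (p 1)" "path_homotopic (realization G) p (word_path G (p 0) us)"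
    using assms(1) unfolding wordy_def by blast
  obtain vs where vs: "is_word G (q 0) vs (q 1)" "path_homotopic (realization G) q (word_path G (q 0) vs)"
    using assms(2) unfolding wordy_def by blast
  have us1: "is_word G (p 0) us (q 0)" using us assms(3) by simp
  have "path_homotopic (realization G) (path_cat p q) (path_cat (word_path G (p 0) us) (word_path G (q 0) vs))"
    by (rule path_homotopic_cat[OF us(2) vs(2) assms(3)])
  also have "path_homotopic (realization G) \<dots> (word_path G (p 0) (us @ vs))"
    by (rule path_homotopic_sym[OF word_path_append[OF us1 vs(1)]])
  finally show ?thesis
    unfolding wordy_def using is_word_append[OF us1 vs(1)] by auto
qed

lemma wordy_seg:
  assumes "e \<in> arcs G" "s \<in> {0..1}" "t \<in> {0..1}" shows "wordy (seg G e s t)"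
  unfolding wordy_def
proof (intro exI[of _ "[(e, s, t)]"] conjI)
  show "path_homotopic (realization G) (seg G e s t) (word_path G (seg G e s t 0) [(e, s, t)])"
    using path_homotopic_sym[OF path_homotopic_rid[OF pathin_seg[OF assms]]] by auto
qed (use assms edge_path_in_gpoints in auto)

lemma openin_inner:
  assumes "0 \<le> a" "b \<le> 1" "e \<in> arcs G"
  shows "openin (realization G) {Inner e t | t. a < t \<and> t < b}"
  unfolding openin_realization
proof (intro conjI ballI)
  show "{Inner e t |t. a < t \<and> t < b} \<subseteq> gpoints G" using assms by (auto simp: gpoints_def)
  fix e' assume "e' \<in> arcs G"
  have "{t \<in> {0..1}. edge_path G e' t \<in> {Inner e t |t. a < t \<and> t < b}} =
      (if e' = e then {0..1} \<inter> {a<..<b} else {})"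
    using assms by (auto simp: edge_path_def split: if_splits)
  then show "openin (top_of_set {0..1}) {t \<in> {0..1}. edge_path G e' t \<in> {Inner e t |t. a < t \<and> t < b}}"
    by (simp add: openin_open_Int)
qed

text \<open>The radius 1/3 is the one that \<open>squeeze\<close> crushes: it sends the outer thirds
  of an edge to its ends. A loop contributes both of its outer thirds to the star of its
  vertex.\<close>

definition star :: "'a \<Rightarrow> ('a, 'b) gpoint set" where
  "star v = insert (Vertex v) {Inner e t | e t. e \<in> arcs G \<and> 0 < t \<and> t < 1 \<and>
     (tail G e = v \<and> t < 1/3 \<or> head G e = v \<and> 2/3 < t)}"

lemma openin_star: assumes "v \<in> verts G" shows "openin (realization G) (star v)"
  unfolding openin_realization
proof (intro conjI ballI)
  show "star v \<subseteq> gpoints G" using assms by (auto simp: gpoints_def star_def)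
  fix e assume e: "e \<in> arcs G"
  have "{t \<in> {0..1}. edge_path G e t \<in> star v} =
      {0..1} \<inter> ((if tail G e = v then {..<1/3} else {}) \<union> (if head G e = v then {2/3<..} else {}))"
    using e by (auto simp: edge_path_def star_def split: if_splits)
  then show "openin (top_of_set {0..1}) {t \<in> {0..1}. edge_path G e t \<in> star v}"
    by (simp add: openin_open_Int open_Un)
qed

fun coord :: "('a, 'b) gpoint \<Rightarrow> real" where
  "coord (Vertex v) = 0" | "coord (Inner e t) = t"

lemma continuous_map_coord:
  assumes "e \<in> arcs G"
  shows "continuous_map (subtopology (realization G) {Inner e t | t. 0 < t \<and> t < 1}) euclideanreal coord"
proof -
  let ?O = "{Inner e t | t. 0 < t \<and> t < 1}"
  have O: "openin (realization G) ?O" using openin_inner[OF _ _ assms, of 0 1] by simp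
  have ts: "topspace (subtopology (realization G) ?O) = ?O"
    using openin_subset[OF O] by auto
  have "openin (subtopology (realization G) ?O) {x \<in> ?O. a < coord x}" for a
  proof -
    have "{x \<in> ?O. a < coord x} = {Inner e t | t. max 0 a < t \<and> t < 1}" by auto
    then show ?thesis
      unfolding openin_open_subtopology[OF O] using openin_inner[OF _ _ assms, of "max 0 a" 1] by auto
  qed
  moreover have "openin (subtopology (realization G) ?O) {x \<in> ?O. coord x < a}" for a
  proof -
    have "{x \<in> ?O. coord x < a} = {Inner e t | t. 0 < t \<and> t < min 1 a}" by auto
    then show ?thesis
      unfolding openin_open_subtopology[OF O] using openin_inner[OF _ _ assms, of 0 "min 1 a"] by auto
  qed
  ultimately show ?thesis
    unfolding continuous_map_upper_lower_semicontinuous_lt ts by blast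
qed

text \<open>Stretches the middle third of an edge over the whole edge. The outer thirds are crushed
  because a path may enter and leave a neighbourhood of a vertex infinitely often.\<close>

definition squeeze :: "real \<Rightarrow> real" where "squeeze t = max 0 (min 1 (3 * t - 1))"

lemma squeeze_mem: "squeeze t \<in> {0..1}" "0 \<le> squeeze t" "squeeze t \<le> 1"
  by (auto simp: squeeze_def)

lemma squeeze_values: "t \<le> 1/3 \<Longrightarrow> squeeze t = 0" "2/3 \<le> t \<Longrightarrow> squeeze t = 1"
  by (auto simp: squeeze_def)

lemma continuous_on_squeeze: "continuous_on S f \<Longrightarrow> continuous_on S (\<lambda>x. squeeze (f x))"
  unfolding squeeze_def by (intro continuous_intros)

text \<open>A homotopy from the identity to a map that is constant on the star of each vertex.\<close>

definition squeeze_homotopy :: "real \<Rightarrow> ('a, 'b) gpoint \<Rightarrow> ('a, 'b) gpoint" where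
  "squeeze_homotopy s = glue Vertex (\<lambda>e t. edge_path G e (t + s * (squeeze t - t)))"

lemma squeeze_homotopy_edge_path:
  "t \<in> {0..1} \<Longrightarrow> squeeze_homotopy s (edge_path G e t) = edge_path G e (t + s * (squeeze t - t))"
  unfolding squeeze_homotopy_def by (subst glue_edge_path) (auto simp: squeeze_def)

lemma continuous_map_squeeze_homotopy:
  "continuous_map (prod_topology (top_of_set {0..1}) (realization G)) (realization G)
     (\<lambda>(s, x). squeeze_homotopy s x)"
proof (rule continuous_map_realization_prodI)
  fix e assume e: "e \<in> arcs G"
  have "continuous_map (top_of_set ({0..1::real} \<times> {0..1})) (top_of_set {0..1::real})
      (\<lambda>x. snd x + fst x * (squeeze (snd x) - snd x))"
    unfolding continuous_map_subtopology_eu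
  proof
    show "continuous_on ({0..1::real} \<times> {0..1}) (\<lambda>x. snd x + fst x * (squeeze (snd x) - snd x))"
      by (intro continuous_intros continuous_on_squeeze)
    show "(\<lambda>x. snd x + fst x * (squeeze (snd x) - snd x)) \<in> {0..1::real} \<times> {0..1} \<rightarrow> {0..1}"
      using affine_mem[OF _ squeeze_mem(1)] by fastforce
  qed
  from continuous_map_compose[OF this pathin_edge_path[OF e, unfolded pathin_def]]
  show "continuous_map (top_of_set ({0..1} \<times> {0..1})) (realization G)
      (\<lambda>(s, t). case (s, edge_path G e t) of (s, x) \<Rightarrow> squeeze_homotopy s x)"
    by (rule continuous_map_eq) (auto simp: squeeze_homotopy_edge_path)
qed (auto simp: squeeze_homotopy_def topspace_realization gpoints_def)

lemma wordy_squeeze_track: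
  assumes "x \<in> gpoints G"
  shows "wordy (\<lambda>s. squeeze_homotopy s x)" "wordy (path_rev (\<lambda>s. squeeze_homotopy s x))"
proof -
  have "wordy (\<lambda>s. squeeze_homotopy s x) \<and> wordy (path_rev (\<lambda>s. squeeze_homotopy s x))"
    using assms
  proof (cases rule: gpoints_cases)
    case (1 v)
    then have "(\<lambda>s. squeeze_homotopy s x) = (\<lambda>_. x)" by (auto simp: squeeze_homotopy_def)
    then show ?thesis using wordy_const[OF assms] by simp
  next
    case (2 e t)
    then have t: "t \<in> {0..1}" by simp
    have eq: "(\<lambda>s. squeeze_homotopy s x) = seg G e t (squeeze t)"
      unfolding 2(5) squeeze_homotopy_edge_path[OF t] by (simp add: seg_def[abs_def])
    have "path_rev (seg G e t (squeeze t)) = seg G e (squeeze t) t"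
      by (auto simp: path_rev_def seg_def algebra_simps)
    then show ?thesis
      unfolding eq using wordy_seg[OF 2(1)] t squeeze_mem(1) by simp
  qed
  then show "wordy (\<lambda>s. squeeze_homotopy s x)" "wordy (path_rev (\<lambda>s. squeeze_homotopy s x))" by auto
qed

definition path_part :: "(real \<Rightarrow> 'c) \<Rightarrow> real \<Rightarrow> real \<Rightarrow> real \<Rightarrow> 'c" where
  "path_part p a b r = p (a + r * (b - a))"

lemma pathin_path_part:
  assumes "pathin X p" "a \<in> {0..1}" "b \<in> {0..1}" shows "pathin X (path_part p a b)"
proof -
  have "continuous_map (top_of_set {0..1}) (top_of_set {0..1}) (\<lambda>r. a + r * (b - a))"
    using affine_mem[of a b] assms by (auto intro!: continuous_intros)
  from continuous_map_compose[OF this assms(1)[unfolded pathin_def]] show ?thesis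
    by (simp add: pathin_def path_part_def[abs_def] o_def)
qed

lemma path_part_cat:
  assumes "pathin X p" "a \<in> {0..1}" "b \<in> {0..1}" "c \<in> {0..1}"
  shows "path_homotopic X (path_part p a c) (path_cat (path_part p a b) (path_part p b c))"
proof -
  let ?\<phi> = "path_cat (\<lambda>r. a + r * (b - a)) (\<lambda>r. b + r * (c - b))"
  have "pathin (top_of_set {0..1}) ?\<phi>"
    using affine_mem[of a b] affine_mem[of b c] assms
    by (intro pathin_path_cat) (auto simp: pathin_def intro!: continuous_intros)
  then have \<phi>: "continuous_on {0..1} ?\<phi>" "?\<phi> ` {0..1} \<subseteq> {0..1}"
    by (auto simp: pathin_def Pi_iff)
  show ?thesis
    by (rule path_homotopic_reparam_path[OF assms(1), where \<phi> = "\<lambda>r. a + r * (c - a)" and \<psi> = ?\<phi>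
          and a = a and b = c])
       (use \<phi> affine_mem[of a c] assms in \<open>auto simp: path_part_def path_cat_def intro!: continuous_intros\<close>)
qed

lemma pathin_eventually:
  assumes p: "pathin X p" and x: "x \<in> {0..1}" and U: "openin X U" "p x \<in> U"
  obtains d where "d > 0" "\<And>y. y \<in> {0..1} \<Longrightarrow> \<bar>y - x\<bar> < d \<Longrightarrow> p y \<in> U"
proof -
  have "openin (top_of_set {0..1}) {y \<in> {0..1}. p y \<in> U}"
    using p U unfolding pathin_def continuous_map_def by simp
  then have "\<forall>s\<in>{y \<in> {0..1}. p y \<in> U}. \<exists>d>0. \<forall>s'\<in>{0..1}. dist s' s < d \<longrightarrow> s' \<in> {y \<in> {0..1}. p y \<in> U}"
    unfolding openin_euclidean_subtopology_iff by (rule conjunct2)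
  then obtain d where "d > 0" "\<forall>s'\<in>{0..1}. dist s' x < d \<longrightarrow> p s' \<in> U"
    using x U by (metis (mono_tags, lifting) mem_Collect_eq)
  then show thesis by (intro that[of d]) (auto simp: dist_real_def)
qed

text \<open>Close to a time at which \<open>p\<close> is at a vertex, \<open>p\<close> stays in its
  star, and the squeezed path is constant. Close to a time at which \<open>p\<close> is inside an
  edge, it stays in that open edge, where it has a continuous coordinate and is therefore homotopic
  to a segment.\<close>

lemma wordy_squeezed:
  assumes p: "pathin (realization G) p" and x: "x \<in> {0..1}"
  obtains d where "d > 0"
    "\<And>a b. 0 \<le> a \<Longrightarrow> b \<le> 1 \<Longrightarrow> a \<le> x \<Longrightarrow> x \<le> b \<Longrightarrow> b - a < d \<Longrightarrow>
      wordy (path_part (squeeze_homotopy 1 \<circ> p) a b)"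
proof -
  have mem: "a + r * (b - a) \<in> {0..1}" "\<bar>a + r * (b - a) - x\<bar> < d"
    if "0 \<le> a" "b \<le> 1" "a \<le> x" "x \<le> b" "b - a < d" "r \<in> {0..1}" for a b d r :: real
  proof -
    show "a + r * (b - a) \<in> {0..1}" using affine_mem[of a b r] that by auto
    have "0 \<le> r * (b - a)" "r * (b - a) \<le> b - a"
      using that by (auto intro: mult_left_le_one_le)
    then show "\<bar>a + r * (b - a) - x\<bar> < d" using that by linarith
  qed
  have "p x \<in> gpoints G" using pathin_in_topspace[OF p x] by (simp add: topspace_realization)
  then show thesis
  proof (cases rule: gpoints_cases)
    case (1 v)
    have "p x \<in> star v" using 1 by (simp add: star_def)
    then obtain d where d: "d > 0" "\<And>y. y \<in> {0..1} \<Longrightarrow> \<bar>y - x\<bar> < d \<Longrightarrow> p y \<in> star v"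
      using pathin_eventually[OF p x openin_star[OF 1(1)]] by metis
    have sq: "squeeze_homotopy 1 y = Vertex v" if "y \<in> star v" for y
      using that by (auto simp: star_def squeeze_homotopy_def squeeze_values)
    show thesis
    proof (rule that[OF d(1)])
      fix a b assume ab: "0 \<le> a" "b \<le> 1" "a \<le> x" "x \<le> b" "b - a < d"
      have pa: "pathin (realization G) (\<lambda>_. Vertex v)"
        using 1 by (auto simp: topspace_realization gpoints_def)
      have "path_homotopic (realization G) (\<lambda>_. Vertex v) (path_part (squeeze_homotopy 1 \<circ> p) a b)"
      proof (rule path_homotopic_eq[OF pa])
        fix t :: real assume "t \<in> {0..1}"
        then show "Vertex v = path_part (squeeze_homotopy 1 \<circ> p) a b t"
          using mem[OF ab] d(2) sq by (auto simp: path_part_def)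
      qed
      moreover have "wordy (\<lambda>_. Vertex v)" using 1 by (intro wordy_const) (auto simp: gpoints_def)
      ultimately show "wordy (path_part (squeeze_homotopy 1 \<circ> p) a b)"
        by (rule wordy_cong[OF path_homotopic_sym])
    qed
  next
    case (2 e t)
    let ?O = "{Inner e t | t. 0 < t \<and> t < 1}"
    have "openin (realization G) ?O" using openin_inner[OF _ _ 2(1), of 0 1] by simp
    then obtain d where d: "d > 0" "\<And>y. y \<in> {0..1} \<Longrightarrow> \<bar>y - x\<bar> < d \<Longrightarrow> p y \<in> ?O"
      by (rule pathin_eventually[OF p x]) (use 2 in auto)
    show thesis
    proof (rule that[OF d(1)])
      fix a b assume ab: "0 \<le> a" "b \<le> 1" "a \<le> x" "x \<le> b" "b - a < d"
      have inO: "path_part p a b r \<in> ?O" if "r \<in> {0..1}" for r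
        using mem[OF ab that] d(2) by (simp add: path_part_def)
      have "pathin (realization G) (path_part p a b)"
        by (rule pathin_path_part[OF p]) (use ab in auto)
      then have "continuous_map (top_of_set {0..1}) (subtopology (realization G) ?O) (path_part p a b)"
        unfolding pathin_def continuous_map_in_subtopology using inO by auto
      from continuous_map_compose[OF this continuous_map_coord[OF 2(1)]]
      have c: "continuous_on {0..1} (\<lambda>r. coord (path_part p a b r))" by (simp add: o_def)
      have "path_homotopic (realization G) (path_part (squeeze_homotopy 1 \<circ> p) a b)
        (seg G e (squeeze (coord (path_part p a b 0))) (squeeze (coord (path_part p a b 1))))"
      proof (rule edge_path_homotopic_seg[where \<phi> = "\<lambda>r. squeeze (coord (path_part p a b r))", OF 2(1)])
        show "continuous_on {0..1} (\<lambda>r. squeeze (coord (path_part p a b r)))"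
          by (rule continuous_on_squeeze[OF c])
        fix r :: real assume "r \<in> {0..1}"
        from inO[OF this] obtain t where "path_part p a b r = Inner e t" by blast
        then show "path_part (squeeze_homotopy 1 \<circ> p) a b r = edge_path G e (squeeze (coord (path_part p a b r)))"
          by (simp add: path_part_def squeeze_homotopy_def)
      qed (use squeeze_mem in auto)
      then show "wordy (path_part (squeeze_homotopy 1 \<circ> p) a b)"
        by (rule wordy_cong) (use wordy_seg[OF 2(1)] squeeze_mem in auto)
    qed
  qed
qed

text \<open>The squeezed path is wordy on short intervals; bisection of the unit interval in the
  form of \<open>Bolzano\<close> makes this global, since words of adjacent parts can be joined.
  Squeezing moves the ends of \<open>p\<close>, but along segments, which lead back to the original
  path.\<close>

lemma pathin_wordy:
  assumes p: "pathin (realization G) p" shows "wordy p"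
proof -
  have "continuous_map (top_of_set ({0..1::real} \<times> {0..1})) (prod_topology (top_of_set {0..1}) (realization G))
      (\<lambda>x. (fst x, p (snd x)))"
  proof (rule continuous_map_pairedI)
    show "continuous_map (top_of_set ({0..1::real} \<times> {0..1})) (realization G) (\<lambda>x. p (snd x))"
      using pathin_imp_continuous_map_snd[OF p, of "{0..1::real}"] by (simp add: case_prod_unfold)
  qed (auto intro: continuous_intros)
  from continuous_map_compose[OF this continuous_map_squeeze_homotopy]
  have F: "continuous_map (top_of_set ({0..1::real} \<times> {0..1})) (realization G)
      (\<lambda>(s, t). squeeze_homotopy s (p t))"
    by (simp add: o_def case_prod_unfold)
  let ?q = "squeeze_homotopy 1 \<circ> p"
  have q: "pathin (realization G) ?q"
    using pathin_slice[OF F, of 1] by (simp add: o_def)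
  have sq0: "squeeze_homotopy 0 x = x" if "x \<in> gpoints G" for x
    using that by (cases rule: gpoints_cases) (auto simp: squeeze_homotopy_def)
  have pg: "p t \<in> gpoints G" if "t \<in> {0..1}" for t
    using pathin_in_topspace[OF p that] by (simp add: topspace_realization)
  have "0 \<le> (0::real) \<and> (1::real) \<le> 1 \<longrightarrow> wordy (path_part ?q 0 1)"
  proof (rule Bolzano[where P = "\<lambda>a b. 0 \<le> a \<and> b \<le> 1 \<longrightarrow> wordy (path_part ?q a b)"])
    fix a b c :: real
    assume ab: "0 \<le> a \<and> b \<le> 1 \<longrightarrow> wordy (path_part ?q a b)"
      and bc: "0 \<le> b \<and> c \<le> 1 \<longrightarrow> wordy (path_part ?q b c)" and le: "a \<le> b" "b \<le> c"
    show "0 \<le> a \<and> c \<le> 1 \<longrightarrow> wordy (path_part ?q a c)"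
    proof
      assume ac: "0 \<le> a \<and> c \<le> 1"
      show "wordy (path_part ?q a c)"
        by (rule wordy_cong[OF path_part_cat[OF q, of a b c]])
           (use ab bc le ac in \<open>auto intro!: wordy_cat simp: path_part_def\<close>)
    qed
  next
    fix x :: real assume "0 \<le> x" "x \<le> 1"
    then obtain d where "d > 0"
    "\<And>a b. 0 \<le> a \<Longrightarrow> b \<le> 1 \<Longrightarrow> a \<le> x \<Longrightarrow> x \<le> b \<Longrightarrow> b - a < d \<Longrightarrow>
      wordy (path_part ?q a b)" using wordy_squeezed[OF p, of x] by auto
    then show "\<exists>d>0. \<forall>a b. a \<le> x \<and> x \<le> b \<and> b - a < d \<longrightarrow> 0 \<le> a \<and> b \<le> 1 \<longrightarrow> wordy (path_part ?q a b)"
      by blast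
  qed simp
  moreover have "path_part ?q 0 1 = ?q" by (auto simp: path_part_def)
  ultimately have wq: "wordy ?q" by simp
  have tr: "pathin (realization G) (\<lambda>s. squeeze_homotopy s x)" if "x \<in> gpoints G" for x
    using wordy_squeeze_track[OF that] path_homotopic_paths(1) unfolding wordy_def by blast
  have "path_homotopic (realization G) (squeeze_homotopy 0 \<circ> p)
      (path_cat (\<lambda>s. squeeze_homotopy s (p 0)) (path_cat ?q (path_rev (\<lambda>s. squeeze_homotopy s (p 1)))))"
    by (rule path_homotopic_conj)
       (use path_homotopic_square[OF F] pathin_slice[OF F, of 0] q tr pg in \<open>auto simp: o_def\<close>)
  moreover have "path_homotopic (realization G) p (squeeze_homotopy 0 \<circ> p)"
    by (rule path_homotopic_eq[OF p]) (use sq0 pg in auto)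
  ultimately have h: "path_homotopic (realization G) p
      (path_cat (\<lambda>s. squeeze_homotopy s (p 0)) (path_cat ?q (path_rev (\<lambda>s. squeeze_homotopy s (p 1)))))"
    by (rule path_homotopic_trans[rotated])
  show ?thesis
    by (rule wordy_cong[OF h]) (use wq wordy_squeeze_track pg in \<open>auto intro!: wordy_cat\<close>)
qed

section \<open>Reduced words\<close>

lemma reduce_word:
  assumes "is_word G x ws y"
  shows "\<exists>vs. reduced vs \<and> is_word G x vs y \<and>
    path_homotopic (realization G) (word_path G x ws) (word_path G x vs)"
  using assms
proof (induction ws arbitrary: x)
  case Nil
  show ?case using Nil path_homotopic_refl[OF pathin_word_path[OF Nil]] by (intro exI[of _ "[]"]) auto
next
  case (Cons a ws)
  obtain e s t where a: "a = (e, s, t)" by (cases a)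
  let ?z = "edge_path G e t" and ?X = "realization G"
  have w: "is_word G ?z ws y" and est: "e \<in> arcs G" "s \<in> {0..1}" "t \<in> {0..1}" and x: "x = edge_path G e s"
    using Cons.prems a by auto
  obtain vs where vs: "reduced vs" "is_word G ?z vs y" "path_homotopic ?X (word_path G ?z ws) (word_path G ?z vs)"
    using Cons.IH[OF w] by blast
  have h: "path_homotopic ?X (word_path G x (a # ws)) (path_cat (seg G e s t) (word_path G ?z vs))"
    unfolding a word_path.simps
    by (rule path_homotopic_cat[OF path_homotopic_refl vs(3)])
       (use est word_path_0[OF w] in \<open>auto simp: pathin_seg\<close>)
  \<comment> \<open>The tail is already reduced, so a new letter can only interact with the first
    letter of the tail. If both merge, the junction behind them is unchanged, and a merged letter
    that has become constant is dropped.\<close>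
  consider (eq) "s = t" | (merge) t' us where "s \<noteq> t" "vs = (e, t, t') # us"
    | (keep) "s \<noteq> t" "\<nexists>t' us. vs = (e, t, t') # us" by blast
  then show ?case
  proof cases
    case eq
    then have "path_homotopic ?X (path_cat (seg G e s t) (word_path G ?z vs)) (word_path G ?z vs)"
      unfolding eq seg_const
      by (intro path_homotopic_lid) (use pathin_word_path[OF vs(2)] word_path_0[OF vs(2)] in auto)
    then show ?thesis
      using path_homotopic_trans[OF h] vs eq x by blast
  next
    case keep
    then have "reduced ((e, s, t) # vs)"
    proof (cases vs)
      case (Cons b us)
      then show ?thesis using keep vs(1) by (cases b) auto
    qed auto
    then show ?thesis
      using h vs est x by (intro exI[of _ "(e, s, t) # vs"]) auto
  next
    case merge
    let ?u = "edge_path G e t'"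
    have us: "is_word G ?u us y" "t' \<in> {0..1}" using vs(2) merge by auto
    have rus: "reduced us" using vs(1) merge by (cases us) auto
    note pu = word_path_props[OF us(1)]
    have "path_homotopic ?X (path_cat (seg G e s t) (word_path G ?z vs))
        (path_cat (path_cat (seg G e s t) (seg G e t t')) (word_path G ?u us))"
      unfolding merge word_path.simps
      by (rule path_homotopic_sym[OF path_homotopic_assoc]) (use est us pu in \<open>auto simp: pathin_seg\<close>)
    also have "path_homotopic ?X \<dots> (path_cat (seg G e s t') (word_path G ?u us))"
      by (rule path_homotopic_cat[OF seg_cat path_homotopic_refl]) (use est us pu in auto)
    finally have h2: "path_homotopic ?X (word_path G x (a # ws)) (path_cat (seg G e s t') (word_path G ?u us))"
      by (rule path_homotopic_trans[OF h])
    show ?thesis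
    proof (cases "s = t'")
      case True
      have "path_homotopic ?X (path_cat (seg G e s t') (word_path G ?u us)) (word_path G ?u us)"
        unfolding True seg_const
        by (intro path_homotopic_lid) (use pu in auto)
      then show ?thesis
        using path_homotopic_trans[OF h2] us x True rus by blast
    next
      case False
      have "reduced ((e, s, t') # us)"
        using vs(1) False merge by (cases us) auto
      then show ?thesis
        using h2 us est x by (intro exI[of _ "(e, s, t') # us"]) auto
    qed
  qed
qed

lemma pathin_reduced_word:
  assumes "pathin (realization G) p"
  obtains ws where "reduced ws" "is_word G (p 0) ws (p 1)"
    "path_homotopic (realization G) p (word_path G (p 0) ws)"
proof -
  obtain vs where vs: "is_word G (p 0) vs (p 1)" "path_homotopic (realization G) p (word_path G (p 0) vs)"
    using pathin_wordy[OF assms] unfolding wordy_def by blast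
  show thesis
    using reduce_word[OF vs(1)] path_homotopic_trans[OF vs(2)] that by blast
qed

text \<open>An inner point of an edge determines the edge and its parameter, so a point with two
  descriptions is a vertex. The third claim concerns a loop passed twice in a row: there the two
  parameters are 0 and 1 in some order.\<close>

lemma junction:
  assumes "edge_path G e t = edge_path G e' s'" "(e, t) \<noteq> (e', s')" "t \<in> {0..1}" "s' \<in> {0..1}"
  shows "t \<in> {0, 1}" "s' \<in> {0, 1}" "e = e' \<Longrightarrow> t \<noteq> s'"
  using assms by (auto simp: edge_path_def split: if_splits)

lemma reduced_tl: "reduced (a # ws) \<Longrightarrow> reduced ws"
  by (cases a, cases ws) auto

text \<open>Letters of a reduced word meet at vertices, and the ends of the word do not lie inside
  \<open>e\<close>, so both parameters of each letter on \<open>e\<close> are 0 or 1; they differ as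
  no letter is constant. This is what lets a virtual loop be deleted as a whole, and what makes
  loops on the rose products of petals.\<close>

lemma reduced_word_full_segment:
  assumes "reduced ws" "is_word G x ws y" "(e, s, t) \<in> set ws"
    and "x \<notin> Inner e ` UNIV" "y \<notin> Inner e ` UNIV"
  shows "(s, t) \<in> {(0, 1), (1, 0)}"
  using assms
proof (induction ws arbitrary: x)
  case (Cons a ws)
  obtain e1 s1 t1 where a: "a = (e1, s1, t1)" by (cases a)
  have e1: "e1 \<in> arcs G" "s1 \<in> {0..1}" "t1 \<in> {0..1}" "x = edge_path G e1 s1" "s1 \<noteq> t1"
    using Cons.prems a by (auto elim: reduced.elims)
  have z: "edge_path G e1 t1 \<notin> Inner e ` UNIV \<and> (ws \<noteq> [] \<longrightarrow> t1 \<in> {0, 1})"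
  proof (cases ws)
    case Nil
    then show ?thesis using Cons.prems a by auto
  next
    case (Cons b us)
    obtain e2 s2 t2 where b: "b = (e2, s2, t2)" by (cases b)
    have "t1 \<in> {0, 1}"
      using junction(1)[of e1 t1 e2 s2] Cons.prems a b Cons e1 by auto
    then show ?thesis by auto
  qed
  show ?case
  proof (cases "(e, s, t) = a")
    case True
    have "s1 \<in> {0, 1}" using Cons.prems(4) e1 True a by (auto simp: edge_path_def split: if_splits)
    moreover have "t1 \<in> {0, 1}" using z e1 True a by (auto simp: edge_path_def split: if_splits)
    ultimately show ?thesis using e1 True a by auto
  next
    case False
    have "reduced ws" using Cons.prems(1) by (rule reduced_tl)
    moreover have "is_word G (edge_path G e1 t1) ws y" using Cons.prems(2) a by simp
    moreover have "(e, s, t) \<in> set ws" using Cons.prems(3) False by auto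
    ultimately show ?thesis using Cons.IH z Cons.prems(5) by blast
  qed
qed simp

text \<open>The path of a word without the final constant path, which would not be locally injective.\<close>

fun tight_path :: "('b \<times> real \<times> real) list \<Rightarrow> real \<Rightarrow> ('a, 'b) gpoint" where
  "tight_path [] = undefined"
| "tight_path [(e, s, t)] = seg G e s t"
| "tight_path ((e, s, t) # b # ws) = path_cat (seg G e s t) (tight_path (b # ws))"

lemma tight_path_homotopic:
  assumes "is_word G x ws y" "ws \<noteq> []"
  shows "path_homotopic (realization G) (word_path G x ws) (tight_path ws)"
  using assms
proof (induction ws arbitrary: x rule: tight_path.induct)
  case (2 e s t)
  then have "pathin (realization G) (seg G e s t)" by (auto simp: pathin_seg)
  from path_homotopic_rid[OF this] show ?case by auto
next
  case (3 e s t b ws)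
  then have w: "is_word G (edge_path G e t) (b # ws) y" by simp
  show ?case
    unfolding word_path.simps tight_path.simps
    by (rule path_homotopic_cat[OF path_homotopic_refl])
       (use 3 w word_path_0[OF w] in \<open>auto simp: pathin_seg\<close>)
qed simp

text \<open>Until time 1/2 the path stays on its first edge with constant speed:
  \<open>t - s\<close> for a single letter, twice as much if \<open>path_cat\<close> leaves it only
  the first half of the time. Nothing more is needed to study the junction with a preceding
  letter.\<close>

lemma tight_path_start:
  assumes "is_word G x ((e, s, t) # ws) y" "s \<noteq> t"
  obtains c where "c \<noteq> 0" "\<bar>c\<bar> \<le> 2"
    "\<And>r. r \<in> {0..1/2} \<Longrightarrow> tight_path ((e, s, t) # ws) r = edge_path G e (s + c * r) \<and> s + c * r \<in> {0..1}"
proof (cases ws)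
  case Nil
  show thesis
  proof (rule that[of "t - s"])
    fix r :: real assume r: "r \<in> {0..1/2}"
    have "s + r * (t - s) \<in> {0..1}" by (rule affine_mem) (use assms r in auto)
    then show "tight_path ((e, s, t) # ws) r = edge_path G e (s + (t - s) * r) \<and> s + (t - s) * r \<in> {0..1}"
      using Nil by (simp add: seg_def mult.commute)
  next
    have "s \<in> {0..1}" "t \<in> {0..1}" using assms by auto
    then show "\<bar>t - s\<bar> \<le> 2" by (auto simp: abs_if)
  qed (use assms in auto)
next
  case (Cons b us)
  show thesis
  proof (rule that[of "2 * (t - s)"])
    fix r :: real assume r: "r \<in> {0..1/2}"
    have m: "s + (2 * r) * (t - s) \<in> {0..1}" by (rule affine_mem) (use assms r in auto)
    have eq: "s + 2 * (t - s) * r = s + (2 * r) * (t - s)" by (simp add: algebra_simps)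
    have "tight_path ((e, s, t) # ws) r = edge_path G e (s + (2 * r) * (t - s))"
      using r Cons by (simp add: path_cat_def seg_def)
    then show "tight_path ((e, s, t) # ws) r = edge_path G e (s + 2 * (t - s) * r) \<and>
        s + 2 * (t - s) * r \<in> {0..1}"
      unfolding eq using m by simp
  next
    have "s \<in> {0..1}" "t \<in> {0..1}" using assms by auto
    then show "\<bar>2 * (t - s)\<bar> \<le> 2" by (auto simp: abs_if)
  qed (use assms in auto)
qed

section \<open>Local injectivity of reduced words\<close>

lemma locally_injective_seg:
  assumes "s \<in> {0..1}" "t \<in> {0..1}" "s \<noteq> t"
  shows "locally_injective (seg G e s t)"
proof -
  have "inj_on (seg G e s t) {0<..<1}"
  proof (rule inj_onI)
    fix r r' :: real assume r: "r \<in> {0<..<1}" "r' \<in> {0<..<1}" and eq: "seg G e s t r = seg G e s t r'"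
    have "s + r * (t - s) = s + r' * (t - s)"
      using eq affine_mem_open[OF assms(1,2) _ _ assms(3), of r] affine_mem_open[OF assms(1,2) _ _ assms(3), of r'] r
      by (auto simp: seg_def edge_path_inner)
    then show "r = r'" using assms by simp
  qed
  then show ?thesis
    unfolding locally_injective_def by (meson inf_le1 inj_on_subset zero_less_one)
qed

lemma locally_injective_path_cat:
  assumes p: "locally_injective p" and q: "locally_injective q"
    and mid: "\<epsilon>0 > 0" "inj_on (path_cat p q) ({0<..<1} \<inter> ball (1/2) \<epsilon>0)"
  shows "locally_injective (path_cat p q)"
  unfolding locally_injective_def
proof (intro allI impI)
  fix t :: real assume t: "0 < t \<and> t < 1"
  consider "t < 1/2" | "t = 1/2" | "1/2 < t" by linarith
  then show "\<exists>\<epsilon>>0. inj_on (path_cat p q) ({0<..<1} \<inter> ball t \<epsilon>)"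
  proof cases
    case 1
    obtain \<epsilon> where \<epsilon>: "\<epsilon> > 0" "inj_on p ({0<..<1} \<inter> ball (2 * t) \<epsilon>)"
      using p t 1 unfolding locally_injective_def by (metis mult_2 add_strict_mono add_pos_pos field_sum_of_halves)
    \<comment> \<open>The radius of \<open>p\<close> is halved because \<open>path_cat\<close> runs
      at double speed; the second bound keeps the ball on the side of \<open>p\<close>.\<close>
    have "inj_on (path_cat p q) ({0<..<1} \<inter> ball t (min (\<epsilon>/2) (1/2 - t)))"
    proof (rule inj_onI)
      fix r r' assume r: "r \<in> {0<..<1} \<inter> ball t (min (\<epsilon>/2) (1/2 - t))" "r' \<in> {0<..<1} \<inter> ball t (min (\<epsilon>/2) (1/2 - t))"
        and eq: "path_cat p q r = path_cat p q r'"
      have "p (2 * r) = p (2 * r')" using eq r by (auto simp: path_cat_def dist_real_def split: if_splits)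
      moreover have "2 * r \<in> {0<..<1} \<inter> ball (2 * t) \<epsilon>" "2 * r' \<in> {0<..<1} \<inter> ball (2 * t) \<epsilon>"
        using r 1 by (auto simp: dist_real_def abs_if split: if_splits)
      ultimately show "r = r'" using \<epsilon>(2) by (auto dest: inj_onD)
    qed
    then show ?thesis using 1 \<epsilon>(1) by (intro exI[of _ "min (\<epsilon>/2) (1/2 - t)"]) auto
  next
    case 2
    show ?thesis unfolding 2 using mid by blast
  next
    case 3
    then have "0 < 2 * t - 1 \<and> 2 * t - 1 < 1" using t by auto
    then obtain \<epsilon> where \<epsilon>: "\<epsilon> > 0" "inj_on q ({0<..<1} \<inter> ball (2 * t - 1) \<epsilon>)"
      using q unfolding locally_injective_def by blast
    have "inj_on (path_cat p q) ({0<..<1} \<inter> ball t (min (\<epsilon>/2) (t - 1/2)))"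
    proof (rule inj_onI)
      fix r r' assume r: "r \<in> {0<..<1} \<inter> ball t (min (\<epsilon>/2) (t - 1/2))" "r' \<in> {0<..<1} \<inter> ball t (min (\<epsilon>/2) (t - 1/2))"
        and eq: "path_cat p q r = path_cat p q r'"
      have "q (2 * r - 1) = q (2 * r' - 1)" using eq r by (auto simp: path_cat_def dist_real_def split: if_splits)
      moreover have "2 * r - 1 \<in> {0<..<1} \<inter> ball (2 * t - 1) \<epsilon>" "2 * r' - 1 \<in> {0<..<1} \<inter> ball (2 * t - 1) \<epsilon>"
        using r 3 by (auto simp: dist_real_def abs_if split: if_splits)
      ultimately have "2 * r - 1 = 2 * r' - 1" using \<epsilon>(2) by (rule inj_onD[rotated])
      then show "r = r'" by simp
    qed
    then show ?thesis using 3 \<epsilon>(1) by (intro exI[of _ "min (\<epsilon>/2) (t - 1/2)"]) auto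
  qed
qed

text \<open>The junction is a vertex, and each side is injective as it moves along its edge with
  nonzero speed. The two sides can only meet if they lie on the same edge; by
  \<open>junction\<close> they are then close to different ends of a loop.\<close>

lemma locally_injective_junction:
  assumes st: "s \<in> {0..1}" "t \<in> {0..1}" "s \<noteq> t" and s': "s' \<in> {0..1}"
    and c: "c \<noteq> 0" "\<bar>c\<bar> \<le> 2"
    and q: "\<And>r. r \<in> {0..1/2} \<Longrightarrow> q r = edge_path G e' (s' + c * r) \<and> s' + c * r \<in> {0..1}"
    and eq: "edge_path G e t = edge_path G e' s'" and ne: "(e, t) \<noteq> (e', s')"
  shows "inj_on (path_cat (seg G e s t) q) ({0<..<1} \<inter> ball (1/2) (1/12))"
proof -
  note j = junction[OF eq ne st(2) s']
  \<comment> \<open>Within time 1/12 of the junction the doubled time changes by less than 1/6, and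
    speeds are at most 2, so both coordinates \<open>?A\<close> and \<open>?B\<close> stay within
    1/3 of the vertex. Hence they cannot meet from opposite ends of an edge.\<close>
  let ?f = "path_cat (seg G e s t) q" and ?A = "\<lambda>r. s + (2 * r) * (t - s)" and ?B = "\<lambda>r. s' + c * (2 * r - 1)"
  have L: "?f r = Inner e (?A r) \<and> \<bar>?A r - t\<bar> < 1/3" if "5/12 < r" "r < 1/2" for r
  proof
    have i: "0 < ?A r" "?A r < 1" using affine_mem_open[OF st(1,2), of "2 * r"] st that by auto
    show "?f r = Inner e (?A r)" using i that by (auto simp: path_cat_def seg_def edge_path_inner)
    have "?A r - t = (1 - 2 * r) * (s - t)" by (simp add: algebra_simps)
    moreover have "\<bar>(1 - 2 * r) * (s - t)\<bar> \<le> (1 - 2 * r) * 1"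
      unfolding abs_mult using st that by (intro mult_mono) auto
    ultimately have "\<bar>?A r - t\<bar> \<le> 1 - 2 * r" by simp
    also have "\<dots> < 1/3" using that by simp
    finally show "\<bar>?A r - t\<bar> < 1/3" .
  qed
  have R: "?f r = Inner e' (?B r) \<and> \<bar>?B r - s'\<bar> < 1/3" if "1/2 < r" "r < 7/12" for r
  proof
    have qr: "?f r = edge_path G e' (?B r)" using q[of "2 * r - 1"] that by (auto simp: path_cat_def)
    have "\<bar>c * (2 * r - 1)\<bar> \<le> 2 * (2 * r - 1)"
      unfolding abs_mult using c that by (intro mult_mono) auto
    also have "\<dots> < 1/3" using that by simp
    finally show b: "\<bar>?B r - s'\<bar> < 1/3" by simp
    have mem: "?B r \<in> {0..1}" using q[of "2 * r - 1"] that by auto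
    have "0 < s' + X \<and> s' + X < 1"
      if "X \<noteq> 0" "s' \<in> {0, 1}" "\<bar>s' + X - s'\<bar> < 1/3" "s' + X \<in> {0..1}" for X
      using that by auto
    from this[OF _ j(2) b mem] have "0 < ?B r \<and> ?B r < 1" using c that by auto
    then show "?f r = Inner e' (?B r)" using qr by (simp add: edge_path_inner)
  qed
  have M: "?f (1/2) = Vertex (if t = 0 then tail G e else head G e)"
    using j(1) by (auto simp: path_cat_def)
  have LR: "?f r \<noteq> ?f r'" if "5/12 < r" "r < 1/2" "1/2 < r'" "r' < 7/12" for r r'
  proof
    assume "?f r = ?f r'"
    then have "e = e'" "?A r = ?B r'" using L[OF that(1,2)] R[OF that(3,4)] by auto
    then show False using j L[OF that(1,2)] R[OF that(3,4)] by auto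
  qed
  show ?thesis
  proof (rule linorder_inj_onI)
    fix r r' :: real assume lt: "r < r'" and mem: "r \<in> {0<..<1} \<inter> ball (1/2) (1/12)" "r' \<in> {0<..<1} \<inter> ball (1/2) (1/12)"
    then have "\<bar>1/2 - r\<bar> < 1/12" "\<bar>1/2 - r'\<bar> < 1/12" by (auto simp: dist_real_def)
    then have b: "5/12 < r" "r < 7/12" "5/12 < r'" "r' < 7/12" by linarith+
    consider "r' < 1/2" | "r' = 1/2" | "r = 1/2" | "1/2 < r" | "r < 1/2" "1/2 < r'" using lt by linarith
    then show "?f r \<noteq> ?f r'"
    proof cases
      case 1
      then have "?A r \<noteq> ?A r'" using lt st by auto
      then show ?thesis using L[of r] L[of r'] b 1 lt by auto
    next
      case 2
      have "?f r = Inner e (?A r)" using L[of r] b lt 2 by simp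
      then show ?thesis unfolding 2 M by simp
    next
      case 3
      have "?f r' = Inner e' (?B r')" using R[of r'] b lt 3 by simp
      then show ?thesis unfolding 3 M by simp
    next
      case 4
      then have "?B r \<noteq> ?B r'" using lt c by auto
      then show ?thesis using R[of r] R[of r'] b 4 lt by auto
    next
      case 5
      then show ?thesis using LR b by auto
    qed
  qed auto
qed

lemma locally_injective_tight_path:
  assumes "is_word G x ws y" "reduced ws" "ws \<noteq> []"
  shows "locally_injective (tight_path ws)"
  using assms
proof (induction ws arbitrary: x rule: tight_path.induct)
  case (2 e s t)
  then show ?case by (auto intro: locally_injective_seg)
next
  case (3 e s t b ws)
  obtain e' s' t' where b: "b = (e', s', t')" by (cases b)
  have w: "is_word G (edge_path G e t) ((e', s', t') # ws) y" using 3 b by simp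
  have r: "reduced ((e', s', t') # ws)" "s \<noteq> t" "(e, t) \<noteq> (e', s')" using 3 b by auto
  then have "s' \<noteq> t'" by (cases ws) auto
  then obtain c where c: "c \<noteq> 0" "\<bar>c\<bar> \<le> 2"
    "\<And>r. r \<in> {0..1/2} \<Longrightarrow> tight_path ((e', s', t') # ws) r = edge_path G e' (s' + c * r) \<and> s' + c * r \<in> {0..1}"
    using tight_path_start[OF w] by blast
  have "inj_on (path_cat (seg G e s t) (tight_path (b # ws))) ({0<..<1} \<inter> ball (1/2) (1/12))"
    unfolding b by (rule locally_injective_junction[OF _ _ r(2) _ c(1,2) c(3) _ r(3)]) (use 3 w in auto)
  moreover have "locally_injective (tight_path (b # ws))"
    using "3.IH"[of "edge_path G e t"] w r b by auto
  moreover have "locally_injective (seg G e s t)"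
    using 3 r by (auto intro: locally_injective_seg)
  ultimately show ?case
    unfolding tight_path.simps by (intro locally_injective_path_cat[where ?\<epsilon>0.0 = "1/12"]) auto
qed simp

text \<open>The empty word is the exception: its path is constant and so not locally injective. For
  the petals of a marking this alternative is later excluded by
  \<open>homotopy_equivalence_petal_not_null\<close>.\<close>

lemma pathin_tighten:
  assumes p: "pathin (realization G) p"
  obtains "path_homotopic (realization G) p (\<lambda>_. p 0)"
  | q where "path_homotopic (realization G) p q" "locally_injective q"
proof -
  obtain ws where ws: "reduced ws" "is_word G (p 0) ws (p 1)"
    "path_homotopic (realization G) p (word_path G (p 0) ws)"
    using pathin_reduced_word[OF p] .
  show thesis
  proof (cases "ws = []")
    case True
    then show ?thesis using ws that(1) by simp
  next
    case False
    show ?thesis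
      by (rule that(2)[OF path_homotopic_trans[OF ws(3) tight_path_homotopic[OF ws(2) False]]
            locally_injective_tight_path[OF ws(2,1) False]])
  qed
qed

end

section \<open>Cancellation of paths\<close>

lemma path_homotopic_cancelR:
  assumes "path_homotopic X (path_cat p r) (path_cat q r)"
    and p: "pathin X p" and q: "pathin X q" and r: "pathin X r" and e: "p 1 = r 0" "q 1 = r 0"
  shows "path_homotopic X p q"
proof -
  have "path_homotopic X p (path_cat (path_cat p r) (path_rev r))"
    by (rule path_homotopic_sym[OF path_homotopic_cancel_right[OF r p]]) (use e in auto)
  also have "path_homotopic X \<dots> (path_cat (path_cat q r) (path_rev r))"
    by (rule path_homotopic_cat[OF assms(1) path_homotopic_refl[OF pathin_path_rev[OF r]]]) auto
  also have "path_homotopic X \<dots> q"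
    by (rule path_homotopic_cancel_right[OF r q]) (use e in auto)
  finally show ?thesis .
qed

lemma path_homotopic_cancelL:
  assumes "path_homotopic X (path_cat r p) (path_cat r q)"
    and p: "pathin X p" and q: "pathin X q" and r: "pathin X r" and e: "r 1 = p 0" "r 1 = q 0"
  shows "path_homotopic X p q"
proof -
  have "path_homotopic X p (path_cat (path_rev r) (path_cat r p))"
    by (rule path_homotopic_sym[OF path_homotopic_cancel_left[OF r p]]) (use e in auto)
  also have "path_homotopic X \<dots> (path_cat (path_rev r) (path_cat r q))"
    by (rule path_homotopic_cat[OF path_homotopic_refl[OF pathin_path_rev[OF r]] assms(1)]) auto
  also have "path_homotopic X \<dots> q"
    by (rule path_homotopic_cancel_left[OF r q]) (use e in auto)
  finally show ?thesis .
qed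

text \<open>Undoes \<open>path_homotopic_conj\<close>. The paths \<open>a\<close> and
  \<open>b\<close> may differ, as they do when the ends of \<open>q\<close> are moved along
  different tracks.\<close>

lemma path_homotopic_unconj:
  assumes a: "pathin X a" and b: "pathin X b" and q: "pathin X q" and e: "a 1 = q 0" "q 1 = b 1"
  shows "path_homotopic X (path_cat (path_cat a (path_cat q (path_rev b))) b) (path_cat a q)"
proof -
  have qb: "pathin X (path_cat q (path_rev b))"
    by (rule pathin_path_cat) (use q b e in \<open>auto simp: pathin_path_rev\<close>)
  have "path_homotopic X (path_cat (path_cat a (path_cat q (path_rev b))) b)
      (path_cat a (path_cat (path_cat q (path_rev b)) b))"
    by (rule path_homotopic_assoc[OF a qb b]) (use e in auto)
  also have "path_homotopic X \<dots> (path_cat a q)"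
    by (rule path_homotopic_cat[OF path_homotopic_refl[OF a] path_homotopic_cancel_right'[OF b q]])
       (use e in auto)
  finally show ?thesis .
qed

lemma path_homotopic_const_of_conj:
  assumes h: "path_homotopic X (path_cat a p) (path_cat (\<lambda>_. a 0) a)"
    and a: "pathin X a" and p: "pathin X p" and e: "a 1 = p 0" "p 1 = p 0"
  shows "path_homotopic X p (\<lambda>_. p 0)"
proof (rule path_homotopic_cancelL[OF _ p _ a e(1)])
  show c: "pathin X (\<lambda>_. p 0)" using pathin_in_topspace[OF p, of 0] by simp
  have "path_homotopic X (path_cat a p) a"
    by (rule path_homotopic_trans[OF h path_homotopic_lid[OF a]]) simp
  then show "path_homotopic X (path_cat a p) (path_cat a (\<lambda>_. p 0))"
    by (rule path_homotopic_trans[OF _ path_homotopic_sym[OF path_homotopic_rid[OF a]]]) (use e in auto)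
qed (use e in auto)

lemma pathin_map: "pathin X p \<Longrightarrow> continuous_map X Y f \<Longrightarrow> pathin Y (f \<circ> p)"
  unfolding pathin_def by (rule continuous_map_compose)

section \<open>Connected graphs\<close>

text \<open>Undirected reachability along the edges in \<open>S\<close>, as a relation on the whole
  type. It serves for connectedness, where \<open>S\<close> consists of all edges, and for
  contractions, where it says which vertices become equal.\<close>

definition conn :: "('v, 'e) pre_digraph \<Rightarrow> 'e set \<Rightarrow> ('v \<times> 'v) set" where
  "conn G S = (\<Union>e\<in>S. {(tail G e, head G e), (head G e, tail G e)})\<^sup>*"

lemma (in wf_digraph) connected_iff_conn:
  "Digraph_Component.connected G \<longleftrightarrow>
     verts G \<noteq> {} \<and> (\<forall>u\<in>verts G. \<forall>v\<in>verts G. (u, v) \<in> conn G (arcs G))"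
proof -
  let ?R = "\<Union>e\<in>arcs G. {(tail G e, head G e), (head G e, tail G e)}"
  have ends: "arcs_ends (with_proj (mk_symmetric G)) = ?R"
    by (simp add: arcs_ends_def arc_to_ends_def mk_symmetric_def)
  have "(u, v) \<in> rtrancl_on (verts G) ?R \<longleftrightarrow> (u, v) \<in> ?R\<^sup>*" if "u \<in> verts G" for u v
  proof
    assume "(u, v) \<in> ?R\<^sup>*"
    then show "(u, v) \<in> rtrancl_on (verts G) ?R"
    proof (induction rule: rtrancl_induct)
      case base
      show ?case using that by (rule rtrancl_on_refl)
    next
      case (step y z)
      have "z \<in> verts G" using step.hyps(2) by auto
      with step.IH step.hyps(2) show ?case by (rule rtrancl_on_into_rtrancl_on)
    qed
  qed (rule rtrancl_on_rtranclI)
  then show ?thesis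
    unfolding Digraph_Component.connected_def strongly_connected_def reachable_def ends conn_def
    by (auto simp: mk_symmetric_def)
qed

lemma (in wf_digraph) conn_path:
  assumes "(u, v) \<in> conn G (arcs G)" "u \<in> verts G"
  shows "\<exists>p. pathin (realization G) p \<and> p 0 = Vertex u \<and> p 1 = Vertex v"
  using assms unfolding conn_def
proof (induction rule: rtrancl_induct)
  case base
  then show ?case
    by (intro exI[of _ "\<lambda>_. Vertex u"]) (auto simp: topspace_realization gpoints_def)
next
  case (step y z)
  then obtain p where p: "pathin (realization G) p" "p 0 = Vertex u" "p 1 = Vertex y" by blast
  obtain e where e: "e \<in> arcs G" "(y, z) = (tail G e, head G e) \<or> (y, z) = (head G e, tail G e)"
    using step by blast
  from e(2) show ?case
  proof
    assume "(y, z) = (tail G e, head G e)"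
    then show ?thesis using p e(1)
      by (intro exI[of _ "path_cat p (edge_path G e)"]) (auto intro!: pathin_path_cat pathin_edge_path)
  next
    assume "(y, z) = (head G e, tail G e)"
    then show ?thesis using p e(1)
      by (intro exI[of _ "path_cat p (path_rev (edge_path G e))"])
         (auto intro!: pathin_path_cat pathin_path_rev pathin_edge_path)
  qed
qed

lemma (in wf_digraph) vertex_path:
  assumes "x \<in> gpoints G"
  shows "\<exists>u\<in>verts G. \<exists>p. pathin (realization G) p \<and> p 0 = x \<and> p 1 = Vertex u"
  using assms
proof (cases rule: gpoints_cases)
  case (1 v)
  then show ?thesis using assms
    by (intro bexI[of _ v] exI[of _ "\<lambda>_. x"]) (auto simp: topspace_realization)
next
  case (2 e t)
  then show ?thesis
    by (intro bexI[of _ "head G e"] exI[of _ "seg G e t 1"]) (auto intro!: pathin_seg)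
qed

lemma (in wf_digraph) realization_path_connected:
  assumes "Digraph_Component.connected G" "x \<in> gpoints G" "y \<in> gpoints G"
  obtains p where "pathin (realization G) p" "p 0 = x" "p 1 = y"
proof -
  obtain u p where u: "u \<in> verts G" "pathin (realization G) p" "p 0 = x" "p 1 = Vertex u"
    using vertex_path[OF assms(2)] by blast
  obtain v q where v: "v \<in> verts G" "pathin (realization G) q" "q 0 = y" "q 1 = Vertex v"
    using vertex_path[OF assms(3)] by blast
  obtain r where r: "pathin (realization G) r" "r 0 = Vertex u" "r 1 = Vertex v"
    using conn_path[of u v] u v assms(1) unfolding connected_iff_conn by blast
  show thesis
    by (rule that[of "path_cat p (path_cat r (path_rev q))"])
       (use u v r in \<open>auto intro!: pathin_path_cat pathin_path_rev\<close>)
qed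

section \<open>Deleting virtual loops\<close>

fun drop_virtual :: "('v, 'e + 'v \<times> nat) gpoint \<Rightarrow> ('v, 'e) gpoint" where
  "drop_virtual (Vertex v) = Vertex v"
| "drop_virtual (Inner (Inl e) t) = Inner e t"
| "drop_virtual (Inner (Inr (v, i)) t) = Vertex v"

fun add_virtual :: "('v, 'e) gpoint \<Rightarrow> ('v, 'e + 'v \<times> nat) gpoint" where
  "add_virtual (Vertex v) = Vertex v"
| "add_virtual (Inner e t) = Inner (Inl e) t"

lemma drop_add_virtual [simp]: "drop_virtual (add_virtual x) = x"
  by (cases x) auto

lemma drop_virtual_edge_path [simp]:
  "drop_virtual (edge_path (virt G w) (Inl e) t) = edge_path G e t"
  "drop_virtual (edge_path (virt G w) (Inr (u, i)) t) = Vertex u"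
  by (auto simp: edge_path_def virt_def)

lemma add_virtual_edge_path [simp]:
  "add_virtual (edge_path G e t) = edge_path (virt G w) (Inl e) t"
  by (auto simp: edge_path_def virt_def)

lemma virt_simps [simp]:
  "verts (virt G w) = verts G" "tail (virt G w) (Inl e) = tail G e" "head (virt G w) (Inl e) = head G e"
  "tail (virt G w) (Inr a) = fst a" "head (virt G w) (Inr a) = fst a"
  "Inl e \<in> arcs (virt G w) \<longleftrightarrow> e \<in> arcs G"
  "Inr (v, i) \<in> arcs (virt G w) \<longleftrightarrow> v \<in> verts G \<and> i < w v"
  by (auto simp: virt_def)

context wf_digraph begin

lemma wf_virt: "wf_digraph (virt G w)"
  by unfold_locales (auto simp: virt_def)

lemma continuous_drop_virtual: "continuous_map (virt_space G w) (realization G) drop_virtual"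
proof (rule wf_digraph.continuous_map_realizationI[OF wf_virt])
  fix e assume e: "e \<in> arcs (virt G w)"
  show "pathin (realization G) (drop_virtual \<circ> edge_path (virt G w) e)"
  proof (cases e)
    case (Inl a)
    then have "drop_virtual \<circ> edge_path (virt G w) e = edge_path G a" by auto
    then show ?thesis using e Inl by (simp add: pathin_edge_path)
  next
    case (Inr b)
    obtain u i where b: "b = (u, i)" by (cases b)
    then have "drop_virtual \<circ> edge_path (virt G w) e = (\<lambda>_. Vertex u)" using Inr by auto
    then show ?thesis using e Inr b by (simp add: topspace_realization gpoints_def)
  qed
qed (auto simp: topspace_realization gpoints_def)

lemma continuous_add_virtual: "continuous_map (realization G) (virt_space G w) add_virtual"
proof (rule continuous_map_realizationI)
  fix e assume e: "e \<in> arcs G"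
  have "add_virtual \<circ> edge_path G e = edge_path (virt G w) (Inl e)" by auto
  then show "pathin (virt_space G w) (add_virtual \<circ> edge_path G e)"
    using e by (simp add: wf_digraph.pathin_edge_path[OF wf_virt])
qed (auto simp: wf_digraph.topspace_realization[OF wf_virt] gpoints_def)

lemma virtual_sequence_props:
  assumes "virtual_sequence G w u s" "u \<in> verts G"
  shows "pathin (virt_space G w) s \<and> s 0 = Vertex u \<and> s 1 = Vertex u \<and>
    path_homotopic (realization G) (drop_virtual \<circ> s) (\<lambda>_. Vertex u)"
  using assms
proof (induction rule: virtual_sequence.induct)
  case empty
  then show ?case
    by (auto simp: topspace_realization wf_digraph.topspace_realization[OF wf_virt] gpoints_def o_def
        intro!: path_homotopic_refl)
next
  case (forward i s)
  note IH = forward.IH[OF forward.prems]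
  have IH4: "path_homotopic (realization G) (drop_virtual \<circ> s) (\<lambda>_. Vertex u)"
    using IH by (simp add: o_def)
  let ?e = "edge_path (virt G w) (Inr (u, i))"
  have c: "path_homotopic (realization G) (\<lambda>_. Vertex u) (\<lambda>_. Vertex u)"
    using forward by (intro path_homotopic_refl) (auto simp: topspace_realization gpoints_def)
  have "drop_virtual \<circ> ?e = (\<lambda>_. Vertex u)" by auto
  then have "path_homotopic (realization G) (drop_virtual \<circ> path_cat ?e s) (path_cat (\<lambda>_. Vertex u) (\<lambda>_. Vertex u))"
    unfolding comp_path_cat by (simp only:) (rule path_homotopic_cat[OF c IH4], simp add: IH)
  then show ?case using forward
    by (auto simp: o_def intro!: pathin_path_cat wf_digraph.pathin_edge_path[OF wf_virt])
next
  case (backward i s)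
  note IH = backward.IH[OF backward.prems]
  have IH4: "path_homotopic (realization G) (drop_virtual \<circ> s) (\<lambda>_. Vertex u)"
    using IH by (simp add: o_def)
  let ?e = "path_rev (edge_path (virt G w) (Inr (u, i)))"
  have c: "path_homotopic (realization G) (\<lambda>_. Vertex u) (\<lambda>_. Vertex u)"
    using backward by (intro path_homotopic_refl) (auto simp: topspace_realization gpoints_def)
  have "drop_virtual \<circ> ?e = (\<lambda>_. Vertex u)" by (auto simp: path_rev_def)
  then have "path_homotopic (realization G) (drop_virtual \<circ> path_cat ?e s) (path_cat (\<lambda>_. Vertex u) (\<lambda>_. Vertex u))"
    unfolding comp_path_cat by (simp only:) (rule path_homotopic_cat[OF c IH4], simp add: IH)
  then show ?case using backward
    by (auto simp: o_def intro!: pathin_path_cat pathin_path_rev wf_digraph.pathin_edge_path[OF wf_virt])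
qed

lemma virtual_replacement_loops:
  assumes "virtual_replacement G w x p q"
  shows "p \<in> loops_at (virt_space G w) x \<and> q \<in> loops_at (virt_space G w) x"
  using assms
proof (induction rule: virtual_replacement.induct)
  case (homotopy p q)
  then show ?case
    using path_homotopic_ends[OF homotopy(2)] path_homotopic_paths[OF homotopy(2)] by (simp add: loops_at_def)
next
  case (replace u a b s s')
  then show ?case using virtual_sequence_props[of w u s] virtual_sequence_props[of w u s']
    by (auto simp: loops_at_def intro!: pathin_path_cat)
qed auto

text \<open>A virtual sequence becomes null-homotopic at its vertex when the virtual loops are
  crushed, so replacing it by another one does not change the image up to homotopy.\<close>

lemma virtual_replacement_drop_virtual:
  assumes "virtual_replacement G w x p q"
  shows "path_homotopic (realization G) (drop_virtual \<circ> p) (drop_virtual \<circ> q)"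
  using assms
proof (induction rule: virtual_replacement.induct)
  case (homotopy p q)
  then show ?case using path_homotopic_map[OF continuous_drop_virtual] by blast
next
  case (replace u a b s s')
  have *: "path_homotopic (realization G) (drop_virtual \<circ> path_cat a (path_cat s b))
      (path_cat (drop_virtual \<circ> a) (path_cat (\<lambda>_. Vertex u) (drop_virtual \<circ> b)))"
    if "virtual_sequence G w u s" for s
    unfolding comp_path_cat
    by (intro path_homotopic_cat path_homotopic_refl pathin_map[OF _ continuous_drop_virtual])
       (use replace virtual_sequence_props[OF that] in auto)
  show ?case
    using *[OF replace(8)] *[OF replace(9)] path_homotopic_sym path_homotopic_trans by blast
next
  case (trans p q r)
  then show ?case using path_homotopic_trans by blast
qed

lemma virtual_replacement_sym:
  assumes "virtual_replacement G w x p q" shows "virtual_replacement G w x q p"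
  using assms
proof (induction rule: virtual_replacement.induct)
  case (homotopy p q)
  have "q \<in> loops_at (virt_space G w) x"
    using virtual_replacement_loops[OF virtual_replacement.homotopy[OF homotopy]] by (rule conjunct2)
  then show ?case by (rule virtual_replacement.homotopy[OF _ path_homotopic_sym[OF homotopy(2)]])
next
  case (replace u a b s s')
  then show ?case by (intro virtual_replacement.replace)
next
  case (trans p q r)
  then show ?case using virtual_replacement.trans by blast
qed

declare virtual_replacement.trans [trans]

text \<open>Induction along the word, with the part already treated collected in \<open>a\<close>. A
  letter of \<open>G\<close> is fixed by the retraction and moves into \<open>a\<close>. By
  \<open>full\<close> a virtual letter is an entire virtual loop in one direction, so it is a
  virtual sequence and may be replaced by the empty one. The condition \<open>x\<close> says that
  the base point is not inside a virtual loop.\<close>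

lemma virtual_replacement_delete_word:
  assumes w: "is_word (virt G w) z ws x" and a: "pathin (virt_space G w) a" "a 0 = x" "a 1 = z"
    and full: "\<And>b s t. (Inr b, s, t) \<in> set ws \<Longrightarrow> (s, t) \<in> {(0, 1), (1, 0)}"
    and x: "add_virtual (drop_virtual x) = x"
  shows "virtual_replacement G w x (path_cat a (word_path (virt G w) z ws))
    (path_cat a (add_virtual \<circ> drop_virtual \<circ> word_path (virt G w) z ws))"
  using assms(1-5)
proof (induction ws arbitrary: z a)
  case Nil
  interpret V: wf_digraph "virt G w" by (rule wf_virt)
  have "path_cat a (\<lambda>_. x) \<in> loops_at (virt_space G w) x"
    using Nil by (auto simp: loops_at_def V.topspace_realization intro!: pathin_path_cat)
  then have "virtual_replacement G w x (path_cat a (\<lambda>_. x)) (path_cat a (\<lambda>_. x))"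
    by (intro virtual_replacement.homotopy path_homotopic_refl) (auto simp: loops_at_def)
  then show ?case using Nil x by (simp add: o_def)
next
  case (Cons c ws)
  interpret V: wf_digraph "virt G w" by (rule wf_virt)
  let ?X = "virt_space G w" and ?\<rho> = "add_virtual \<circ> drop_virtual :: _ \<Rightarrow> ('a, 'b + 'a \<times> nat) gpoint"
  obtain e s t where c: "c = (e, s, t)" by (cases c)
  let ?z = "edge_path (virt G w) e t"
  have e: "e \<in> arcs (virt G w)" "s \<in> {0..1}" "t \<in> {0..1}" "z = edge_path (virt G w) e s"
    and w': "is_word (virt G w) ?z ws x" using Cons.prems c by auto
  note W = V.word_path_props[OF w']
  let ?W = "word_path (virt G w) ?z ws" and ?S = "seg (virt G w) e s t"
  have S: "pathin ?X ?S" using e by (auto intro: V.pathin_seg)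
  have c\<rho>: "continuous_map ?X ?X ?\<rho>"
    by (rule continuous_map_compose[OF continuous_drop_virtual continuous_add_virtual])
  have \<rho>W: "pathin ?X (?\<rho> \<circ> ?W)" using W pathin_map[OF _ c\<rho>] by blast
  have full': "\<And>b s t. (Inr b, s, t) \<in> set ws \<Longrightarrow> (s, t) \<in> {(0, 1), (1, 0)}"
    using Cons.prems(5) by auto
  have loop: "path_cat a (path_cat ?S ?W) \<in> loops_at ?X x"
    using Cons.prems S W e by (auto simp: loops_at_def intro!: pathin_path_cat)
  show ?case
  proof (cases e)
    case (Inl a0)
    have \<rho>S: "?\<rho> \<circ> ?S = ?S" using Inl by (auto simp: seg_def)
    have z: "?\<rho> ?z = ?z" using Inl by simp
    have aS: "pathin ?X (path_cat a ?S)" "path_cat a ?S 0 = x" "path_cat a ?S 1 = ?z"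
      using Cons.prems S e by (auto intro!: pathin_path_cat)
    have "virtual_replacement G w x (path_cat a (path_cat ?S ?W)) (path_cat (path_cat a ?S) ?W)"
      by (rule virtual_replacement.homotopy[OF loop path_homotopic_sym[OF path_homotopic_assoc]])
         (use Cons.prems S W e in auto)
    also have "virtual_replacement G w x (path_cat (path_cat a ?S) ?W) (path_cat (path_cat a ?S) (?\<rho> \<circ> ?W))"
      by (rule Cons.IH[OF w' aS full'])
    also have "virtual_replacement G w x (path_cat (path_cat a ?S) (?\<rho> \<circ> ?W)) (path_cat a (path_cat ?S (?\<rho> \<circ> ?W)))"
    proof (rule virtual_replacement.homotopy[OF _ path_homotopic_assoc])
      show "path_cat (path_cat a ?S) (?\<rho> \<circ> ?W) \<in> loops_at ?X x"
        using aS \<rho>W W z x by (auto simp: loops_at_def intro!: pathin_path_cat)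
    qed (use Cons.prems S \<rho>W W e z in auto)
    finally show ?thesis
      unfolding c word_path.simps comp_path_cat \<rho>S .
  next
    case (Inr b)
    obtain u i where b: "b = (u, i)" by (cases b)
    have ui: "u \<in> verts G" "i < w u" using e Inr b by auto
    have "(s, t) \<in> {(0, 1), (1, 0)}" using Cons.prems(5)[of b s t] c Inr by auto
    then have zu: "z = Vertex u" "?z = Vertex u" using e Inr b by auto
    have \<rho>S: "?\<rho> \<circ> ?S = (\<lambda>_. Vertex u)" using Inr b by (auto simp: seg_def)
    have cu: "pathin ?X (\<lambda>_. Vertex u)" using ui by (auto simp: V.topspace_realization gpoints_def)
    have vs: "virtual_sequence G w u (path_cat ?S (\<lambda>_. Vertex u))"
      using \<open>(s, t) \<in> {(0, 1), (1, 0)}\<close>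
    proof
      assume "(s, t) = (0, 1)"
      then have "?S = edge_path (virt G w) (Inr (u, i))" using Inr b by (auto simp: seg_def)
      then show ?thesis using ui by (auto intro: virtual_sequence.intros)
    next
      assume "(s, t) \<in> {(1, 0)}"
      then have "?S = path_rev (edge_path (virt G w) (Inr (u, i)))"
        using Inr b by (auto simp: seg_def path_rev_def)
      then show ?thesis using ui by (auto intro: virtual_sequence.intros)
    qed
    \<comment> \<open>A \<open>virtual_sequence\<close> always ends with a constant path, so one is
      appended to the loop before it is replaced.\<close>
    have "virtual_replacement G w x (path_cat a (path_cat ?S ?W)) (path_cat a (path_cat (path_cat ?S (\<lambda>_. Vertex u)) ?W))"
    proof (rule virtual_replacement.homotopy[OF loop])
      show "path_homotopic ?X (path_cat a (path_cat ?S ?W)) (path_cat a (path_cat (path_cat ?S (\<lambda>_. Vertex u)) ?W))"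
        by (intro path_homotopic_cat path_homotopic_refl path_homotopic_sym[OF path_homotopic_rid])
           (use Cons.prems S W zu e in auto)
    qed
    also have "virtual_replacement G w x (path_cat a (path_cat (path_cat ?S (\<lambda>_. Vertex u)) ?W))
        (path_cat a (path_cat (\<lambda>_. Vertex u) ?W))"
      by (rule virtual_replacement.replace[OF ui(1)])
         (use Cons.prems W zu vs in \<open>auto intro: virtual_sequence.empty\<close>)
    also have "virtual_replacement G w x (path_cat a (path_cat (\<lambda>_. Vertex u) ?W)) (path_cat a ?W)"
    proof (rule virtual_replacement.homotopy)
      show "path_cat a (path_cat (\<lambda>_. Vertex u) ?W) \<in> loops_at ?X x"
        using Cons.prems cu W zu by (auto simp: loops_at_def intro!: pathin_path_cat)
      show "path_homotopic ?X (path_cat a (path_cat (\<lambda>_. Vertex u) ?W)) (path_cat a ?W)"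
        by (intro path_homotopic_cat path_homotopic_refl path_homotopic_lid)
           (use Cons.prems W zu in auto)
    qed
    also have "virtual_replacement G w x (path_cat a ?W) (path_cat a (?\<rho> \<circ> ?W))"
      by (rule Cons.IH[OF w' _ _ _ full']) (use Cons.prems zu in auto)
    \<comment> \<open>The constant path is put back because the retraction does not remove the
      letter \<open>?S\<close> but makes it constant.\<close>
    also have "virtual_replacement G w x (path_cat a (?\<rho> \<circ> ?W)) (path_cat a (path_cat (\<lambda>_. Vertex u) (?\<rho> \<circ> ?W)))"
    proof (rule virtual_replacement.homotopy)
      show "path_cat a (?\<rho> \<circ> ?W) \<in> loops_at ?X x"
        using Cons.prems \<rho>W W zu x by (auto simp: loops_at_def intro!: pathin_path_cat)
      show "path_homotopic ?X (path_cat a (?\<rho> \<circ> ?W)) (path_cat a (path_cat (\<lambda>_. Vertex u) (?\<rho> \<circ> ?W)))"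
        by (intro path_homotopic_cat path_homotopic_refl path_homotopic_sym[OF path_homotopic_lid])
           (use Cons.prems \<rho>W W zu in auto)
    qed
    finally show ?thesis
      unfolding c word_path.simps comp_path_cat \<rho>S .
  qed
qed

lemma virtual_replacement_delete:
  assumes p: "p \<in> loops_at (virt_space G w) x" and x: "add_virtual (drop_virtual x) = x"
  shows "virtual_replacement G w x p (add_virtual \<circ> drop_virtual \<circ> p)"
proof -
  interpret V: wf_digraph "virt G w" by (rule wf_virt)
  let ?X = "virt_space G w" and ?\<rho> = "add_virtual \<circ> drop_virtual :: _ \<Rightarrow> ('a, 'b + 'a \<times> nat) gpoint"
  have p': "pathin ?X p" "p 0 = x" "p 1 = x" using p by (auto simp: loops_at_def)
  obtain ws where ws: "reduced ws" "is_word (virt G w) x ws x" "path_homotopic ?X p (word_path (virt G w) x ws)"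
    using V.pathin_reduced_word[OF p'(1)] p' by auto
  let ?W = "word_path (virt G w) x ws"
  note W = V.word_path_props[OF ws(2)]
  have c\<rho>: "continuous_map ?X ?X ?\<rho>"
    by (rule continuous_map_compose[OF continuous_drop_virtual continuous_add_virtual])
  have \<rho>W: "pathin ?X (?\<rho> \<circ> ?W)" using W pathin_map[OF _ c\<rho>] by blast
  have cx: "pathin ?X (\<lambda>_. x)" using pathin_in_topspace[OF p'(1), of 0] p' by auto
  have notin: "x \<notin> Inner (Inr b) ` UNIV" for b
    using x by (cases b) auto
  have "virtual_replacement G w x p (path_cat (\<lambda>_. x) ?W)"
    by (rule virtual_replacement.homotopy[OF p path_homotopic_trans[OF ws(3) path_homotopic_sym[OF path_homotopic_lid]]])
       (use W in auto)
  also have "virtual_replacement G w x (path_cat (\<lambda>_. x) ?W) (path_cat (\<lambda>_. x) (?\<rho> \<circ> ?W))"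
    by (rule virtual_replacement_delete_word[OF ws(2) cx refl refl _ x])
       (rule V.reduced_word_full_segment[OF ws(1,2) _ notin notin])
  also have "virtual_replacement G w x (path_cat (\<lambda>_. x) (?\<rho> \<circ> ?W)) (?\<rho> \<circ> p)"
  proof (rule virtual_replacement.homotopy)
    show "path_cat (\<lambda>_. x) (?\<rho> \<circ> ?W) \<in> loops_at ?X x"
      using cx \<rho>W W x by (auto simp: loops_at_def intro!: pathin_path_cat)
    have "path_homotopic ?X (path_cat (\<lambda>_. x) (?\<rho> \<circ> ?W)) (?\<rho> \<circ> ?W)"
      by (rule path_homotopic_lid[OF \<rho>W]) (use W x in auto)
    also have "path_homotopic ?X (?\<rho> \<circ> ?W) (?\<rho> \<circ> p)"
      by (rule path_homotopic_map[OF c\<rho> path_homotopic_sym[OF ws(3)]])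
    finally show "path_homotopic ?X (path_cat (\<lambda>_. x) (?\<rho> \<circ> ?W)) (?\<rho> \<circ> p)" .
  qed
  finally show ?thesis .
qed

text \<open>Both loops can be deformed to their images in the copy of \<open>G\<close> by deleting
  virtual loops, and there the given homotopy takes over. With
  \<open>virtual_replacement_drop_virtual\<close> this makes virtual replacement the same as
  homotopy in \<open>G\<close>.\<close>

lemma virtual_replacementI:
  assumes p: "p \<in> loops_at (virt_space G w) x" and q: "q \<in> loops_at (virt_space G w) x"
    and x: "add_virtual (drop_virtual x) = x"
    and h: "path_homotopic (realization G) (drop_virtual \<circ> p) (drop_virtual \<circ> q)"
  shows "virtual_replacement G w x p q"
proof -
  have "virtual_replacement G w x p (add_virtual \<circ> drop_virtual \<circ> p)"
    by (rule virtual_replacement_delete[OF p x])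
  also have "virtual_replacement G w x (add_virtual \<circ> drop_virtual \<circ> p) (add_virtual \<circ> drop_virtual \<circ> q)"
  proof (rule virtual_replacement.homotopy)
    show "add_virtual \<circ> drop_virtual \<circ> p \<in> loops_at (virt_space G w) x"
      using virtual_replacement_loops[OF virtual_replacement_delete[OF p x]] by blast
    show "path_homotopic (virt_space G w) (add_virtual \<circ> drop_virtual \<circ> p) (add_virtual \<circ> drop_virtual \<circ> q)"
      using path_homotopic_map[OF continuous_add_virtual h] by (simp add: o_assoc)
  qed
  also have "virtual_replacement G w x (add_virtual \<circ> drop_virtual \<circ> q) q"
    by (rule virtual_replacement_sym[OF virtual_replacement_delete[OF q x]])
  finally show ?thesis .
qed

end

section \<open>Maps from the rose\<close>

lemma rose_simps [simp]: "verts (rose g) = {()}" "arcs (rose g) = {..<g}" "tail (rose g) i = ()" "head (rose g) i = ()"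
  by (auto simp: rose_def)

interpretation rose: wf_digraph "rose g" for g
  by unfold_locales auto

lemma pathin_petal: "i < g \<Longrightarrow> pathin (rose_space g) (edge_path (rose g) i)"
  by (rule rose.pathin_edge_path) auto

lemma petal_loop: "i < g \<Longrightarrow> edge_path (rose g) i \<in> loops_at (rose_space g) rose_base"
  by (auto simp: loops_at_def pathin_petal)

lemma rose_base_in_topspace: "rose_base \<in> topspace (rose_space g)"
  by (auto simp: rose.topspace_realization gpoints_def)

text \<open>The rose is mapped to the punctured plane so that petal \<open>i\<close> winds once
  round the unit circle and the others are crushed to 1. The lift of this loop through the
  exponential map goes from 0 to twice pi times the imaginary unit, whereas the constant loop lifts
  to a constant; monodromy would make their ends equal.\<close>

lemma petal_not_null:
  assumes i: "i < g" shows "\<not> path_homotopic (rose_space g) (edge_path (rose g) i) (\<lambda>_. rose_base)"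
proof
  assume h: "path_homotopic (rose_space g) (edge_path (rose g) i) (\<lambda>_. rose_base)"
  let ?h = "\<lambda>t. complex_of_real (2 * pi * t) * \<i>"
  define c where "c = glue (\<lambda>_::unit. 1) (\<lambda>j t. if j = i then exp (?h t) else 1 :: complex)"
  have "continuous_map (rose_space g) (top_of_set (- {0})) c"
    unfolding c_def by (rule rose.continuous_map_glue) (auto simp: pathin_def intro!: continuous_intros)
  from path_homotopic_map[OF this h]
  have hp: "homotopic_paths (- {0}) (c \<circ> edge_path (rose g) i) (c \<circ> (\<lambda>_. rose_base))"
    by (simp add: path_homotopic_def homotopic_paths_def pathstart_def pathfinish_def)
  have "pathfinish ?h = pathfinish (\<lambda>_. 0 :: complex)"
  proof (rule covering_space_monodromy[OF covering_space_exp_punctured_plane _ _ _ _ hp])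
    show "path (c \<circ> edge_path (rose g) i)" "path (c \<circ> (\<lambda>_. rose_base))"
      using homotopic_paths_imp_path[OF hp] by auto
    show "path_image (c \<circ> edge_path (rose g) i) \<subseteq> - {0}" "path_image (c \<circ> (\<lambda>_. rose_base)) \<subseteq> - {0}"
      using homotopic_paths_imp_subset[OF hp] by auto
    show "path ?h" "path (\<lambda>_. 0 :: complex)" by (auto simp: path_def intro!: continuous_intros)
    show "exp (?h t) = (c \<circ> edge_path (rose g) i) t" if "t \<in> {0..1}" for t
      using that by (auto simp: c_def glue_edge_path edge_path_def mult.commute)
  qed (auto simp: c_def pathstart_def)
  then show False by (simp add: pathfinish_def)
qed

text \<open>The homotopy inverse brings a null-homotopy back to the rose, where the track of the
  base point conjugates it to one of the petal itself. This is what allows the petals of a marking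
  to be made locally injective.\<close>

lemma homotopy_equivalence_petal_not_null:
  assumes h: "homotopy_equivalence_map (rose_space g) X h" and i: "i < g"
  shows "\<not> path_homotopic X (h \<circ> edge_path (rose g) i) (\<lambda>_. h rose_base)"
proof
  assume null: "path_homotopic X (h \<circ> edge_path (rose g) i) (\<lambda>_. h rose_base)"
  obtain m where m: "continuous_map X (rose_space g) m"
    "homotopic_with (\<lambda>_. True) (rose_space g) (rose_space g) (m \<circ> h) id"
    using h unfolding homotopy_equivalence_map_def by blast
  obtain \<tau> where \<tau>_props: "\<forall>x\<in>topspace (rose_space g). pathin (rose_space g) (\<tau> x)"
    "\<forall>x. \<tau> x 0 = (m \<circ> h) x" "\<forall>x. \<tau> x 1 = id x"
    "\<forall>p. pathin (rose_space g) p \<longrightarrow>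
       path_homotopic (rose_space g) (path_cat ((m \<circ> h) \<circ> p) (\<tau> (p 1))) (path_cat (\<tau> (p 0)) (id \<circ> p))"
    using homotopic_with_track[OF m(2)] .
  note \<tau> = \<tau>_props[rule_format]
  let ?e = "edge_path (rose g) i" and ?t = "\<tau> rose_base"
  have t: "pathin (rose_space g) ?t" by (rule \<tau>(1)[OF rose_base_in_topspace])
  have "path_homotopic (rose_space g) ?e (\<lambda>_. ?e 0)"
  proof (rule path_homotopic_const_of_conj[OF _ t pathin_petal[OF i]])
    have "path_homotopic (rose_space g) (path_cat ?t ?e) (path_cat ((m \<circ> h) \<circ> ?e) ?t)"
      using path_homotopic_sym[OF \<tau>(4)[OF pathin_petal[OF i]]] by simp
    also have "path_homotopic (rose_space g) \<dots> (path_cat (\<lambda>_. ?t 0) ?t)"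
      by (rule path_homotopic_cat[OF _ path_homotopic_refl[OF t]])
         (use path_homotopic_map[OF m(1) null] \<tau> in \<open>auto simp: o_def\<close>)
    finally show "path_homotopic (rose_space g) (path_cat ?t ?e) (path_cat (\<lambda>_. ?t 0) ?t)" .
  qed (use \<tau> in auto)
  then show False using petal_not_null[OF i] by simp
qed

section \<open>Equivalence of markings\<close>

text \<open>\<open>k\<close> sends each petal to a tightened version of the petal of
  \<open>h\<close> conjugated by \<open>\<tau>\<close>. Conjugation does not affect being
  null-homotopic, so \<open>nn\<close> guarantees that tightening succeeds. The last property
  records the conjugation, which the comparison of two markings needs.\<close>

lemma (in wf_digraph) move_marking:
  assumes h: "continuous_map (rose_space g) (realization G) h"
    and \<tau>: "pathin (realization G) \<tau>" "\<tau> 1 = h rose_base"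
    and nn: "\<And>i. i < g \<Longrightarrow> \<not> path_homotopic (realization G) (h \<circ> edge_path (rose g) i) (\<lambda>_. h rose_base)"
  obtains k where "homotopic_with (\<lambda>_. True) (rose_space g) (realization G) h k" "k rose_base = \<tau> 0"
    "\<And>i. i < g \<Longrightarrow> locally_injective (k \<circ> edge_path (rose g) i)"
    "\<And>i. i < g \<Longrightarrow> path_homotopic (realization G) (path_cat (k \<circ> edge_path (rose g) i) \<tau>)
       (path_cat \<tau> (h \<circ> edge_path (rose g) i))"
proof -
  let ?X = "realization G"
  define C where "C i = path_cat \<tau> (path_cat (h \<circ> edge_path (rose g) i) (path_rev \<tau>))" for i
  have hp: "pathin ?X (h \<circ> edge_path (rose g) i)" if "i < g" for i
    by (rule pathin_map[OF pathin_petal[OF that] h])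
  have C: "pathin ?X (C i)" "C i 0 = \<tau> 0" "C i 1 = \<tau> 0" if "i < g" for i
    unfolding C_def using hp[OF that] \<tau> by (auto intro!: pathin_path_cat pathin_path_rev)
  have C\<tau>: "path_homotopic ?X (path_cat (C i) \<tau>) (path_cat \<tau> (h \<circ> edge_path (rose g) i))" if "i < g" for i
    unfolding C_def by (rule path_homotopic_unconj) (use \<tau> hp[OF that] in auto)
  have "\<exists>q. path_homotopic ?X (C i) q \<and> locally_injective q" if i: "i < g" for i
  proof (rule pathin_tighten[OF C(1)[OF i]])
    assume c: "path_homotopic ?X (C i) (\<lambda>_. C i 0)"
    let ?p = "h \<circ> edge_path (rose g) i"
    have "path_homotopic ?X ?p (\<lambda>_. ?p 0)"
    proof (rule path_homotopic_const_of_conj[OF _ \<tau>(1) hp[OF i]])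
      show "path_homotopic ?X (path_cat \<tau> ?p) (path_cat (\<lambda>_. \<tau> 0) \<tau>)"
      proof (rule path_homotopic_trans[OF path_homotopic_sym[OF C\<tau>[OF i]]])
        show "path_homotopic ?X (path_cat (C i) \<tau>) (path_cat (\<lambda>_. \<tau> 0) \<tau>)"
          by (rule path_homotopic_cat[OF _ path_homotopic_refl[OF \<tau>(1)]]) (use c C i in auto)
      qed
    qed (use \<tau> in auto)
    then show ?thesis using nn[OF i] by simp
  qed blast
  then obtain q where q: "\<And>i. i < g \<Longrightarrow> path_homotopic ?X (C i) (q i)" "\<And>i. i < g \<Longrightarrow> locally_injective (q i)"
    by metis
  have q01: "pathin ?X (q i)" "q i 0 = \<tau> 0" "q i 1 = \<tau> 0" if "i < g" for i
    using path_homotopic_paths[OF q(1)[OF that]] path_homotopic_ends[OF q(1)[OF that]] C[OF that] by auto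
  define k where "k = glue (\<lambda>_::unit. \<tau> 0) q"
  have kb: "k rose_base = \<tau> 0" by (simp add: k_def)
  have k: "continuous_map (rose_space g) ?X k"
    unfolding k_def
    by (rule rose.continuous_map_glue) (use q01 pathin_in_topspace[OF \<tau>(1), of 0] in auto)
  have kq: "path_homotopic ?X (k \<circ> edge_path (rose g) i) (q i)" if "i < g" for i
    unfolding k_def by (rule rose.glue_path_homotopic) (use q01[OF that] that in auto)
  have kC: "path_homotopic ?X (k \<circ> edge_path (rose g) i) (C i)" if "i < g" for i
    by (rule path_homotopic_trans[OF kq[OF that] path_homotopic_sym[OF q(1)[OF that]]])
  show thesis
  proof (rule that[of k, OF _ kb])
    show "homotopic_with (\<lambda>_. True) (rose_space g) ?X h k"
      by (rule homotopic_with_symD[OF rose.homotopic_with_realizationI[OF k h, where \<tau> = "\<lambda>_. \<tau>"]])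
         (use \<tau> kb kC in \<open>auto simp: C_def\<close>)
  next
    fix i assume i: "i < g"
    \<comment> \<open>\<open>k\<close> along the petal need only agree with \<open>q i\<close> for
      parameters strictly between 0 and 1, and \<open>locally_injective\<close> looks at no
      others.\<close>
    have "inj_on (k \<circ> edge_path (rose g) i) ({0<..<1} \<inter> B) \<longleftrightarrow> inj_on (q i) ({0<..<1} \<inter> B)" for B
      by (rule inj_on_cong) (simp add: k_def edge_path_inner)
    then show "locally_injective (k \<circ> edge_path (rose g) i)"
      using q(2)[OF i] unfolding locally_injective_def by simp
    show "path_homotopic ?X (path_cat (k \<circ> edge_path (rose g) i) \<tau>) (path_cat \<tau> (h \<circ> edge_path (rose g) i))"
      by (rule path_homotopic_trans[OF path_homotopic_cat[OF kC[OF i] path_homotopic_refl[OF \<tau>(1)]] C\<tau>[OF i]])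
         (use kb in auto)
  qed
qed

text \<open>
  Replacing virtual sequences amounts to working modulo the normal closure of the virtual loops, that
  is, in the fundamental group of the graph without them.
\<close>

lemma marking_equiv_imp_homotopic:
  assumes "wf_digraph G" "marking_equiv g G w h h'"
  shows "homotopic_with (\<lambda>_. True) (rose_space g) (realization G) (drop_virtual \<circ> h) (drop_virtual \<circ> h')"
proof -
  interpret wf_digraph G by fact
  let ?X = "virt_space G w"
  obtain k k' where k: "homotopic_with (\<lambda>_. True) (rose_space g) ?X h k"
    "homotopic_with (\<lambda>_. True) (rose_space g) ?X h' k'" "k rose_base = k' rose_base"
    "\<forall>i<g. virtual_replacement G w (k rose_base) (k \<circ> edge_path (rose g) i) (k' \<circ> edge_path (rose g) i)"
    using assms(2) unfolding marking_equiv_def by blast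
  have cont: "continuous_map (rose_space g) (realization G) (drop_virtual \<circ> f)"
    if "continuous_map (rose_space g) ?X f" for f
    by (rule continuous_map_compose[OF that continuous_drop_virtual])
  have hom: "homotopic_with (\<lambda>_. True) (rose_space g) (realization G) (drop_virtual \<circ> f) (drop_virtual \<circ> f')"
    if "homotopic_with (\<lambda>_. True) (rose_space g) ?X f f'" for f f'
    by (rule homotopic_with_compose_continuous_map_left[OF that continuous_drop_virtual]) auto
  have "homotopic_with (\<lambda>_. True) (rose_space g) (realization G) (drop_virtual \<circ> k) (drop_virtual \<circ> k')"
  proof (rule rose.homotopic_with_realization_relI)
    fix e assume "e \<in> arcs (rose g)"
    then show "path_homotopic (realization G) (drop_virtual \<circ> k \<circ> edge_path (rose g) e) (drop_virtual \<circ> k' \<circ> edge_path (rose g) e)"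
      using k(4) virtual_replacement_drop_virtual[of w "k rose_base" "k \<circ> edge_path (rose g) e" "k' \<circ> edge_path (rose g) e"]
      by (simp add: o_assoc)
  next
    show "continuous_map (rose_space g) (realization G) (drop_virtual \<circ> k)"
      "continuous_map (rose_space g) (realization G) (drop_virtual \<circ> k')"
      using homotopic_with_imp_continuous_maps[OF k(1)] homotopic_with_imp_continuous_maps[OF k(2)] cont by blast+
  qed (use k(3) in auto)
  then show ?thesis
    using hom[OF k(1)] homotopic_with_symD[OF hom[OF k(2)]] homotopic_with_trans by blast
qed

text \<open>Both markings are moved to a common base point \<open>x\<close>. The two paths along
  which they are moved must not be independent: after deleting virtual loops they have to differ by
  the track of the base point under \<open>hom\<close>. This is arranged by inserting a loop of
  \<open>G\<close> into the second path; then the petals have homotopic images and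
  \<open>virtual_replacementI\<close> applies.\<close>

lemma homotopic_imp_marking_equiv:
  assumes G: "wf_digraph G" "Digraph_Component.connected G"
    and h: "homotopy_equivalence_map (rose_space g) (virt_space G w) h"
    and h': "homotopy_equivalence_map (rose_space g) (virt_space G w) h'"
    and hom: "homotopic_with (\<lambda>_. True) (rose_space g) (realization G) (drop_virtual \<circ> h) (drop_virtual \<circ> h')"
  shows "marking_equiv g G w h h'"
proof -
  interpret wf_digraph G by fact
  interpret V: wf_digraph "virt G w" by (rule wf_virt)
  let ?X = "virt_space G w" and ?Y = "realization G" and ?d = "drop_virtual :: (nat, nat + nat \<times> nat) gpoint \<Rightarrow> _"
  let ?e = "edge_path (rose g)"
  have conh: "continuous_map (rose_space g) ?X h" "continuous_map (rose_space g) ?X h'"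
    using h h' by (auto simp: homotopy_equivalence_map_def)
  have Vc: "Digraph_Component.connected (virt G w)"
  proof -
    have "conn G (arcs G) \<subseteq> conn (virt G w) (arcs (virt G w))"
      unfolding conn_def by (rule rtrancl_mono) (force simp: virt_def)
    then show ?thesis using G(2) unfolding connected_iff_conn V.connected_iff_conn by auto
  qed
  \<comment> \<open>The midpoint of an edge of \<open>G\<close>, or a vertex if there is no edge.
    Neither lies inside a virtual loop, which the second condition expresses.\<close>
  obtain x where x: "x \<in> gpoints (virt G w)" "add_virtual (?d x) = x"
    "if arcs G = {} then x \<in> Vertex ` verts G
     else x \<in> {Inner (Inl e) t | e t. e \<in> arcs G \<and> 0 < t \<and> t < 1}"
  proof (cases "arcs G = {}")
    case True
    obtain v where "v \<in> verts G" using G(2) unfolding connected_iff_conn by blast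
    then show ?thesis using True by (intro that[of "Vertex v"]) (auto simp: gpoints_def)
  next
    case False
    then obtain e where "e \<in> arcs G" by blast
    then show ?thesis using False
      by (intro that[of "Inner (Inl e) (1/2)"]) (auto simp: gpoints_def intro!: exI[of _ "1/2::real"])
  qed
  have hb: "h rose_base \<in> gpoints (virt G w)" "h' rose_base \<in> gpoints (virt G w)"
    using conh rose_base_in_topspace by (auto simp: continuous_map_def V.topspace_realization Pi_iff)
  obtain \<tau> where \<tau>: "pathin ?X \<tau>" "\<tau> 0 = x" "\<tau> 1 = h rose_base"
    using V.realization_path_connected[OF Vc x(1) hb(1)] .
  obtain \<mu> where \<mu>: "pathin ?X \<mu>" "\<mu> 0 = x" "\<mu> 1 = h' rose_base"
    using V.realization_path_connected[OF Vc x(1) hb(2)] .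
  obtain T where T_props: "\<forall>y\<in>topspace (rose_space g). pathin ?Y (T y)"
    "\<forall>y. T y 0 = (?d \<circ> h) y" "\<forall>y. T y 1 = (?d \<circ> h') y"
    "\<forall>p. pathin (rose_space g) p \<longrightarrow>
       path_homotopic ?Y (path_cat (?d \<circ> h \<circ> p) (T (p 1))) (path_cat (T (p 0)) (?d \<circ> h' \<circ> p))"
    using homotopic_with_track[OF hom] .
  note T = T_props[rule_format]
  define \<sigma> where "\<sigma> = T rose_base"
  have \<sigma>: "pathin ?Y \<sigma>" "\<sigma> 0 = ?d (h rose_base)" "\<sigma> 1 = ?d (h' rose_base)"
    unfolding \<sigma>_def using T rose_base_in_topspace by auto
  note dpath = pathin_map[OF _ continuous_drop_virtual[of w]]
  let ?A = "?d \<circ> \<tau>" and ?M = "?d \<circ> \<mu>"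
  have A: "pathin ?Y ?A" "pathin ?Y ?M" using dpath \<tau> \<mu> by auto
  have A\<sigma>: "pathin ?Y (path_cat ?A \<sigma>)" using A \<sigma> \<tau> by (intro pathin_path_cat) auto
  \<comment> \<open>\<open>path_cat ?A \<sigma>\<close> and \<open>?M\<close> lead from the same
    point to the image of \<open>h' rose_base\<close>. The loop \<open>l\<close> is their
    difference; being a loop in \<open>G\<close> it lifts through \<open>add_virtual\<close>, so
    that \<open>\<mu>\<close> can be corrected by it.\<close>
  define l where "l = path_cat (path_cat ?A \<sigma>) (path_rev ?M)"
  have l: "pathin ?Y l" "l 0 = ?d x" "l 1 = ?d x"
    unfolding l_def using A A\<sigma> \<sigma> \<tau> \<mu> by (auto intro!: pathin_path_cat pathin_path_rev)
  have al: "pathin ?X (add_virtual \<circ> l)" by (rule pathin_map[OF l(1) continuous_add_virtual])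
  text \<open>A path from \<open>x\<close> to the base point of \<open>h'\<close> lying over the track of the base point.\<close>
  define \<tau>' where "\<tau>' = path_cat (add_virtual \<circ> l) \<mu>"
  have \<tau>': "pathin ?X \<tau>'" "\<tau>' 0 = x" "\<tau>' 1 = h' rose_base"
    unfolding \<tau>'_def using al l \<mu> x by (auto intro!: pathin_path_cat)
  let ?B = "?d \<circ> \<tau>'"
  have B: "pathin ?Y ?B" using dpath \<tau>' by auto
  have BA: "path_homotopic ?Y ?B (path_cat ?A \<sigma>)"
  proof -
    have "?d \<circ> (add_virtual \<circ> l) = l" by auto
    then have eq: "?B = path_cat (path_cat (path_cat ?A \<sigma>) (path_rev ?M)) ?M"
      by (simp add: \<tau>'_def comp_path_cat l_def)
    show ?thesis
      unfolding eq by (rule path_homotopic_cancel_right'[OF A(2) A\<sigma>]) (use \<sigma> \<mu> in auto)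
  qed
  obtain k where k: "homotopic_with (\<lambda>_. True) (rose_space g) ?X h k" "k rose_base = \<tau> 0"
    "\<And>i. i < g \<Longrightarrow> locally_injective (k \<circ> ?e i)"
    "\<And>i. i < g \<Longrightarrow> path_homotopic ?X (path_cat (k \<circ> ?e i) \<tau>) (path_cat \<tau> (h \<circ> ?e i))"
    using V.move_marking[OF conh(1) \<tau>(1,3) homotopy_equivalence_petal_not_null[OF h]] by metis
  obtain k' where k': "homotopic_with (\<lambda>_. True) (rose_space g) ?X h' k'" "k' rose_base = \<tau>' 0"
    "\<And>i. i < g \<Longrightarrow> locally_injective (k' \<circ> ?e i)"
    "\<And>i. i < g \<Longrightarrow> path_homotopic ?X (path_cat (k' \<circ> ?e i) \<tau>') (path_cat \<tau>' (h' \<circ> ?e i))"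
    using V.move_marking[OF conh(2) \<tau>'(1,3) homotopy_equivalence_petal_not_null[OF h']] by metis
  have kc: "continuous_map (rose_space g) ?X k" "continuous_map (rose_space g) ?X k'"
    using homotopic_with_imp_continuous_maps k(1) k'(1) by blast+
  have "virtual_replacement G w x (k \<circ> ?e i) (k' \<circ> ?e i)" if i: "i < g" for i
  proof (rule virtual_replacementI[OF _ _ x(2)])
    note pe = pathin_petal[OF i]
    let ?K = "?d \<circ> (k \<circ> ?e i)" and ?K' = "?d \<circ> (k' \<circ> ?e i)" and ?H = "?d \<circ> (h \<circ> ?e i)" and ?H' = "?d \<circ> (h' \<circ> ?e i)"
    have P: "pathin ?Y ?K" "pathin ?Y ?K'" "pathin ?Y ?H" "pathin ?Y ?H'"
      using dpath pathin_map[OF pe] kc conh by auto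
    show "k \<circ> ?e i \<in> loops_at ?X x" "k' \<circ> ?e i \<in> loops_at ?X x"
      using pathin_map[OF pe] kc k k' \<tau> \<tau>' by (auto simp: loops_at_def)
    have ends: "?K 0 = ?A 0" "?K 1 = ?A 0" "?K' 0 = ?A 0" "?K' 1 = ?A 0" "?H 0 = ?A 1" "?H 1 = ?A 1"
      "?H' 0 = \<sigma> 1" "?H' 1 = \<sigma> 1" "?A 1 = \<sigma> 0" "?B 0 = ?A 0" "?B 1 = \<sigma> 1"
      using k k' \<tau> \<tau>' \<sigma> by auto
    have KA: "path_homotopic ?Y (path_cat ?K ?A) (path_cat ?A ?H)"
      using path_homotopic_map[OF continuous_drop_virtual k(4)[OF i]] by (simp add: comp_path_cat)
    have K'B: "path_homotopic ?Y (path_cat ?K' ?B) (path_cat ?B ?H')"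
      using path_homotopic_map[OF continuous_drop_virtual k'(4)[OF i]] by (simp add: comp_path_cat)
    have HS: "path_homotopic ?Y (path_cat ?H \<sigma>) (path_cat \<sigma> ?H')"
      using T(4)[OF pe] by (simp add: \<sigma>_def o_assoc)
    \<comment> \<open>Both \<open>?K\<close> and \<open>?K'\<close>, followed by
      \<open>path_cat ?A \<sigma>\<close>, are homotopic to that path followed by
      \<open>?H'\<close>; the path is then cancelled.\<close>
    have "path_homotopic ?Y (path_cat ?K' (path_cat ?A \<sigma>)) (path_cat ?K' ?B)"
      by (rule path_homotopic_cat[OF path_homotopic_refl[OF P(2)] path_homotopic_sym[OF BA]]) (use ends in simp)
    also have "path_homotopic ?Y \<dots> (path_cat ?B ?H')" by (rule K'B)
    also have "path_homotopic ?Y \<dots> (path_cat (path_cat ?A \<sigma>) ?H')"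
      by (rule path_homotopic_cat[OF BA path_homotopic_refl[OF P(4)]]) (use ends in simp)
    also have "path_homotopic ?Y \<dots> (path_cat ?A (path_cat \<sigma> ?H'))"
      by (rule path_homotopic_assoc) (use A \<sigma> P ends in simp_all)
    also have "path_homotopic ?Y \<dots> (path_cat ?A (path_cat ?H \<sigma>))"
      by (rule path_homotopic_cat[OF path_homotopic_refl[OF A(1)] path_homotopic_sym[OF HS]]) (use ends in simp)
    also have "path_homotopic ?Y \<dots> (path_cat (path_cat ?A ?H) \<sigma>)"
      by (rule path_homotopic_sym[OF path_homotopic_assoc]) (use A \<sigma> P ends in simp_all)
    also have "path_homotopic ?Y \<dots> (path_cat (path_cat ?K ?A) \<sigma>)"
      by (rule path_homotopic_cat[OF path_homotopic_sym[OF KA] path_homotopic_refl[OF \<sigma>(1)]]) (use ends in simp)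
    also have "path_homotopic ?Y \<dots> (path_cat ?K (path_cat ?A \<sigma>))"
      by (rule path_homotopic_assoc) (use A \<sigma> P ends in simp_all)
    finally have "path_homotopic ?Y ?K' ?K"
      by (rule path_homotopic_cancelR[OF _ P(2,1) A\<sigma>]) (use ends in simp_all)
    then show "path_homotopic ?Y ?K ?K'" by (rule path_homotopic_sym)
  qed
  then show ?thesis
    unfolding marking_equiv_def using k k' \<tau> \<tau>' x(3)
    by (rule_tac exI[of _ k], rule_tac exI[of _ k'], cases "arcs G = {}") simp_all
qed

section \<open>Fundamental groups and outer automorphisms\<close>

lemma loops_at_const: "x \<in> topspace X \<Longrightarrow> (\<lambda>_. x) \<in> loops_at X x"
  by (simp add: loops_at_def)

lemma loops_at_cat: "p \<in> loops_at X x \<Longrightarrow> q \<in> loops_at X x \<Longrightarrow> path_cat p q \<in> loops_at X x"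
  by (auto simp: loops_at_def intro!: pathin_path_cat)

lemma loops_at_rev: "p \<in> loops_at X x \<Longrightarrow> path_rev p \<in> loops_at X x"
  by (auto simp: loops_at_def intro!: pathin_path_rev)

lemma loops_at_map: "p \<in> loops_at X x \<Longrightarrow> continuous_map X Y f \<Longrightarrow> f x = y \<Longrightarrow> f \<circ> p \<in> loops_at Y y"
  by (auto simp: loops_at_def intro!: pathin_map)

lemma loops_at_homotopic:
  assumes "p \<in> loops_at X x" "path_homotopic X p q" shows "q \<in> loops_at X x"
  using assms(1) path_homotopic_ends[OF assms(2)] path_homotopic_paths[OF assms(2)] by (simp add: loops_at_def)

lemma loop_class_eq_iff:
  assumes "p \<in> loops_at X x" "q \<in> loops_at X x"
  shows "loop_class X x p = loop_class X x q \<longleftrightarrow> path_homotopic X p q"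
proof
  have "q \<in> loop_class X x q"
    using assms by (auto simp: loop_class_def loops_at_def intro: path_homotopic_refl)
  moreover assume "loop_class X x p = loop_class X x q"
  ultimately show "path_homotopic X p q" by (auto simp: loop_class_def)
next
  assume "path_homotopic X p q"
  then show "loop_class X x p = loop_class X x q"
    unfolding loop_class_def using path_homotopic_sym path_homotopic_trans by blast
qed

lemma fundamental_group_mult:
  assumes p: "p \<in> loops_at X x" and q: "q \<in> loops_at X x"
  shows "loop_class X x p \<otimes>\<^bsub>fundamental_group X x\<^esub> loop_class X x q = loop_class X x (path_cat p q)"
proof -
  have eq: "loop_class X x (path_cat p' q') = loop_class X x (path_cat p q)"
    if "p' \<in> loop_class X x p" "q' \<in> loop_class X x q" for p' q'
  proof -
    have h: "path_homotopic X p p'" "path_homotopic X q q'" and l: "p' \<in> loops_at X x" "q' \<in> loops_at X x"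
      using that by (auto simp: loop_class_def)
    have "path_homotopic X (path_cat p q) (path_cat p' q')"
      by (rule path_homotopic_cat[OF h]) (use p q in \<open>simp add: loops_at_def\<close>)
    then show ?thesis
      unfolding loop_class_eq_iff[OF loops_at_cat[OF l] loops_at_cat[OF p q]] by (rule path_homotopic_sym)
  qed
  have mem: "p \<in> loop_class X x p" "q \<in> loop_class X x q"
    using p q by (auto simp: loop_class_def loops_at_def intro: path_homotopic_refl)
  have "(\<Union>p'\<in>loop_class X x p. \<Union>q'\<in>loop_class X x q. loop_class X x (path_cat p' q')) =
      (\<Union>p'\<in>loop_class X x p. \<Union>q'\<in>loop_class X x q. loop_class X x (path_cat p q))"
    by (intro SUP_cong refl eq)
  also have "\<dots> = loop_class X x (path_cat p q)"
    using mem by blast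
  finally show ?thesis by (simp add: fundamental_group_def)
qed

lemma fundamental_group_carrier: "carrier (fundamental_group X x) = loop_class X x ` loops_at X x"
  and fundamental_group_one: "\<one>\<^bsub>fundamental_group X x\<^esub> = loop_class X x (\<lambda>_. x)"
  by (auto simp: fundamental_group_def)

lemma group_fundamental_group:
  assumes x: "x \<in> topspace X" shows "group (fundamental_group X x)"
proof (rule groupI)
  let ?G = "fundamental_group X x"
  note c = loops_at_const[OF x]
  show "\<one>\<^bsub>?G\<^esub> \<in> carrier ?G"
    using c by (auto simp: fundamental_group_carrier fundamental_group_one)
  fix a assume "a \<in> carrier ?G"
  then obtain p where p: "a = loop_class X x p" "p \<in> loops_at X x" by (auto simp: fundamental_group_carrier)
  then have pp: "pathin X p" "p 0 = x" "p 1 = x" by (auto simp: loops_at_def)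
  show "\<one>\<^bsub>?G\<^esub> \<otimes>\<^bsub>?G\<^esub> a = a"
    using p c pp
    by (auto simp: fundamental_group_one fundamental_group_mult loop_class_eq_iff loops_at_cat intro!: path_homotopic_lid)
  show "\<exists>b\<in>carrier ?G. b \<otimes>\<^bsub>?G\<^esub> a = \<one>\<^bsub>?G\<^esub>"
    by (rule bexI[of _ "loop_class X x (path_rev p)"])
       (use p c pp path_homotopic_linv[OF pp(1)] in \<open>auto simp: fundamental_group_one fundamental_group_carrier
          fundamental_group_mult loops_at_rev loop_class_eq_iff loops_at_cat\<close>)
  fix b assume "b \<in> carrier ?G"
  then obtain q where q: "b = loop_class X x q" "q \<in> loops_at X x" by (auto simp: fundamental_group_carrier)
  show "a \<otimes>\<^bsub>?G\<^esub> b \<in> carrier ?G"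
    using p q by (auto simp: fundamental_group_mult fundamental_group_carrier loops_at_cat)
  fix d assume "d \<in> carrier ?G"
  then obtain r where r: "d = loop_class X x r" "r \<in> loops_at X x" by (auto simp: fundamental_group_carrier)
  have "path_homotopic X (path_cat (path_cat p q) r) (path_cat p (path_cat q r))"
    by (rule path_homotopic_assoc) (use p q r in \<open>auto simp: loops_at_def\<close>)
  then show "a \<otimes>\<^bsub>?G\<^esub> b \<otimes>\<^bsub>?G\<^esub> d = a \<otimes>\<^bsub>?G\<^esub> (b \<otimes>\<^bsub>?G\<^esub> d)"
    using p q r by (simp add: fundamental_group_mult loops_at_cat loop_class_eq_iff)
qed

lemma fundamental_group_inv:
  assumes x: "x \<in> topspace X" and p: "p \<in> loops_at X x"
  shows "inv\<^bsub>fundamental_group X x\<^esub> (loop_class X x p) = loop_class X x (path_rev p)"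
proof (rule group.inv_equality[OF group_fundamental_group[OF x]])
  have pp: "pathin X p" "p 1 = x" using p by (auto simp: loops_at_def)
  show "loop_class X x (path_rev p) \<otimes>\<^bsub>fundamental_group X x\<^esub> loop_class X x p = \<one>\<^bsub>fundamental_group X x\<^esub>"
    using p pp path_homotopic_linv[OF pp(1)] loops_at_const[OF x]
    by (simp add: fundamental_group_mult fundamental_group_one loops_at_rev loops_at_cat loop_class_eq_iff)
qed (use p in \<open>auto simp: fundamental_group_carrier loops_at_rev\<close>)

section \<open>Inner automorphisms and the outer automorphism group\<close>

definition conjugation :: "('a, 'b) monoid_scheme \<Rightarrow> 'a \<Rightarrow> 'a \<Rightarrow> 'a" where
  "conjugation G x = (\<lambda>y\<in>carrier G. x \<otimes>\<^bsub>G\<^esub> y \<otimes>\<^bsub>G\<^esub> inv\<^bsub>G\<^esub> x)"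

lemma Inn_conjugation: "Inn G = conjugation G ` carrier G"
  by (auto simp: Inn_def conjugation_def)

context group begin

lemma carrier_AutoGroup: "carrier (AutoGroup G) = auto G"
  by (simp add: AutoGroup_def)

lemma mult_AutoGroup: "a \<in> auto G \<Longrightarrow> b \<in> auto G \<Longrightarrow> a \<otimes>\<^bsub>AutoGroup G\<^esub> b = compose (carrier G) a b"
  by (simp add: AutoGroup_def BijGroup_def auto_def)

lemma one_AutoGroup: "\<one>\<^bsub>AutoGroup G\<^esub> = (\<lambda>x\<in>carrier G. x)"
  by (simp add: AutoGroup_def BijGroup_def)

lemma auto_hom: "a \<in> auto G \<Longrightarrow> a \<in> hom G G"
  by (simp add: auto_def)

lemma auto_closed: "a \<in> auto G \<Longrightarrow> x \<in> carrier G \<Longrightarrow> a x \<in> carrier G"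
  using auto_hom by (auto simp: hom_def)

lemma auto_group_hom: "a \<in> auto G \<Longrightarrow> group_hom G G a"
  by unfold_locales (rule auto_hom)

lemma auto_ext: "a \<in> auto G \<Longrightarrow> b \<in> auto G \<Longrightarrow> (\<And>x. x \<in> carrier G \<Longrightarrow> a x = b x) \<Longrightarrow> a = b"
  by (rule extensionalityI[of _ "carrier G"]) (auto simp: auto_def Bij_def)

lemma conjugation_mult:
  assumes "x \<in> carrier G" "y \<in> carrier G" "z \<in> carrier G"
  shows "conjugation G (x \<otimes> y) z = conjugation G x (conjugation G y z)"
  using assms by (simp add: conjugation_def inv_mult_group m_assoc)

lemma conjugation_closed: "x \<in> carrier G \<Longrightarrow> y \<in> carrier G \<Longrightarrow> conjugation G x y \<in> carrier G"
  by (simp add: conjugation_def)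

lemma conjugation_one: "y \<in> carrier G \<Longrightarrow> conjugation G \<one> y = y"
  by (simp add: conjugation_def)

lemma conjugation_auto: assumes x: "x \<in> carrier G" shows "conjugation G x \<in> auto G"
proof -
  have "bij_betw (conjugation G x) (carrier G) (carrier G)"
  proof (rule bij_betwI[where g = "conjugation G (inv x)"])
    fix y assume "y \<in> carrier G"
    then show "conjugation G (inv x) (conjugation G x y) = y" "conjugation G x (conjugation G (inv x) y) = y"
      using x by (auto simp: conjugation_one simp flip: conjugation_mult)
  qed (use x in \<open>auto simp: conjugation_closed\<close>)
  moreover have "conjugation G x \<in> hom G G"
  proof (rule homI)
    fix y z assume yz: "y \<in> carrier G" "z \<in> carrier G"
    have "x \<otimes> y \<otimes> inv x \<otimes> (x \<otimes> z \<otimes> inv x) = x \<otimes> y \<otimes> (inv x \<otimes> x) \<otimes> z \<otimes> inv x"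
      using x yz by (simp only: m_assoc m_closed inv_closed)
    then show "conjugation G x (y \<otimes> z) = conjugation G x y \<otimes> conjugation G x z"
      using x yz by (simp add: conjugation_def m_assoc)
  qed (use x in \<open>auto simp: conjugation_closed\<close>)
  ultimately show ?thesis by (simp add: auto_def Bij_def conjugation_def)
qed

text \<open>An automorphism carries conjugation by \<open>x\<close> to conjugation by its value at
  \<open>x\<close>; this is the normality of the inner automorphisms.\<close>

lemma conjugation_auto_commute:
  assumes a: "a \<in> auto G" and x: "x \<in> carrier G"
  shows "a \<otimes>\<^bsub>AutoGroup G\<^esub> conjugation G x = conjugation G (a x) \<otimes>\<^bsub>AutoGroup G\<^esub> a"
proof -
  interpret a: group_hom G G a by (rule auto_group_hom[OF a])
  show ?thesis
    unfolding mult_AutoGroup[OF a conjugation_auto[OF x]]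
      mult_AutoGroup[OF conjugation_auto[OF auto_closed[OF a x]] a]
    using a x by (auto simp: compose_def fun_eq_iff conjugation_def auto_closed)
qed

lemma Inn_normal: "Inn G \<lhd> AutoGroup G"
proof -
  interpret A: group "AutoGroup G" by (rule AutoGroup)
  have mult: "conjugation G x \<otimes>\<^bsub>AutoGroup G\<^esub> conjugation G y = conjugation G (x \<otimes> y)"
    if "x \<in> carrier G" "y \<in> carrier G" for x y
  proof (rule auto_ext)
    show "conjugation G x \<otimes>\<^bsub>AutoGroup G\<^esub> conjugation G y \<in> auto G"
      using that A.m_closed conjugation_auto by (simp add: carrier_AutoGroup)
  qed (use that in \<open>auto simp: mult_AutoGroup conjugation_auto compose_def conjugation_mult\<close>)
  have one: "conjugation G \<one> = \<one>\<^bsub>AutoGroup G\<^esub>"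
    by (auto simp: one_AutoGroup fun_eq_iff conjugation_def)
  have inv: "inv\<^bsub>AutoGroup G\<^esub> (conjugation G x) = conjugation G (inv x)" if "x \<in> carrier G" for x
    by (rule A.inv_equality) (use that in \<open>auto simp: mult one carrier_AutoGroup conjugation_auto\<close>)
  have "subgroup (Inn G) (AutoGroup G)"
  proof (rule A.subgroupI)
    show "Inn G \<subseteq> carrier (AutoGroup G)" by (auto simp: Inn_conjugation conjugation_auto carrier_AutoGroup)
    show "Inn G \<noteq> {}" by (auto simp: Inn_conjugation)
    show "inv\<^bsub>AutoGroup G\<^esub> a \<in> Inn G" if "a \<in> Inn G" for a
      using that by (auto simp: Inn_conjugation inv)
    show "a \<otimes>\<^bsub>AutoGroup G\<^esub> b \<in> Inn G" if "a \<in> Inn G" "b \<in> Inn G" for a b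
      using that by (auto simp: Inn_conjugation mult)
  qed
  moreover have "a \<otimes>\<^bsub>AutoGroup G\<^esub> b \<otimes>\<^bsub>AutoGroup G\<^esub> inv\<^bsub>AutoGroup G\<^esub> a \<in> Inn G"
    if a: "a \<in> carrier (AutoGroup G)" and b: "b \<in> Inn G" for a b
  proof -
    obtain x where x: "x \<in> carrier G" "b = conjugation G x" using b by (auto simp: Inn_conjugation)
    have ax: "a x \<in> carrier G" using a x auto_closed by (simp add: carrier_AutoGroup)
    have "a \<otimes>\<^bsub>AutoGroup G\<^esub> b = conjugation G (a x) \<otimes>\<^bsub>AutoGroup G\<^esub> a"
      using conjugation_auto_commute a x by (simp add: carrier_AutoGroup)
    moreover have c: "conjugation G (a x) \<in> carrier (AutoGroup G)"
      using ax conjugation_auto by (simp add: carrier_AutoGroup)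
    ultimately have "a \<otimes>\<^bsub>AutoGroup G\<^esub> b \<otimes>\<^bsub>AutoGroup G\<^esub> inv\<^bsub>AutoGroup G\<^esub> a = conjugation G (a x)"
      by (simp only: A.m_assoc[OF c a A.inv_closed[OF a]] A.r_inv[OF a] A.r_one[OF c])
    then show ?thesis using ax by (simp add: Inn_conjugation)
  qed
  ultimately show ?thesis unfolding A.normal_inv_iff by blast
qed

lemma group_Out: "group (Out G)"
  unfolding Out_def by (rule normal.factorgroup_is_group[OF Inn_normal])

lemma Out_carrierE:
  assumes "A \<in> carrier (Out G)"
  obtains a where "a \<in> auto G" "a \<in> A" "A \<subseteq> auto G"
    "\<And>b. b \<in> A \<Longrightarrow> \<exists>x\<in>carrier G. b = conjugation G x \<otimes>\<^bsub>AutoGroup G\<^esub> a"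
proof -
  interpret A: group "AutoGroup G" by (rule AutoGroup)
  interpret N: normal "Inn G" "AutoGroup G" by (rule Inn_normal)
  obtain a where a: "a \<in> auto G" "A = Inn G #>\<^bsub>AutoGroup G\<^esub> a"
    using assms by (auto simp: Out_def FactGroup_def RCOSETS_def carrier_AutoGroup)
  have ax: "\<exists>x\<in>carrier G. b = conjugation G x \<otimes>\<^bsub>AutoGroup G\<^esub> a" if "b \<in> A" for b
    using that a by (auto simp: r_coset_def Inn_conjugation)
  show thesis
  proof (rule that[OF a(1) _ _ ax])
    show "a \<in> A" using A.rcos_self[OF _ N.is_subgroup] a by (simp add: carrier_AutoGroup)
    show "A \<subseteq> auto G"
    proof
      fix b assume "b \<in> A"
      then obtain x where "x \<in> carrier G" "b = conjugation G x \<otimes>\<^bsub>AutoGroup G\<^esub> a" using ax by blast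
      then show "b \<in> auto G" using A.m_closed a conjugation_auto by (simp add: carrier_AutoGroup)
    qed
  qed
qed

lemma Out_coset_conjugate:
  assumes A: "A \<in> carrier (Out G)" and a: "a \<in> A" and b: "b \<in> A"
  obtains x where "x \<in> carrier G" "\<forall>y\<in>carrier G. b y = x \<otimes> a y \<otimes> inv x"
proof -
  obtain c where c: "c \<in> auto G" "\<And>b. b \<in> A \<Longrightarrow> \<exists>x\<in>carrier G. b = conjugation G x \<otimes>\<^bsub>AutoGroup G\<^esub> c"
    using Out_carrierE[OF A] by metis
  obtain x where x: "x \<in> carrier G" "a = conjugation G x \<otimes>\<^bsub>AutoGroup G\<^esub> c" using c(2)[OF a] by blast
  obtain z where z: "z \<in> carrier G" "b = conjugation G z \<otimes>\<^bsub>AutoGroup G\<^esub> c" using c(2)[OF b] by blast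
  \<comment> \<open>\<open>a\<close> and \<open>b\<close> arise from the same \<open>c\<close> by
    conjugation with \<open>x\<close> and \<open>z\<close>, so \<open>z \<otimes> inv x\<close>
    leads from \<open>a\<close> to \<open>b\<close>.\<close>
  show thesis
  proof (rule that[of "z \<otimes> inv x"], rule_tac [2] ballI)
    fix y assume y: "y \<in> carrier G"
    have cy: "c y \<in> carrier G" using c y auto_closed by blast
    have ay: "a y = conjugation G x (c y)" "b y = conjugation G z (c y)"
      using x z c y by (auto simp: mult_AutoGroup conjugation_auto compose_def)
    then have "conjugation G (z \<otimes> inv x) (a y) = conjugation G (z \<otimes> inv x \<otimes> x) (c y)"
      using x z cy by (simp only: conjugation_mult m_closed inv_closed)
    also have "z \<otimes> inv x \<otimes> x = z" using x z by (simp add: m_assoc)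
    finally have "b y = conjugation G (z \<otimes> inv x) (a y)" using ay by simp
    moreover have "a y \<in> carrier G" using ay x cy conjugation_closed by simp
    ultimately show "b y = z \<otimes> inv x \<otimes> a y \<otimes> inv (z \<otimes> inv x)" by (simp add: conjugation_def)
  qed (use x z in auto)
qed

lemma one_Out: "(\<lambda>x\<in>carrier G. x) \<in> \<one>\<^bsub>Out G\<^esub>"
proof -
  have "conjugation G \<one> = (\<lambda>x\<in>carrier G. x)" by (auto simp: fun_eq_iff conjugation_def)
  then show ?thesis by (auto simp: Out_def FactGroup_def Inn_conjugation image_iff intro!: bexI[of _ \<one>])
qed

lemma mult_Out:
  assumes "a \<in> A" "b \<in> B" "A \<in> carrier (Out G)" "B \<in> carrier (Out G)"
  shows "compose (carrier G) a b \<in> A \<otimes>\<^bsub>Out G\<^esub> B"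
proof -
  have "a \<in> auto G" "b \<in> auto G" using assms Out_carrierE by (metis subsetD)+
  then have "compose (carrier G) a b = a \<otimes>\<^bsub>AutoGroup G\<^esub> b" by (simp add: mult_AutoGroup)
  then show ?thesis using assms by (auto simp: Out_def FactGroup_def set_mult_def)
qed

end

section \<open>Realizing automorphisms on the rose\<close>

lemma homotopy_equivalence_map_compose:
  assumes f: "homotopy_equivalence_map X Y f" and h: "homotopy_equivalence_map Y Z h"
  shows "homotopy_equivalence_map X Z (h \<circ> f)"
proof -
  obtain k where k: "continuous_map Y X k" "homotopic_with (\<lambda>_. True) X X (k \<circ> f) id"
    "homotopic_with (\<lambda>_. True) Y Y (f \<circ> k) id" and cf: "continuous_map X Y f"
    using f by (auto simp: homotopy_equivalence_map_def)
  obtain m where m: "continuous_map Z Y m" "homotopic_with (\<lambda>_. True) Y Y (m \<circ> h) id"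
    "homotopic_with (\<lambda>_. True) Z Z (h \<circ> m) id" and ch: "continuous_map Y Z h"
    using h by (auto simp: homotopy_equivalence_map_def)
  have "homotopic_with (\<lambda>_. True) X Y ((m \<circ> h) \<circ> f) (id \<circ> f)"
    by (rule homotopic_with_compose_continuous_map_right[OF m(2) cf]) auto
  then have "homotopic_with (\<lambda>_. True) X X (k \<circ> ((m \<circ> h) \<circ> f)) (k \<circ> (id \<circ> f))"
    by (rule homotopic_with_compose_continuous_map_left[OF _ k(1)]) auto
  then have 1: "homotopic_with (\<lambda>_. True) X X ((k \<circ> m) \<circ> (h \<circ> f)) id"
    using homotopic_with_trans[OF _ k(2)] by (simp add: o_assoc)
  have "homotopic_with (\<lambda>_. True) Z Y ((f \<circ> k) \<circ> m) (id \<circ> m)"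
    by (rule homotopic_with_compose_continuous_map_right[OF k(3) m(1)]) auto
  then have "homotopic_with (\<lambda>_. True) Z Z (h \<circ> ((f \<circ> k) \<circ> m)) (h \<circ> (id \<circ> m))"
    by (rule homotopic_with_compose_continuous_map_left[OF _ ch]) auto
  then have 2: "homotopic_with (\<lambda>_. True) Z Z ((h \<circ> f) \<circ> (k \<circ> m)) id"
    using homotopic_with_trans[OF _ m(3)] by (simp add: o_assoc)
  show ?thesis
    unfolding homotopy_equivalence_map_def
    using 1 2 continuous_map_compose[OF cf ch] continuous_map_compose[OF m(1) k(1)] by blast
qed

lemma homotopy_equivalence_map_id: "homotopy_equivalence_map X X id"
  unfolding homotopy_equivalence_map_def by (auto intro!: exI[of _ id] homotopic_with_equal)

text \<open>By \<open>reduced_word_full_segment\<close> a reduced loop at the only vertex consists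
  of whole petals, run forwards or backwards. This is the statement that the petals generate the
  fundamental group, in the form of an induction rule.\<close>

lemma rose_loop_induct [consumes 1, case_names homotopic const petal rev_petal cat]:
  assumes p: "p \<in> loops_at (rose_space g) rose_base"
    and hom: "\<And>p q. p \<in> loops_at (rose_space g) rose_base \<Longrightarrow> path_homotopic (rose_space g) p q \<Longrightarrow> P q \<Longrightarrow> P p"
    and const: "P (\<lambda>_. rose_base)"
    and petal: "\<And>i. i < g \<Longrightarrow> P (edge_path (rose g) i)" "\<And>i. i < g \<Longrightarrow> P (path_rev (edge_path (rose g) i))"
    and cat: "\<And>p q. p \<in> loops_at (rose_space g) rose_base \<Longrightarrow> q \<in> loops_at (rose_space g) rose_base \<Longrightarrow>
      P p \<Longrightarrow> P q \<Longrightarrow> P (path_cat p q)"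
  shows "P p"
proof -
  have p': "pathin (rose_space g) p" "p 0 = rose_base" "p 1 = rose_base" using p by (auto simp: loops_at_def)
  obtain ws where ws: "reduced ws" "is_word (rose g) rose_base ws rose_base"
    "path_homotopic (rose_space g) p (word_path (rose g) rose_base ws)"
    using rose.pathin_reduced_word[OF p'(1)] p' by auto
  have "(s, t) \<in> {(0, 1), (1, 0)}" if "(e, s, t) \<in> set ws" for e s t
    by (rule rose.reduced_word_full_segment[OF ws(1,2) that]) auto
  then have "P (word_path (rose g) rose_base ws)"
    using ws(2)
  proof (induction ws)
    case (Cons a ws)
    obtain e s t where a: "a = (e, s, t)" by (cases a)
    have st: "(s, t) \<in> {(0, 1), (1, 0)}" using Cons.prems(1)[of e s t] a by simp
    then have et: "edge_path (rose g) e t = rose_base" by auto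
    have e: "e < g" and w: "is_word (rose g) rose_base ws rose_base" using Cons.prems(2) a et by auto
    have Pw: "P (word_path (rose g) rose_base ws)" by (rule Cons.IH[OF Cons.prems(1) w]) auto
    have "seg (rose g) e s t = edge_path (rose g) e \<or> seg (rose g) e s t = path_rev (edge_path (rose g) e)"
      using st by (auto simp: seg_def path_rev_def)
    then have s: "P (seg (rose g) e s t)" "seg (rose g) e s t \<in> loops_at (rose_space g) rose_base"
      using petal e petal_loop loops_at_rev by metis+
    have "word_path (rose g) rose_base ws \<in> loops_at (rose_space g) rose_base"
      using rose.word_path_props[OF w] by (simp add: loops_at_def)
    then show ?case
      unfolding a word_path.simps et by (intro cat s Pw)
  qed (simp add: const)
  with hom[OF p ws(3)] show ?thesis .
qed

abbreviation petal_class :: "nat \<Rightarrow> nat \<Rightarrow> (real \<Rightarrow> (unit, nat) gpoint) set" where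
  "petal_class g i \<equiv> loop_class (rose_space g) rose_base (edge_path (rose g) i)"

lemma group_free_group: "group (free_group g)"
  by (rule group_fundamental_group[OF rose_base_in_topspace])

lemma loop_class_in_free_group:
  "p \<in> loops_at (rose_space g) rose_base \<Longrightarrow> loop_class (rose_space g) rose_base p \<in> carrier (free_group g)"
  by (auto simp: fundamental_group_carrier)

text \<open>A homomorphism and a map that fixes the base point agree on all classes once they agree
  on petals: both respect concatenation and reversal.\<close>

lemma hom_eq_induced_map:
  assumes \<alpha>: "\<alpha> \<in> hom (free_group g) (free_group g)"
    and f: "continuous_map (rose_space g) (rose_space g) f" "f rose_base = rose_base"
    and petal: "\<And>i. i < g \<Longrightarrow> \<alpha> (petal_class g i) = loop_class (rose_space g) rose_base (f \<circ> edge_path (rose g) i)"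
    and p: "p \<in> loops_at (rose_space g) rose_base"
  shows "\<alpha> (loop_class (rose_space g) rose_base p) = loop_class (rose_space g) rose_base (f \<circ> p)"
  using p
proof (induction rule: rose_loop_induct)
  let ?F = "free_group g" and ?c = "loop_class (rose_space g) rose_base" and ?L = "loops_at (rose_space g) rose_base"
  interpret F: group ?F by (rule group_free_group)
  interpret \<alpha>: group_hom ?F ?F \<alpha> by unfold_locales (rule \<alpha>)
  have fl: "f \<circ> p \<in> ?L" if "p \<in> ?L" for p using loops_at_map[OF that f] .
  {
    case (homotopic p q)
    have q: "q \<in> ?L" by (rule loops_at_homotopic[OF homotopic(1,2)])
    have "?c p = ?c q" using homotopic q by (simp add: loop_class_eq_iff)
    moreover have "?c (f \<circ> p) = ?c (f \<circ> q)"
      using path_homotopic_map[OF f(1) homotopic(2)] homotopic q fl by (simp add: loop_class_eq_iff)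
    ultimately show ?case using homotopic by (simp add: o_def)
  next
    case const
    have "(f \<circ> (\<lambda>_. rose_base)) = (\<lambda>_::real. rose_base)" using f by auto
    then show ?case using \<alpha>.hom_one by (simp add: fundamental_group_one)
  next
    case (petal i)
    then show ?case by (rule assms)
  next
    case (rev_petal i)
    have e: "edge_path (rose g) i \<in> ?L" by (rule petal_loop[OF rev_petal])
    have "\<alpha> (?c (path_rev (edge_path (rose g) i))) = \<alpha> (inv\<^bsub>?F\<^esub> (petal_class g i))"
      by (simp add: fundamental_group_inv[OF rose_base_in_topspace e])
    also have "\<dots> = inv\<^bsub>?F\<^esub> (\<alpha> (petal_class g i))"
      by (rule \<alpha>.hom_inv[OF loop_class_in_free_group[OF e]])
    also have "\<dots> = ?c (f \<circ> path_rev (edge_path (rose g) i))"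
      by (simp add: assms(4)[OF rev_petal] fundamental_group_inv[OF rose_base_in_topspace fl[OF e]] comp_path_rev)
    finally show ?case .
  next
    case (cat p q)
    have "\<alpha> (?c (path_cat p q)) = \<alpha> (?c p \<otimes>\<^bsub>?F\<^esub> ?c q)" using cat by (simp add: fundamental_group_mult)
    also have "\<dots> = \<alpha> (?c p) \<otimes>\<^bsub>?F\<^esub> \<alpha> (?c q)"
      by (rule \<alpha>.hom_mult) (use cat in \<open>auto intro: loop_class_in_free_group\<close>)
    also have "\<dots> = ?c (f \<circ> path_cat p q)"
      using cat by (simp only: fundamental_group_mult fl comp_path_cat)
    finally show ?case .
  }
qed

text \<open>Each petal is sent to some loop that represents the image of its class; these choices
  are compatible because all petals meet only in the base point.\<close>

lemma induced_map_exists: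
  assumes \<alpha>: "\<alpha> \<in> hom (free_group g) (free_group g)"
  obtains f where "continuous_map (rose_space g) (rose_space g) f" "f rose_base = rose_base"
    "\<forall>p\<in>loops_at (rose_space g) rose_base.
       \<alpha> (loop_class (rose_space g) rose_base p) = loop_class (rose_space g) rose_base (f \<circ> p)"
proof -
  let ?F = "free_group g" and ?c = "loop_class (rose_space g) rose_base" and ?L = "loops_at (rose_space g) rose_base"
  have "\<exists>p\<in>?L. \<alpha> (petal_class g i) = ?c p" if "i < g" for i
  proof -
    have "\<alpha> (petal_class g i) \<in> carrier ?F"
      using hom_in_carrier[OF \<alpha> loop_class_in_free_group[OF petal_loop[OF that]]] .
    then show ?thesis by (auto simp: fundamental_group_carrier)
  qed
  then obtain q where q: "\<And>i. i < g \<Longrightarrow> q i \<in> ?L" "\<And>i. i < g \<Longrightarrow> \<alpha> (petal_class g i) = ?c (q i)"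
    by metis
  define f where "f = glue (\<lambda>_::unit. rose_base) q"
  have q': "pathin (rose_space g) (q i)" "q i 0 = rose_base" "q i 1 = rose_base" if "i < g" for i
    using q(1)[OF that] by (auto simp: loops_at_def)
  have f: "continuous_map (rose_space g) (rose_space g) f"
    unfolding f_def by (rule rose.continuous_map_glue) (use q' rose_base_in_topspace in auto)
  have fb: "f rose_base = rose_base" by (simp add: f_def)
  have "\<alpha> (petal_class g i) = ?c (f \<circ> edge_path (rose g) i)" if "i < g" for i
  proof -
    have "path_homotopic (rose_space g) (f \<circ> edge_path (rose g) i) (q i)"
      unfolding f_def by (rule rose.glue_path_homotopic) (use q'[OF that] that in auto)
    then have "?c (f \<circ> edge_path (rose g) i) = ?c (q i)"
      using q(1)[OF that] loops_at_map[OF petal_loop[OF that] f fb] by (simp add: loop_class_eq_iff)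
    then show ?thesis using q(2)[OF that] by simp
  qed
  from hom_eq_induced_map[OF \<alpha> f fb this] show thesis using that f fb by blast
qed

lemma homotopic_id_rose:
  assumes f: "continuous_map (rose_space g) (rose_space g) f" "f rose_base = rose_base"
    and petal: "\<And>i. i < g \<Longrightarrow> loop_class (rose_space g) rose_base (f \<circ> edge_path (rose g) i) = petal_class g i"
  shows "homotopic_with (\<lambda>_. True) (rose_space g) (rose_space g) f id"
proof (rule rose.homotopic_with_realization_relI[OF f(1) continuous_map_id])
  fix i assume "i \<in> arcs (rose g)"
  then have i: "i < g" by simp
  show "path_homotopic (rose_space g) (f \<circ> edge_path (rose g) i) (id \<circ> edge_path (rose g) i)"
    using petal[OF i] loops_at_map[OF petal_loop[OF i] f] petal_loop[OF i] by (simp add: loop_class_eq_iff)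
qed (use f in auto)

text \<open>The inverse automorphism is realized as well, and the two maps are homotopy inverse to
  each other: on the classes of petals both composites act as the identity.\<close>

lemma induces_automorphism_exists:
  assumes \<alpha>: "\<alpha> \<in> auto (free_group g)"
  obtains f where "induces_automorphism g f \<alpha>"
proof -
  let ?F = "free_group g" and ?c = "loop_class (rose_space g) rose_base" and ?L = "loops_at (rose_space g) rose_base"
  interpret F: group ?F by (rule group_free_group)
  interpret A: group "AutoGroup ?F" by (rule F.AutoGroup)
  define \<beta> where "\<beta> = inv\<^bsub>AutoGroup ?F\<^esub> \<alpha>"
  have \<beta>: "\<beta> \<in> auto ?F" using A.inv_closed \<alpha> unfolding \<beta>_def by (simp add: F.carrier_AutoGroup)
  have "\<beta> \<otimes>\<^bsub>AutoGroup ?F\<^esub> \<alpha> = \<one>\<^bsub>AutoGroup ?F\<^esub>" "\<alpha> \<otimes>\<^bsub>AutoGroup ?F\<^esub> \<beta> = \<one>\<^bsub>AutoGroup ?F\<^esub>"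
    using A.l_inv A.r_inv \<alpha> unfolding \<beta>_def by (auto simp: F.carrier_AutoGroup)
  then have c: "compose (carrier ?F) \<beta> \<alpha> = (\<lambda>x\<in>carrier ?F. x)" "compose (carrier ?F) \<alpha> \<beta> = (\<lambda>x\<in>carrier ?F. x)"
    using \<alpha> \<beta> by (simp_all only: F.mult_AutoGroup F.one_AutoGroup)
  have inv: "\<beta> (\<alpha> x) = x" "\<alpha> (\<beta> x) = x" if "x \<in> carrier ?F" for x
    using fun_cong[OF c(1), of x] fun_cong[OF c(2), of x] that by (simp_all only: compose_eq restrict_apply')
  obtain f where f: "continuous_map (rose_space g) (rose_space g) f" "f rose_base = rose_base"
    "\<forall>p\<in>?L. \<alpha> (?c p) = ?c (f \<circ> p)"
    using induced_map_exists[OF F.auto_hom[OF \<alpha>]] .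
  obtain k where k: "continuous_map (rose_space g) (rose_space g) k" "k rose_base = rose_base"
    "\<forall>p\<in>?L. \<beta> (?c p) = ?c (k \<circ> p)"
    using induced_map_exists[OF F.auto_hom[OF \<beta>]] .
  have "homotopic_with (\<lambda>_. True) (rose_space g) (rose_space g) (k \<circ> f) id"
  proof (rule homotopic_id_rose[OF continuous_map_compose[OF f(1) k(1)]])
    fix i assume i: "i < g"
    note e = petal_loop[OF i]
    have "?c (k \<circ> f \<circ> edge_path (rose g) i) = \<beta> (\<alpha> (petal_class g i))"
      using f(3)[rule_format, OF e] k(3)[rule_format, OF loops_at_map[OF e f(1,2)]] by (simp add: o_assoc)
    then show "?c (k \<circ> f \<circ> edge_path (rose g) i) = petal_class g i"
      using inv loop_class_in_free_group[OF e] by simp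
  qed (use f k in auto)
  moreover have "homotopic_with (\<lambda>_. True) (rose_space g) (rose_space g) (f \<circ> k) id"
  proof (rule homotopic_id_rose[OF continuous_map_compose[OF k(1) f(1)]])
    fix i assume i: "i < g"
    note e = petal_loop[OF i]
    have "?c (f \<circ> k \<circ> edge_path (rose g) i) = \<alpha> (\<beta> (petal_class g i))"
      using k(3)[rule_format, OF e] f(3)[rule_format, OF loops_at_map[OF e k(1,2)]] by (simp add: o_assoc)
    then show "?c (f \<circ> k \<circ> edge_path (rose g) i) = petal_class g i"
      using inv loop_class_in_free_group[OF e] by simp
  qed (use f k in auto)
  ultimately have "homotopy_equivalence_map (rose_space g) (rose_space g) f"
    unfolding homotopy_equivalence_map_def using f(1) k(1) by blast
  then show thesis using that[of f] f unfolding induces_automorphism_def by blast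
qed

text \<open>Inner automorphisms move the base point around a loop, so they do not change the free homotopy class.\<close>

lemma induces_automorphism_unique:
  assumes A: "A \<in> carrier (Out (free_group g))" and \<alpha>: "\<alpha> \<in> A" "\<beta> \<in> A"
    and f: "induces_automorphism g f \<alpha>" and k: "induces_automorphism g k \<beta>"
  shows "homotopic_with (\<lambda>_. True) (rose_space g) (rose_space g) f k"
proof -
  let ?X = "rose_space g" and ?F = "free_group g"
  let ?c = "loop_class ?X rose_base" and ?L = "loops_at ?X rose_base"
  have cf: "continuous_map ?X ?X f" "continuous_map ?X ?X k" and b: "f rose_base = rose_base" "k rose_base = rose_base"
    using f k by (auto simp: induces_automorphism_def homotopy_equivalence_map_def)
  obtain x where x: "x \<in> carrier ?F" "\<forall>y\<in>carrier ?F. \<alpha> y = x \<otimes>\<^bsub>?F\<^esub> \<beta> y \<otimes>\<^bsub>?F\<^esub> inv\<^bsub>?F\<^esub> x"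
    using group.Out_coset_conjugate[OF group_free_group A \<alpha>(2,1)] .
  obtain r where r: "r \<in> ?L" "x = ?c r" using x(1) by (auto simp: fundamental_group_carrier)
  have rp: "pathin ?X r" "r 0 = rose_base" "r 1 = rose_base" using r by (auto simp: loops_at_def)
  show ?thesis
  proof (rule rose.homotopic_with_realizationI[OF cf, where \<tau> = "\<lambda>_. r"])
    fix i assume "i \<in> arcs (rose g)"
    then have e: "edge_path (rose g) i \<in> ?L" using petal_loop by simp
    let ?f = "f \<circ> edge_path (rose g) i" and ?k = "k \<circ> edge_path (rose g) i"
    have l: "?f \<in> ?L" "?k \<in> ?L" using loops_at_map[OF e cf(1) b(1)] loops_at_map[OF e cf(2) b(2)] by auto
    have "?c ?f = \<alpha> (petal_class g i)" "?c ?k = \<beta> (petal_class g i)"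
      using f k e by (auto simp: induces_automorphism_def)
    then have "?c ?f = ?c r \<otimes>\<^bsub>?F\<^esub> ?c ?k \<otimes>\<^bsub>?F\<^esub> inv\<^bsub>?F\<^esub> (?c r)"
      using x(2) loop_class_in_free_group[OF e] r by simp
    also have "\<dots> = ?c (path_cat (path_cat r ?k) (path_rev r))"
      using r(1) l by (simp only: fundamental_group_mult fundamental_group_inv[OF rose_base_in_topspace] loops_at_cat loops_at_rev)
    finally have "path_homotopic ?X ?f (path_cat (path_cat r ?k) (path_rev r))"
      using r(1) l by (simp only: loop_class_eq_iff loops_at_cat loops_at_rev)
    also have "path_homotopic ?X \<dots> (path_cat r (path_cat ?k (path_rev r)))"
      by (rule path_homotopic_assoc) (use rp l in \<open>auto simp: loops_at_def pathin_path_rev\<close>)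
    finally show "path_homotopic ?X ?f (path_cat r (path_cat ?k (path_rev r)))" .
  qed (use rp b in auto)
qed

text \<open>The order is that of composition. Precomposing a marking with \<open>f \<circ> k\<close>
  is precomposing first with \<open>f\<close> and then with \<open>k\<close>, which is why the
  action is a right action.\<close>

lemma induces_automorphism_compose:
  assumes f: "induces_automorphism g f \<alpha>" and k: "induces_automorphism g k \<beta>"
  shows "induces_automorphism g (f \<circ> k) (compose (carrier (free_group g)) \<alpha> \<beta>)"
proof -
  let ?X = "rose_space g" and ?c = "loop_class (rose_space g) rose_base" and ?L = "loops_at (rose_space g) rose_base"
  have ck: "continuous_map ?X ?X k" "k rose_base = rose_base"
    using k by (auto simp: induces_automorphism_def homotopy_equivalence_map_def)
  have "compose (carrier (free_group g)) \<alpha> \<beta> (?c p) = ?c (f \<circ> k \<circ> p)" if p: "p \<in> ?L" for p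
  proof -
    have "compose (carrier (free_group g)) \<alpha> \<beta> (?c p) = \<alpha> (\<beta> (?c p))"
      using loop_class_in_free_group[OF p] by (simp add: compose_eq)
    also have "\<dots> = ?c (f \<circ> (k \<circ> p))"
      using f k p loops_at_map[OF p ck] by (simp add: induces_automorphism_def)
    finally show ?thesis by (simp add: o_assoc)
  qed
  then show ?thesis
    using f k homotopy_equivalence_map_compose[of ?X ?X k ?X f] by (auto simp: induces_automorphism_def)
qed

lemma induces_automorphism_id: "induces_automorphism g id (\<lambda>x\<in>carrier (free_group g). x)"
  by (auto simp: induces_automorphism_def homotopy_equivalence_map_id loop_class_in_free_group)

section \<open>Contractions of graphs\<close>

text \<open>
  \<open>graph_collapse G w S \<pi> \<theta> \<phi> G' w'\<close>: contracting the set \<open>S\<close> of edges of \<open>(G, w)\<close> gives \<open>(G', w')\<close>, where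
  \<open>\<pi>\<close> is the map on vertices, \<open>\<theta>\<close> the bijection on the remaining edges, and \<open>\<phi>\<close> tells which of them
  are reversed. The weight of \<open>v'\<close> is the total weight plus the first Betti number of the subgraph of \<open>S\<close>
  over \<open>v'\<close>, written with \<open>w v - 1\<close> so that it is additive under composition.
\<close>

definition graph_collapse ::
    "('v, 'e) pre_digraph \<Rightarrow> ('v \<Rightarrow> nat) \<Rightarrow> 'e set \<Rightarrow> ('v \<Rightarrow> 'v2) \<Rightarrow> ('e \<Rightarrow> 'e2) \<Rightarrow> ('e \<Rightarrow> bool) \<Rightarrow>
     ('v2, 'e2) pre_digraph \<Rightarrow> ('v2 \<Rightarrow> nat) \<Rightarrow> bool" where
  "graph_collapse G w S \<pi> \<theta> \<phi> G' w' \<longleftrightarrow> S \<subseteq> arcs G \<and> \<pi> ` verts G = verts G' \<and>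
     bij_betw \<theta> (arcs G - S) (arcs G') \<and>
     (\<forall>e\<in>arcs G - S. (tail G' (\<theta> e), head G' (\<theta> e)) =
        (if \<phi> e then (\<pi> (head G e), \<pi> (tail G e)) else (\<pi> (tail G e), \<pi> (head G e)))) \<and>
     (\<forall>u\<in>verts G. \<forall>v\<in>verts G. \<pi> u = \<pi> v \<longleftrightarrow> (u, v) \<in> conn G S) \<and>
     (\<forall>v'\<in>verts G'. int (w' v') - 1 =
        (\<Sum>v\<in>{v \<in> verts G. \<pi> v = v'}. int (w v) - 1) + (\<Sum>e\<in>{e \<in> S. \<pi> (tail G e) = v'}. 1))"

lemma graph_collapseD:
  assumes "graph_collapse G w S \<pi> \<theta> \<phi> G' w'"
  shows "S \<subseteq> arcs G" "\<pi> ` verts G = verts G'" "bij_betw \<theta> (arcs G - S) (arcs G')"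
    "\<And>e. e \<in> arcs G - S \<Longrightarrow> tail G' (\<theta> e) = (if \<phi> e then \<pi> (head G e) else \<pi> (tail G e))"
    "\<And>e. e \<in> arcs G - S \<Longrightarrow> head G' (\<theta> e) = (if \<phi> e then \<pi> (tail G e) else \<pi> (head G e))"
    "\<And>u v. u \<in> verts G \<Longrightarrow> v \<in> verts G \<Longrightarrow> \<pi> u = \<pi> v \<longleftrightarrow> (u, v) \<in> conn G S"
    "\<And>v'. v' \<in> verts G' \<Longrightarrow> int (w' v') - 1 =
        (\<Sum>v\<in>{v \<in> verts G. \<pi> v = v'}. int (w v) - 1) + (\<Sum>e\<in>{e \<in> S. \<pi> (tail G e) = v'}. 1)"
  using assms unfolding graph_collapse_def by (simp_all split: if_splits) blast+

lemma conn_empty [simp]: "conn G {} = Id"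
  by (simp add: conn_def)

lemma conn_mono: "S \<subseteq> T \<Longrightarrow> conn G S \<subseteq> conn G T"
  unfolding conn_def by (rule rtrancl_mono) auto

lemma conn_refl: "(u, u) \<in> conn G S"
  by (simp add: conn_def)

lemma conn_trans: "(u, v) \<in> conn G S \<Longrightarrow> (v, x) \<in> conn G S \<Longrightarrow> (u, x) \<in> conn G S"
  unfolding conn_def by (rule rtrancl_trans)

lemma conn_edge: "e \<in> S \<Longrightarrow> (tail G e, head G e) \<in> conn G S" "e \<in> S \<Longrightarrow> (head G e, tail G e) \<in> conn G S"
  unfolding conn_def by auto

lemma conn_induct [consumes 1, case_names refl step]:
  assumes "(u, v) \<in> conn G S" "P u"
    "\<And>x y e. (u, x) \<in> conn G S \<Longrightarrow> P x \<Longrightarrow> e \<in> S \<Longrightarrow>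
      (x, y) = (tail G e, head G e) \<or> (x, y) = (head G e, tail G e) \<Longrightarrow> P y"
  shows "P v"
  using assms(1) unfolding conn_def
proof (induction rule: rtrancl_induct)
  case (step y z)
  then show ?case using assms(3)[of y _ z] unfolding conn_def by auto
qed (rule assms(2))

text \<open>What two successive contractions remove together, the second set \<open>T\<close> being
  brought back to \<open>G\<close> along the edge bijection.\<close>

definition pulled_back :: "('v, 'e) pre_digraph \<Rightarrow> 'e set \<Rightarrow> ('e \<Rightarrow> 'e2) \<Rightarrow> 'e2 set \<Rightarrow> 'e set" where
  "pulled_back G S \<theta> T = S \<union> {e \<in> arcs G - S. \<theta> e \<in> T}"

context
  fixes G :: "('v, 'e) pre_digraph" and G' :: "('v2, 'e2) pre_digraph" and w w' S \<pi> \<theta> \<phi>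
  assumes G: "wf_digraph G" and G': "wf_digraph G'"
    and col: "graph_collapse G w S \<pi> \<theta> \<phi> G' w'"
begin

interpretation G: wf_digraph G by (rule G)
interpretation G': wf_digraph G' by (rule G')

lemma collapse_contracted: "e \<in> S \<Longrightarrow> \<pi> (tail G e) = \<pi> (head G e)"
  using graph_collapseD(1,6)[OF col] conn_edge(1)[of e S G] by (metis G.head_in_verts G.tail_in_verts subsetD)

lemma collapse_arc: "e \<in> arcs G - S \<Longrightarrow> \<theta> e \<in> arcs G'"
  using graph_collapseD(3)[OF col] by (auto simp: bij_betw_def)

text \<open>A walk in \<open>G\<close> has an image in \<open>G'\<close>, in which edges of
  \<open>S\<close> disappear. Conversely a walk in \<open>G'\<close> lifts edge by edge, the gaps
  between the lifts being bridged along \<open>S\<close>.\<close>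

lemma conn_collapse_iff:
  assumes T: "T \<subseteq> arcs G'" and u: "u \<in> verts G" and v: "v \<in> verts G"
  shows "(\<pi> u, \<pi> v) \<in> conn G' T \<longleftrightarrow> (u, v) \<in> conn G (pulled_back G S \<theta> T)"
proof
  assume "(u, v) \<in> conn G (pulled_back G S \<theta> T)"
  then show "(\<pi> u, \<pi> v) \<in> conn G' T"
  proof (induction rule: conn_induct)
    case (step x y e)
    show ?case
    proof (cases "e \<in> S")
      case True
      then have "\<pi> x = \<pi> y" using collapse_contracted step(3) by auto
      then show ?thesis using step by simp
    next
      case False
      then have e: "e \<in> arcs G - S" "\<theta> e \<in> T" using step(2) by (auto simp: pulled_back_def)
      have "(\<pi> (tail G e), \<pi> (head G e)) \<in> conn G' T \<and> (\<pi> (head G e), \<pi> (tail G e)) \<in> conn G' T"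
        using conn_edge[OF e(2), of G'] graph_collapseD(4,5)[OF col e(1)] by (cases "\<phi> e") simp_all
      then have "(\<pi> x, \<pi> y) \<in> conn G' T" using step(3) by auto
      then show ?thesis by (rule conn_trans[OF step(4)])
    qed
  qed (rule conn_refl)
next
  assume "(\<pi> u, \<pi> v) \<in> conn G' T"
  \<comment> \<open>Strengthened to all vertices over the end point: the lift of the next edge need
    not begin where the previous one ended.\<close>
  then have "\<forall>x\<in>verts G. \<pi> x = \<pi> v \<longrightarrow> (u, x) \<in> conn G (pulled_back G S \<theta> T)"
  proof (induction rule: conn_induct)
    case refl
    have "conn G S \<subseteq> conn G (pulled_back G S \<theta> T)" by (rule conn_mono) (auto simp: pulled_back_def)
    then show ?case using graph_collapseD(6)[OF col u] by (metis subsetD)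
  next
    case (step y z e')
    have "e' \<in> arcs G'" using step(2) T by blast
    then obtain e where e: "e \<in> arcs G - S" "e' = \<theta> e"
      using graph_collapseD(3)[OF col] by (auto simp: bij_betw_def)
    have "\<exists>p q. p \<in> verts G \<and> q \<in> verts G \<and> \<pi> p = y \<and> \<pi> q = z \<and> (p, q) \<in> conn G (pulled_back G S \<theta> T)"
    proof -
      have "e \<in> pulled_back G S \<theta> T" using e step(2) by (simp add: pulled_back_def)
      note ce = conn_edge[OF this, of G]
      have "y = \<pi> (tail G e) \<and> z = \<pi> (head G e) \<or> y = \<pi> (head G e) \<and> z = \<pi> (tail G e)"
        using step(3) graph_collapseD(4,5)[OF col e(1)] e(2) by (cases "\<phi> e") auto
      moreover have "tail G e \<in> verts G" "head G e \<in> verts G" using e by auto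
      ultimately show ?thesis using ce by blast
    qed
    then obtain p q where pq: "p \<in> verts G" "q \<in> verts G" "\<pi> p = y" "\<pi> q = z" "(p, q) \<in> conn G (pulled_back G S \<theta> T)"
      by blast
    show ?case
    proof (intro ballI impI)
      fix x assume x: "x \<in> verts G" "\<pi> x = z"
      have "(q, x) \<in> conn G S" using graph_collapseD(6)[OF col pq(2) x(1)] pq x by simp
      then have "(q, x) \<in> conn G (pulled_back G S \<theta> T)"
        using conn_mono[of S "pulled_back G S \<theta> T" G] by (auto simp: pulled_back_def)
      moreover have "(u, p) \<in> conn G (pulled_back G S \<theta> T)" using step(4) pq by blast
      ultimately show "(u, x) \<in> conn G (pulled_back G S \<theta> T)" using pq(5) conn_trans by metis
    qed
  qed
  then show "(u, v) \<in> conn G (pulled_back G S \<theta> T)" using v by blast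
qed

lemma collapse_connected:
  assumes "Digraph_Component.connected G" shows "Digraph_Component.connected G'"
  unfolding G'.connected_iff_conn
proof (intro conjI ballI)
  show "verts G' \<noteq> {}"
    using assms graph_collapseD(2)[OF col] unfolding G.connected_iff_conn by auto
  fix u' v' assume "u' \<in> verts G'" "v' \<in> verts G'"
  then obtain u v where uv: "u \<in> verts G" "v \<in> verts G" "u' = \<pi> u" "v' = \<pi> v"
    using graph_collapseD(2)[OF col] by (metis imageE)
  have "pulled_back G S \<theta> (arcs G') = arcs G"
    using graph_collapseD(1)[OF col] collapse_arc by (auto simp: pulled_back_def)
  then show "(u', v') \<in> conn G' (arcs G')"
    using conn_collapse_iff[OF order_refl uv(1,2)] assms uv unfolding G.connected_iff_conn by auto
qed

end

text \<open>The vertex and edge conditions follow from \<open>conn_collapse_iff\<close> and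
  composition of bijections. An edge is reversed in total if exactly one of the two contractions
  reverses it. The weights add up because the formula with \<open>w v - 1\<close> is a sum over
  fibres.\<close>

lemma graph_collapse_compose:
  assumes G: "fin_digraph G" and G1: "fin_digraph G1" and G2: "fin_digraph G2"
    and c1: "graph_collapse G w S \<pi> \<theta> \<phi> G1 w1" and c2: "graph_collapse G1 w1 S1 \<pi>1 \<theta>1 \<phi>1 G2 w2"
  shows "graph_collapse G w (pulled_back G S \<theta> S1) (\<pi>1 \<circ> \<pi>) (\<theta>1 \<circ> \<theta>) (\<lambda>e. \<phi> e \<noteq> \<phi>1 (\<theta> e)) G2 w2"
proof -
  interpret G: fin_digraph G by fact
  interpret G1: fin_digraph G1 by fact
  interpret G2: fin_digraph G2 by fact
  note d1 = graph_collapseD[OF c1] and d2 = graph_collapseD[OF c2]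
  note wf = G.wf_digraph_axioms G1.wf_digraph_axioms G2.wf_digraph_axioms
  have \<pi>V: "\<pi> v \<in> verts G1" if "v \<in> verts G" for v using d1(2) that by blast
  let ?T = "pulled_back G S \<theta> S1" and ?U = "{e \<in> arcs G - S. \<theta> e \<in> S1}"
  have compl: "arcs G - ?T = {e \<in> arcs G - S. \<theta> e \<in> arcs G1 - S1}"
    using collapse_arc[OF wf(1,2) c1] by (auto simp: pulled_back_def)
  have bijU: "bij_betw \<theta> ?U S1"
    using d1(3) d2(1) by (force simp: bij_betw_def inj_on_def)
  have bij: "bij_betw (\<theta>1 \<circ> \<theta>) (arcs G - ?T) (arcs G2)"
  proof (rule bij_betw_trans[OF _ d2(3)])
    show "bij_betw \<theta> (arcs G - ?T) (arcs G1 - S1)"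
      unfolding compl using d1(3) d2(1) by (force simp: bij_betw_def inj_on_def)
  qed
  have ends: "(tail G2 ((\<theta>1 \<circ> \<theta>) e), head G2 ((\<theta>1 \<circ> \<theta>) e)) =
      (if \<phi> e \<noteq> \<phi>1 (\<theta> e) then ((\<pi>1 \<circ> \<pi>) (head G e), (\<pi>1 \<circ> \<pi>) (tail G e))
       else ((\<pi>1 \<circ> \<pi>) (tail G e), (\<pi>1 \<circ> \<pi>) (head G e)))" if "e \<in> arcs G - ?T" for e
  proof -
    have "e \<in> arcs G - S" "\<theta> e \<in> arcs G1 - S1" using that unfolding compl by auto
    then show ?thesis using d1(4,5)[of e] d2(4,5)[of "\<theta> e"] by auto
  qed
  have conn: "(\<pi>1 \<circ> \<pi>) u = (\<pi>1 \<circ> \<pi>) v \<longleftrightarrow> (u, v) \<in> conn G ?T" if "u \<in> verts G" "v \<in> verts G" for u v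
    using d2(6)[of "\<pi> u" "\<pi> v"] conn_collapse_iff[OF wf(1,2) c1 d2(1) that] d1(2) that by auto
  have weight: "int (w2 x) - 1 = (\<Sum>v\<in>{v \<in> verts G. (\<pi>1 \<circ> \<pi>) v = x}. int (w v) - 1) +
      (\<Sum>e\<in>{e \<in> ?T. (\<pi>1 \<circ> \<pi>) (tail G e) = x}. 1)" if x: "x \<in> verts G2" for x
  proof -
    let ?F = "{v' \<in> verts G1. \<pi>1 v' = x}"
    \<comment> \<open>The weights over \<open>x\<close> in \<open>G1\<close> are expanded by the
      formula of the first contraction; \<open>sum.group\<close> then joins the fibres of
      \<open>\<pi>\<close> to the fibre of the composite.\<close>
    have "(\<Sum>v'\<in>?F. int (w1 v') - 1) =
      (\<Sum>v'\<in>?F. \<Sum>v\<in>{v \<in> {v \<in> verts G. \<pi>1 (\<pi> v) = x}. \<pi> v = v'}. int (w v) - 1) +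
      (\<Sum>v'\<in>?F. \<Sum>e\<in>{e \<in> {e \<in> S. \<pi>1 (\<pi> (tail G e)) = x}. \<pi> (tail G e) = v'}. 1)"
    proof -
      have "{v \<in> verts G. \<pi> v = v'} = {v \<in> {v \<in> verts G. \<pi>1 (\<pi> v) = x}. \<pi> v = v'}"
        "{e \<in> S. \<pi> (tail G e) = v'} = {e \<in> {e \<in> S. \<pi>1 (\<pi> (tail G e)) = x}. \<pi> (tail G e) = v'}"
        if "v' \<in> ?F" for v' using that by auto
      then show ?thesis
        unfolding sum.distrib[symmetric] using d1(7) by (intro sum.cong refl) auto
    qed
    also have "(\<Sum>v'\<in>?F. \<Sum>v\<in>{v \<in> {v \<in> verts G. \<pi>1 (\<pi> v) = x}. \<pi> v = v'}. int (w v) - 1) =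
        (\<Sum>v\<in>{v \<in> verts G. \<pi>1 (\<pi> v) = x}. int (w v) - 1)"
      by (rule sum.group) (use d1(2) in auto)
    also have "(\<Sum>v'\<in>?F. \<Sum>e\<in>{e \<in> {e \<in> S. \<pi>1 (\<pi> (tail G e)) = x}. \<pi> (tail G e) = v'}. 1 :: int) =
        (\<Sum>e\<in>{e \<in> S. \<pi>1 (\<pi> (tail G e)) = x}. 1)"
      by (rule sum.group) (use \<pi>V d1(1) finite_subset[OF d1(1)] in auto)
    finally have A: "(\<Sum>v'\<in>?F. int (w1 v') - 1) = (\<Sum>v\<in>{v \<in> verts G. \<pi>1 (\<pi> v) = x}. int (w v) - 1) +
        (\<Sum>e\<in>{e \<in> S. \<pi>1 (\<pi> (tail G e)) = x}. 1)" .
    have B: "(\<Sum>e1\<in>{e1 \<in> S1. \<pi>1 (tail G1 e1) = x}. 1 :: int) = (\<Sum>e\<in>{e \<in> ?U. \<pi>1 (\<pi> (tail G e)) = x}. 1)"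
    proof (rule sym, rule sum.reindex_bij_betw)
      \<comment> \<open>If \<open>e\<close> is reversed, the tail of \<open>\<theta> e\<close> is
        the image of the head of \<open>e\<close>. As \<open>\<theta> e\<close> is contracted next,
        \<open>\<pi>1\<close> identifies its two ends anyway.\<close>
      have t: "\<pi>1 (tail G1 (\<theta> e)) = \<pi>1 (\<pi> (tail G e))" if "e \<in> ?U" for e
        using that d1(4,5)[of e] collapse_contracted[OF wf(2,3) c2, of "\<theta> e"] by (auto split: if_splits)
      have im: "\<theta> ` ?U = S1" using bijU by (simp add: bij_betw_def)
      show "bij_betw \<theta> {e \<in> ?U. \<pi>1 (\<pi> (tail G e)) = x} {e1 \<in> S1. \<pi>1 (tail G1 e1) = x}"
      proof (rule bij_betw_subset[OF bijU])
        show "\<theta> ` {e \<in> ?U. \<pi>1 (\<pi> (tail G e)) = x} = {e1 \<in> S1. \<pi>1 (tail G1 e1) = x}"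
        proof (intro equalityI subsetI)
          fix y assume "y \<in> \<theta> ` {e \<in> ?U. \<pi>1 (\<pi> (tail G e)) = x}"
          then obtain e where e0: "y = \<theta> e" "e \<in> {e \<in> ?U. \<pi>1 (\<pi> (tail G e)) = x}" by (rule imageE)
          have e: "e \<in> ?U" "\<pi>1 (\<pi> (tail G e)) = x" "y = \<theta> e"
            using CollectD[OF e0(2)] e0(1) by blast+
          have "y \<in> S1" using e(1,3) by simp
          moreover have "\<pi>1 (tail G1 y) = x" unfolding e(3) t[OF e(1)] by (rule e(2))
          ultimately show "y \<in> {e1 \<in> S1. \<pi>1 (tail G1 e1) = x}" by (intro CollectI conjI)
        next
          fix y assume y: "y \<in> {e1 \<in> S1. \<pi>1 (tail G1 e1) = x}"
          then have "y \<in> \<theta> ` ?U" using im by simp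
          then obtain e where e: "e \<in> ?U" "y = \<theta> e" by (rule imageE) simp
          have "\<pi>1 (\<pi> (tail G e)) = x" unfolding t[OF e(1), symmetric] e(2)[symmetric] using y by simp
          with e(1) have "e \<in> {e \<in> ?U. \<pi>1 (\<pi> (tail G e)) = x}" by blast
          with e(2) show "y \<in> \<theta> ` {e \<in> ?U. \<pi>1 (\<pi> (tail G e)) = x}" by (rule image_eqI)
        qed
      qed blast
    qed
    have "int (w2 x) - 1 = (\<Sum>v\<in>{v \<in> verts G. \<pi>1 (\<pi> v) = x}. int (w v) - 1) +
        ((\<Sum>e\<in>{e \<in> S. \<pi>1 (\<pi> (tail G e)) = x}. 1) + (\<Sum>e\<in>{e \<in> ?U. \<pi>1 (\<pi> (tail G e)) = x}. 1))"
      unfolding d2(7)[OF x] A B by (simp only: add.assoc)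
    also have "(\<Sum>e\<in>{e \<in> S. \<pi>1 (\<pi> (tail G e)) = x}. 1 :: int) + (\<Sum>e\<in>{e \<in> ?U. \<pi>1 (\<pi> (tail G e)) = x}. 1) =
        (\<Sum>e\<in>{e \<in> S. \<pi>1 (\<pi> (tail G e)) = x} \<union> {e \<in> ?U. \<pi>1 (\<pi> (tail G e)) = x}. 1)"
      by (rule sum.union_disjoint[symmetric]) (use finite_subset[OF d1(1)] in auto)
    also have "{e \<in> S. \<pi>1 (\<pi> (tail G e)) = x} \<union> {e \<in> ?U. \<pi>1 (\<pi> (tail G e)) = x} =
        {e \<in> ?T. (\<pi>1 \<circ> \<pi>) (tail G e) = x}"
      by (auto simp: pulled_back_def)
    finally show ?thesis by simp
  qed
  have "(\<pi>1 \<circ> \<pi>) ` verts G = verts G2" using d1(2) d2(2) by (metis image_comp)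
  moreover have "?T \<subseteq> arcs G" using d1(1) by (auto simp: pulled_back_def)
  ultimately show ?thesis
    unfolding graph_collapse_def using bij ends conn weight by blast
qed

lemma graph_collapse_id: "fin_digraph G \<Longrightarrow> graph_collapse G w {} id id (\<lambda>_. False) G w"
  by (auto simp: graph_collapse_def bij_betw_def cong: conj_cong)

text \<open>\<open>S\<close> fixes everything up to renaming: the fibres on vertices are the
  components of \<open>S\<close>, the remaining edges are those outside \<open>S\<close>, and the
  weights are given by a formula. The last three properties make the isomorphism compatible with
  both contractions, which later transports markings and lengths.\<close>

lemma graph_collapse_unique:
  assumes G: "fin_digraph G"
    and c1: "graph_collapse G w S \<pi>1 \<theta>1 \<phi>1 G1 w1" and c2: "graph_collapse G w S \<pi>2 \<theta>2 \<phi>2 G2 w2"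
  obtains \<nu> \<theta> \<phi> where "graph_collapse G1 w1 {} \<nu> \<theta> \<phi> G2 w2"
    "\<forall>v\<in>verts G. \<nu> (\<pi>1 v) = \<pi>2 v" "\<forall>e\<in>arcs G - S. \<theta> (\<theta>1 e) = \<theta>2 e"
    "\<forall>e\<in>arcs G - S. \<phi> (\<theta>1 e) \<longleftrightarrow> \<phi>1 e \<noteq> \<phi>2 e"
proof -
  interpret G: fin_digraph G by fact
  note d1 = graph_collapseD[OF c1] and d2 = graph_collapseD[OF c2]
  have eq: "\<pi>1 u = \<pi>1 v \<longleftrightarrow> \<pi>2 u = \<pi>2 v" if "u \<in> verts G" "v \<in> verts G" for u v
    using d1(6)[OF that] d2(6)[OF that] by simp
  \<comment> \<open>Any vertex of the fibre will do, since by \<open>eq\<close> both contractions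
    have the same fibres.\<close>
  define \<nu> where "\<nu> v' = \<pi>2 (SOME v. v \<in> verts G \<and> \<pi>1 v = v')" for v'
  have \<nu>: "\<nu> (\<pi>1 v) = \<pi>2 v" if "v \<in> verts G" for v
  proof -
    have "(SOME u. u \<in> verts G \<and> \<pi>1 u = \<pi>1 v) \<in> verts G \<and> \<pi>1 (SOME u. u \<in> verts G \<and> \<pi>1 u = \<pi>1 v) = \<pi>1 v"
      by (rule someI[of _ v]) (use that in auto)
    then show ?thesis unfolding \<nu>_def using eq that by blast
  qed
  define \<theta>' where "\<theta>' = inv_into (arcs G - S) \<theta>1"
  have \<theta>': "\<theta>' (\<theta>1 e) = e" if "e \<in> arcs G - S" for e
    unfolding \<theta>'_def using d1(3) that by (auto simp: bij_betw_def)
  have bij\<theta>': "bij_betw \<theta>' (arcs G1) (arcs G - S)"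
    unfolding \<theta>'_def by (rule bij_betw_inv_into[OF d1(3)])
  have "graph_collapse G1 w1 {} \<nu> (\<theta>2 \<circ> \<theta>') (\<lambda>e. \<phi>1 (\<theta>' e) \<noteq> \<phi>2 (\<theta>' e)) G2 w2"
    unfolding graph_collapse_def
  proof (intro conjI ballI)
    have "\<nu> ` verts G1 = \<pi>2 ` verts G"
      unfolding d1(2)[symmetric] using \<nu> by (auto simp: image_image)
    then show "\<nu> ` verts G1 = verts G2" using d2(2) by simp
    show "bij_betw (\<theta>2 \<circ> \<theta>') (arcs G1 - {}) (arcs G2)"
      using bij_betw_trans[OF bij\<theta>' d2(3)] by simp
  next
    fix e1 assume "e1 \<in> arcs G1 - {}"
    then obtain e where e: "e \<in> arcs G - S" "e1 = \<theta>1 e" using d1(3) by (auto simp: bij_betw_def)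
    have "\<nu> (\<pi>1 (tail G e)) = \<pi>2 (tail G e)" "\<nu> (\<pi>1 (head G e)) = \<pi>2 (head G e)"
      using \<nu> e by auto
    then show "(tail G2 ((\<theta>2 \<circ> \<theta>') e1), head G2 ((\<theta>2 \<circ> \<theta>') e1)) =
      (if \<phi>1 (\<theta>' e1) \<noteq> \<phi>2 (\<theta>' e1) then (\<nu> (head G1 e1), \<nu> (tail G1 e1))
       else (\<nu> (tail G1 e1), \<nu> (head G1 e1)))"
      using d1(4,5)[OF e(1)] d2(4,5)[OF e(1)] \<theta>'[OF e(1)] e(2) by auto
  next
    fix u' v' assume "u' \<in> verts G1" "v' \<in> verts G1"
    then obtain u v where uv: "u \<in> verts G" "v \<in> verts G" "u' = \<pi>1 u" "v' = \<pi>1 v"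
      unfolding d1(2)[symmetric] by auto
    show "\<nu> u' = \<nu> v' \<longleftrightarrow> (u', v') \<in> conn G1 {}"
      using \<nu> eq uv by simp
  next
    fix x assume "x \<in> verts G2"
    then obtain v where v: "v \<in> verts G" "x = \<pi>2 v" unfolding d2(2)[symmetric] by auto
    have "{v' \<in> verts G1. \<nu> v' = x} = {\<pi>1 v}"
      using v \<nu> eq unfolding d1(2)[symmetric] by auto
    moreover have "int (w1 (\<pi>1 v)) - 1 = int (w2 x) - 1"
    proof -
      have "{u \<in> verts G. \<pi>1 u = \<pi>1 v} = {u \<in> verts G. \<pi>2 u = \<pi>2 v}" using eq v by auto
      moreover have "{e \<in> S. \<pi>1 (tail G e) = \<pi>1 v} = {e \<in> S. \<pi>2 (tail G e) = \<pi>2 v}"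
        using eq v d1(1) by auto
      moreover have "\<pi>1 v \<in> verts G1" "\<pi>2 v \<in> verts G2" using v d1(2) d2(2) by auto
      ultimately show ?thesis using d1(7)[of "\<pi>1 v"] d2(7)[of "\<pi>2 v"] v(2) by simp
    qed
    ultimately show "int (w2 x) - 1 = (\<Sum>v\<in>{v \<in> verts G1. \<nu> v = x}. int (w1 v) - 1) +
        (\<Sum>e\<in>{e \<in> {}. \<nu> (tail G1 e) = x}. 1)" by simp
  qed simp
  then show thesis by (rule that) (use \<nu> \<theta>' in auto)
qed

lemma graph_collapse_iso_weight:
  assumes G: "wf_digraph G" and c: "graph_collapse G w {} \<pi> \<theta> \<phi> G' w'" and v: "v \<in> verts G"
  shows "w' (\<pi> v) = w v"
proof -
  note d = graph_collapseD[OF c]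
  have "{u \<in> verts G. \<pi> u = \<pi> v} = {v}" using d(6) v by auto
  moreover have "\<pi> v \<in> verts G'" using d(2) v by auto
  ultimately show ?thesis using d(7)[of "\<pi> v"] by simp
qed

text \<open>Summing the weight formula over all vertices shows that total weight minus number of
  vertices grows by \<open>card S\<close>, while the number of edges drops by the same
  amount.\<close>

lemma graph_collapse_genus:
  assumes G: "fin_digraph G" and G': "fin_digraph G'" and c: "graph_collapse G w S \<pi> \<theta> \<phi> G' w'"
  shows "weighted_genus G' w' = weighted_genus G w"
proof -
  interpret G: fin_digraph G by fact
  interpret G': fin_digraph G' by fact
  note d = graph_collapseD[OF c]
  have fS: "finite S" using finite_subset[OF d(1)] by simp
  have \<pi>V: "\<pi> v \<in> verts G'" if "v \<in> verts G" for v using d(2) that by blast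
  have "(\<Sum>v'\<in>verts G'. int (w' v') - 1) =
      (\<Sum>v'\<in>verts G'. \<Sum>v\<in>{v \<in> verts G. \<pi> v = v'}. int (w v) - 1) +
      (\<Sum>v'\<in>verts G'. \<Sum>e\<in>{e \<in> S. \<pi> (tail G e) = v'}. 1)"
    unfolding sum.distrib[symmetric] by (intro sum.cong refl d(7))
  also have "(\<Sum>v'\<in>verts G'. \<Sum>v\<in>{v \<in> verts G. \<pi> v = v'}. int (w v) - 1) = (\<Sum>v\<in>verts G. int (w v) - 1)"
    by (rule sum.group) (use d(2) in auto)
  also have "(\<Sum>v'\<in>verts G'. \<Sum>e\<in>{e \<in> S. \<pi> (tail G e) = v'}. 1 :: int) = (\<Sum>e\<in>S. 1)"
    by (rule sum.group) (use \<pi>V d(1) fS in auto)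
  finally have 1: "(\<Sum>v'\<in>verts G'. int (w' v')) - int (card (verts G')) =
      (\<Sum>v\<in>verts G. int (w v)) - int (card (verts G)) + int (card S)"
    by (simp add: sum_subtractf)
  have "card (arcs G') = card (arcs G - S)" using bij_betw_same_card[OF d(3)] by simp
  then have "int (card (arcs G')) = int (card (arcs G)) - int (card S)"
    using d(1) fS by (simp add: card_Diff_subset card_mono of_nat_diff)
  then show ?thesis using 1 by (simp add: weighted_genus_def)
qed

section \<open>Cycles\<close>

lemma bidirected_simps [simp]:
  "verts (bidirected G S) = verts G" "arcs (bidirected G S) = S \<times> UNIV"
  "tail (bidirected G S) (e, b) = (if b then tail G e else head G e)"
  "head (bidirected G S) (e, b) = (if b then head G e else tail G e)"
  by (auto simp: bidirected_def)

lemma wf_bidirected: "wf_digraph G \<Longrightarrow> S \<subseteq> arcs G \<Longrightarrow> wf_digraph (bidirected G S)"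
  by unfold_locales (auto simp: wf_digraph.tail_in_verts wf_digraph.head_in_verts subset_iff)

lemma cas_bidirected_mono: "pre_digraph.cas (bidirected G S) u p v = pre_digraph.cas (bidirected G T) u p v"
  by (induction p arbitrary: u) (auto simp: pre_digraph.cas.simps bidirected_def)

lemma awalk_verts_bidirected_mono:
  "pre_digraph.awalk_verts (bidirected G S) u p = pre_digraph.awalk_verts (bidirected G T) u p"
  by (induction p arbitrary: u) (auto simp: pre_digraph.awalk_verts.simps bidirected_def)

lemma contains_cycle_mono:
  assumes "contains_cycle G S" "S \<subseteq> T" shows "contains_cycle G T"
proof -
  obtain p u where p: "distinct (map fst p)" "u \<in> verts G" "set p \<subseteq> S \<times> UNIV" "p \<noteq> []"
    "pre_digraph.cas (bidirected G S) u p u" "distinct (tl (pre_digraph.awalk_verts (bidirected G S) u p))"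
    using assms(1) unfolding contains_cycle_def pre_digraph.cycle_def pre_digraph.awalk_def by auto
  then show ?thesis
    unfolding contains_cycle_def pre_digraph.cycle_def pre_digraph.awalk_def
      cas_bidirected_mono[of G T _ _ _ S] awalk_verts_bidirected_mono[of G T _ _ S]
    using assms(2) by (intro exI[of _ p] conjI exI[of _ u]) auto
qed

lemma contains_cycle_collapse_iso:
  assumes G: "wf_digraph G" and c: "graph_collapse G w {} \<pi> \<theta> \<phi> G' w'" and S: "S \<subseteq> arcs G"
    and cyc: "contains_cycle G S"
  shows "contains_cycle G' (\<theta> ` S)"
proof -
  interpret G: wf_digraph G by fact
  note d = graph_collapseD[OF c]
  let ?B = "bidirected G S" and ?B' = "bidirected G' (\<theta> ` S)"
  \<comment> \<open>The flag gives the direction of travel, so it is switched on the edges that the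
    isomorphism reverses.\<close>
  let ?f = "\<lambda>(e, b). (\<theta> e, b \<noteq> \<phi> e)"
  have inj: "inj_on \<pi> (verts G)" using d(6) by (auto simp: inj_on_def)
  have inj\<theta>: "inj_on \<theta> S" using d(3) S by (auto simp: bij_betw_def intro: inj_on_subset)
  have ends: "tail ?B' (?f a) = \<pi> (tail ?B a)" "head ?B' (?f a) = \<pi> (head ?B a)" if "a \<in> S \<times> UNIV" for a
    using that d(4,5)[of "fst a"] S by (cases a; cases "\<phi> (fst a)"; auto)+
  have cas: "pre_digraph.cas ?B' (\<pi> u) (map ?f p) (\<pi> v)" if "pre_digraph.cas ?B u p v" "set p \<subseteq> S \<times> UNIV" for u v p
    using that
  proof (induction p arbitrary: u)
    case (Cons a p)
    then show ?case using ends[of a] by (simp add: pre_digraph.cas.simps)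
  qed (simp add: pre_digraph.cas.simps)
  have aw: "pre_digraph.awalk_verts ?B' (\<pi> u) (map ?f p) = map \<pi> (pre_digraph.awalk_verts ?B u p)"
    if "set p \<subseteq> S \<times> UNIV" for u p
    using that
  proof (induction p arbitrary: u)
    case (Cons a p)
    then show ?case using ends[of a] by (simp add: pre_digraph.awalk_verts.simps)
  qed (simp add: pre_digraph.awalk_verts.simps)
  obtain p u where p: "distinct (map fst p)" "u \<in> verts G" "set p \<subseteq> S \<times> UNIV" "p \<noteq> []"
    "pre_digraph.cas ?B u p u" "distinct (tl (pre_digraph.awalk_verts ?B u p))"
    using cyc unfolding contains_cycle_def pre_digraph.cycle_def pre_digraph.awalk_def by auto
  interpret B: wf_digraph ?B by (rule wf_bidirected[OF G S])
  have vs: "set (B.awalk_verts u p) \<subseteq> verts G"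
    using B.awalk_verts_in_verts[of u p] p by auto
  show ?thesis
    unfolding contains_cycle_def pre_digraph.cycle_def pre_digraph.awalk_def
  proof (intro exI[of _ "map ?f p"] conjI exI[of _ "\<pi> u"])
    show "\<pi> u \<in> verts ?B'" using p d(2) by auto
    show "set (map ?f p) \<subseteq> arcs ?B'" using p(3) by auto
    show "pre_digraph.cas ?B' (\<pi> u) (map ?f p) (\<pi> u)" by (rule cas) (use p in auto)
    show "distinct (tl (pre_digraph.awalk_verts ?B' (\<pi> u) (map ?f p)))"
    proof -
      have "set (tl (B.awalk_verts u p)) \<subseteq> verts G"
        using vs by (cases "B.awalk_verts u p") auto
      then show ?thesis
        unfolding aw[OF p(3)] map_tl[symmetric] distinct_map using p(6) inj by (auto intro: inj_on_subset)
    qed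
    have "map fst (map ?f p) = map \<theta> (map fst p)" by (induction p) auto
    moreover have "set (map fst p) \<subseteq> S" using p(3) by auto
    ultimately show "distinct (map fst (map ?f p))"
      using p(1) inj\<theta> by (simp only: distinct_map) (auto intro: inj_on_subset)
  qed (use p in auto)
qed

text \<open>A walk from the head to the tail of \<open>e\<close> inside \<open>S\<close> is
  shortened to one without repeated vertices and closed up by \<open>e\<close>. Used to see that an
  edge which has become a loop closes a cycle with the edges contracted before it.\<close>

lemma contains_cycle_insert:
  assumes G: "wf_digraph G" and S: "S \<subseteq> arcs G" and e: "e \<in> arcs G" "e \<notin> S"
    and con: "(head G e, tail G e) \<in> conn G S"
  shows "contains_cycle G (insert e S)"
proof -
  interpret G: wf_digraph G by fact
  let ?B = "bidirected G S"
  interpret B: wf_digraph ?B by (rule wf_bidirected[OF G S])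
  have "\<exists>p. B.awalk (head G e) p (tail G e)"
    using con
  proof (induction rule: conn_induct)
    case refl
    show ?case by (rule exI[of _ "[]"]) (use e in \<open>auto simp: B.awalk_simps\<close>)
  next
    case (step x y a)
    then obtain p where p: "B.awalk (head G e) p x" by blast
    obtain b where b: "(x, y) = (tail ?B (a, b), head ?B (a, b))" "(a, b) \<in> arcs ?B"
      using step by (metis (full_types) bidirected_simps(2,3,4) SigmaI UNIV_I)
    have "B.awalk x [(a, b)] y" using B.arc_implies_awalk[OF b(2)] b(1) by simp
    then show ?case using B.awalk_appendI[OF p] by blast
  qed
  then obtain p where p: "B.apath (head G e) p (tail G e)" using B.apath_awalk_to_apath by blast
  \<comment> \<open>An edge could a priori occur once in each direction. Its second occurrence would
    visit both of its ends again, which a walk without repeated vertices does not allow.\<close>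
  have dist: "distinct (map fst q)" if "B.apath u q v" for u q v
    using that
  proof (induction q arbitrary: u)
    case (Cons a q)
    obtain c b where a: "a = (c, b)" by (cases a)
    have q: "B.apath (head ?B a) q v" "tail ?B a \<notin> set (B.awalk_verts (head ?B a) q)"
      using Cons.prems by (auto simp: B.apath_Cons_iff)
    have "c \<notin> fst ` set q"
    proof
      assume "c \<in> fst ` set q"
      then obtain b' where b': "(c, b') \<in> set q" by auto
      have "B.awalk (head ?B a) q v" using q by (simp add: B.apath_def)
      then have "tail ?B (c, b') \<in> set (B.awalk_verts (head ?B a) q)" "head ?B (c, b') \<in> set (B.awalk_verts (head ?B a) q)"
        using B.awalk_verts_arc1[OF b'] B.awalk_verts_arc2[OF _ b'] by auto
      then show False using q(2) a by (auto split: if_splits)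
    qed
    then show ?case using Cons.IH[OF q(1)] a by simp
  qed simp
  have aw: "B.awalk (head G e) p (tail G e)" "distinct (B.awalk_verts (head G e) p)"
    using p by (auto simp: B.apath_def)
  let ?C = "bidirected G (insert e S)" and ?q = "(e, True) # p"
  have "pre_digraph.cycle ?C ?q"
    unfolding pre_digraph.cycle_def pre_digraph.awalk_def
  proof (intro exI[of _ "tail G e"] conjI)
    show "set ?q \<subseteq> arcs ?C" using aw by (auto simp: B.awalk_def)
    show "pre_digraph.cas ?C (tail G e) ?q (tail G e)"
      using aw by (simp add: pre_digraph.cas.simps B.awalk_def cas_bidirected_mono[of G "insert e S" _ _ _ S])
    show "distinct (tl (pre_digraph.awalk_verts ?C (tail G e) ?q))"
      using aw by (simp add: pre_digraph.awalk_verts.simps awalk_verts_bidirected_mono[of G "insert e S" _ _ S])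
  qed (use e in auto)
  moreover have "distinct (map fst ?q)"
    using dist[OF p] aw e by (auto simp: B.awalk_def)
  ultimately show ?thesis unfolding contains_cycle_def by blast
qed

lemma not_contains_cycle_empty: "\<not> contains_cycle G {}"
  unfolding contains_cycle_def pre_digraph.cycle_def pre_digraph.awalk_def by auto

section \<open>The maps of contractions\<close>

text \<open>A contracted loop goes to its vertex like every other contracted edge: it becomes a
  virtual loop, which \<open>drop_virtual\<close> would delete anyway.\<close>

definition collapse_map ::
    "('v, 'e) pre_digraph \<Rightarrow> 'e set \<Rightarrow> ('v \<Rightarrow> 'v2) \<Rightarrow> ('e \<Rightarrow> 'e2) \<Rightarrow> ('e \<Rightarrow> bool) \<Rightarrow>
     ('v, 'e) gpoint \<Rightarrow> ('v2, 'e2) gpoint" where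
  "collapse_map G S \<pi> \<theta> \<phi> = glue (\<lambda>v. Vertex (\<pi> v))
     (\<lambda>e t. if e \<in> S then Vertex (\<pi> (tail G e)) else Inner (\<theta> e) (if \<phi> e then 1 - t else t))"

lemma collapse_map_simps [simp]:
  "collapse_map G S \<pi> \<theta> \<phi> (Vertex v) = Vertex (\<pi> v)"
  "collapse_map G S \<pi> \<theta> \<phi> (Inner e t) =
     (if e \<in> S then Vertex (\<pi> (tail G e)) else Inner (\<theta> e) (if \<phi> e then 1 - t else t))"
  by (auto simp: collapse_map_def)

lemma collapse_map_edge_path:
  assumes "e \<in> S \<Longrightarrow> \<pi> (tail G e) = \<pi> (head G e)"
    and "e \<notin> S \<Longrightarrow> tail G' (\<theta> e) = (if \<phi> e then \<pi> (head G e) else \<pi> (tail G e))"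
    and "e \<notin> S \<Longrightarrow> head G' (\<theta> e) = (if \<phi> e then \<pi> (tail G e) else \<pi> (head G e))"
  shows "collapse_map G S \<pi> \<theta> \<phi> (edge_path G e t) =
    (if e \<in> S then Vertex (\<pi> (tail G e)) else edge_path G' (\<theta> e) (if \<phi> e then 1 - t else t))"
  using assms by (auto simp: edge_path_def)

lemma continuous_collapse_mapI:
  assumes G: "wf_digraph G" and G': "wf_digraph G'"
    and V: "\<And>v. v \<in> verts G \<Longrightarrow> \<pi> v \<in> verts G'"
    and S: "\<And>e. e \<in> arcs G \<Longrightarrow> e \<in> S \<Longrightarrow> \<pi> (tail G e) = \<pi> (head G e)"
    and E: "\<And>e. e \<in> arcs G - S \<Longrightarrow> \<theta> e \<in> arcs G' \<and> tail G' (\<theta> e) = (if \<phi> e then \<pi> (head G e) else \<pi> (tail G e))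
      \<and> head G' (\<theta> e) = (if \<phi> e then \<pi> (tail G e) else \<pi> (head G e))"
  shows "continuous_map (realization G) (realization G') (collapse_map G S \<pi> \<theta> \<phi>)"
proof -
  interpret G: wf_digraph G by fact
  interpret G': wf_digraph G' by fact
  show ?thesis
  proof (rule G.continuous_map_realizationI)
    fix e assume e: "e \<in> arcs G"
    show "pathin (realization G') (collapse_map G S \<pi> \<theta> \<phi> \<circ> edge_path G e)"
    proof (cases "e \<in> S")
      case True
      then have "collapse_map G S \<pi> \<theta> \<phi> \<circ> edge_path G e = (\<lambda>_. Vertex (\<pi> (tail G e)))"
        using S[OF e True] by (auto simp: edge_path_def)
      then show ?thesis using V[of "tail G e"] e by (simp add: G'.topspace_realization gpoints_def)
    next
      case False
      have "collapse_map G S \<pi> \<theta> \<phi> \<circ> edge_path G e =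
          (if \<phi> e then path_rev (edge_path G' (\<theta> e)) else edge_path G' (\<theta> e))"
        using E[of e] e False collapse_map_edge_path[of e S \<pi> G G' \<theta> \<phi>] by (auto simp: path_rev_def)
      then show ?thesis using E[of e] e False G'.pathin_edge_path pathin_path_rev by auto
    qed
  qed (use V in \<open>auto simp: G'.topspace_realization gpoints_def\<close>)
qed

lemma continuous_collapse_map:
  assumes "wf_digraph G" "wf_digraph G'" "graph_collapse G w S \<pi> \<theta> \<phi> G' w'"
  shows "continuous_map (realization G) (realization G') (collapse_map G S \<pi> \<theta> \<phi>)"
  using assms graph_collapseD(2,4,5)[OF assms(3)] collapse_contracted[OF assms] collapse_arc[OF assms]
  by (intro continuous_collapse_mapI) auto

lemma collapse_map_compose:
  assumes G: "wf_digraph G" "wf_digraph G1" "wf_digraph G2"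
    and c1: "graph_collapse G w S \<pi> \<theta> \<phi> G1 w1" and c2: "graph_collapse G1 w1 S1 \<pi>1 \<theta>1 \<phi>1 G2 w2"
    and x: "x \<in> gpoints G"
  shows "collapse_map G1 S1 \<pi>1 \<theta>1 \<phi>1 (collapse_map G S \<pi> \<theta> \<phi> x) =
    collapse_map G (pulled_back G S \<theta> S1) (\<pi>1 \<circ> \<pi>) (\<theta>1 \<circ> \<theta>) (\<lambda>e. \<phi> e \<noteq> \<phi>1 (\<theta> e)) x"
  using x
proof (cases rule: gpoints_cases)
  case (2 e t)
  show ?thesis
  proof (cases "e \<in> S")
    case True
    then show ?thesis using 2 by (simp add: pulled_back_def)
  next
    case False
    then have e: "e \<in> arcs G - S" using 2 by simp
    have "\<pi>1 (tail G1 (\<theta> e)) = \<pi>1 (\<pi> (tail G e))" if "\<theta> e \<in> S1"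
      using graph_collapseD(4,5)[OF c1 e] collapse_contracted[OF G(2,3) c2 that] by (auto split: if_splits)
    then show ?thesis using 2 False by (auto simp: pulled_back_def)
  qed
qed auto

lemma collapse_map_unique:
  assumes x: "x \<in> gpoints G" and G: "wf_digraph G"
    and "\<forall>v\<in>verts G. \<nu> (\<pi>1 v) = \<pi>2 v" "\<forall>e\<in>arcs G - S. \<theta> (\<theta>1 e) = \<theta>2 e"
    "\<forall>e\<in>arcs G - S. \<phi> (\<theta>1 e) \<longleftrightarrow> \<phi>1 e \<noteq> \<phi>2 e"
  shows "collapse_map G1 {} \<nu> \<theta> \<phi> (collapse_map G S \<pi>1 \<theta>1 \<phi>1 x) = collapse_map G S \<pi>2 \<theta>2 \<phi>2 x"
proof -
  interpret wf_digraph G by fact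
  show ?thesis using x by (cases rule: gpoints_cases) (use assms in auto)
qed

lemma homotopic_with_pointwise:
  assumes "continuous_map X Y f" "\<And>x. x \<in> topspace X \<Longrightarrow> f x = h x"
  shows "homotopic_with (\<lambda>_. True) X Y f h"
  by (rule homotopic_with_equal) (use assms in auto)

lemma homotopy_equivalence_collapse_iso:
  assumes G: "fin_digraph G" and G': "wf_digraph G'" and c: "graph_collapse G w {} \<pi> \<theta> \<phi> G' w'"
  shows "homotopy_equivalence_map (realization G) (realization G') (collapse_map G {} \<pi> \<theta> \<phi>)"
proof -
  interpret G: fin_digraph G by fact
  interpret G': wf_digraph G' by fact
  note wf = G.wf_digraph_axioms G'.wf_digraph_axioms
  obtain \<nu> \<theta>' \<phi>' where c': "graph_collapse G' w' {} \<nu> \<theta>' \<phi>' G w"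
    and n: "\<forall>v\<in>verts G. \<nu> (\<pi> v) = id v" "\<forall>e\<in>arcs G - {}. \<theta>' (\<theta> e) = id e"
    "\<forall>e\<in>arcs G - {}. \<phi>' (\<theta> e) \<longleftrightarrow> \<phi> e \<noteq> (\<lambda>_. False) e"
    using graph_collapse_unique[OF G c graph_collapse_id[OF G]] .
  let ?f = "collapse_map G {} \<pi> \<theta> \<phi>" and ?k = "collapse_map G' {} \<nu> \<theta>' \<phi>'"
  have cf: "continuous_map (realization G) (realization G') ?f" by (rule continuous_collapse_map[OF wf c])
  have ck: "continuous_map (realization G') (realization G) ?k"
    by (rule continuous_collapse_map[OF wf(2,1) c'])
  have kf: "?k (?f x) = x" if "x \<in> gpoints G" for x
  proof -
    have "?k (?f x) = collapse_map G {} id id (\<lambda>_. False) x"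
      by (rule collapse_map_unique) (use that wf(1) n in simp_all)
    then show ?thesis by (cases x) simp_all
  qed
  have fk: "?f (?k y) = y" if "y \<in> gpoints G'" for y
  proof -
    have "\<exists>x\<in>gpoints G. y = ?f x"
      using that
    proof (cases rule: gpoints_cases)
      case (1 v)
      then obtain u where "u \<in> verts G" "v = \<pi> u" using graph_collapseD(2)[OF c] by (metis imageE)
      then show ?thesis using 1 by (intro bexI[of _ "Vertex u"]) (auto simp: gpoints_def)
    next
      case (2 e' t)
      then obtain e where "e \<in> arcs G" "e' = \<theta> e"
        using graph_collapseD(3)[OF c] by (auto simp: bij_betw_def)
      then show ?thesis using 2
        by (intro bexI[of _ "Inner e (if \<phi> e then 1 - t else t)"]) (auto simp: gpoints_def)
    qed
    then show ?thesis using kf by auto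
  qed
  have "homotopic_with (\<lambda>_. True) (realization G) (realization G) (?k \<circ> ?f) id"
    by (rule homotopic_with_pointwise[OF continuous_map_compose[OF cf ck]]) (simp add: G.topspace_realization kf)
  moreover have "homotopic_with (\<lambda>_. True) (realization G') (realization G') (?f \<circ> ?k) id"
    by (rule homotopic_with_pointwise[OF continuous_map_compose[OF ck cf]]) (simp add: G'.topspace_realization fk)
  ultimately show ?thesis unfolding homotopy_equivalence_map_def using cf ck by blast
qed

text \<open>
  The homotopy inverse to the contraction of an edge that is not a loop lets the edges at the vanished vertex
  start with a run through the contracted edge.
\<close>

lemma homotopy_equivalence_collapse_edge:
  assumes H: "wf_digraph H" and K: "wf_digraph K"
    and e: "e \<in> arcs H" "tail H e \<noteq> head H e"
    and \<pi>: "\<And>y. \<pi> y = (if y = head H e then tail H e else y)"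
    and V: "verts K = verts H - {head H e}"
    and \<psi>: "bij_betw \<psi> (arcs H - {e}) (arcs K)"
    and E: "\<And>a. a \<in> arcs H - {e} \<Longrightarrow> tail K (\<psi> a) = \<pi> (tail H a) \<and> head K (\<psi> a) = \<pi> (head H a)"
  shows "homotopy_equivalence_map (realization H) (realization K) (collapse_map H {e} \<pi> \<psi> (\<lambda>_. False))"
proof -
  interpret H: wf_digraph H by fact
  interpret K: wf_digraph K by fact
  let ?X = "realization H" and ?Y = "realization K"
  let ?q = "collapse_map H {e} \<pi> \<psi> (\<lambda>_. False)"
  have \<psi>K: "\<psi> a \<in> arcs K" if "a \<in> arcs H - {e}" for a using \<psi> that by (auto simp: bij_betw_def)
  have \<pi>V: "\<pi> v \<in> verts K" if "v \<in> verts H" for v using that e V by (auto simp: \<pi>)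
  have q: "continuous_map ?X ?Y ?q"
    by (rule continuous_collapse_mapI[OF H K]) (use E \<psi>K \<pi>V e in \<open>auto simp: \<pi>\<close>)
  have q_edge: "?q \<circ> edge_path H a = edge_path K (\<psi> a)" if "a \<in> arcs H - {e}" for a
    using E[OF that] that by (auto simp: edge_path_def)
  have q_e: "?q \<circ> edge_path H e = (\<lambda>_. Vertex (tail H e))" by (auto simp: edge_path_def \<pi>)
  \<comment> \<open>A path from the image of \<open>y\<close> to \<open>y\<close>: along
    \<open>e\<close> for the vanished vertex, constant otherwise. It prolongs the edges in
    \<open>P\<close> and is later the track of \<open>y\<close> in the homotopy from
    \<open>k \<circ> ?q\<close> to the identity.\<close>
  define \<rho> where "\<rho> y = (if y = head H e then edge_path H e else (\<lambda>_. Vertex y))" for y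
  have \<rho>: "pathin ?X (\<rho> y)" "\<rho> y 0 = Vertex (\<pi> y)" "\<rho> y 1 = Vertex y" if "y \<in> verts H" for y
    using that e by (auto simp: \<rho>_def \<pi> H.pathin_edge_path H.topspace_realization gpoints_def)
  have q\<rho>: "?q \<circ> \<rho> y = (\<lambda>_. Vertex (\<pi> y))" for y
    using e q_e by (auto simp: \<rho>_def \<pi>)
  define \<psi>' where "\<psi>' = inv_into (arcs H - {e}) \<psi>"
  have \<psi>': "\<psi>' (\<psi> a) = a" if "a \<in> arcs H - {e}" for a
    unfolding \<psi>'_def using \<psi> that by (auto simp: bij_betw_def)
  define P where "P b = path_cat (\<rho> (tail H (\<psi>' b))) (path_cat (edge_path H (\<psi>' b)) (path_rev (\<rho> (head H (\<psi>' b)))))" for b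
  have ob: "\<exists>a. a \<in> arcs H - {e} \<and> b = \<psi> a" if "b \<in> arcs K" for b
    using \<psi> that by (auto simp: bij_betw_def)
  have P: "P (\<psi> a) = path_cat (\<rho> (tail H a)) (path_cat (edge_path H a) (path_rev (\<rho> (head H a))))"
    "pathin ?X (P (\<psi> a))" "P (\<psi> a) 0 = Vertex (tail K (\<psi> a))" "P (\<psi> a) 1 = Vertex (head K (\<psi> a))"
    if a: "a \<in> arcs H - {e}" for a
  proof -
    show eq: "P (\<psi> a) = path_cat (\<rho> (tail H a)) (path_cat (edge_path H a) (path_rev (\<rho> (head H a))))"
      using \<psi>'[OF a] by (simp add: P_def)
    have v: "tail H a \<in> verts H" "head H a \<in> verts H" using a by auto
    show "pathin ?X (P (\<psi> a))" "P (\<psi> a) 0 = Vertex (tail K (\<psi> a))" "P (\<psi> a) 1 = Vertex (head K (\<psi> a))"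
      unfolding eq using a \<rho>[OF v(1)] \<rho>[OF v(2)] E[OF a]
      by (auto intro!: pathin_path_cat pathin_path_rev H.pathin_edge_path)
  qed
  define k where "k = glue Vertex P"
  have kP: "path_homotopic ?X (k \<circ> edge_path K (\<psi> a)) (P (\<psi> a))" if "a \<in> arcs H - {e}" for a
    unfolding k_def by (rule K.glue_path_homotopic[OF \<psi>K[OF that]]) (use P[OF that] in auto)
  have k: "continuous_map ?Y ?X k"
    unfolding k_def
  proof (rule K.continuous_map_glue)
    show "Vertex v \<in> topspace ?X" if "v \<in> verts K" for v
      using that V by (auto simp: H.topspace_realization gpoints_def)
  next
    fix b assume "b \<in> arcs K"
    then obtain a where a: "a \<in> arcs H - {e}" "b = \<psi> a" using ob by blast
    show "pathin ?X (P b)" "P b 0 = Vertex (tail K b)" "P b 1 = Vertex (head K b)"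
      using P[OF a(1)] a(2) by auto
  qed
  have "homotopic_with (\<lambda>_. True) ?Y ?Y (?q \<circ> k) id"
  proof (rule K.homotopic_with_realization_relI[OF continuous_map_compose[OF k q] continuous_map_id])
    fix v assume "v \<in> verts K"
    then show "(?q \<circ> k) (Vertex v) = id (Vertex v)" using V by (auto simp: k_def \<pi>)
  next
    fix b assume "b \<in> arcs K"
    then obtain a where a: "a \<in> arcs H - {e}" "b = \<psi> a" using ob by blast
    have b: "pathin ?Y (edge_path K b)" by (rule K.pathin_edge_path) fact
    have cv: "Vertex (head K b) \<in> topspace ?Y"
      using \<open>b \<in> arcs K\<close> by (auto simp: K.topspace_realization gpoints_def)
    have "path_homotopic ?Y (?q \<circ> (k \<circ> edge_path K b)) (?q \<circ> P b)"
      using path_homotopic_map[OF q kP[OF a(1)]] a(2) by simp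
    also have "?q \<circ> P b = path_cat (\<lambda>_. Vertex (tail K b)) (path_cat (edge_path K b) (\<lambda>_. Vertex (head K b)))"
      using P(1)[OF a(1)] q_edge[OF a(1)] E[OF a(1)] a(2) by (simp add: comp_path_cat comp_path_rev q\<rho>)
    also have "path_homotopic ?Y \<dots> (path_cat (edge_path K b) (\<lambda>_. Vertex (head K b)))"
      by (rule path_homotopic_lid) (use b cv in \<open>auto intro!: pathin_path_cat\<close>)
    also have "path_homotopic ?Y \<dots> (edge_path K b)"
      by (rule path_homotopic_rid[OF b]) simp
    finally have "path_homotopic ?Y (?q \<circ> (k \<circ> edge_path K b)) (edge_path K b)" .
    then show "path_homotopic ?Y (?q \<circ> k \<circ> edge_path K b) (id \<circ> edge_path K b)"
      unfolding o_assoc id_comp .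
  qed
  moreover have "homotopic_with (\<lambda>_. True) ?X ?X (k \<circ> ?q) id"
  proof (rule H.homotopic_with_realizationI[OF continuous_map_compose[OF q k] continuous_map_id, where \<tau> = \<rho>])
    fix a assume a: "a \<in> arcs H"
    show "path_homotopic ?X (k \<circ> ?q \<circ> edge_path H a)
      (path_cat (\<rho> (tail H a)) (path_cat (id \<circ> edge_path H a) (path_rev (\<rho> (head H a)))))"
    proof (cases "a = e")
      case True
      have pe: "pathin ?X (edge_path H e)" by (rule H.pathin_edge_path[OF e(1)])
      have ct: "Vertex (tail H e) \<in> topspace ?X" using e by (auto simp: H.topspace_realization gpoints_def)
      have "k \<circ> ?q \<circ> edge_path H a = (\<lambda>_. Vertex (tail H e))"
        unfolding True o_assoc[symmetric] q_e by (auto simp: k_def)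
      moreover have "\<rho> (tail H a) = (\<lambda>_. Vertex (tail H e))" "\<rho> (head H a) = edge_path H e"
        using True e by (auto simp: \<rho>_def)
      moreover have "path_homotopic ?X (path_cat (\<lambda>_. Vertex (tail H e)) (path_cat (edge_path H e) (path_rev (edge_path H e))))
          (\<lambda>_. Vertex (tail H e))"
      proof -
        have "path_homotopic ?X (path_cat (\<lambda>_. Vertex (tail H e)) (path_cat (edge_path H e) (path_rev (edge_path H e))))
          (path_cat (edge_path H e) (path_rev (edge_path H e)))"
          by (rule path_homotopic_lid) (use pe in \<open>auto intro!: pathin_path_cat pathin_path_rev\<close>)
        also have "path_homotopic ?X \<dots> (\<lambda>_. edge_path H e 0)" by (rule path_homotopic_rinv[OF pe])
        finally show ?thesis by simp
      qed
      ultimately show ?thesis using True by (simp add: path_homotopic_sym)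
    next
      case False
      then have a': "a \<in> arcs H - {e}" using a by simp
      have "k \<circ> ?q \<circ> edge_path H a = k \<circ> edge_path K (\<psi> a)"
        by (simp only: o_assoc[symmetric] q_edge[OF a'])
      then show ?thesis using kP[OF a'] P(1)[OF a'] by simp
    qed
  next
    fix v assume v: "v \<in> verts H"
    show "pathin ?X (\<rho> v)" "\<rho> v 0 = (k \<circ> ?q) (Vertex v)" "\<rho> v 1 = id (Vertex v)"
      using \<rho>[OF v] by (auto simp: k_def)
  qed
  ultimately show ?thesis unfolding homotopy_equivalence_map_def using q k by blast
qed

section \<open>Contractions of marked graphs\<close>

lemma fin_virt: assumes "fin_digraph G" shows "fin_digraph (virt G w)"
proof -
  interpret fin_digraph G by fact
  have "{(v, i). v \<in> verts G \<and> i < w v} = (SIGMA v:verts G. {..<w v})" by auto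
  then have "finite {(v, i). v \<in> verts G \<and> i < w v}" by simp
  then show ?thesis
    using wf_virt by (intro wf_digraph.fin_digraphI) (auto simp: virt_def)
qed

lemma stable_marked_graphsD:
  assumes "(G, w, h) \<in> stable_marked_graphs g"
  shows "fin_digraph G" "wf_digraph G" "Digraph_Component.connected G" "stable G w" "weighted_genus G w = int g"
    "homotopy_equivalence_map (rose_space g) (virt_space G w) h"
    "continuous_map (rose_space g) (virt_space G w) h"
    "continuous_map (rose_space g) (realization G) (drop_virtual \<circ> h)"
    "\<And>x. x \<in> topspace (rose_space g) \<Longrightarrow> h x \<in> gpoints (virt G w)"
    "\<And>x. x \<in> topspace (rose_space g) \<Longrightarrow> drop_virtual (h x) \<in> gpoints G"
proof -
  show fG: "fin_digraph G" and "Digraph_Component.connected G" "stable G w" "weighted_genus G w = int g"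
    and he: "homotopy_equivalence_map (rose_space g) (virt_space G w) h"
    using assms by (auto simp: stable_marked_graphs_def)
  then interpret fin_digraph G by simp
  show "wf_digraph G" by (rule wf_digraph_axioms)
  show ch: "continuous_map (rose_space g) (virt_space G w) h" using he by (simp add: homotopy_equivalence_map_def)
  then show cd: "continuous_map (rose_space g) (realization G) (drop_virtual \<circ> h)"
    by (rule continuous_map_compose[OF _ continuous_drop_virtual])
  fix x assume "x \<in> topspace (rose_space g)"
  then show "h x \<in> gpoints (virt G w)" "drop_virtual (h x) \<in> gpoints G"
    using ch cd wf_digraph.topspace_realization[OF wf_virt] topspace_realization
    by (auto simp: continuous_map_def Pi_iff)
qed

lemma stable_marked_graphsI:
  assumes "fin_digraph G" "Digraph_Component.connected G" "stable G w" "weighted_genus G w = int g"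
    "homotopy_equivalence_map (rose_space g) (virt_space G w) h"
  shows "(G, w, h) \<in> stable_marked_graphs g"
  using assms by (simp add: stable_marked_graphs_def)

text \<open>The markings are compared only after \<open>drop_virtual\<close>. By
  \<open>homotopic_imp_marking_equiv\<close> this still determines the marking up to equivalence,
  and it makes composition of contractions a matter of composing
  \<open>collapse_map\<close>.\<close>

fun marked_collapse ::
    "nat \<Rightarrow> marked_graph \<Rightarrow> nat set \<Rightarrow> (nat \<Rightarrow> nat) \<Rightarrow> (nat \<Rightarrow> nat) \<Rightarrow> (nat \<Rightarrow> bool) \<Rightarrow> marked_graph \<Rightarrow> bool" where
  "marked_collapse g (G, w, h) S \<pi> \<theta> \<phi> (G', w', h') \<longleftrightarrow> graph_collapse G w S \<pi> \<theta> \<phi> G' w' \<and>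
     homotopic_with (\<lambda>_. True) (rose_space g) (realization G')
       (collapse_map G S \<pi> \<theta> \<phi> \<circ> (drop_virtual \<circ> h)) (drop_virtual \<circ> h')"

lemma marked_collapse_compose:
  assumes m: "m \<in> stable_marked_graphs g" "m1 \<in> stable_marked_graphs g" "m2 \<in> stable_marked_graphs g"
    and c1: "marked_collapse g m S \<pi> \<theta> \<phi> m1" and c2: "marked_collapse g m1 S1 \<pi>1 \<theta>1 \<phi>1 m2"
  shows "marked_collapse g m (pulled_back (fst m) S \<theta> S1) (\<pi>1 \<circ> \<pi>) (\<theta>1 \<circ> \<theta>) (\<lambda>e. \<phi> e \<noteq> \<phi>1 (\<theta> e)) m2"
proof -
  obtain G w h G1 w1 h1 G2 w2 h2 where eq: "m = (G, w, h)" "m1 = (G1, w1, h1)" "m2 = (G2, w2, h2)"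
    by (metis prod_cases3)
  note s = stable_marked_graphsD[OF m(1)[unfolded eq]]
  note s1 = stable_marked_graphsD[OF m(2)[unfolded eq]]
  note s2 = stable_marked_graphsD[OF m(3)[unfolded eq]]
  have gc: "graph_collapse G w S \<pi> \<theta> \<phi> G1 w1" "graph_collapse G1 w1 S1 \<pi>1 \<theta>1 \<phi>1 G2 w2"
    and hc: "homotopic_with (\<lambda>_. True) (rose_space g) (realization G1) (collapse_map G S \<pi> \<theta> \<phi> \<circ> (drop_virtual \<circ> h)) (drop_virtual \<circ> h1)"
    "homotopic_with (\<lambda>_. True) (rose_space g) (realization G2) (collapse_map G1 S1 \<pi>1 \<theta>1 \<phi>1 \<circ> (drop_virtual \<circ> h1)) (drop_virtual \<circ> h2)"
    using c1 c2 eq by auto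
  have "homotopic_with (\<lambda>_. True) (rose_space g) (realization G2)
      (collapse_map G1 S1 \<pi>1 \<theta>1 \<phi>1 \<circ> (collapse_map G S \<pi> \<theta> \<phi> \<circ> (drop_virtual \<circ> h)))
      (collapse_map G1 S1 \<pi>1 \<theta>1 \<phi>1 \<circ> (drop_virtual \<circ> h1))"
    by (rule homotopic_with_compose_continuous_map_left[OF hc(1) continuous_collapse_map[OF s1(2) s2(2) gc(2)]]) auto
  then have "homotopic_with (\<lambda>_. True) (rose_space g) (realization G2)
      (collapse_map G1 S1 \<pi>1 \<theta>1 \<phi>1 \<circ> (collapse_map G S \<pi> \<theta> \<phi> \<circ> (drop_virtual \<circ> h))) (drop_virtual \<circ> h2)"
    using hc(2) by (rule homotopic_with_trans)
  then have "homotopic_with (\<lambda>_. True) (rose_space g) (realization G2)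
      (collapse_map G (pulled_back G S \<theta> S1) (\<pi>1 \<circ> \<pi>) (\<theta>1 \<circ> \<theta>) (\<lambda>e. \<phi> e \<noteq> \<phi>1 (\<theta> e)) \<circ> (drop_virtual \<circ> h)) (drop_virtual \<circ> h2)"
    by (rule homotopic_with_eq) (simp_all add: collapse_map_compose[OF s(2) s1(2) s2(2) gc] s(10))
  then show ?thesis
    using graph_collapse_compose[OF s(1) s1(1) s2(1) gc] eq by simp
qed

lemma marked_collapse_refl:
  assumes "m \<in> stable_marked_graphs g"
  shows "marked_collapse g m {} id id (\<lambda>_. False) m"
proof -
  obtain G w h where eq: "m = (G, w, h)" by (metis prod_cases3)
  note s = stable_marked_graphsD[OF assms[unfolded eq]]
  have id: "collapse_map G {} id id (\<lambda>_. False) x = x" for x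
    by (cases x) auto
  have "homotopic_with (\<lambda>_. True) (rose_space g) (realization G)
      (collapse_map G {} id id (\<lambda>_. False) \<circ> (drop_virtual \<circ> h)) (drop_virtual \<circ> h)"
    by (rule homotopic_with_symD[OF homotopic_with_pointwise[OF s(8)]]) (simp add: id)
  then show ?thesis using graph_collapse_id[OF s(1)] eq by simp
qed

text \<open>The isomorphism from \<open>graph_collapse_unique\<close> commutes with both
  contractions pointwise, so it matches the two markings up to homotopy. Its effect on edges is
  recorded because lengths are transported along it.\<close>

lemma marked_collapse_unique:
  assumes m: "m \<in> stable_marked_graphs g" "m1 \<in> stable_marked_graphs g" "m2 \<in> stable_marked_graphs g"
    and c1: "marked_collapse g m S \<pi>1 \<theta>1 \<phi>1 m1" and c2: "marked_collapse g m S \<pi>2 \<theta>2 \<phi>2 m2"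
  obtains \<nu> \<theta> \<phi> where "marked_collapse g m1 {} \<nu> \<theta> \<phi> m2" "\<forall>e\<in>arcs (fst m) - S. \<theta> (\<theta>1 e) = \<theta>2 e"
proof -
  obtain G w h G1 w1 h1 G2 w2 h2 where eq: "m = (G, w, h)" "m1 = (G1, w1, h1)" "m2 = (G2, w2, h2)"
    by (metis prod_cases3)
  note s = stable_marked_graphsD[OF m(1)[unfolded eq]]
  note s1 = stable_marked_graphsD[OF m(2)[unfolded eq]]
  note s2 = stable_marked_graphsD[OF m(3)[unfolded eq]]
  have gc: "graph_collapse G w S \<pi>1 \<theta>1 \<phi>1 G1 w1" "graph_collapse G w S \<pi>2 \<theta>2 \<phi>2 G2 w2"
    and hc: "homotopic_with (\<lambda>_. True) (rose_space g) (realization G1) (collapse_map G S \<pi>1 \<theta>1 \<phi>1 \<circ> (drop_virtual \<circ> h)) (drop_virtual \<circ> h1)"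
    "homotopic_with (\<lambda>_. True) (rose_space g) (realization G2) (collapse_map G S \<pi>2 \<theta>2 \<phi>2 \<circ> (drop_virtual \<circ> h)) (drop_virtual \<circ> h2)"
    using c1 c2 eq by auto
  obtain \<nu> \<theta> \<phi> where n: "graph_collapse G1 w1 {} \<nu> \<theta> \<phi> G2 w2"
    "\<forall>v\<in>verts G. \<nu> (\<pi>1 v) = \<pi>2 v" "\<forall>e\<in>arcs G - S. \<theta> (\<theta>1 e) = \<theta>2 e"
    "\<forall>e\<in>arcs G - S. \<phi> (\<theta>1 e) \<longleftrightarrow> \<phi>1 e \<noteq> \<phi>2 e"
    using graph_collapse_unique[OF s(1) gc] .
  have A: "homotopic_with (\<lambda>_. True) (rose_space g) (realization G2)
      (collapse_map G1 {} \<nu> \<theta> \<phi> \<circ> (collapse_map G S \<pi>1 \<theta>1 \<phi>1 \<circ> (drop_virtual \<circ> h)))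
      (collapse_map G1 {} \<nu> \<theta> \<phi> \<circ> (drop_virtual \<circ> h1))"
    by (rule homotopic_with_compose_continuous_map_left[OF hc(1) continuous_collapse_map[OF s1(2) s2(2) n(1)]]) auto
  have B: "homotopic_with (\<lambda>_. True) (rose_space g) (realization G2)
      (collapse_map G1 {} \<nu> \<theta> \<phi> \<circ> (collapse_map G S \<pi>1 \<theta>1 \<phi>1 \<circ> (drop_virtual \<circ> h))) (drop_virtual \<circ> h2)"
  proof -
    have pt: "collapse_map G1 {} \<nu> \<theta> \<phi> (collapse_map G S \<pi>1 \<theta>1 \<phi>1 x) = collapse_map G S \<pi>2 \<theta>2 \<phi>2 x"
      if "x \<in> gpoints G" for x
      by (rule collapse_map_unique) (use that s(2) n in simp_all)
    show ?thesis by (rule homotopic_with_eq[OF hc(2)]) (simp_all add: pt s(10))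
  qed
  have "homotopic_with (\<lambda>_. True) (rose_space g) (realization G2)
      (collapse_map G1 {} \<nu> \<theta> \<phi> \<circ> (drop_virtual \<circ> h1)) (drop_virtual \<circ> h2)"
    by (rule homotopic_with_trans[OF homotopic_with_symD[OF A] B])
  then show thesis using that[of \<nu> \<theta> \<phi>] n eq by simp
qed

text \<open>With zero weights, what is known about contractions becomes available for isomorphisms
  of graphs that contain their virtual loops as edges, such as those of the form
  \<open>virt G w\<close>.\<close>

lemma is_complex_iso_graph_collapse:
  assumes "is_complex_iso G H \<gamma>"
  shows "graph_collapse G (\<lambda>_. 0) {} (vmap \<gamma>) (emap \<gamma>) (flipped \<gamma>) H (\<lambda>_. 0)"
proof -
  have b: "bij_betw (vmap \<gamma>) (verts G) (verts H)" using assms by (simp add: is_complex_iso_def)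
  have "{v \<in> verts G. vmap \<gamma> v = vmap \<gamma> u} = {u}" if "u \<in> verts G" for u
    using b that by (auto simp: bij_betw_def inj_on_def)
  moreover have "\<exists>u\<in>verts G. v' = vmap \<gamma> u" if "v' \<in> verts H" for v'
    using b that by (auto simp: bij_betw_def)
  ultimately have "card {v \<in> verts G. vmap \<gamma> v = v'} = 1" if "v' \<in> verts H" for v'
    using that by fastforce
  then show ?thesis
    using assms by (auto simp: graph_collapse_def is_complex_iso_def bij_betw_def inj_on_def)
qed

lemma iso_point_eq_collapse_map: "iso_point \<gamma> = collapse_map G {} (vmap \<gamma>) (emap \<gamma>) (flipped \<gamma>)"
proof
  show "iso_point \<gamma> x = collapse_map G {} (vmap \<gamma>) (emap \<gamma>) (flipped \<gamma>) x" for x by (cases x) auto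
qed

lemma is_marked_iso_collapse:
  assumes m: "m \<in> stable_marked_graphs g" "m' \<in> stable_marked_graphs g" and iso: "is_marked_iso g \<gamma> m m'"
  shows "marked_collapse g m {} (vmap \<gamma>) (real_edge_map \<gamma>) (\<lambda>e. flipped \<gamma> (Inl e)) m'"
proof -
  obtain G w h G' w' h' where eq: "m = (G, w, h)" "m' = (G', w', h')"
    by (metis prod_cases3)
  note s = stable_marked_graphsD[OF m(1)[unfolded eq]]
  note s' = stable_marked_graphsD[OF m(2)[unfolded eq]]
  interpret G: fin_digraph G by (rule s(1))
  interpret G': fin_digraph G' by (rule s'(1))
  let ?V = "virt G w" and ?V' = "virt G' w'"
  have ci: "is_complex_iso ?V ?V' \<gamma>" and l: "\<And>e. e \<in> arcs ?V \<Longrightarrow> isl (emap \<gamma> e) = isl e"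
    and me: "marking_equiv g G' w' (iso_point \<gamma> \<circ> h) h'"
    using iso eq by auto
  have bv: "bij_betw (vmap \<gamma>) (verts G) (verts G')" and be: "bij_betw (emap \<gamma>) (arcs ?V) (arcs ?V')"
    and ends: "\<And>e. e \<in> arcs ?V \<Longrightarrow> (tail ?V' (emap \<gamma> e), head ?V' (emap \<gamma> e)) =
        (if flipped \<gamma> e then (vmap \<gamma> (head ?V e), vmap \<gamma> (tail ?V e))
         else (vmap \<gamma> (tail ?V e), vmap \<gamma> (head ?V e)))"
    using ci by (auto simp: is_complex_iso_def)
  let ?\<theta> = "real_edge_map \<gamma>"
  have emapl: "emap \<gamma> (Inl e) = Inl (?\<theta> e)" if "e \<in> arcs G" for e
    using l[of "Inl e"] that by (simp add: real_edge_map_def)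
  have emapV: "emap \<gamma> e \<in> arcs ?V'" if "e \<in> arcs ?V" for e
    using be that by (auto simp: bij_betw_def)
  have emapr: "\<exists>j. emap \<gamma> (Inr (v, i)) = Inr (vmap \<gamma> v, j) \<and> j < w' (vmap \<gamma> v)" if "v \<in> verts G" "i < w v" for v i
  proof -
    have a: "Inr (v, i) \<in> arcs ?V" using that by simp
    have "\<not> isl (emap \<gamma> (Inr (v, i)))" using l[OF a] by simp
    then obtain b where b: "emap \<gamma> (Inr (v, i)) = Inr b" by (cases "emap \<gamma> (Inr (v, i))") auto
    have "fst b = vmap \<gamma> v" using ends[OF a] b by (auto split: if_splits)
    then show ?thesis using b emapV[OF a] by (cases b) auto
  qed
  have \<theta>: "bij_betw ?\<theta> (arcs G) (arcs G')"
  proof (rule bij_betwI')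
    fix a b assume "a \<in> arcs G" "b \<in> arcs G"
    then show "(?\<theta> a = ?\<theta> b) = (a = b)"
      using be emapl[of a] emapl[of b] by (auto simp: bij_betw_def dest!: inj_onD[of "emap \<gamma>" _ "Inl a" "Inl b"])
  next
    fix a assume "a \<in> arcs G"
    then show "?\<theta> a \<in> arcs G'" using emapV[of "Inl a"] emapl[of a] by simp
  next
    fix b assume b: "b \<in> arcs G'"
    then have "Inl b \<in> emap \<gamma> ` arcs ?V" using be by (simp add: bij_betw_def)
    then obtain a where a: "a \<in> arcs ?V" "emap \<gamma> a = Inl b" by (metis imageE)
    then have "isl a" using l[OF a(1)] by simp
    then obtain e where "a = Inl e" by (cases a) auto
    then show "\<exists>e\<in>arcs G. b = ?\<theta> e" using a emapl[of e] by auto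
  qed
  \<comment> \<open>Weights are recovered by counting: the isomorphism maps the virtual loops at
    \<open>v\<close> bijectively to those at \<open>vmap \<gamma> v\<close>.\<close>
  have weight: "w' (vmap \<gamma> v) = w v" if v: "v \<in> verts G" for v
  proof -
    have "emap \<gamma> ` (\<lambda>i. Inr (v, i)) ` {..<w v} = (\<lambda>i. Inr (vmap \<gamma> v, i)) ` {..<w' (vmap \<gamma> v)}"
    proof (intro equalityI subsetI)
      fix x assume "x \<in> emap \<gamma> ` (\<lambda>i. Inr (v, i)) ` {..<w v}"
      then obtain i where i: "i < w v" "x = emap \<gamma> (Inr (v, i))" by auto
      then show "x \<in> (\<lambda>i. Inr (vmap \<gamma> v, i)) ` {..<w' (vmap \<gamma> v)}"
        using emapr[OF v i(1)] by auto
    next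
      fix x assume "x \<in> (\<lambda>i. Inr (vmap \<gamma> v, i) :: nat + nat \<times> nat) ` {..<w' (vmap \<gamma> v)}"
      then obtain j where j: "j < w' (vmap \<gamma> v)" "x = Inr (vmap \<gamma> v, j)" by auto
      have "vmap \<gamma> v \<in> verts G'" using bv v by (auto simp: bij_betw_def)
      then have "x \<in> emap \<gamma> ` arcs ?V" using be j by (simp add: bij_betw_def)
      then obtain a where a: "a \<in> arcs ?V" "emap \<gamma> a = x" by (metis imageE)
      then have "\<not> isl a" using l[OF a(1)] j by simp
      then obtain u i where ui: "a = Inr (u, i)" "u \<in> verts G" "i < w u" using a by (cases a) auto
      then have "vmap \<gamma> u = vmap \<gamma> v" using emapr[OF ui(2,3)] a j by auto
      then have "u = v" using bv v ui by (auto simp: bij_betw_def dest: inj_onD)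
      then show "x \<in> emap \<gamma> ` (\<lambda>i. Inr (v, i)) ` {..<w v}" using a ui by auto
    qed
    moreover have "inj_on (emap \<gamma>) ((\<lambda>i. Inr (v, i)) ` {..<w v})"
      using be v by (auto simp: bij_betw_def intro: inj_on_subset)
    ultimately have "card ((\<lambda>i. Inr (v, i) :: nat + nat \<times> nat) ` {..<w v}) = card ((\<lambda>i. Inr (vmap \<gamma> v, i) :: nat + nat \<times> nat) ` {..<w' (vmap \<gamma> v)})"
      by (metis card_image)
    then show ?thesis by (simp add: card_image inj_on_def)
  qed
  have gc: "graph_collapse G w {} (vmap \<gamma>) ?\<theta> (\<lambda>e. flipped \<gamma> (Inl e)) G' w'"
    unfolding graph_collapse_def
  proof (intro conjI ballI)
    fix e assume "e \<in> arcs G - {}"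
    then show "(tail G' (?\<theta> e), head G' (?\<theta> e)) =
      (if flipped \<gamma> (Inl e) then (vmap \<gamma> (head G e), vmap \<gamma> (tail G e)) else (vmap \<gamma> (tail G e), vmap \<gamma> (head G e)))"
      using ends[of "Inl e"] emapl[of e] by simp
  next
    fix v' assume "v' \<in> verts G'"
    then obtain v where v: "v \<in> verts G" "v' = vmap \<gamma> v" using bv by (auto simp: bij_betw_def)
    then have "{u \<in> verts G. vmap \<gamma> u = v'} = {v}" using bv by (auto simp: bij_betw_def inj_on_def)
    then show "int (w' v') - 1 = (\<Sum>v\<in>{v \<in> verts G. vmap \<gamma> v = v'}. int (w v) - 1) +
        (\<Sum>e\<in>{e \<in> {}. vmap \<gamma> (tail G e) = v'}. 1)"
      using weight[OF v(1)] v(2) by simp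
  qed (use bv \<theta> in \<open>auto simp: bij_betw_def inj_on_def\<close>)
  let ?c = "collapse_map G {} (vmap \<gamma>) ?\<theta> (\<lambda>e. flipped \<gamma> (Inl e))"
  have pt: "?c (drop_virtual x) = drop_virtual (iso_point \<gamma> x)" if "x \<in> gpoints ?V" for x
    using that
  proof (cases rule: gpoints_cases)
    case (2 e t)
    show ?thesis
    proof (cases e)
      case (Inl a)
      then show ?thesis using 2 emapl[of a] by simp
    next
      case (Inr b)
      then show ?thesis using 2 emapr[of "fst b" "snd b"] by (cases b) auto
    qed
  qed auto
  have "homotopic_with (\<lambda>_. True) (rose_space g) (realization G') (drop_virtual \<circ> (iso_point \<gamma> \<circ> h)) (drop_virtual \<circ> h')"
    by (rule marking_equiv_imp_homotopic[OF s'(2) me])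
  then have "homotopic_with (\<lambda>_. True) (rose_space g) (realization G') (?c \<circ> (drop_virtual \<circ> h)) (drop_virtual \<circ> h')"
    by (rule homotopic_with_eq) (simp_all add: pt s(9))
  then show ?thesis using gc eq by simp
qed

text \<open>Converse of \<open>is_marked_iso_collapse\<close>. The isomorphism of graphs is extended
  over the virtual loops; the homotopy of the markings without virtual loops then suffices by
  \<open>homotopic_imp_marking_equiv\<close>.\<close>

lemma collapse_imp_marked_iso:
  assumes m: "m \<in> stable_marked_graphs g" "m' \<in> stable_marked_graphs g"
    and c: "marked_collapse g m {} \<pi> \<theta> \<phi> m'"
  obtains \<gamma> where "is_marked_iso g \<gamma> m m'" "\<And>e. real_edge_map \<gamma> e = \<theta> e"
proof -
  obtain G w h G' w' h' where eq: "m = (G, w, h)" "m' = (G', w', h')"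
    by (metis prod_cases3)
  note s = stable_marked_graphsD[OF m(1)[unfolded eq]]
  note s' = stable_marked_graphsD[OF m(2)[unfolded eq]]
  interpret G: fin_digraph G by (rule s(1))
  interpret G': fin_digraph G' by (rule s'(1))
  let ?V = "virt G w" and ?V' = "virt G' w'"
  have gc: "graph_collapse G w {} \<pi> \<theta> \<phi> G' w'"
    and hc: "homotopic_with (\<lambda>_. True) (rose_space g) (realization G') (collapse_map G {} \<pi> \<theta> \<phi> \<circ> (drop_virtual \<circ> h)) (drop_virtual \<circ> h')"
    using c eq by auto
  note d = graph_collapseD[OF gc]
  have weight: "w' (\<pi> v) = w v" if "v \<in> verts G" for v
    by (rule graph_collapse_iso_weight[OF s(2) gc that])
  have inj: "\<pi> u = \<pi> v \<longleftrightarrow> u = v" if "u \<in> verts G" "v \<in> verts G" for u v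
    using d(6)[OF that] by simp
  \<comment> \<open>Virtual loops keep their numbers, which is possible since corresponding vertices
    have equal weight.\<close>
  define \<gamma> :: marked_iso where "\<gamma> = \<lparr>vmap = \<pi>, emap = case_sum (\<lambda>e. Inl (\<theta> e)) (\<lambda>(v, i). Inr (\<pi> v, i)), flipped = case_sum \<phi> (\<lambda>_. False)\<rparr>"
  have be: "bij_betw (emap \<gamma>) (arcs ?V) (arcs ?V')"
  proof (rule bij_betwI')
    fix a b assume ab: "a \<in> arcs ?V" "b \<in> arcs ?V"
    show "(emap \<gamma> a = emap \<gamma> b) = (a = b)"
      using ab d(3) inj by (cases a; cases b) (auto simp: \<gamma>_def bij_betw_def dest: inj_onD)
  next
    fix a assume "a \<in> arcs ?V"
    then show "emap \<gamma> a \<in> arcs ?V'"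
      using d(2,3) weight by (cases a) (auto simp: \<gamma>_def bij_betw_def)
  next
    fix b assume b: "b \<in> arcs ?V'"
    show "\<exists>a\<in>arcs ?V. b = emap \<gamma> a"
    proof (cases b)
      case (Inl e')
      then have "e' \<in> \<theta> ` arcs G" using b d(3) by (simp add: bij_betw_def)
      then obtain e where "e \<in> arcs G" "e' = \<theta> e" by (metis imageE)
      then show ?thesis using Inl by (intro bexI[of _ "Inl e"]) (auto simp: \<gamma>_def)
    next
      case (Inr c)
      obtain v' i where c: "c = (v', i)" by (cases c)
      then have v': "v' \<in> verts G'" "i < w' v'" using b Inr by auto
      then obtain v where "v \<in> verts G" "v' = \<pi> v" using d(2) by (metis imageE)
      then show ?thesis using Inr c v' weight by (intro bexI[of _ "Inr (v, i)"]) (auto simp: \<gamma>_def)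
    qed
  qed
  have bv: "bij_betw \<pi> (verts G) (verts G')"
    using d(2) inj by (auto simp: bij_betw_def inj_on_def)
  have ci: "is_complex_iso ?V ?V' \<gamma>"
    unfolding is_complex_iso_def
  proof (intro conjI ballI)
    fix e assume "e \<in> arcs ?V"
    then show "(tail ?V' (emap \<gamma> e), head ?V' (emap \<gamma> e)) =
        (if flipped \<gamma> e then (vmap \<gamma> (head ?V e), vmap \<gamma> (tail ?V e))
         else (vmap \<gamma> (tail ?V e), vmap \<gamma> (head ?V e)))"
      using d(4,5) by (cases e) (auto simp: \<gamma>_def)
  qed (use be bv in \<open>auto simp: \<gamma>_def\<close>)
  have pt: "drop_virtual (iso_point \<gamma> x) = collapse_map G {} \<pi> \<theta> \<phi> (drop_virtual x)" for x
  proof (cases x)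
    case (Inner e t)
    then show ?thesis by (cases e) (auto simp: \<gamma>_def)
  qed (auto simp: \<gamma>_def)
  have "homotopy_equivalence_map (virt_space G w) (virt_space G' w') (iso_point \<gamma>)"
    unfolding iso_point_eq_collapse_map[of \<gamma> ?V]
    by (rule homotopy_equivalence_collapse_iso[OF fin_virt[OF s(1)] G'.wf_virt is_complex_iso_graph_collapse[OF ci]])
  from homotopy_equivalence_map_compose[OF s(6) this]
  have he: "homotopy_equivalence_map (rose_space g) (virt_space G' w') (iso_point \<gamma> \<circ> h)" .
  have "homotopic_with (\<lambda>_. True) (rose_space g) (realization G') (drop_virtual \<circ> (iso_point \<gamma> \<circ> h)) (drop_virtual \<circ> h')"
    using hc by (rule homotopic_with_eq) (simp_all add: pt)
  then have me: "marking_equiv g G' w' (iso_point \<gamma> \<circ> h) h'"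
    by (rule homotopic_imp_marking_equiv[OF s'(2,3) he s'(6)])
  have "is_marked_iso g \<gamma> m m'"
    using ci me eq by (auto simp: \<gamma>_def virt_def)
  moreover have "real_edge_map \<gamma> e = \<theta> e" for e by (simp add: real_edge_map_def \<gamma>_def)
  ultimately show thesis using that by blast
qed

section \<open>Contracting edges one by one\<close>

lemma conn_single:
  "(a, b) \<in> conn G {e} \<longleftrightarrow> a = b \<or> a = tail G e \<and> b = head G e \<or> a = head G e \<and> b = tail G e"
proof
  assume "(a, b) \<in> conn G {e}"
  then show "a = b \<or> a = tail G e \<and> b = head G e \<or> a = head G e \<and> b = tail G e"
    by (induction rule: conn_induct) auto
next
  assume "a = b \<or> a = tail G e \<and> b = head G e \<or> a = head G e \<and> b = tail G e"
  then show "(a, b) \<in> conn G {e}" using conn_refl conn_edge[of e "{e}" G] by auto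
qed

text \<open>With virtual loops attached nothing is crushed: the contraction is an isomorphism that
  turns the edge \<open>e\<close> into a virtual one. Only after \<open>drop_virtual\<close> does it
  become a map that sends the loop to its vertex.\<close>

lemma contract_loop:
  assumes m: "(G, w, h) \<in> stable_marked_graphs g" and e: "e \<in> arcs G" "tail G e = head G e"
  shows "contract_edge e (G, w, h) \<in> stable_marked_graphs g"
    and "marked_collapse g (G, w, h) {e} id id (\<lambda>_. False) (contract_edge e (G, w, h))"
proof -
  note s = stable_marked_graphsD[OF m]
  interpret G: fin_digraph G by (rule s(1))
  let ?u = "tail G e"
  define G' where "G' = G\<lparr>arcs := arcs G - {e}\<rparr>"
  define w' where "w' = w(?u := w ?u + 1)"
  have eq: "contract_edge e (G, w, h) = (G', w', contract_point G w e \<circ> h)"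
    using e by (simp add: G'_def w'_def Let_def)
  have G' [simp]: "verts G' = verts G" "arcs G' = arcs G - {e}" "tail G' = tail G" "head G' = head G"
    by (auto simp: G'_def)
  have fG': "fin_digraph G'" by unfold_locales auto
  interpret G': fin_digraph G' by (rule fG')
  have gc: "graph_collapse G w {e} id id (\<lambda>_. False) G' w'"
    unfolding graph_collapse_def
  proof (intro conjI ballI)
    fix v' assume v': "v' \<in> verts G'"
    have "{v \<in> verts G. id v = v'} = {v'}" using v' by auto
    moreover have "{x \<in> {e}. id (tail G x) = v'} = (if v' = ?u then {e} else {})" by auto
    ultimately show "int (w' v') - 1 = (\<Sum>v\<in>{v \<in> verts G. id v = v'}. int (w v) - 1) +
        (\<Sum>x\<in>{x \<in> {e}. id (tail G x) = v'}. 1)"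
      by (simp add: w'_def)
  qed (use e in \<open>auto simp: conn_single bij_betw_def\<close>)
  let ?V = "virt G w" and ?V' = "virt G' w'"
  \<comment> \<open>The virtual loops at \<open>?u\<close> have the numbers below
    \<open>w ?u\<close>, so \<open>w ?u\<close> is the first free one.\<close>
  define \<psi> where "\<psi> a = (if a = Inl e then Inr (?u, w ?u) else a)" for a :: "nat + nat \<times> nat"
  have tV: "tail ?V = case_sum (tail G) fst" "head ?V = case_sum (head G) fst"
    "tail ?V' = case_sum (tail G) fst" "head ?V' = case_sum (head G) fst"
    by (auto simp: virt_def)
  have "bij_betw \<psi> (arcs ?V) (arcs ?V')"
  proof (rule bij_betwI')
    fix a b assume "a \<in> arcs ?V" "b \<in> arcs ?V"
    then show "(\<psi> a = \<psi> b) = (a = b)" by (auto simp: \<psi>_def)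
  next
    fix a assume "a \<in> arcs ?V"
    then show "\<psi> a \<in> arcs ?V'" using e by (cases a) (auto simp: \<psi>_def w'_def)
  next
    fix b assume b: "b \<in> arcs ?V'"
    show "\<exists>a\<in>arcs ?V. b = \<psi> a"
    proof (cases "b = Inr (?u, w ?u)")
      case True
      then show ?thesis using e by (intro bexI[of _ "Inl e"]) (auto simp: \<psi>_def)
    next
      case False
      then have "b \<in> arcs ?V \<and> b \<noteq> Inl e"
        using b by (cases b) (auto simp: w'_def split: if_splits)
      then show ?thesis by (intro bexI[of _ b]) (auto simp: \<psi>_def)
    qed
  qed
  then have ci: "is_complex_iso ?V ?V' \<lparr>vmap = id, emap = \<psi>, flipped = \<lambda>_. False\<rparr>"
    using e by (auto simp: is_complex_iso_def \<psi>_def tV)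
  have cp: "contract_point G w e = iso_point \<lparr>vmap = id, emap = \<psi>, flipped = \<lambda>_. False\<rparr>"
  proof
    fix x show "contract_point G w e x = iso_point \<lparr>vmap = id, emap = \<psi>, flipped = \<lambda>_. False\<rparr> x"
    proof (cases x)
      case (Inner a t)
      then show ?thesis using e by (cases a) (auto simp: contract_point_def \<psi>_def Let_def)
    qed (use e in \<open>auto simp: contract_point_def Let_def\<close>)
  qed
  have "homotopy_equivalence_map (virt_space G w) (virt_space G' w') (contract_point G w e)"
    unfolding cp iso_point_eq_collapse_map[of _ ?V]
    by (rule homotopy_equivalence_collapse_iso[OF fin_virt[OF s(1)] G'.wf_virt is_complex_iso_graph_collapse[OF ci]])
  from homotopy_equivalence_map_compose[OF s(6) this]
  have he: "homotopy_equivalence_map (rose_space g) (virt_space G' w') (contract_point G w e \<circ> h)" .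
  \<comment> \<open>The vertex of the loop now has positive weight, and no other vertex loses an
    edge.\<close>
  have st: "stable G' w'"
    unfolding stable_def
  proof (intro ballI impI)
    fix v assume v: "v \<in> verts G'" "w' v = 0"
    then have "v \<noteq> ?u" "w v = 0" by (auto simp: w'_def split: if_splits)
    moreover from this have "in_arcs G' v = in_arcs G v" "out_arcs G' v = out_arcs G v"
      using e by (auto simp: in_arcs_def out_arcs_def)
    ultimately show "3 \<le> in_degree G' v + out_degree G' v"
      using s(4) v by (auto simp: stable_def in_degree_def out_degree_def)
  qed
  show st': "contract_edge e (G, w, h) \<in> stable_marked_graphs g"
    unfolding eq using collapse_connected[OF s(2) G'.wf_digraph_axioms gc s(3)]
      graph_collapse_genus[OF s(1) fG' gc] s(5) fG' st he by (intro stable_marked_graphsI) auto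
  have pt: "drop_virtual (contract_point G w e x) = collapse_map G {e} id id (\<lambda>_. False) (drop_virtual x)" for x
  proof (cases x)
    case (Inner a t)
    then show ?thesis using e by (cases a) (auto simp: contract_point_def Let_def)
  qed (use e in \<open>auto simp: contract_point_def Let_def\<close>)
  have "continuous_map (rose_space g) (realization G') (drop_virtual \<circ> (contract_point G w e \<circ> h))"
    using stable_marked_graphsD(8)[OF st'[unfolded eq]] .
  then have "homotopic_with (\<lambda>_. True) (rose_space g) (realization G')
      (drop_virtual \<circ> (contract_point G w e \<circ> h)) (collapse_map G {e} id id (\<lambda>_. False) \<circ> (drop_virtual \<circ> h))"
    by (rule homotopic_with_pointwise) (simp add: pt)
  then show "marked_collapse g (G, w, h) {e} id id (\<lambda>_. False) (contract_edge e (G, w, h))"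
    unfolding eq marked_collapse.simps using gc homotopic_with_symD by blast
qed

text \<open>With virtual loops attached this is the contraction of the single edge
  \<open>Inl e\<close>, so the marking remains a homotopy equivalence by
  \<open>homotopy_equivalence_collapse_edge\<close>.\<close>

lemma contract_nonloop:
  assumes m: "(G, w, h) \<in> stable_marked_graphs g" and e: "e \<in> arcs G" "tail G e \<noteq> head G e"
    and \<pi>: "\<And>y. \<pi> y = (if y = head G e then tail G e else y)"
  shows "contract_edge e (G, w, h) \<in> stable_marked_graphs g"
    and "marked_collapse g (G, w, h) {e} \<pi> id (\<lambda>_. False) (contract_edge e (G, w, h))"
proof -
  note s = stable_marked_graphsD[OF m]
  interpret G: fin_digraph G by (rule s(1))
  let ?u = "tail G e" and ?v = "head G e"
  define G' where "G' = \<lparr>verts = verts G - {?v}, arcs = arcs G - {e},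
          tail = (\<lambda>a. if tail G a = ?v then ?u else tail G a),
          head = (\<lambda>a. if head G a = ?v then ?u else head G a)\<rparr>"
  define w' where "w' = w(?u := w ?u + w ?v)"
  have eq: "contract_edge e (G, w, h) = (G', w', contract_point G w e \<circ> h)"
    using e by (simp add: G'_def w'_def Let_def)
  have G' [simp]: "verts G' = verts G - {?v}" "arcs G' = arcs G - {e}" "tail G' a = \<pi> (tail G a)" "head G' a = \<pi> (head G a)" for a
    by (auto simp: G'_def \<pi>)
  have \<pi>V: "\<pi> y \<in> verts G - {?v}" if "y \<in> verts G" for y using that e by (auto simp: \<pi>)
  have fG': "fin_digraph G'"
  proof unfold_locales
    fix a assume "a \<in> arcs G'"
    then have "tail G a \<in> verts G" "head G a \<in> verts G" by auto
    then show "tail G' a \<in> verts G'" "head G' a \<in> verts G'" using \<pi>V by auto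
  qed auto
  interpret G': fin_digraph G' by (rule fG')
  have fibre: "{v \<in> verts G. \<pi> v = v'} = (if v' = ?u then {?u, ?v} else {v'})" if "v' \<in> verts G - {?v}" for v'
    using that e by (auto simp: \<pi>)
  have gc: "graph_collapse G w {e} \<pi> id (\<lambda>_. False) G' w'"
    unfolding graph_collapse_def
  proof (intro conjI ballI)
    fix v' assume v': "v' \<in> verts G'"
    have "{x \<in> {e}. \<pi> (tail G x) = v'} = (if v' = ?u then {e} else {})" using e by (auto simp: \<pi>)
    then show "int (w' v') - 1 = (\<Sum>v\<in>{v \<in> verts G. \<pi> v = v'}. int (w v) - 1) +
        (\<Sum>x\<in>{x \<in> {e}. \<pi> (tail G x) = v'}. 1)"
      using fibre[of v'] v' e by (simp add: w'_def)
  next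
    show "\<pi> ` verts G = verts G'"
    proof
      show "verts G' \<subseteq> \<pi> ` verts G"
      proof
        fix y assume "y \<in> verts G'"
        then have "y = \<pi> y" "y \<in> verts G" by (auto simp: \<pi>)
        then show "y \<in> \<pi> ` verts G" by (rule image_eqI)
      qed
    qed (use \<pi>V in auto)
  next
    fix a b assume "a \<in> verts G" "b \<in> verts G"
    show "\<pi> a = \<pi> b \<longleftrightarrow> (a, b) \<in> conn G {e}" using e by (auto simp: conn_single \<pi>)
  qed (use e in \<open>auto simp: bij_betw_def\<close>)
  let ?V = "virt G w" and ?V' = "virt G' w'"
  define \<psi> :: "nat + nat \<times> nat \<Rightarrow> nat + nat \<times> nat" where "\<psi> = case_sum Inl (\<lambda>(y, i). if y = ?v then Inr (?u, w ?u + i) else Inr (y, i))"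
  have \<psi> [simp]: "\<psi> (Inl a) = Inl a" "\<psi> (Inr (y, i)) = (if y = ?v then Inr (?u, w ?u + i) else Inr (y, i))" for a y i
    by (auto simp: \<psi>_def)
  have w'le: "i < w y \<Longrightarrow> i < w' y" for i y by (auto simp: w'_def)
  have bij: "bij_betw \<psi> (arcs ?V - {Inl e}) (arcs ?V')"
  proof (rule bij_betwI')
    fix a b assume ab: "a \<in> arcs ?V - {Inl e}" "b \<in> arcs ?V - {Inl e}"
    show "(\<psi> a = \<psi> b) = (a = b)"
    proof (cases a; cases b)
      fix c d assume cd: "a = Inr c" "b = Inr d"
      obtain y i z j where "c = (y, i)" "d = (z, j)" by (cases c; cases d)
      then show ?thesis using ab cd e by auto
    qed (auto simp: \<psi>_def split: if_splits prod.splits)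
  next
    fix a assume a: "a \<in> arcs ?V - {Inl e}"
    show "\<psi> a \<in> arcs ?V'"
    proof (cases a)
      case (Inr c)
      obtain y i where "c = (y, i)" by (cases c)
      then show ?thesis using a Inr e w'le by (auto simp: w'_def)
    qed (use a in auto)
  next
    fix b assume b: "b \<in> arcs ?V'"
    show "\<exists>a\<in>arcs ?V - {Inl e}. b = \<psi> a"
    proof (cases b)
      case (Inl a)
      then show ?thesis using b by (intro bexI[of _ "Inl a"]) auto
    next
      case (Inr c)
      obtain y i where c: "c = (y, i)" by (cases c)
      have y: "y \<in> verts G" "y \<noteq> ?v" "i < w' y" using b Inr c by auto
      show ?thesis
      proof (cases "i < w y")
        case True
        then show ?thesis using y Inr c by (intro bexI[of _ "Inr (y, i)"]) auto
      next
        case False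
        then have "y = ?u" "i - w ?u < w ?v" "w ?u + (i - w ?u) = i"
          using y by (auto simp: w'_def split: if_splits)
        then show ?thesis using y Inr c e by (intro bexI[of _ "Inr (?v, i - w ?u)"]) auto
      qed
    qed
  qed
  have ends: "tail ?V' (\<psi> a) = \<pi> (tail ?V a) \<and> head ?V' (\<psi> a) = \<pi> (head ?V a)" for a
  proof (cases a)
    case (Inr c)
    then show ?thesis by (cases c) (auto simp: \<pi>)
  qed auto
  have he0: "homotopy_equivalence_map (virt_space G w) (virt_space G' w') (collapse_map ?V {Inl e} \<pi> \<psi> (\<lambda>_. False))"
    by (rule homotopy_equivalence_collapse_edge[OF G.wf_virt G'.wf_virt]) (use e bij ends in \<open>auto simp: \<pi>\<close>)
  have cp: "contract_point G w e = collapse_map ?V {Inl e} \<pi> \<psi> (\<lambda>_. False)"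
  proof
    fix x show "contract_point G w e x = collapse_map ?V {Inl e} \<pi> \<psi> (\<lambda>_. False) x"
    proof (cases x)
      case (Inner a t)
      show ?thesis
      proof (cases a)
        case (Inr c)
        then show ?thesis using e Inner by (cases c) (auto simp: contract_point_def Let_def)
      qed (use e Inner in \<open>auto simp: contract_point_def Let_def \<pi>\<close>)
    qed (use e in \<open>auto simp: contract_point_def Let_def \<pi>\<close>)
  qed
  from homotopy_equivalence_map_compose[OF s(6) he0]
  have he: "homotopy_equivalence_map (rose_space g) (virt_space G' w') (contract_point G w e \<circ> h)" unfolding cp .
  have st: "stable G' w'"
    unfolding stable_def
  proof (intro ballI impI)
    fix y assume y: "y \<in> verts G'" "w' y = 0"
    show "3 \<le> in_degree G' y + out_degree G' y"
    proof (cases "y = ?u")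
      case False
      then have "w y = 0" using y by (auto simp: w'_def)
      moreover have "in_arcs G' y = in_arcs G y" "out_arcs G' y = out_arcs G y"
        using e y False by (auto simp: in_arcs_def out_arcs_def \<pi> split: if_splits)
      ultimately show ?thesis
        using s(4) y by (auto simp: stable_def in_degree_def out_degree_def)
    next
      case True
      \<comment> \<open>Weight 0 after merging means weight 0 at both ends, hence valence at least 3
        at each. The edge \<open>e\<close> is lost once as incoming and once as outgoing, so at
        least 4 remain.\<close>
      have w0: "w ?u = 0" "w ?v = 0" using y True by (auto simp: w'_def)
      have "in_arcs G' y = (in_arcs G ?u \<union> in_arcs G ?v) - {e}" "out_arcs G' y = (out_arcs G ?u \<union> out_arcs G ?v) - {e}"
        using True e by (auto simp: in_arcs_def out_arcs_def \<pi> split: if_splits)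
      moreover have "card (in_arcs G ?u \<union> in_arcs G ?v) = in_degree G ?u + in_degree G ?v"
        unfolding in_degree_def by (rule card_Un_disjoint) (use e in \<open>auto simp: in_arcs_def\<close>)
      moreover have "card (out_arcs G ?u \<union> out_arcs G ?v) = out_degree G ?u + out_degree G ?v"
        unfolding out_degree_def by (rule card_Un_disjoint) (use e in \<open>auto simp: out_arcs_def\<close>)
      moreover have "e \<in> in_arcs G ?u \<union> in_arcs G ?v" "e \<in> out_arcs G ?u \<union> out_arcs G ?v"
        using e by (auto simp: in_arcs_def out_arcs_def)
      ultimately have "in_degree G' y = in_degree G ?u + in_degree G ?v - 1"
        "out_degree G' y = out_degree G ?u + out_degree G ?v - 1"
        by (simp_all add: in_degree_def[of G' y] out_degree_def[of G' y] card_Diff_singleton)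
      moreover have "3 \<le> in_degree G ?u + out_degree G ?u" "3 \<le> in_degree G ?v + out_degree G ?v"
        using s(4) e w0 by (auto simp: stable_def)
      ultimately show ?thesis by linarith
    qed
  qed
  show st': "contract_edge e (G, w, h) \<in> stable_marked_graphs g"
    unfolding eq using collapse_connected[OF s(2) G'.wf_digraph_axioms gc s(3)]
      graph_collapse_genus[OF s(1) fG' gc] s(5) fG' st he by (intro stable_marked_graphsI) auto
  have pt: "drop_virtual (contract_point G w e x) = collapse_map G {e} \<pi> id (\<lambda>_. False) (drop_virtual x)" for x
  proof (cases x)
    case (Inner a t)
    show ?thesis
    proof (cases a)
      case (Inr c)
      then show ?thesis using e Inner by (cases c) (auto simp: contract_point_def Let_def \<pi>)
    qed (use e Inner in \<open>auto simp: contract_point_def Let_def \<pi>\<close>)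
  qed (use e in \<open>auto simp: contract_point_def Let_def \<pi>\<close>)
  have "continuous_map (rose_space g) (realization G') (drop_virtual \<circ> (contract_point G w e \<circ> h))"
    using stable_marked_graphsD(8)[OF st'[unfolded eq]] .
  then have "homotopic_with (\<lambda>_. True) (rose_space g) (realization G')
      (drop_virtual \<circ> (contract_point G w e \<circ> h)) (collapse_map G {e} \<pi> id (\<lambda>_. False) \<circ> (drop_virtual \<circ> h))"
    by (rule homotopic_with_pointwise) (simp add: pt)
  then show "marked_collapse g (G, w, h) {e} \<pi> id (\<lambda>_. False) (contract_edge e (G, w, h))"
    unfolding eq marked_collapse.simps using gc homotopic_with_symD by blast
qed

lemma contract_edge_collapse:
  assumes m: "m \<in> stable_marked_graphs g" and e: "e \<in> arcs (fst m)"
  obtains \<pi> where "contract_edge e m \<in> stable_marked_graphs g"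
    "marked_collapse g m {e} \<pi> id (\<lambda>_. False) (contract_edge e m)"
proof -
  obtain G w h where eq: "m = (G, w, h)" by (metis prod_cases3)
  show thesis
  proof (cases "tail G e = head G e")
    case True
    show ?thesis
      using contract_loop[OF m[unfolded eq] _ True] e that unfolding eq fst_conv by blast
  next
    case False
    show ?thesis
      using contract_nonloop[OF m[unfolded eq] _ False refl] e that unfolding eq fst_conv by blast
  qed
qed

lemma marked_collapse_arcs:
  assumes "marked_collapse g m S \<pi> \<theta> \<phi> m'"
  shows "S \<subseteq> arcs (fst m)" "bij_betw \<theta> (arcs (fst m) - S) (arcs (fst m'))"
proof -
  obtain G w h G' w' h' where eq: "m = (G, w, h)" "m' = (G', w', h')" by (metis prod_cases3)
  have "graph_collapse G w S \<pi> \<theta> \<phi> G' w'" using assms eq by simp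
  from graph_collapseD(1,3)[OF this] show "S \<subseteq> arcs (fst m)" "bij_betw \<theta> (arcs (fst m) - S) (arcs (fst m'))"
    using eq by auto
qed

lemma marked_collapse_id_arcs:
  "marked_collapse g m S \<pi> id \<phi> m' \<Longrightarrow> arcs (fst m') = arcs (fst m) - S"
  using marked_collapse_arcs(2) by (fastforce simp: bij_betw_def)

lemma fold_contract_edge:
  assumes "m \<in> stable_marked_graphs g" "distinct es" "set es \<subseteq> arcs (fst m)"
  shows "fold contract_edge es m \<in> stable_marked_graphs g \<and>
    (\<exists>\<pi>. marked_collapse g m (set es) \<pi> id (\<lambda>_. False) (fold contract_edge es m))"
  using assms
proof (induction es arbitrary: m)
  case Nil
  have eq: "fold contract_edge [] m = m" by simp
  show ?case unfolding eq list.set(1) using Nil.prems(1) marked_collapse_refl by blast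
next
  case (Cons e es)
  let ?m1 = "contract_edge e m"
  obtain \<pi> where \<pi>: "?m1 \<in> stable_marked_graphs g" "marked_collapse g m {e} \<pi> id (\<lambda>_. False) ?m1"
    using contract_edge_collapse[OF Cons.prems(1)] Cons.prems(3) by (metis insert_subset list.simps(15))
  have arcs1: "arcs (fst ?m1) = arcs (fst m) - {e}" by (rule marked_collapse_id_arcs[OF \<pi>(2)])
  then have es: "distinct es" "set es \<subseteq> arcs (fst ?m1)" using Cons.prems by auto
  obtain \<pi>1 where \<pi>1: "fold contract_edge es ?m1 \<in> stable_marked_graphs g"
    "marked_collapse g ?m1 (set es) \<pi>1 id (\<lambda>_. False) (fold contract_edge es ?m1)"
    using Cons.IH[OF \<pi>(1) es] by blast
  have "pulled_back (fst m) {e} id (set es) = set (e # es)"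
    using es arcs1 by (auto simp: pulled_back_def)
  then have c: "marked_collapse g m (set (e # es)) (\<pi>1 \<circ> \<pi>) id (\<lambda>_. False) (fold contract_edge es ?m1)"
    using marked_collapse_compose[OF Cons.prems(1) \<pi>(1) \<pi>1(1) \<pi>(2) \<pi>1(2)] by simp
  have eq: "fold contract_edge (e # es) m = fold contract_edge es ?m1" by simp
  show ?case unfolding eq using c \<pi>1(1) by blast
qed

text \<open>Weights become positive only when a loop is contracted. If \<open>e\<close> were a loop
  after the contraction of \<open>es\<close>, its ends would be connected by \<open>es\<close> in
  the original graph, and \<open>e\<close> would close a cycle. The induction goes from the right
  because the last edge meets a graph in which the others are already contracted.\<close>

lemma fold_contract_edge_pure:
  assumes m: "m \<in> pure_marked_graphs g" and "distinct es" "set es \<subseteq> arcs (fst m)"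
    and "\<not> contains_cycle (fst m) (set es)"
  shows "fold contract_edge es m \<in> pure_marked_graphs g"
  using assms(2-)
proof (induction es rule: rev_induct)
  case Nil
  then show ?case using m by simp
next
  case (snoc e es)
  have st: "m \<in> stable_marked_graphs g" using m by (auto simp: pure_marked_graphs_def)
  obtain G w h where eq: "m = (G, w, h)" by (metis prod_cases3)
  note s = stable_marked_graphsD[OF st[unfolded eq]]
  let ?m1 = "fold contract_edge es m"
  have es: "distinct es" "set es \<subseteq> arcs G" "e \<in> arcs G" "e \<notin> set es" using snoc.prems eq by auto
  have nc: "\<not> contains_cycle G (insert e (set es))" using snoc.prems(3) eq by simp
  have "?m1 \<in> pure_marked_graphs g"
    using snoc es nc contains_cycle_mono[of G "set es" "insert e (set es)"] eq by auto
  moreover obtain G1 w1 h1 where eq1: "?m1 = (G1, w1, h1)" by (metis prod_cases3)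
  ultimately have w1: "\<forall>v\<in>verts G1. w1 v = 0" by (auto simp: pure_marked_graphs_def)
  obtain \<pi> where \<pi>: "?m1 \<in> stable_marked_graphs g" "marked_collapse g m (set es) \<pi> id (\<lambda>_. False) ?m1"
    using fold_contract_edge[OF st] es eq by auto
  have gc: "graph_collapse G w (set es) \<pi> id (\<lambda>_. False) G1 w1" using \<pi>(2) eq eq1 by simp
  note d = graph_collapseD[OF gc]
  interpret G: fin_digraph G by (rule s(1))
  interpret G1: fin_digraph G1 using stable_marked_graphsD(1) \<pi>(1) eq1 by metis
  have e1: "e \<in> arcs G1" "tail G1 e = \<pi> (tail G e)" "head G1 e = \<pi> (head G e)"
    using es d(4,5)[of e] marked_collapse_id_arcs[OF \<pi>(2)] eq eq1 by auto
  have "tail G1 e \<noteq> head G1 e"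
  proof
    assume "tail G1 e = head G1 e"
    then have "(head G e, tail G e) \<in> conn G (set es)"
      using d(6)[of "head G e" "tail G e"] e1 es by simp
    then show False using contains_cycle_insert[OF s(2) es(2,3,4)] nc by blast
  qed
  then have "fst (snd (contract_edge e ?m1)) = w1(tail G1 e := w1 (tail G1 e) + w1 (head G1 e))"
    "verts (fst (contract_edge e ?m1)) \<subseteq> verts G1"
    by (simp_all add: eq1 Let_def)
  moreover have "w1 (tail G1 e) = 0" "w1 (head G1 e) = 0"
    using w1 G1.tail_in_verts[OF e1(1)] G1.head_in_verts[OF e1(1)] by auto
  moreover have "contract_edge e ?m1 \<in> stable_marked_graphs g"
    using contract_edge_collapse[OF \<pi>(1)] e1 eq1 by (metis fst_conv)
  ultimately have "contract_edge e ?m1 \<in> pure_marked_graphs g"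
    using w1 by (cases "contract_edge e ?m1") (auto simp: pure_marked_graphs_def)
  then show ?case by simp
qed

section \<open>Changing the marking\<close>

fun change :: "marked_graph \<Rightarrow> ((unit, nat) gpoint \<Rightarrow> (unit, nat) gpoint) \<Rightarrow> marked_graph" where
  "change (G, w, h) f = (G, w, h \<circ> f)"

lemma fst_change [simp]: "fst (change m f) = fst m"
  by (cases m) auto

lemma change_change: "change (change m f) k = change m (f \<circ> k)"
  by (cases m) (auto simp: o_assoc)

lemma change_id [simp]: "change m id = m"
  by (cases m) auto

lemma change_stable:
  assumes "m \<in> stable_marked_graphs g" "homotopy_equivalence_map (rose_space g) (rose_space g) f"
  shows "change m f \<in> stable_marked_graphs g"
  using assms homotopy_equivalence_map_compose[OF assms(2)]
  by (cases m) (auto simp: stable_marked_graphs_def)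

lemma change_pure:
  assumes "m \<in> pure_marked_graphs g" "homotopy_equivalence_map (rose_space g) (rose_space g) f"
  shows "change m f \<in> pure_marked_graphs g"
  using assms change_stable[of m g f] by (cases m) (auto simp: pure_marked_graphs_def)

text \<open>The marking is changed before, and the graph contracted after, so the two operations
  commute and the data of the contraction stay the same.\<close>

lemma marked_collapse_change:
  assumes c: "marked_collapse g m S \<pi> \<theta> \<phi> m'" and f: "continuous_map (rose_space g) (rose_space g) f"
  shows "marked_collapse g (change m f) S \<pi> \<theta> \<phi> (change m' f)"
proof -
  obtain G w h G' w' h' where eq: "m = (G, w, h)" "m' = (G', w', h')" by (metis prod_cases3)
  have "homotopic_with (\<lambda>_. True) (rose_space g) (realization G')
       ((collapse_map G S \<pi> \<theta> \<phi> \<circ> (drop_virtual \<circ> h)) \<circ> f) ((drop_virtual \<circ> h') \<circ> f)"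
    using c eq by (intro homotopic_with_compose_continuous_map_right[OF _ f]) auto
  then show ?thesis using c eq by (simp add: o_assoc)
qed

lemma marked_collapse_change_homotopic:
  assumes m: "m \<in> stable_marked_graphs g"
    and h: "homotopic_with (\<lambda>_. True) (rose_space g) (rose_space g) f k"
  shows "marked_collapse g (change m f) {} id id (\<lambda>_. False) (change m k)"
proof -
  obtain G w h where eq: "m = (G, w, h)" by (metis prod_cases3)
  note s = stable_marked_graphsD[OF m[unfolded eq]]
  have id: "collapse_map G {} id id (\<lambda>_. False) x = x" for x
    by (cases x) auto
  have "homotopic_with (\<lambda>_. True) (rose_space g) (realization G) ((drop_virtual \<circ> h) \<circ> f) ((drop_virtual \<circ> h) \<circ> k)"
    by (rule homotopic_with_compose_continuous_map_left[OF assms(2) s(8)]) auto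
  then have "homotopic_with (\<lambda>_. True) (rose_space g) (realization G)
      (collapse_map G {} id id (\<lambda>_. False) \<circ> (drop_virtual \<circ> (h \<circ> f))) (drop_virtual \<circ> (h \<circ> k))"
    by (rule homotopic_with_eq) (simp_all add: id)
  then show ?thesis using graph_collapse_id[OF s(1)] eq by simp
qed

section \<open>Contractions of metric graphs\<close>

text \<open>\<open>S\<close> need not contain all edges of length zero. With \<open>S\<close> empty
  this is an isometry; in general it is the relation between two points of cones of which the first
  is obtained from the second by extending lengths by zero.\<close>

definition len_collapse :: "nat \<Rightarrow> marked_graph \<times> lengths \<Rightarrow> marked_graph \<times> lengths \<Rightarrow> bool" where
  "len_collapse g a b \<longleftrightarrow> (\<exists>S \<pi> \<theta> \<phi>. marked_collapse g (fst a) S \<pi> \<theta> \<phi> (fst b) \<and>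
     (\<forall>e\<in>arcs (fst (fst a)) - S. Poly_Mapping.lookup (snd b) (\<theta> e) = Poly_Mapping.lookup (snd a) e) \<and>
     (\<forall>e\<in>S. Poly_Mapping.lookup (snd a) e = 0))"

lemma len_collapseE:
  assumes "len_collapse g (m, l) (m', l')"
  obtains S \<pi> \<theta> \<phi> where "marked_collapse g m S \<pi> \<theta> \<phi> m'"
    "\<forall>e\<in>arcs (fst m) - S. Poly_Mapping.lookup l' (\<theta> e) = Poly_Mapping.lookup l e"
    "\<forall>e\<in>S. Poly_Mapping.lookup l e = 0"
  using assms unfolding len_collapse_def fst_conv snd_conv by (elim exE conjE)

lemma len_collapseI:
  assumes "marked_collapse g m S \<pi> \<theta> \<phi> m'"
    "\<And>e. e \<in> arcs (fst m) - S \<Longrightarrow> Poly_Mapping.lookup l' (\<theta> e) = Poly_Mapping.lookup l e"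
    "\<And>e. e \<in> S \<Longrightarrow> Poly_Mapping.lookup l e = 0"
  shows "len_collapse g (m, l) (m', l')"
  unfolding len_collapse_def fst_conv snd_conv using assms by blast

definition positive :: "marked_graph \<times> lengths \<Rightarrow> bool" where
  "positive a \<longleftrightarrow> (\<forall>e\<in>arcs (fst (fst a)). 0 < Poly_Mapping.lookup (snd a) e)"

lemma len_collapse_trans:
  assumes st: "fst a \<in> stable_marked_graphs g" "fst b \<in> stable_marked_graphs g" "fst c \<in> stable_marked_graphs g"
    and ab: "len_collapse g a b" and bc: "len_collapse g b c"
  shows "len_collapse g a c"
proof -
  obtain m l m1 l1 m2 l2 where eq: "a = (m, l)" "b = (m1, l1)" "c = (m2, l2)" by (metis surj_pair)
  obtain S \<pi> \<theta> \<phi> where 1: "marked_collapse g m S \<pi> \<theta> \<phi> m1"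
    "\<forall>e\<in>arcs (fst m) - S. Poly_Mapping.lookup l1 (\<theta> e) = Poly_Mapping.lookup l e"
    "\<forall>e\<in>S. Poly_Mapping.lookup l e = 0"
    using len_collapseE[OF ab[unfolded eq]] .
  obtain S1 \<pi>1 \<theta>1 \<phi>1 where 2: "marked_collapse g m1 S1 \<pi>1 \<theta>1 \<phi>1 m2"
    "\<forall>e\<in>arcs (fst m1) - S1. Poly_Mapping.lookup l2 (\<theta>1 e) = Poly_Mapping.lookup l1 e"
    "\<forall>e\<in>S1. Poly_Mapping.lookup l1 e = 0"
    using len_collapseE[OF bc[unfolded eq]] .
  have \<theta>: "\<theta> e \<in> arcs (fst m1)" if "e \<in> arcs (fst m) - S" for e
    using marked_collapse_arcs(2)[OF 1(1)] that by (auto simp: bij_betw_def)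
  show ?thesis
    unfolding eq
  proof (rule len_collapseI[OF marked_collapse_compose[OF st[unfolded eq fst_conv] 1(1) 2(1)]])
    fix e assume "e \<in> arcs (fst m) - pulled_back (fst m) S \<theta> S1"
    then have "e \<in> arcs (fst m) - S" "\<theta> e \<in> arcs (fst m1) - S1"
      using \<theta> by (auto simp: pulled_back_def)
    then show "Poly_Mapping.lookup l2 ((\<theta>1 \<circ> \<theta>) e) = Poly_Mapping.lookup l e" using 1 2 by simp
  next
    fix e assume "e \<in> pulled_back (fst m) S \<theta> S1"
    then consider "e \<in> S" | "e \<in> arcs (fst m) - S" "\<theta> e \<in> S1" by (auto simp: pulled_back_def)
    then show "Poly_Mapping.lookup l e = 0"
    proof cases
      case 2
      then have "Poly_Mapping.lookup l e = Poly_Mapping.lookup l1 (\<theta> e)" using 1(2) by simp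
      also have "\<dots> = 0" using \<open>\<forall>e\<in>S1. Poly_Mapping.lookup l1 e = 0\<close> 2 by blast
      finally show ?thesis .
    qed (use 1 in auto)
  qed
qed

lemma len_collapse_positive_zeros:
  assumes "marked_collapse g m S \<pi> \<theta> \<phi> m'"
    "\<forall>e\<in>arcs (fst m) - S. Poly_Mapping.lookup l' (\<theta> e) = Poly_Mapping.lookup l e"
    "\<forall>e\<in>S. Poly_Mapping.lookup l e = 0" "positive (m', l')"
  shows "S = {e \<in> arcs (fst m). Poly_Mapping.lookup l e = 0}"
proof -
  have "Poly_Mapping.lookup l e \<noteq> 0" if "e \<in> arcs (fst m) - S" for e
  proof -
    have "\<theta> e \<in> arcs (fst m')" using marked_collapse_arcs(2)[OF assms(1)] that by (auto simp: bij_betw_def)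
    then show ?thesis using assms(2,4) that by (force simp: positive_def)
  qed
  then show ?thesis using marked_collapse_arcs(1)[OF assms(1)] assms(3) by auto
qed

text \<open>All edges of length zero are contracted on the way to positive lengths, so the result is unique.\<close>

lemma len_collapse_unique:
  assumes st: "fst a \<in> stable_marked_graphs g" "fst b \<in> stable_marked_graphs g" "fst c \<in> stable_marked_graphs g"
    and ab: "len_collapse g a b" and ac: "len_collapse g a c" and pos: "positive b" "positive c"
  shows "len_collapse g b c"
proof -
  obtain m l m1 l1 m2 l2 where eq: "a = (m, l)" "b = (m1, l1)" "c = (m2, l2)" by (metis surj_pair)
  obtain S \<pi> \<theta> \<phi> where 1: "marked_collapse g m S \<pi> \<theta> \<phi> m1"
    "\<forall>e\<in>arcs (fst m) - S. Poly_Mapping.lookup l1 (\<theta> e) = Poly_Mapping.lookup l e"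
    "\<forall>e\<in>S. Poly_Mapping.lookup l e = 0"
    using len_collapseE[OF ab[unfolded eq]] .
  obtain S2 \<pi>2 \<theta>2 \<phi>2 where 2: "marked_collapse g m S2 \<pi>2 \<theta>2 \<phi>2 m2"
    "\<forall>e\<in>arcs (fst m) - S2. Poly_Mapping.lookup l2 (\<theta>2 e) = Poly_Mapping.lookup l e"
    "\<forall>e\<in>S2. Poly_Mapping.lookup l e = 0"
    using len_collapseE[OF ac[unfolded eq]] .
  have SS: "S2 = S"
    using len_collapse_positive_zeros[OF 1] len_collapse_positive_zeros[OF 2] pos eq by simp
  obtain \<nu> \<theta>' \<phi>' where n: "marked_collapse g m1 {} \<nu> \<theta>' \<phi>' m2" "\<forall>e\<in>arcs (fst m) - S. \<theta>' (\<theta> e) = \<theta>2 e"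
    using marked_collapse_unique[OF st[unfolded eq fst_conv] 1(1) 2(1)[unfolded SS]] .
  show ?thesis
    unfolding eq
  proof (rule len_collapseI[OF n(1)])
    fix e1 assume "e1 \<in> arcs (fst m1) - {}"
    then obtain e where e: "e \<in> arcs (fst m) - S" "e1 = \<theta> e"
      using marked_collapse_arcs(2)[OF 1(1)] by (auto simp: bij_betw_def)
    have "\<theta>' e1 = \<theta>2 e" using n(2) e by blast
    then show "Poly_Mapping.lookup l2 (\<theta>' e1) = Poly_Mapping.lookup l1 e1"
      using 1(2) 2(2) e SS by simp
  qed simp
qed

lemma marked_collapse_iso_inverse:
  assumes st: "m \<in> stable_marked_graphs g" "m' \<in> stable_marked_graphs g"
    and c: "marked_collapse g m {} \<pi> \<theta> \<phi> m'"
  obtains \<nu> \<theta>' \<phi>' where "marked_collapse g m' {} \<nu> \<theta>' \<phi>' m" "\<forall>e\<in>arcs (fst m). \<theta>' (\<theta> e) = e"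
proof -
  obtain \<nu> \<theta>' \<phi>' where n: "marked_collapse g m' {} \<nu> \<theta>' \<phi>' m" "\<forall>e\<in>arcs (fst m) - {}. \<theta>' (\<theta> e) = id e"
    using marked_collapse_unique[OF st(1,2,1) c marked_collapse_refl[OF st(1)]] .
  then show thesis using that by auto
qed

lemma len_collapse_iso_sym:
  assumes st: "m \<in> stable_marked_graphs g" "m' \<in> stable_marked_graphs g"
    and c: "marked_collapse g m {} \<pi> \<theta> \<phi> m'"
    and l: "\<forall>e\<in>arcs (fst m). Poly_Mapping.lookup l' (\<theta> e) = Poly_Mapping.lookup l e"
  shows "len_collapse g (m', l') (m, l)"
proof -
  obtain \<nu> \<theta>' \<phi>' where n: "marked_collapse g m' {} \<nu> \<theta>' \<phi>' m" "\<forall>e\<in>arcs (fst m). \<theta>' (\<theta> e) = e"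
    using marked_collapse_iso_inverse[OF st c] .
  show ?thesis
  proof (rule len_collapseI[OF n(1)])
    fix e' assume "e' \<in> arcs (fst m') - {}"
    then obtain e where "e \<in> arcs (fst m)" "e' = \<theta> e"
      using marked_collapse_arcs(2)[OF c] by (auto simp: bij_betw_def)
    then show "Poly_Mapping.lookup l (\<theta>' e') = Poly_Mapping.lookup l' e'" using n(2) l by simp
  qed simp
qed

text \<open>Positive lengths leave no edge to contract, so only an isometry compatible with the
  markings remains.\<close>

lemma curve_equiv_iff:
  assumes st: "fst a \<in> stable_marked_graphs g" "fst b \<in> stable_marked_graphs g" and pos: "positive a"
  shows "curve_equiv g a b \<longleftrightarrow> len_collapse g a b"
proof -
  obtain m l m' l' where eq: "a = (m, l)" "b = (m', l')" by (metis surj_pair)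
  have st': "m \<in> stable_marked_graphs g" "m' \<in> stable_marked_graphs g" using st eq by auto
  show ?thesis
  proof
    assume "curve_equiv g a b"
    then obtain \<gamma> where \<gamma>: "is_marked_iso g \<gamma> m m'"
      "\<forall>e\<in>arcs (fst m). Poly_Mapping.lookup l' (real_edge_map \<gamma> e) = Poly_Mapping.lookup l e"
      unfolding curve_equiv_def eq by auto
    show "len_collapse g a b"
      unfolding eq by (rule len_collapseI[OF is_marked_iso_collapse[OF st' \<gamma>(1)]]) (use \<gamma> in auto)
  next
    assume "len_collapse g a b"
    then obtain S \<pi> \<theta> \<phi> where 1: "marked_collapse g m S \<pi> \<theta> \<phi> m'"
      "\<forall>e\<in>arcs (fst m) - S. Poly_Mapping.lookup l' (\<theta> e) = Poly_Mapping.lookup l e"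
      "\<forall>e\<in>S. Poly_Mapping.lookup l e = 0"
      unfolding eq by (rule len_collapseE)
    have S: "S = {}"
      using 1(3) marked_collapse_arcs(1)[OF 1(1)] pos eq by (force simp: positive_def)
    obtain \<gamma> where "is_marked_iso g \<gamma> m m'" "\<And>e. real_edge_map \<gamma> e = \<theta> e"
      using collapse_imp_marked_iso[OF st' 1(1)[unfolded S]] by blast
    then show "curve_equiv g a b"
      unfolding curve_equiv_def eq using 1(2) S by auto
  qed
qed

lemma len_collapse_positive_sym:
  assumes st: "fst a \<in> stable_marked_graphs g" "fst b \<in> stable_marked_graphs g" and pos: "positive a"
    and c: "len_collapse g a b"
  shows "len_collapse g b a" "positive b"
proof -
  obtain m l m' l' where eq: "a = (m, l)" "b = (m', l')" by (metis surj_pair)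
  obtain S \<pi> \<theta> \<phi> where 1: "marked_collapse g m S \<pi> \<theta> \<phi> m'"
      "\<forall>e\<in>arcs (fst m) - S. Poly_Mapping.lookup l' (\<theta> e) = Poly_Mapping.lookup l e"
      "\<forall>e\<in>S. Poly_Mapping.lookup l e = 0"
    using len_collapseE[OF c[unfolded eq]] .
  have S: "S = {}"
    using 1(3) marked_collapse_arcs(1)[OF 1(1)] pos eq by (force simp: positive_def)
  show "len_collapse g b a"
    unfolding eq by (rule len_collapse_iso_sym[OF _ _ 1(1)[unfolded S]]) (use st eq 1(2) S in auto)
  show "positive b"
    unfolding positive_def eq fst_conv snd_conv
  proof
    fix e' assume "e' \<in> arcs (fst m')"
    then obtain e where "e \<in> arcs (fst m)" "e' = \<theta> e"
      using marked_collapse_arcs(2)[OF 1(1)] S by (auto simp: bij_betw_def)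
    then show "0 < Poly_Mapping.lookup l' e'" using 1(2) S pos eq by (auto simp: positive_def)
  qed
qed

section \<open>Linear maps induced by maps of edges\<close>

definition push_lengths :: "(nat \<Rightarrow> nat) \<Rightarrow> nat set \<Rightarrow> lengths \<Rightarrow> lengths" where
  "push_lengths \<eta> A l = (\<Sum>e\<in>A. Poly_Mapping.single (\<eta> e) (Poly_Mapping.lookup l e))"

lemma extend_lengths_push: "extend_lengths \<gamma> m l = push_lengths (real_edge_map \<gamma>) (arcs (fst m)) l"
  by (simp add: extend_lengths_def push_lengths_def)

lemma lookup_push:
  assumes "finite A" "inj_on \<eta> A" "e \<in> A"
  shows "Poly_Mapping.lookup (push_lengths \<eta> A l) (\<eta> e) = Poly_Mapping.lookup l e"
proof -
  have "Poly_Mapping.lookup (push_lengths \<eta> A l) (\<eta> e) =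
      (\<Sum>a\<in>A. if a = e then Poly_Mapping.lookup l a else 0)"
    unfolding push_lengths_def lookup_sum
    using assms by (intro sum.cong) (auto simp: lookup_single when_def dest: inj_onD)
  then show ?thesis using assms by simp
qed

lemma lookup_push_notin:
  assumes "x \<notin> \<eta> ` A" shows "Poly_Mapping.lookup (push_lengths \<eta> A l) x = 0"
  unfolding push_lengths_def lookup_sum
  by (rule sum.neutral) (use assms in \<open>auto simp: lookup_single when_def\<close>)

lemma lookup_scaleR_lengths: "Poly_Mapping.lookup (r *\<^sub>R (l :: lengths)) x = r * Poly_Mapping.lookup l x"
proof -
  have "finite {i. r *\<^sub>R Poly_Mapping.lookup l i \<noteq> 0}"
    by (rule finite_subset[OF _ finite_lookup[of l]]) auto
  then show ?thesis by (simp add: scaleR_poly_mapping_def Abs_poly_mapping_inverse)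
qed

lemma linear_push: "linear (push_lengths \<eta> A)"
proof (rule linearI)
  fix l l' :: lengths and r :: real
  show "push_lengths \<eta> A (l + l') = push_lengths \<eta> A l + push_lengths \<eta> A l'"
    by (simp add: push_lengths_def lookup_add single_add sum.distrib)
  show "push_lengths \<eta> A (r *\<^sub>R l) = r *\<^sub>R push_lengths \<eta> A l"
  proof (rule poly_mapping_eqI)
    fix k
    show "Poly_Mapping.lookup (push_lengths \<eta> A (r *\<^sub>R l)) k = Poly_Mapping.lookup (r *\<^sub>R push_lengths \<eta> A l) k"
      unfolding lookup_scaleR_lengths push_lengths_def lookup_sum sum_distrib_left
      by (rule sum.cong) (auto simp: lookup_single when_def)
  qed
qed

lemma keys_push_subset: "Poly_Mapping.keys (push_lengths \<eta> A l) \<subseteq> \<eta> ` A"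
proof
  fix x assume "x \<in> Poly_Mapping.keys (push_lengths \<eta> A l)"
  then show "x \<in> \<eta> ` A" using lookup_push_notin[of x \<eta> A l] unfolding in_keys_iff by blast
qed

lemma push_push:
  assumes "finite A" "inj_on \<eta> A" "finite B" "inj_on \<theta> B" "\<And>e. e \<in> B \<Longrightarrow> \<theta> e \<in> A \<and> \<eta> (\<theta> e) = e"
    and l: "Poly_Mapping.keys l \<subseteq> B"
  shows "push_lengths \<eta> A (push_lengths \<theta> B l) = l"
proof (rule poly_mapping_eqI)
  fix k
  show "Poly_Mapping.lookup (push_lengths \<eta> A (push_lengths \<theta> B l)) k = Poly_Mapping.lookup l k"
  proof (cases "k \<in> \<eta> ` A")
    case False
    then have "k \<notin> B" using assms(5) by (metis imageI)
    then have "Poly_Mapping.lookup l k = 0" using l by (auto simp: in_keys_iff)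
    then show ?thesis using lookup_push_notin[OF False] by simp
  next
    case True
    then obtain a where a: "a \<in> A" "k = \<eta> a" by blast
    show ?thesis
    proof (cases "a \<in> \<theta> ` B")
      case True
      then obtain b where b: "b \<in> B" "a = \<theta> b" by blast
      then show ?thesis using a assms lookup_push[OF assms(1,2) a(1)] lookup_push[OF assms(3,4) b(1)] by simp
    next
      case False
      have "k \<notin> B"
      proof
        assume "k \<in> B"
        then have "\<theta> k = a" using assms(2,5) a by (metis inj_onD)
        then show False using False \<open>k \<in> B\<close> by blast
      qed
      then have "Poly_Mapping.lookup l k = 0" using l by (auto simp: in_keys_iff)
      then show ?thesis using a lookup_push[OF assms(1,2) a(1)] lookup_push_notin[OF False] by simp
    qed
  qed
qed

lemma subspace_keys: "subspace {l :: lengths. Poly_Mapping.keys l \<subseteq> A}"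
proof (rule subspaceI)
  show "0 \<in> {l :: lengths. Poly_Mapping.keys l \<subseteq> A}" by simp
  show "x + y \<in> {l :: lengths. Poly_Mapping.keys l \<subseteq> A}"
    if "x \<in> {l :: lengths. Poly_Mapping.keys l \<subseteq> A}" "y \<in> {l :: lengths. Poly_Mapping.keys l \<subseteq> A}" for x y
    using that keys_add[of x y] by auto
  show "r *\<^sub>R x \<in> {l :: lengths. Poly_Mapping.keys l \<subseteq> A}"
    if "x \<in> {l :: lengths. Poly_Mapping.keys l \<subseteq> A}" for x r
    using that by (auto simp: in_keys_iff lookup_scaleR_lengths subset_iff)
qed

section \<open>Specializations\<close>

text \<open>The isomorphism of a specialization starts at \<open>m'\<close>, so it has to be
  inverted to give a contraction of \<open>m\<close> to \<open>m'\<close>. Extension by zero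
  provides the vanishing lengths on the contracted edges.\<close>

lemma specialization_imp_len_collapse:
  assumes st: "m \<in> stable_marked_graphs g" "m' \<in> stable_marked_graphs g"
    and sp: "specialization g m es \<gamma> m'" and l: "l = extend_lengths \<gamma> m' l'"
  shows "len_collapse g (m, l) (m', l')"
proof -
  let ?m1 = "fold contract_edge es m"
  have es: "distinct es" "set es \<subseteq> arcs (fst m)" and iso: "is_marked_iso g \<gamma> m' ?m1"
    using sp by (auto simp: specialization_def)
  obtain \<pi> where \<pi>: "?m1 \<in> stable_marked_graphs g" "marked_collapse g m (set es) \<pi> id (\<lambda>_. False) ?m1"
    using fold_contract_edge[OF st(1) es] by blast
  note c = is_marked_iso_collapse[OF st(2) \<pi>(1) iso]
  have bij: "bij_betw (real_edge_map \<gamma>) (arcs (fst m')) (arcs (fst m) - set es)"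
    using marked_collapse_arcs(2)[OF c] marked_collapse_id_arcs[OF \<pi>(2)] by simp
  have fin: "finite (arcs (fst m'))"
    using st(2) by (cases m') (auto simp: stable_marked_graphs_def fin_digraph.finite_arcs)
  have "len_collapse g (m, l) (?m1, l)"
  proof (rule len_collapseI[OF \<pi>(2)])
    fix e assume "e \<in> set es"
    then have "e \<notin> real_edge_map \<gamma> ` arcs (fst m')" using bij by (auto simp: bij_betw_def)
    then show "Poly_Mapping.lookup l e = 0" unfolding l extend_lengths_push by (rule lookup_push_notin)
  qed simp
  moreover have "len_collapse g (?m1, l) (m', l')"
    by (rule len_collapse_iso_sym[OF st(2) \<pi>(1) c])
       (use bij fin lookup_push in \<open>auto simp: l extend_lengths_push bij_betw_def\<close>)
  ultimately show ?thesis using len_collapse_trans[of "(m, l)" g "(?m1, l)" "(m', l')"] st \<pi>(1) by simp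
qed

text \<open>The contracted set is enumerated in any order; by \<open>marked_collapse_unique\<close>
  the result is isomorphic to \<open>m'\<close>, compatibly with the edges. The condition on
  \<open>keys\<close> makes \<open>l\<close> vanish off the edges, as an extension by zero
  does.\<close>

lemma len_collapse_imp_specialization:
  assumes st: "m \<in> stable_marked_graphs g" "m' \<in> stable_marked_graphs g"
    and c: "len_collapse g (m, l) (m', l')" and l: "Poly_Mapping.keys l \<subseteq> arcs (fst m)"
  shows "\<exists>es \<gamma>. specialization g m es \<gamma> m' \<and> l = extend_lengths \<gamma> m' l'"
proof -
  obtain S \<pi> \<theta> \<phi> where 1: "marked_collapse g m S \<pi> \<theta> \<phi> m'"
    "\<forall>e\<in>arcs (fst m) - S. Poly_Mapping.lookup l' (\<theta> e) = Poly_Mapping.lookup l e"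
    "\<forall>e\<in>S. Poly_Mapping.lookup l e = 0"
    using len_collapseE[OF c] .
  have S: "S \<subseteq> arcs (fst m)" by (rule marked_collapse_arcs(1)[OF 1(1)])
  have fin: "finite (arcs (fst m))" "finite (arcs (fst m'))"
    using st by (cases m; cases m'; auto simp: stable_marked_graphs_def fin_digraph.finite_arcs)+
  obtain es where es: "set es = S" "distinct es"
    using finite_distinct_list[OF finite_subset[OF S fin(1)]] by blast
  let ?m1 = "fold contract_edge es m"
  obtain \<pi>1 where \<pi>1: "?m1 \<in> stable_marked_graphs g" "marked_collapse g m S \<pi>1 id (\<lambda>_. False) ?m1"
    using fold_contract_edge[OF st(1) es(2)] es S by blast
  obtain \<nu> \<theta>' \<phi>' where n: "marked_collapse g m' {} \<nu> \<theta>' \<phi>' ?m1" "\<forall>e\<in>arcs (fst m) - S. \<theta>' (\<theta> e) = id e"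
    using marked_collapse_unique[OF st(1,2) \<pi>1(1) 1(1) \<pi>1(2)] .
  obtain \<gamma> where \<gamma>: "is_marked_iso g \<gamma> m' ?m1" "\<And>e. real_edge_map \<gamma> e = \<theta>' e"
    using collapse_imp_marked_iso[OF st(2) \<pi>1(1) n(1)] by blast
  have bij': "bij_betw \<theta>' (arcs (fst m')) (arcs (fst m) - S)"
    using marked_collapse_arcs(2)[OF n(1)] marked_collapse_id_arcs[OF \<pi>1(2)] by simp
  have re: "real_edge_map \<gamma> = \<theta>'" using \<gamma>(2) by auto
  have "l = extend_lengths \<gamma> m' l'"
  proof (rule poly_mapping_eqI)
    fix k
    show "Poly_Mapping.lookup l k = Poly_Mapping.lookup (extend_lengths \<gamma> m' l') k"
    proof (cases "k \<in> arcs (fst m) - S")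
      case True
      then have \<theta>k: "\<theta> k \<in> arcs (fst m')" "\<theta>' (\<theta> k) = k"
        using marked_collapse_arcs(2)[OF 1(1)] n(2) by (auto simp: bij_betw_def)
      then show ?thesis
        using lookup_push[OF fin(2) _ \<theta>k(1), of \<theta>' l'] bij' 1(2) True
        by (simp add: extend_lengths_push re bij_betw_def)
    next
      case False
      then have "k \<notin> \<theta>' ` arcs (fst m')" using bij' by (auto simp: bij_betw_def)
      moreover have "Poly_Mapping.lookup l k = 0" using False 1(3) l by (auto simp: in_keys_iff)
      ultimately show ?thesis by (simp add: extend_lengths_push re lookup_push_notin)
    qed
  qed
  moreover have "specialization g m es \<gamma> m'"
    unfolding specialization_def using es S \<gamma> by simp
  ultimately show ?thesis by blast
qed

section \<open>The points of a Teichmueller fan\<close>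

text \<open>What the two spaces have in common, so that admissibility is proved once. Through
  \<open>contract_closed\<close> every point of a cone leads to a marked curve of the same kind; in
  the pure case it holds because the zero edges of a point of an ideal cone contain no
  cycle.\<close>

locale marked_fan =
  fixes g :: nat and M :: "marked_graph set" and C :: "marked_graph \<Rightarrow> lengths set"
  assumes stable: "M \<subseteq> stable_marked_graphs g"
    and change_closed: "\<And>m f. m \<in> M \<Longrightarrow> homotopy_equivalence_map (rose_space g) (rose_space g) f \<Longrightarrow> change m f \<in> M"
    and cone_orthant: "\<And>m. C m \<subseteq> orthant m"
    and cone_change: "\<And>m f. C (change m f) = C m"
    and cone_positive: "\<And>m l. Poly_Mapping.keys l = arcs (fst m) \<Longrightarrow> positive (m, l) \<Longrightarrow> l \<in> C m"
    and contract_closed: "\<And>m l es. m \<in> M \<Longrightarrow> l \<in> C m \<Longrightarrow> distinct es \<Longrightarrow>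
      set es = {e \<in> arcs (fst m). Poly_Mapping.lookup l e = 0} \<Longrightarrow> fold contract_edge es m \<in> M"
    and cone_iso: "\<And>m m' \<pi> \<theta> \<phi> l. m \<in> M \<Longrightarrow> m' \<in> M \<Longrightarrow> marked_collapse g m {} \<pi> \<theta> \<phi> m' \<Longrightarrow> l \<in> C m \<Longrightarrow>
      push_lengths \<theta> (arcs (fst m)) l \<in> C m'"
begin

abbreviation F :: "marked_graph set ideal_stacky_fan" where "F \<equiv> teichmueller_fan g M C"

definition eq_rel :: "(marked_graph \<times> marked_graph) set" where
  "eq_rel = {(m, m') \<in> M \<times> M. marked_equiv g m m'}"

abbreviation cls :: "marked_graph \<Rightarrow> marked_graph set" where "cls m \<equiv> eq_rel `` {m}"

lemma in_stable: "m \<in> M \<Longrightarrow> m \<in> stable_marked_graphs g"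
  using stable by blast

lemma finite_arcs_M: "m \<in> M \<Longrightarrow> finite (arcs (fst m))"
  using in_stable by (cases m) (auto simp: stable_marked_graphs_def fin_digraph.finite_arcs)

lemma marked_equiv_iff:
  assumes "m \<in> M" "m' \<in> M"
  shows "marked_equiv g m m' \<longleftrightarrow> (\<exists>\<pi> \<theta> \<phi>. marked_collapse g m {} \<pi> \<theta> \<phi> m')"
  unfolding marked_equiv_def
  using is_marked_iso_collapse[OF in_stable[OF assms(1)] in_stable[OF assms(2)]]
    collapse_imp_marked_iso[OF in_stable[OF assms(1)] in_stable[OF assms(2)]] by metis

lemma equiv_eq_rel: "equiv M eq_rel"
proof (rule equivI)
  show "eq_rel \<subseteq> M \<times> M" by (auto simp: eq_rel_def)
  show "refl_on M eq_rel"
  proof (rule refl_onI)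
    fix m assume m: "m \<in> M"
    then have "marked_equiv g m m" using marked_equiv_iff[OF m m] marked_collapse_refl[OF in_stable] by blast
    then show "(m, m) \<in> eq_rel" using m by (simp add: eq_rel_def)
  qed
  show "sym eq_rel"
  proof (rule symI)
    fix a b assume "(a, b) \<in> eq_rel"
    then have ab: "a \<in> M" "b \<in> M" "marked_equiv g a b" by (auto simp: eq_rel_def)
    then obtain \<pi> \<theta> \<phi> where "marked_collapse g a {} \<pi> \<theta> \<phi> b" using marked_equiv_iff by blast
    from marked_collapse_iso_inverse[OF in_stable[OF ab(1)] in_stable[OF ab(2)] this]
    have "\<exists>\<pi> \<theta> \<phi>. marked_collapse g b {} \<pi> \<theta> \<phi> a" by metis
    then have "marked_equiv g b a" using marked_equiv_iff[OF ab(2,1)] by blast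
    then show "(b, a) \<in> eq_rel" using ab by (simp add: eq_rel_def)
  qed
  show "trans eq_rel"
  proof (rule transI)
    fix a b c assume "(a, b) \<in> eq_rel" "(b, c) \<in> eq_rel"
    then have abc: "a \<in> M" "b \<in> M" "c \<in> M" "marked_equiv g a b" "marked_equiv g b c"
      by (auto simp: eq_rel_def)
    obtain \<pi> \<theta> \<phi> where 1: "marked_collapse g a {} \<pi> \<theta> \<phi> b" using abc marked_equiv_iff by blast
    obtain \<pi>1 \<theta>1 \<phi>1 where 2: "marked_collapse g b {} \<pi>1 \<theta>1 \<phi>1 c" using abc marked_equiv_iff by blast
    have "pulled_back (fst a) {} \<theta> {} = {}" by (simp add: pulled_back_def)
    then have "\<exists>\<pi> \<theta> \<phi>. marked_collapse g a {} \<pi> \<theta> \<phi> c"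
      using marked_collapse_compose[OF in_stable[OF abc(1)] in_stable[OF abc(2)] in_stable[OF abc(3)] 1 2] by metis
    then have "marked_equiv g a c" using marked_equiv_iff[OF abc(1,3)] by blast
    then show "(a, c) \<in> eq_rel" using abc by (simp add: eq_rel_def)
  qed
qed

lemma fan_index_F: "fan_index F = M // eq_rel"
  and fan_cone_F: "fan_cone F c = C (class_rep c)"
  and fan_gluing_F: "fan_gluing F (c', l') (c, l) \<longleftrightarrow> (\<exists>es \<gamma>.
        specialization g (class_rep c) es \<gamma> (class_rep c') \<and> l = extend_lengths \<gamma> (class_rep c') l')"
  by (auto simp: teichmueller_fan_def eq_rel_def)

lemma cls_index: "m \<in> M \<Longrightarrow> cls m \<in> fan_index F"
  unfolding fan_index_F by (rule quotientI)

lemma class_rep_props: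
  assumes "c \<in> fan_index F" shows "class_rep c \<in> M" "c = cls (class_rep c)"
proof -
  have "c \<noteq> {}" using assms equiv_eq_rel unfolding fan_index_F by (metis in_quotient_imp_non_empty)
  then have r: "class_rep c \<in> c" unfolding class_rep_def by (simp add: some_in_eq)
  show "class_rep c \<in> M"
    using r assms in_quotient_imp_subset[OF equiv_eq_rel] unfolding fan_index_F by blast
  obtain m where m: "m \<in> M" "c = cls m" using assms unfolding fan_index_F by (auto elim: quotientE)
  then have "(m, class_rep c) \<in> eq_rel" using r by blast
  then show "c = cls (class_rep c)" unfolding m(2) using equiv_class_eq[OF equiv_eq_rel] m(2) by metis
qed

lemma cls_rep_iso:
  assumes "m \<in> M"
  obtains \<pi> \<theta> \<phi> where "marked_collapse g m {} \<pi> \<theta> \<phi> (class_rep (cls m))" "class_rep (cls m) \<in> M"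
proof -
  have r: "class_rep (cls m) \<in> M" "cls m = cls (class_rep (cls m))"
    using class_rep_props[OF cls_index[OF assms]] by auto
  then have "(m, class_rep (cls m)) \<in> eq_rel"
    using eq_equiv_class_iff[OF equiv_eq_rel] assms by metis
  moreover have "marked_equiv g m x" if "(m, x) \<in> eq_rel" for x using that by (simp add: eq_rel_def)
  ultimately have "marked_equiv g m (class_rep (cls m))" by blast
  then show thesis using that marked_equiv_iff[OF assms r(1)] r(1) by blast
qed

lemma fan_union_iff: "(c, l) \<in> fan_union F \<longleftrightarrow> c \<in> fan_index F \<and> l \<in> C (class_rep c)"
  by (simp add: fan_union_def fan_cone_F)

lemma cone_keys: "l \<in> C m \<Longrightarrow> Poly_Mapping.keys l \<subseteq> arcs (fst m)"
  using cone_orthant[of m] by (auto simp: orthant_def)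

text \<open>Marked curves have positive lengths, so all edges of length zero are contracted.\<close>

definition reduct :: "marked_graph \<times> lengths \<Rightarrow> marked_graph \<times> lengths \<Rightarrow> bool" where
  "reduct a b \<longleftrightarrow> b \<in> marked_curves M \<and> len_collapse g a b"

abbreviation rep :: "marked_graph set \<times> lengths \<Rightarrow> marked_graph \<times> lengths" where
  "rep p \<equiv> (class_rep (fst p), snd p)"

lemma marked_curves_props:
  assumes "b \<in> marked_curves M"
  shows "fst b \<in> M" "positive b" "Poly_Mapping.keys (snd b) = arcs (fst (fst b))" "snd b \<in> C (fst b)"
proof -
  show 1: "fst b \<in> M" "positive b" "Poly_Mapping.keys (snd b) = arcs (fst (fst b))"
    using assms by (auto simp: marked_curves_def positive_def)
  then show "snd b \<in> C (fst b)" using cone_positive[of "snd b" "fst b"] by simp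
qed

lemma reduct_exists:
  assumes "m \<in> M" "l \<in> C m" shows "\<exists>b. reduct (m, l) b"
proof -
  let ?Z = "{e \<in> arcs (fst m). Poly_Mapping.lookup l e = 0}"
  obtain es where es: "set es = ?Z" "distinct es"
    using finite_distinct_list[of ?Z] finite_arcs_M[OF assms(1)] by auto
  let ?m1 = "fold contract_edge es m"
  have m1: "?m1 \<in> M" by (rule contract_closed[OF assms es(2,1)])
  obtain \<pi> where \<pi>: "marked_collapse g m ?Z \<pi> id (\<lambda>_. False) ?m1"
    using fold_contract_edge[OF in_stable[OF assms(1)] es(2)] es(1) by auto
  have arcs: "arcs (fst ?m1) = arcs (fst m) - ?Z" by (rule marked_collapse_id_arcs[OF \<pi>])
  have nonneg: "0 \<le> Poly_Mapping.lookup l e" for e using cone_orthant[of m] assms(2) by (auto simp: orthant_def)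
  \<comment> \<open>Edges keep their names under \<open>contract_edge\<close>, so the same
    \<open>l\<close> serves as length function; its keys are exactly the edges that survive.\<close>
  have "(?m1, l) \<in> marked_curves M"
    unfolding marked_curves_def
    using m1 arcs cone_keys[OF assms(2)] nonneg by (auto simp: in_keys_iff less_le)
  moreover have "len_collapse g (m, l) (?m1, l)"
    by (rule len_collapseI[OF \<pi>]) auto
  ultimately show ?thesis unfolding reduct_def by blast
qed

lemma reduct_unique:
  assumes "fst a \<in> M" "reduct a b" "reduct a b'" shows "len_collapse g b b'"
  using assms marked_curves_props in_stable unfolding reduct_def
  by (intro len_collapse_unique[of a g b b']) auto

lemma reduct_collapse:
  assumes "fst a \<in> M" "fst b \<in> M" "len_collapse g a b" "reduct b c" shows "reduct a c"
  using assms marked_curves_props in_stable len_collapse_trans[of a g b c] unfolding reduct_def by auto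

lemma reduct_move:
  assumes "fst a \<in> M" "reduct a b" "len_collapse g b b'" "b' \<in> marked_curves M" shows "reduct a b'"
  using assms marked_curves_props in_stable len_collapse_trans[of a g b b'] unfolding reduct_def by auto

text \<open>Two points over the same point of the fan have a common reduct, which determines it.\<close>

definition joinable :: "marked_graph \<times> lengths \<Rightarrow> marked_graph \<times> lengths \<Rightarrow> bool" where
  "joinable a b \<longleftrightarrow> (\<exists>x. reduct a x \<and> reduct b x)"

text \<open>Reducts of a point are unique up to equivalence, so one common reduct makes all of them
  common.\<close>

lemma joinable_reduct:
  assumes "fst a \<in> M" "fst b \<in> M" "joinable a b" "reduct a x" shows "reduct b x"
proof -
  obtain y where y: "reduct a y" "reduct b y" using assms(3) unfolding joinable_def by blast
  have "len_collapse g y x" by (rule reduct_unique[OF assms(1) y(1) assms(4)])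
  then show ?thesis using reduct_move[OF assms(2) y(2)] assms(4) unfolding reduct_def by blast
qed

lemma joinable_trans:
  assumes "fst a \<in> M" "fst b \<in> M" "fst c \<in> M" "joinable a b" "joinable b c" shows "joinable a c"
  using assms joinable_reduct[of b c] unfolding joinable_def by blast

lemma joinable_sym: "joinable a b \<Longrightarrow> joinable b a"
  unfolding joinable_def by blast

lemma joinable_collapse:
  assumes "fst a \<in> M" "fst b \<in> M" "snd b \<in> C (fst b)" "len_collapse g a b" shows "joinable a b"
proof -
  obtain x where "reduct b x" using reduct_exists[OF assms(2,3)] by auto
  then show ?thesis using reduct_collapse[OF assms(1,2,4)] unfolding joinable_def by blast
qed

lemma fan_union_rep:
  assumes "p \<in> fan_union F"
  shows "fst p \<in> fan_index F" "fst (rep p) \<in> M" "snd (rep p) \<in> C (fst (rep p))"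
  using assms fan_union_iff[of "fst p" "snd p"] class_rep_props by auto

lemma gluing_joinable:
  assumes p: "p \<in> fan_union F" and q: "q \<in> fan_union F" and gl: "fan_gluing F p q"
  shows "joinable (rep p) (rep q)"
proof -
  obtain es \<gamma> where "specialization g (class_rep (fst q)) es \<gamma> (class_rep (fst p))"
    "snd q = extend_lengths \<gamma> (class_rep (fst p)) (snd p)"
    using gl fan_gluing_F[of "fst p" "snd p" "fst q" "snd q"] by auto
  then have "len_collapse g (rep q) (rep p)"
    using specialization_imp_len_collapse in_stable fan_union_rep(2)[OF p] fan_union_rep(2)[OF q] by simp
  then have "joinable (rep q) (rep p)"
    using joinable_collapse fan_union_rep[OF p] fan_union_rep[OF q] by blast
  then show ?thesis by (rule joinable_sym)
qed

text \<open>A marked curve lies on the cone of the chosen representative of its class once its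
  lengths are carried along an isomorphism.\<close>

lemma point_on_rep:
  assumes b: "b \<in> marked_curves M"
  obtains p where "p \<in> fan_union F" "len_collapse g b (rep p)" "reduct (rep p) b"
proof -
  obtain m l where eq: "b = (m, l)" by (cases b)
  note bp = marked_curves_props[OF b, unfolded eq fst_conv snd_conv]
  obtain \<pi> \<theta> \<phi> where c: "marked_collapse g m {} \<pi> \<theta> \<phi> (class_rep (cls m))" and r: "class_rep (cls m) \<in> M"
    using cls_rep_iso[OF bp(1)] .
  let ?l = "push_lengths \<theta> (arcs (fst m)) l"
  have lk: "\<forall>e\<in>arcs (fst m). Poly_Mapping.lookup ?l (\<theta> e) = Poly_Mapping.lookup l e"
    using lookup_push[OF finite_arcs_M[OF bp(1)]] marked_collapse_arcs(2)[OF c] by (auto simp: bij_betw_def)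
  show thesis
  proof (rule that[of "(cls m, ?l)"])
    show "(cls m, ?l) \<in> fan_union F"
      unfolding fan_union_iff using cls_index[OF bp(1)] cone_iso[OF bp(1) r c bp(4)] by simp
    show "len_collapse g b (rep (cls m, ?l))"
      unfolding eq fst_conv snd_conv by (rule len_collapseI[OF c]) (use lk in auto)
    show "reduct (rep (cls m, ?l)) b"
      unfolding reduct_def using b len_collapse_iso_sym[OF in_stable[OF bp(1)] in_stable[OF r] c lk] eq by simp
  qed
qed

lemma collapse_gluing:
  assumes p: "p \<in> fan_union F" and q: "q \<in> fan_union F" and c: "len_collapse g (rep q) (rep p)"
  shows "fan_gluing F p q"
proof -
  have "\<exists>es \<gamma>. specialization g (class_rep (fst q)) es \<gamma> (class_rep (fst p)) \<and>
      snd q = extend_lengths \<gamma> (class_rep (fst p)) (snd p)"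
    by (rule len_collapse_imp_specialization)
       (use c fan_union_rep[OF p] fan_union_rep[OF q] in_stable cone_keys in auto)
  then show ?thesis using fan_gluing_F[of "fst p" "snd p" "fst q" "snd q"] by simp
qed

text \<open>Each gluing step preserves the reduct. Conversely the common reduct of \<open>p\<close>
  and \<open>q\<close> has a copy \<open>r\<close> on the cone of a representative, and
  \<open>r\<close> is glued directly to both, so that two steps suffice.\<close>

lemma fan_rel_iff:
  assumes p: "p \<in> fan_union F" and q: "q \<in> fan_union F"
  shows "(p, q) \<in> fan_rel F \<longleftrightarrow> joinable (rep p) (rep q)"
proof -
  let ?R = "\<lambda>a b. a \<in> fan_union F \<and> b \<in> fan_union F \<and> fan_gluing F a b"
  have "equivclp ?R p q \<longleftrightarrow> joinable (rep p) (rep q)"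
  proof
    assume "equivclp ?R p q"
    then have "q \<in> fan_union F \<and> joinable (rep p) (rep q)"
    proof (induction rule: equivclp_induct)
      case base
      obtain x where "reduct (rep p) x" using reduct_exists[OF fan_union_rep(2,3)[OF p]] by auto
      then show ?case using p unfolding joinable_def by blast
    next
      case (step y z)
      then have "z \<in> fan_union F" "joinable (rep y) (rep z)"
        using gluing_joinable joinable_sym by blast+
      then show ?case
        using step joinable_trans fan_union_rep(2) p by blast
    qed
    then show "joinable (rep p) (rep q)" by blast
  next
    assume "joinable (rep p) (rep q)"
    then obtain x where x: "reduct (rep p) x" "reduct (rep q) x" unfolding joinable_def by blast
    then have xc: "x \<in> marked_curves M" by (simp add: reduct_def)
    obtain r where r: "r \<in> fan_union F" "len_collapse g x (rep r)" using point_on_rep[OF xc] by blast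
    have "?R r p'" if p': "p' \<in> fan_union F" "reduct (rep p') x" for p'
    proof -
      have "len_collapse g (rep p') (rep r)"
        by (rule len_collapse_trans[OF _ _ _ _ r(2)])
           (use p' in_stable fan_union_rep(2)[OF p'(1)] fan_union_rep(2)[OF r(1)] marked_curves_props(1)[OF xc]
            in \<open>simp_all add: reduct_def\<close>)
      from collapse_gluing[OF r(1) p'(1) this] r(1) p'(1) show ?thesis by (intro conjI)
    qed
    note rp = this[OF p x(1)] and rq = this[OF q x(2)]
    show "equivclp ?R p q"
      by (rule equivclp_trans[OF equivclp_sym[OF r_into_equivclp[of ?R, OF rp]] r_into_equivclp[of ?R, OF rq]])
  qed
  then show ?thesis using p q by (simp add: fan_rel_def)
qed

lemma equiv_fan_rel: "equiv (fan_union F) (fan_rel F)"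
proof (rule equivI)
  show "fan_rel F \<subseteq> fan_union F \<times> fan_union F" by (auto simp: fan_rel_def)
  show "refl_on (fan_union F) (fan_rel F)" by (auto simp: refl_on_def fan_rel_def)
  show "sym (fan_rel F)" by (auto simp: sym_def fan_rel_def intro: equivclp_sym)
  show "trans (fan_rel F)" by (auto simp: trans_def fan_rel_def intro: equivclp_trans)
qed

abbreviation pt :: "marked_graph set \<times> lengths \<Rightarrow> (marked_graph set \<times> lengths) set" where
  "pt p \<equiv> fan_rel F `` {p}"

lemma pt_eq_iff: "p \<in> fan_union F \<Longrightarrow> q \<in> fan_union F \<Longrightarrow> pt p = pt q \<longleftrightarrow> joinable (rep p) (rep q)"
  using eq_equiv_class_iff[OF equiv_fan_rel] fan_rel_iff by blast

lemma fan_points_pt: "x \<in> fan_points F \<longleftrightarrow> (\<exists>p\<in>fan_union F. x = pt p)"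
  unfolding fan_points_def by (auto simp: quotient_def)

text \<open>Translates points of the fan into curves: the curves lying over a point are precisely
  the reducts of any of its members on a cone.\<close>

lemma is_point_of_pt:
  assumes p: "p \<in> fan_union F" and b: "b \<in> marked_curves M"
  shows "is_point_of g b (pt p) \<longleftrightarrow> reduct (rep p) b"
proof
  note bp = marked_curves_props[OF b]
  assume "is_point_of g b (pt p)"
  then obtain q where q: "q \<in> pt p" "curve_equiv g b (rep q)" unfolding is_point_of_def by auto
  have qu: "q \<in> fan_union F" using q(1) by (auto simp: fan_rel_def)
  have "len_collapse g b (rep q)"
    using q(2) curve_equiv_iff[of b g "rep q"] bp fan_union_rep[OF qu] in_stable by auto
  then have "reduct (rep q) b"
    unfolding reduct_def using b len_collapse_positive_sym(1)[of b g "rep q"] bp fan_union_rep[OF qu] in_stable by auto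
  moreover have "joinable (rep q) (rep p)" using q(1) fan_rel_iff[OF p qu] joinable_sym by auto
  ultimately show "reduct (rep p) b" using joinable_reduct fan_union_rep(2) p qu by blast
next
  note bp = marked_curves_props[OF b]
  assume r: "reduct (rep p) b"
  obtain q where q: "q \<in> fan_union F" "len_collapse g b (rep q)" "reduct (rep q) b"
    using point_on_rep[OF b] .
  have "(p, q) \<in> fan_rel F" using fan_rel_iff[OF p q(1)] r q(3) unfolding joinable_def by blast
  moreover have "curve_equiv g b (rep q)"
    using q(2) curve_equiv_iff[of b g "rep q"] bp fan_union_rep[OF q(1)] in_stable by auto
  ultimately show "is_point_of g b (pt p)"
    unfolding is_point_of_def by (intro bexI[of _ q]) (auto simp: case_prod_unfold)
qed

section \<open>The action\<close>

fun change_curve :: "((unit, nat) gpoint \<Rightarrow> (unit, nat) gpoint) \<Rightarrow> marked_graph \<times> lengths \<Rightarrow> marked_graph \<times> lengths" where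
  "change_curve f (m, l) = (change m f, l)"

lemma fst_change_curve [simp]: "fst (change_curve f a) = change (fst a) f"
  and snd_change_curve [simp]: "snd (change_curve f a) = snd a"
  by (cases a; simp)+

lemma change_curve_marked_curves:
  assumes "b \<in> marked_curves M" "homotopy_equivalence_map (rose_space g) (rose_space g) f"
  shows "change_curve f b \<in> marked_curves M"
  using assms change_closed by (cases b) (auto simp: marked_curves_def)

lemma len_collapse_change:
  assumes "len_collapse g a b" "continuous_map (rose_space g) (rose_space g) f"
  shows "len_collapse g (change_curve f a) (change_curve f b)"
  using assms(1) marked_collapse_change[OF _ assms(2)] unfolding len_collapse_def fst_change_curve snd_change_curve fst_change by blast

lemma reduct_change:
  assumes "reduct a b" "homotopy_equivalence_map (rose_space g) (rose_space g) f"
  shows "reduct (change_curve f a) (change_curve f b)"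
  using assms change_curve_marked_curves len_collapse_change
  unfolding reduct_def homotopy_equivalence_map_def by blast

lemma induces_heq: "induces_automorphism g f \<alpha> \<Longrightarrow> homotopy_equivalence_map (rose_space g) (rose_space g) f"
  by (simp add: induces_automorphism_def)

text \<open>The value is described by a definite description over all curves at the point, all
  automorphisms in the coset and all maps inducing them. Changing the marking respects reducts, so
  one compatible pair \<open>p\<close>, \<open>q\<close> determines the value for every
  choice.\<close>

lemma change_marking_pt:
  assumes A: "A \<in> carrier (Out (free_group g))" and \<alpha>: "\<alpha> \<in> A" and f: "induces_automorphism g f \<alpha>"
    and p: "p \<in> fan_union F" and q: "q \<in> fan_union F"
    and j: "joinable (change_curve f (rep p)) (rep q)"
  shows "change_marking g M F A (pt p) = pt q"
  unfolding change_marking_def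
proof (rule the_equality)
  note he = induces_heq[OF f]
  have pM: "fst (rep p) \<in> M" "fst (change_curve f (rep p)) \<in> M" "fst (rep q) \<in> M"
    using fan_union_rep(2)[OF p] fan_union_rep(2)[OF q] change_closed he by auto
  obtain b where b: "reduct (rep p) b" using reduct_exists[OF fan_union_rep(2,3)[OF p]] by auto
  obtain G w h l where eq: "b = ((G, w, h), l)" by (metis prod_cases4 surj_pair)
  have bf: "((G, w, h \<circ> f), l) = change_curve f b" by (simp add: eq)
  have bM: "b \<in> marked_curves M" using b by (simp add: reduct_def)
  have "reduct (rep q) (change_curve f b)"
    by (rule joinable_reduct[OF pM(2,3) j reduct_change[OF b he]])
  then have 1: "is_point_of g ((G, w, h \<circ> f), l) (pt q)"
    unfolding bf using is_point_of_pt[OF q change_curve_marked_curves[OF bM he]] by simp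
  have 2: "is_point_of g ((G, w, h), l) (pt p)"
    using is_point_of_pt[OF p bM] b eq by simp
  show "pt q \<in> fan_points F \<and> (\<exists>G w h l. \<exists>\<alpha>\<in>A. \<exists>f. ((G, w, h), l) \<in> marked_curves M \<and> is_point_of g ((G, w, h), l) (pt p) \<and>
           induces_automorphism g f \<alpha> \<and> is_point_of g ((G, w, h \<circ> f), l) (pt q))"
    using 1 2 q bM eq \<alpha> f fan_points_pt by blast
next
  note he = induces_heq[OF f]
  have pM: "fst (rep p) \<in> M" "fst (change_curve f (rep p)) \<in> M" "fst (rep q) \<in> M"
    using fan_union_rep(2)[OF p] fan_union_rep(2)[OF q] change_closed he by auto
  fix y
  assume "y \<in> fan_points F \<and> (\<exists>G w h l. \<exists>\<alpha>\<in>A. \<exists>f. ((G, w, h), l) \<in> marked_curves M \<and> is_point_of g ((G, w, h), l) (pt p) \<and>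
           induces_automorphism g f \<alpha> \<and> is_point_of g ((G, w, h \<circ> f), l) y)"
  then obtain G w h l \<beta> k r where r: "r \<in> fan_union F" "y = pt r" and \<beta>: "\<beta> \<in> A" "induces_automorphism g k \<beta>"
    and b: "((G, w, h), l) \<in> marked_curves M" "is_point_of g ((G, w, h), l) (pt p)"
    "is_point_of g ((G, w, h \<circ> k), l) (pt r)"
    using fan_points_pt by auto
  let ?b = "((G, w, h), l)"
  note hk = induces_heq[OF \<beta>(2)]
  have bk: "((G, w, h \<circ> k), l) = change_curve k ?b" by simp
  have red: "reduct (rep p) ?b" using is_point_of_pt[OF p b(1)] b(2) by simp
  have redr: "reduct (rep r) (change_curve k ?b)"
    using b(3) is_point_of_pt[OF r(1) change_curve_marked_curves[OF b(1) hk]] unfolding bk by simp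
  have bM: "fst ?b \<in> M" using marked_curves_props(1)[OF b(1)] .
  \<comment> \<open>Another automorphism of the coset and another map of the rose inducing it give a
    freely homotopic map, hence an isometric marked curve.\<close>
  have "homotopic_with (\<lambda>_. True) (rose_space g) (rose_space g) k f"
    by (rule induces_automorphism_unique[OF A \<beta>(1) \<alpha> \<beta>(2) f])
  from marked_collapse_change_homotopic[OF in_stable[OF bM] this]
  have "len_collapse g (change (fst ?b) k, l) (change (fst ?b) f, l)"
    by (rule len_collapseI) auto
  then have "len_collapse g (change_curve k ?b) (change_curve f ?b)" by simp
  then have "reduct (rep r) (change_curve f ?b)"
    using reduct_move[OF fan_union_rep(2)[OF r(1)] redr] change_curve_marked_curves[OF b(1) he] by blast
  moreover have "reduct (rep q) (change_curve f ?b)"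
    by (rule joinable_reduct[OF pM(2,3) j reduct_change[OF red he]])
  ultimately have "joinable (rep r) (rep q)" unfolding joinable_def by blast
  then show "y = pt q" using pt_eq_iff[OF r(1) q] r(2) by simp
qed

lemma change_target:
  assumes c: "c \<in> fan_index F" and he: "homotopy_equivalence_map (rose_space g) (rose_space g) f"
  obtains c2 \<pi> \<theta> \<phi> where "c2 \<in> fan_index F" "marked_collapse g (change (class_rep c) f) {} \<pi> \<theta> \<phi> (class_rep c2)"
proof -
  have "change (class_rep c) f \<in> M" using change_closed class_rep_props(1)[OF c] he by blast
  then show thesis using cls_rep_iso cls_index that by metis
qed

text \<open>The underlying graph and the lengths are untouched by a change of marking; only the
  passage to the chosen representative of the new class relabels the edges.\<close>

lemma joinable_target:
  assumes p: "p \<in> fan_union F" and he: "homotopy_equivalence_map (rose_space g) (rose_space g) f"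
    and c2: "c2 \<in> fan_index F" and col: "marked_collapse g (change (class_rep (fst p)) f) {} \<pi> \<theta> \<phi> (class_rep c2)"
  defines "q \<equiv> (c2, push_lengths \<theta> (arcs (fst (class_rep (fst p)))) (snd p))"
  shows "q \<in> fan_union F" "joinable (change_curve f (rep p)) (rep q)"
proof -
  let ?m = "class_rep (fst p)" and ?l = "snd p"
  have mM: "?m \<in> M" "?l \<in> C ?m" using fan_union_rep[OF p] by auto
  have m: "change ?m f \<in> M" "?l \<in> C (change ?m f)"
    using change_closed he mM cone_change by auto
  have r: "class_rep c2 \<in> M" by (rule class_rep_props(1)[OF c2])
  show q: "q \<in> fan_union F"
    unfolding q_def fan_union_iff using c2 cone_iso[OF m(1) r col m(2)] by simp
  have "len_collapse g (change ?m f, ?l) (rep q)"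
    unfolding q_def fst_conv snd_conv
  proof (rule len_collapseI[OF col])
    fix e assume "e \<in> arcs (fst (change ?m f)) - {}"
    then show "Poly_Mapping.lookup (push_lengths \<theta> (arcs (fst ?m)) ?l) (\<theta> e) = Poly_Mapping.lookup ?l e"
      using lookup_push[OF finite_arcs_M[OF mM(1)]] marked_collapse_arcs(2)[OF col] by (auto simp: bij_betw_def)
  qed simp
  then show "joinable (change_curve f (rep p)) (rep q)"
    using joinable_collapse[of "change_curve f (rep p)" "rep q"] m fan_union_rep[OF q] by simp
qed

lemma target_exists:
  assumes A: "A \<in> carrier (Out (free_group g))" and p: "p \<in> fan_union F"
  obtains \<alpha> f q where "\<alpha> \<in> A" "induces_automorphism g f \<alpha>" "q \<in> fan_union F" "joinable (change_curve f (rep p)) (rep q)"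
proof -
  obtain \<alpha> where \<alpha>: "\<alpha> \<in> A" "\<alpha> \<in> auto (free_group g)"
    using group.Out_carrierE[OF group_free_group A] by metis
  obtain f where f: "induces_automorphism g f \<alpha>" using induces_automorphism_exists[OF \<alpha>(2)] .
  obtain c2 \<pi> \<theta> \<phi> where "c2 \<in> fan_index F" "marked_collapse g (change (class_rep (fst p)) f) {} \<pi> \<theta> \<phi> (class_rep c2)"
    using change_target[OF fan_union_rep(1)[OF p] induces_heq[OF f]] .
  from joinable_target[OF p induces_heq[OF f] this] show thesis using that \<alpha> f by blast
qed

lemma right_action_change_marking: "right_action (Out (free_group g)) (fan_points F) (change_marking g M F)"
  unfolding right_action_def
proof (intro conjI ballI)
  interpret group "free_group g" by (rule group_free_group)
  show "group (Out (free_group g))" by (rule group_Out)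
  fix x assume "x \<in> fan_points F"
  then obtain p where p: "p \<in> fan_union F" "x = pt p" using fan_points_pt by blast
  show "change_marking g M F \<one>\<^bsub>Out (free_group g)\<^esub> x = x"
  proof -
    have O: "\<one>\<^bsub>Out (free_group g)\<^esub> \<in> carrier (Out (free_group g))"
      using group_Out by (simp add: group.is_monoid monoid.one_closed)
    have "change_curve id (rep p) = rep p" by simp
    moreover have "joinable (rep p) (rep p)"
      using reduct_exists[OF fan_union_rep(2,3)[OF p(1)]] unfolding joinable_def by auto
    ultimately show ?thesis
      unfolding p(2) by (intro change_marking_pt[OF O one_Out induces_automorphism_id p(1) p(1)]) simp
  qed
  fix A assume A: "A \<in> carrier (Out (free_group g))"
  obtain \<alpha> f q where q: "\<alpha> \<in> A" "induces_automorphism g f \<alpha>" "q \<in> fan_union F" "joinable (change_curve f (rep p)) (rep q)"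
    using target_exists[OF A p(1)] .
  have Ax: "change_marking g M F A x = pt q"
    unfolding p(2) by (rule change_marking_pt[OF A q(1,2) p(1) q(3,4)])
  show "change_marking g M F A x \<in> fan_points F"
    unfolding Ax using q(3) fan_points_pt by blast
  fix B assume B: "B \<in> carrier (Out (free_group g))"
  obtain \<beta> k r where r: "\<beta> \<in> B" "induces_automorphism g k \<beta>" "r \<in> fan_union F" "joinable (change_curve k (rep q)) (rep r)"
    using target_exists[OF B q(3)] .
  have BAx: "change_marking g M F B (change_marking g M F A x) = pt r"
    unfolding Ax by (rule change_marking_pt[OF B r(1,2) q(3) r(3,4)])
  note hf = induces_heq[OF q(2)] and hk = induces_heq[OF r(2)]
  have AB: "A \<otimes>\<^bsub>Out (free_group g)\<^esub> B \<in> carrier (Out (free_group g))"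
    using group_Out A B by (simp add: group.is_monoid monoid.m_closed)
  have ind: "induces_automorphism g (f \<circ> k) (compose (carrier (free_group g)) \<alpha> \<beta>)"
    by (rule induces_automorphism_compose[OF q(2) r(2)])
  have M: "fst (rep p) \<in> M" "fst (rep q) \<in> M" "fst (rep r) \<in> M"
    using fan_union_rep(2) p q r by auto
  \<comment> \<open>Applying \<open>k\<close> to a common reduct for the first step gives one for
    the changed curves; together with the second step this is the target of the composite.\<close>
  have "joinable (change_curve k (change_curve f (rep p))) (change_curve k (rep q))"
    using q(4) reduct_change[OF _ hk] unfolding joinable_def by blast
  then have "joinable (change_curve k (change_curve f (rep p))) (rep r)"
    using joinable_trans[of "change_curve k (change_curve f (rep p))" "change_curve k (rep q)" "rep r"]
      r(4) M change_closed hf hk by auto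
  then have "joinable (change_curve (f \<circ> k) (rep p)) (rep r)"
    by (simp add: change_change)
  from change_marking_pt[OF AB mult_Out[OF q(1) r(1) A B] ind p(1) r(3) this]
  show "change_marking g M F (A \<otimes>\<^bsub>Out (free_group g)\<^esub> B) x = change_marking g M F B (change_marking g M F A x)"
    unfolding BAx unfolding p(2) .
qed

text \<open>The target is the cone of the class of the changed marking, and the linear map relabels
  coordinates along the edge bijection to its representative. Relabelling preserves integrality in
  both directions, and the inverse isomorphism of graphs shows that cones are mapped onto
  cones.\<close>

theorem admissible: "admissible_action (Out (free_group g)) F (change_marking g M F)"
  unfolding admissible_action_def
proof (intro conjI ballI)
  show "right_action (Out (free_group g)) (fan_points F) (change_marking g M F)"
    by (rule right_action_change_marking)
  fix A c assume A: "A \<in> carrier (Out (free_group g))" and c: "c \<in> fan_index F"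
  obtain \<alpha> where \<alpha>: "\<alpha> \<in> A" "\<alpha> \<in> auto (free_group g)"
    using group.Out_carrierE[OF group_free_group A] by metis
  obtain f where f: "induces_automorphism g f \<alpha>" using induces_automorphism_exists[OF \<alpha>(2)] .
  note he = induces_heq[OF f]
  obtain c2 \<pi> \<theta> \<phi> where c2: "c2 \<in> fan_index F" and col: "marked_collapse g (change (class_rep c) f) {} \<pi> \<theta> \<phi> (class_rep c2)"
    using change_target[OF c he] .
  let ?m = "class_rep c" and ?m2 = "class_rep c2"
  have m: "?m \<in> M" "?m2 \<in> M" "change ?m f \<in> M" using class_rep_props(1) c c2 change_closed he by auto
  obtain \<nu> \<theta>' \<phi>' where inv: "marked_collapse g ?m2 {} \<nu> \<theta>' \<phi>' (change ?m f)" "\<forall>e\<in>arcs (fst (change ?m f)). \<theta>' (\<theta> e) = e"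
    using marked_collapse_iso_inverse[OF in_stable[OF m(3)] in_stable[OF m(2)] col] .
  let ?E = "arcs (fst ?m)" and ?E2 = "arcs (fst ?m2)"
  have fin: "finite ?E" "finite ?E2" using finite_arcs_M m by auto
  have \<theta>: "inj_on \<theta> ?E" "\<theta> ` ?E = ?E2" and \<theta>': "inj_on \<theta>' ?E2" "\<theta>' ` ?E2 = ?E"
    using marked_collapse_arcs(2)[OF col] marked_collapse_arcs(2)[OF inv(1)] by (auto simp: bij_betw_def)
  have \<theta>'\<theta>: "\<theta>' (\<theta> e) = e" if "e \<in> ?E" for e using inv(2) that by simp
  have \<theta>\<theta>': "\<theta> (\<theta>' e) = e" if "e \<in> ?E2" for e using \<theta>'\<theta> \<theta>(2) that by (metis imageE)
  let ?L = "push_lengths \<theta> ?E" and ?L' = "push_lengths \<theta>' ?E2"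
  have L'L: "?L' (?L l) = l" if "Poly_Mapping.keys l \<subseteq> ?E" for l
    by (rule push_push) (use fin \<theta> \<theta>' \<theta>'\<theta> that in auto)
  have LL': "?L (?L' l) = l" if "Poly_Mapping.keys l \<subseteq> ?E2" for l
    by (rule push_push) (use fin \<theta> \<theta>' \<theta>\<theta>' that in auto)
  have cone: "?L ` C ?m = C ?m2"
  proof (intro equalityI subsetI)
    fix l assume "l \<in> ?L ` C ?m"
    then show "l \<in> C ?m2" using cone_iso[OF m(3,2) col] cone_change by auto
  next
    fix l assume l: "l \<in> C ?m2"
    have "?L' l \<in> C ?m" using cone_iso[OF m(2,3) inv(1) l] cone_change by simp
    moreover have "l = ?L (?L' l)" using LL' cone_keys[OF l] by simp
    ultimately show "l \<in> ?L ` C ?m" by (rule rev_image_eqI)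
  qed
  \<comment> \<open>\<open>?L\<close> is defined on the whole ambient space but is inverted by
    \<open>?L'\<close> only on lengths supported on the edges; the span of the cone consists of
    such.\<close>
  have sp: "span (C ?m) \<subseteq> {l. Poly_Mapping.keys l \<subseteq> ?E}"
    by (rule span_minimal[OF _ subspace_keys]) (use cone_keys[of _ ?m] in auto)
  have spim: "?L ` span (C ?m) = span (C ?m2)"
    using linear_span_image[OF linear_push, of \<theta> ?E "C ?m"] cone by simp
  have "inj_on ?L (span (C ?m))"
    by (rule inj_on_inverseI[where g = ?L']) (use L'L sp in auto)
  then have bij: "bij_betw ?L (span (C ?m)) (span (C ?m2))" using spim by (simp add: bij_betw_def)
  have lat: "?L ` lattice_in (span (C ?m)) = lattice_in (span (C ?m2))"
  proof (intro equalityI subsetI)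
    fix l2 assume "l2 \<in> ?L ` lattice_in (span (C ?m))"
    then obtain l where l: "l \<in> span (C ?m)" "\<forall>e. Poly_Mapping.lookup l e \<in> \<int>" "l2 = ?L l"
      by (auto simp: lattice_in_def)
    have "Poly_Mapping.lookup l2 x \<in> \<int>" for x
    proof (cases "x \<in> \<theta> ` ?E")
      case True
      then obtain e where "e \<in> ?E" "x = \<theta> e" by blast
      then show ?thesis using lookup_push[OF fin(1) \<theta>(1)] l by simp
    qed (use lookup_push_notin l in auto)
    then show "l2 \<in> lattice_in (span (C ?m2))" using l spim by (auto simp: lattice_in_def)
  next
    fix l2 assume "l2 \<in> lattice_in (span (C ?m2))"
    then have l2: "l2 \<in> span (C ?m2)" "\<forall>e. Poly_Mapping.lookup l2 e \<in> \<int>" by (auto simp: lattice_in_def)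
    then obtain l where l: "l \<in> span (C ?m)" "l2 = ?L l" using spim by blast
    have "Poly_Mapping.lookup l e \<in> \<int>" for e
    proof (cases "e \<in> ?E")
      case True
      then show ?thesis using lookup_push[OF fin(1) \<theta>(1) True, of l] l2(2) l(2) by metis
    next
      case False
      moreover have "Poly_Mapping.keys l \<subseteq> ?E" using sp l(1) by blast
      ultimately have "Poly_Mapping.lookup l e = 0" by (auto simp: in_keys_iff)
      then show ?thesis by simp
    qed
    then show "l2 \<in> ?L ` lattice_in (span (C ?m))" using l by (auto simp: lattice_in_def)
  qed
  have act: "change_marking g M F A (fan_proj F c l) = fan_proj F c2 (?L l)" if l: "l \<in> fan_cone F c" for l
  proof -
    have p: "(c, l) \<in> fan_union F" using c l by (simp add: fan_union_iff fan_cone_F)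
    have "(c2, ?L l) \<in> fan_union F" "joinable (change_curve f (rep (c, l))) (rep (c2, ?L l))"
      using joinable_target[OF p he c2] col by auto
    from change_marking_pt[OF A \<alpha>(1) f p this] show ?thesis by (simp add: fan_proj_def)
  qed
  show "\<exists>j\<in>fan_index F. \<exists>L. linear L \<and> bij_betw L (span (fan_cone F c)) (span (fan_cone F j)) \<and>
      L ` lattice_in (span (fan_cone F c)) = lattice_in (span (fan_cone F j)) \<and>
      L ` fan_cone F c = fan_cone F j \<and>
      (\<forall>l\<in>fan_cone F c. change_marking g M F A (fan_proj F c l) = fan_proj F j (L l))"
    by (rule bexI[OF exI[of _ ?L] c2]) (use linear_push bij lat cone act in \<open>simp add: fan_cone_F\<close>)
qed

end

interpretation stable_fan: marked_fan g "stable_marked_graphs g" orthant for g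
proof
  show "push_lengths \<theta> (arcs (fst m)) l \<in> orthant m'"
    if "m \<in> stable_marked_graphs g" "m' \<in> stable_marked_graphs g" "marked_collapse g m {} \<pi> \<theta> \<phi> m'" "l \<in> orthant m"
    for m m' \<pi> \<theta> \<phi> l
  proof -
    have bij: "bij_betw \<theta> (arcs (fst m)) (arcs (fst m'))" using marked_collapse_arcs(2)[OF that(3)] by simp
    have fin: "finite (arcs (fst m))"
      using that(1) by (cases m) (auto simp: stable_marked_graphs_def fin_digraph.finite_arcs)
    have "0 \<le> Poly_Mapping.lookup (push_lengths \<theta> (arcs (fst m)) l) x" for x
    proof (cases "x \<in> \<theta> ` arcs (fst m)")
      case True
      then obtain e where "e \<in> arcs (fst m)" "x = \<theta> e" by blast
      then show ?thesis using lookup_push[OF fin] bij that(4) by (simp add: bij_betw_def orthant_def)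
    qed (simp add: lookup_push_notin)
    then show ?thesis using keys_push_subset[of \<theta> "arcs (fst m)" l] bij by (auto simp: orthant_def bij_betw_def)
  qed
  show "fold contract_edge es m \<in> stable_marked_graphs g"
    if "m \<in> stable_marked_graphs g" "distinct es" "set es = {e \<in> arcs (fst m). Poly_Mapping.lookup l e = 0}" for m es and l :: lengths
    using fold_contract_edge[OF that(1,2)] that(3) by auto
  show "l \<in> orthant m" if "Poly_Mapping.keys l = arcs (fst m)" "positive (m, l)" for m l
  proof -
    have "0 \<le> Poly_Mapping.lookup l e" for e
      using that by (cases "e \<in> arcs (fst m)") (auto simp: positive_def in_keys_iff less_imp_le)
    then show ?thesis using that by (simp add: orthant_def)
  qed
qed (auto simp: change_stable orthant_def)

text \<open>Cycles enter in two conditions. An inverse isomorphism would carry a cycle of zero edges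
  in \<open>m'\<close> back to one in \<open>m\<close>, so ideal cones correspond; and contracting
  edges without a cycle keeps all weights 0.\<close>

interpretation pure_fan: marked_fan g "pure_marked_graphs g" pure_cone for g
proof
  show "push_lengths \<theta> (arcs (fst m)) l \<in> pure_cone m'"
    if m: "m \<in> pure_marked_graphs g" "m' \<in> pure_marked_graphs g" and c: "marked_collapse g m {} \<pi> \<theta> \<phi> m'" and l: "l \<in> pure_cone m"
    for m m' \<pi> \<theta> \<phi> l
  proof -
    have st: "m \<in> stable_marked_graphs g" "m' \<in> stable_marked_graphs g" using m by (auto simp: pure_marked_graphs_def)
    let ?l = "push_lengths \<theta> (arcs (fst m)) l"
    have o: "?l \<in> orthant m'" using stable_fan.cone_iso[OF st c] l by (simp add: pure_cone_def)
    have bij: "bij_betw \<theta> (arcs (fst m)) (arcs (fst m'))" using marked_collapse_arcs(2)[OF c] by simp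
    have fin: "finite (arcs (fst m))"
      using st(1) by (cases m) (auto simp: stable_marked_graphs_def fin_digraph.finite_arcs)
    obtain \<nu> \<theta>' \<phi>' where inv: "marked_collapse g m' {} \<nu> \<theta>' \<phi>' m" "\<forall>e\<in>arcs (fst m). \<theta>' (\<theta> e) = e"
      using marked_collapse_iso_inverse[OF st c] .
    obtain G w h G' w' h' where eq: "m = (G, w, h)" "m' = (G', w', h')" by (metis prod_cases3)
    have gc: "graph_collapse G' w' {} \<nu> \<theta>' \<phi>' G w" using inv(1) eq by simp
    have lk: "Poly_Mapping.lookup ?l (\<theta> e) = Poly_Mapping.lookup l e" if "e \<in> arcs (fst m)" for e
      using lookup_push[OF fin _ that] bij by (simp add: bij_betw_def)
    have "\<not> contains_cycle G' {e \<in> arcs G'. Poly_Mapping.lookup ?l e = 0}"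
    proof
      assume "contains_cycle G' {e \<in> arcs G'. Poly_Mapping.lookup ?l e = 0}"
      from contains_cycle_collapse_iso[OF stable_marked_graphsD(2)[OF st(2)[unfolded eq]] gc _ this]
      have "contains_cycle G (\<theta>' ` {e \<in> arcs G'. Poly_Mapping.lookup ?l e = 0})" by auto
      moreover have "\<theta>' ` {e \<in> arcs G'. Poly_Mapping.lookup ?l e = 0} \<subseteq> {e \<in> arcs G. Poly_Mapping.lookup l e = 0}"
      proof
        fix x assume "x \<in> \<theta>' ` {e \<in> arcs G'. Poly_Mapping.lookup ?l e = 0}"
        then obtain e' where e': "e' \<in> arcs G'" "Poly_Mapping.lookup ?l e' = 0" "x = \<theta>' e'" by blast
        then obtain e where e: "e \<in> arcs G" "e' = \<theta> e" using bij eq by (auto simp: bij_betw_def)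
        then show "x \<in> {e \<in> arcs G. Poly_Mapping.lookup l e = 0}" using e' inv(2) lk eq by simp
      qed
      ultimately have "contains_cycle G {e \<in> arcs G. Poly_Mapping.lookup l e = 0}" by (rule contains_cycle_mono)
      then show False using l eq by (simp add: pure_cone_def)
    qed
    then show ?thesis using o eq by (simp add: pure_cone_def)
  qed
  show "fold contract_edge es m \<in> pure_marked_graphs g"
    if "m \<in> pure_marked_graphs g" "l \<in> pure_cone m" "distinct es" "set es = {e \<in> arcs (fst m). Poly_Mapping.lookup l e = 0}" for m l es
    using fold_contract_edge_pure[OF that(1,3)] that(2,4) by (auto simp: pure_cone_def)
  show "l \<in> pure_cone m" if "Poly_Mapping.keys l = arcs (fst m)" "positive (m, l)" for m l
  proof -
    have "{e \<in> arcs (fst m). Poly_Mapping.lookup l e = 0} = {}" using that by (auto simp: in_keys_iff)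
    then have "\<not> contains_cycle (fst m) {e \<in> arcs (fst m). Poly_Mapping.lookup l e = 0}"
      using not_contains_cycle_empty by (simp only:) simp
    with stable_fan.cone_positive[OF that] show ?thesis unfolding pure_cone_def by blast
  qed
  show "change m f \<in> pure_marked_graphs g"
    if "m \<in> pure_marked_graphs g" "homotopy_equivalence_map (rose_space g) (rose_space g) f" for m f
    using that by (rule change_pure)
qed (auto simp: pure_cone_def orthant_def pure_marked_graphs_def)

theorem proposition3p4p1:
  fixes g :: nat
  shows "admissible_action (Out (free_group g)) (pure_tropical_teichmueller g)
           (pure_teichmueller_action g) \<and>
         admissible_action (Out (free_group g)) (tropical_teichmueller g)
           (teichmueller_action g)"
  using pure_fan.admissible[of g] stable_fan.admissible[of g]
  unfolding pure_teichmueller_action_def teichmueller_action_def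
    pure_tropical_teichmueller_def tropical_teichmueller_def
  by blast

end
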